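(* Let $T$ be an LR tableau with shape $\lambda/\mu$ and word $w$, and let $\varrho:=\mathrm{ot}\,\rho=\mathrm{ot}\,\bullet\, e=\bullet\,\mathrm{ot}\,e=\bullet\, e\,\mathrm{ot}=\rho\,\mathrm{ot}$ where $\rho=\bullet\, e$. Then $$e:\mathrm{LR}(\mu,\nu,\lambda)\to\mathrm{LR}(\mu,\nu^\bullet,\lambda),\ T\mapsto eT,\ w(eT)=\sigma_0 w;$$ $$\rho:\mathrm{LR}(\mu,\nu,\lambda)\to\mathrm{LR}(\lambda,\nu,\mu),\ T\mapsto \rho(T)=\bullet\, eT,\ w(\rho(T))=(\sigma_0 w)^\bullet;$$ $$\varrho:\mathrm{LR}(\mu,\nu,\lambda)\to\mathrm{LR}(\mu^t,\nu^t,\lambda^t),\ T\mapsto \varrho(T)=\mathrm{ot}\,\bullet\, eT,\ w_{col}(\varrho(T))=(\sigma_0 w)^{\mathrm{ot}\,\bullet}$$ are involutions exhibiting respectively the symmetries $c_{\mu\nu\lambda}=c_{\mu\nu^\bullet\lambda}$, $c_{\mu\nu\lambda}=c_{\lambda\nu\mu}$ and $c_{\mu\nu\lambda}=c_{\mu^t\nu^t\lambda^t}$. The three involutions $e,\rho,\varrho$ are linear time equivalent to each other, in particular to the reversal $e$.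
   Context: $\mathrm{LR}(\mu,\nu,\lambda)$ is the set of LR tableaux inside a $d\times(n-d)$ rectangle with boundary data $(\mu,\nu,\lambda)$ (inner shape $\mu$, content $\nu$, outer shape $\lambda^\vee$), $\mathrm{LR}(\mu,\nu^\bullet,\lambda)$ the corresponding opposite LR tableaux with content $\nu^\bullet$ (reverse of $\nu$), and $c$ denotes cardinalities; $w_{col}$ is the column reading word. $\bullet$: rotate the tableau by $\pi$ and replace each entry $i$ by $d-i+1$ (on words $w^\bullet=w_s^\bullet\cdots w_1^\bullet$). $e$: reversal involution; $T^e$ is the unique tableau dual Knuth equivalent to $T$ and Knuth equivalent to $\bullet T$; it coincides with the action of the longest element $\sigma_0$ of $\mathfrak S_d$ by crystal reflection operators, $w(T^e)=\sigma_0 w(T)$; $e$ commutes with $\bullet$. $\mathrm{ot}$: orthogonal transpose; on a Yamanouchi word of weight $\nu$, $w^{\mathrm{ot}}$ replaces, for each $i$, the subword of all letters $i$ by $12\cdots\nu_i$ (for opposite Yamanouchi words, letters $d-i+1$ replaced by $(\nu_1-\nu_i+1)\cdots\nu_1$), and on an (opposite) LR tableau $T$ of shape $\lambda/\mu$, $\mathrm{ot}(T)$ is the (opposite) LR tableau of shape $(\lambda/\mu)^{t\bullet}$ with column word $w(T)^{\mathrm{ot}}$; $\mathrm{ot}$ and $\bullet$ are linear cost involutions and $\mathrm{ot},e,\bullet$ pairwise commute. Linear reducibility/equivalence is in the sense of Pak–Vallejo (parallel-sequential circuits of linear cost maps), and the reversal $e$ is linearly equivalent to Schützenberger evacuation.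 *)

theory Defs
  imports Complex_Main "HOL-Library.Log_Nat"
begin

text \<open>Partitions in the rectangle with \<open>d\<close> rows and \<open>m\<close> columns, padded with zeros to exactly
  \<open>d\<close> parts.\<close>

definition part_in :: "nat \<Rightarrow> nat \<Rightarrow> nat list \<Rightarrow> bool" where
  "part_in d m p \<longleftrightarrow> length p = d \<and> sorted_wrt (\<ge>) p \<and> (\<forall>x\<in>set p. x \<le> m)"

definition dual_part :: "nat \<Rightarrow> nat list \<Rightarrow> nat list" where
  "dual_part m p = rev (map (\<lambda>x. m - x) p)"

definition transpose_part :: "nat \<Rightarrow> nat list \<Rightarrow> nat list" where
  "transpose_part m p = map (\<lambda>j. length (filter (\<lambda>x. j < x) p)) [0..<m]"

definition first_part :: "nat list \<Rightarrow> nat" where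
  "first_part p = (case p of [] \<Rightarrow> 0 | x # _ \<Rightarrow> x)"

text \<open>A filled skew shape \<open>outer/inner\<close> placed in a rectangle. Boxes are \<open>(i, j)\<close> with
  \<open>1 \<le> i \<le> nrows\<close>, \<open>1 \<le> j \<le> ncols\<close>, row 1 on top. The filling is \<open>0\<close> off the shape
  (part of \<open>semistandard\<close>), so that equal tableaux are equal records.\<close>

record skew_tab =
  nrows :: nat
  ncols :: nat
  inner :: "nat list"
  outer :: "nat list"
  fill :: "nat \<Rightarrow> nat \<Rightarrow> nat"

definition box :: "skew_tab \<Rightarrow> nat \<Rightarrow> nat \<Rightarrow> bool" where
  "box T i j \<longleftrightarrow> 1 \<le> i \<and> i \<le> nrows T \<and> inner T ! (i - 1) < j \<and> j \<le> outer T ! (i - 1)"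

definition semistandard :: "skew_tab \<Rightarrow> bool" where
  "semistandard T \<longleftrightarrow>
     part_in (nrows T) (ncols T) (inner T) \<and> part_in (nrows T) (ncols T) (outer T) \<and>
     list_all2 (\<le>) (inner T) (outer T) \<and>
     (\<forall>i j. box T i j \<longleftrightarrow> fill T i j \<noteq> 0) \<and>
     (\<forall>i j j'. box T i j \<and> box T i j' \<and> j < j' \<longrightarrow> fill T i j \<le> fill T i j') \<and>
     (\<forall>i i' j. box T i j \<and> box T i' j \<and> i < i' \<longrightarrow> fill T i j < fill T i' j)"

definition same_shape :: "skew_tab \<Rightarrow> skew_tab \<Rightarrow> bool" where
  "same_shape S T \<longleftrightarrow> nrows S = nrows T \<and> ncols S = ncols T \<and> inner S = inner T \<and> outer S = outer T"

text \<open>The word \<open>w(T)\<close> reads each row from right to left, rows from top to bottom; the column word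
  reads each column from top to bottom, columns from right to left.\<close>

definition row_boxes :: "skew_tab \<Rightarrow> (nat \<times> nat) list" where
  "row_boxes T = filter (\<lambda>(i, j). box T i j)
     [(i, j). i \<leftarrow> [1..<Suc (nrows T)], j \<leftarrow> rev [1..<Suc (ncols T)]]"

definition col_boxes :: "skew_tab \<Rightarrow> (nat \<times> nat) list" where
  "col_boxes T = filter (\<lambda>(i, j). box T i j)
     [(i, j). j \<leftarrow> rev [1..<Suc (ncols T)], i \<leftarrow> [1..<Suc (nrows T)]]"

definition row_word :: "skew_tab \<Rightarrow> nat list" where
  "row_word T = map (\<lambda>(i, j). fill T i j) (row_boxes T)"

definition col_word :: "skew_tab \<Rightarrow> nat list" where
  "col_word T = map (\<lambda>(i, j). fill T i j) (col_boxes T)"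

definition has_content :: "nat list \<Rightarrow> nat list \<Rightarrow> bool" where
  "has_content w \<kappa> \<longleftrightarrow>
     set w \<subseteq> {1..length \<kappa>} \<and> (\<forall>i<length \<kappa>. count_list w (Suc i) = \<kappa> ! i)"

definition yamanouchi :: "nat list \<Rightarrow> bool" where
  "yamanouchi w \<longleftrightarrow>
     (\<forall>p\<le>length w. \<forall>i\<ge>1. count_list (take p w) (Suc i) \<le> count_list (take p w) i)"

definition bullet_word :: "nat \<Rightarrow> nat list \<Rightarrow> nat list" where
  "bullet_word k w = rev (map (\<lambda>x. Suc k - x) w)"

definition opp_yamanouchi :: "nat \<Rightarrow> nat list \<Rightarrow> bool" where
  "opp_yamanouchi k w \<longleftrightarrow> yamanouchi (bullet_word k w)"

definition skew_tabs :: "nat \<Rightarrow> nat \<Rightarrow> nat list \<Rightarrow> nat list \<Rightarrow> nat list \<Rightarrow> skew_tab set" where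
  "skew_tabs d m \<mu> \<kappa> lam = {T. semistandard T \<and> nrows T = d \<and> ncols T = m \<and>
     inner T = \<mu> \<and> outer T = dual_part m lam \<and> has_content (row_word T) \<kappa>}"

definition LR :: "nat \<Rightarrow> nat \<Rightarrow> nat list \<Rightarrow> nat list \<Rightarrow> nat list \<Rightarrow> skew_tab set" where
  "LR d m \<mu> \<nu> lam = {T \<in> skew_tabs d m \<mu> \<nu> lam. yamanouchi (row_word T)}"

definition oppLR :: "nat \<Rightarrow> nat \<Rightarrow> nat list \<Rightarrow> nat list \<Rightarrow> nat list \<Rightarrow> skew_tab set" where
  "oppLR d m \<mu> \<kappa> lam = {T \<in> skew_tabs d m \<mu> \<kappa> lam. opp_yamanouchi d (row_word T)}"

definition cLR :: "nat \<Rightarrow> nat \<Rightarrow> nat list \<Rightarrow> nat list \<Rightarrow> nat list \<Rightarrow> nat" where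
  "cLR d m \<mu> \<nu> lam = card (LR d m \<mu> \<nu> lam)"

definition coppLR :: "nat \<Rightarrow> nat \<Rightarrow> nat list \<Rightarrow> nat list \<Rightarrow> nat list \<Rightarrow> nat" where
  "coppLR d m \<mu> \<kappa> lam = card (oppLR d m \<mu> \<kappa> lam)"

inductive knuth_step :: "nat list \<Rightarrow> nat list \<Rightarrow> bool" where
  "x < y \<Longrightarrow> y \<le> z \<Longrightarrow> knuth_step (u @ [y, x, z] @ v) (u @ [y, z, x] @ v)"
| "x \<le> y \<Longrightarrow> y < z \<Longrightarrow> knuth_step (u @ [x, z, y] @ v) (u @ [z, x, y] @ v)"

definition standardize :: "nat list \<Rightarrow> nat list" where
  "standardize u = map (\<lambda>p. card {q. q < length u \<and> (u ! q < u ! p \<or> u ! q = u ! p \<and> q \<le> p)})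
     [0..<length u]"

text \<open>On permutations: exchange the values \<open>a\<close> and \<open>a + 1\<close> if \<open>a - 1\<close> or \<open>a + 2\<close> stands
  between them.\<close>

inductive dual_knuth_step :: "nat list \<Rightarrow> nat list \<Rightarrow> bool" where
  "p < q \<Longrightarrow> q < r \<Longrightarrow> r < length u \<Longrightarrow> {u ! p, u ! r} = {a, Suc a} \<Longrightarrow>
   Suc (u ! q) = a \<or> u ! q = Suc (Suc a) \<Longrightarrow>
   dual_knuth_step u (u[p := u ! r, r := u ! p])"

text \<open>The Knuth relations above are those for the reading word that goes from left to right in rows
  and from the bottom row to the top row, i.e. for the reverse of \<open>w(T)\<close>. With this reading
  standardization numbers equal letters from left to right.\<close>

definition knuth_equiv :: "skew_tab \<Rightarrow> skew_tab \<Rightarrow> bool" where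
  "knuth_equiv S T \<longleftrightarrow> equivclp knuth_step (rev (row_word S)) (rev (row_word T))"

definition dual_knuth_equiv :: "skew_tab \<Rightarrow> skew_tab \<Rightarrow> bool" where
  "dual_knuth_equiv S T \<longleftrightarrow> same_shape S T \<and>
     equivclp dual_knuth_step
       (standardize (rev (row_word S))) (standardize (rev (row_word T)))"

text \<open>The alphabet size \<open>k\<close> is a parameter of \<open>\<bullet>\<close>, of the reversal and of \<open>ot\<close>: it is the number
  \<open>d\<close> of rows for (opposite) LR tableaux in the \<open>d\<close>-row rectangle, while the opposite tableau
  obtained by applying \<open>ot\<close> to an opposite tableau is an opposite tableau over the alphabet
  \<open>{1..\<nu>\<^sub>1}\<close>.\<close>

definition bullet :: "nat \<Rightarrow> skew_tab \<Rightarrow> skew_tab" where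
  "bullet k T = \<lparr>nrows = nrows T, ncols = ncols T,
     inner = dual_part (ncols T) (outer T), outer = dual_part (ncols T) (inner T),
     fill = (\<lambda>i j. if i \<le> nrows T \<and> j \<le> ncols T \<and> box T (Suc (nrows T) - i) (Suc (ncols T) - j)
       then Suc k - fill T (Suc (nrows T) - i) (Suc (ncols T) - j) else 0)\<rparr>"

definition reversal_over :: "nat \<Rightarrow> skew_tab \<Rightarrow> skew_tab" where
  "reversal_over k T = (THE T'. semistandard T' \<and> set (row_word T') \<subseteq> {1..k} \<and>
     dual_knuth_equiv T T' \<and> knuth_equiv T' (bullet k T))"

text \<open>Letter number \<open>p\<close> of the word, being the \<open>r\<close>-th occurrence of its value, is replaced by
  \<open>r\<close> if the word is Yamanouchi. If it is opposite Yamanouchi over \<open>{1..k}\<close> with weight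
  \<open>(\<nu>\<^sub>k, \<dots>, \<nu>\<^sub>1)\<close>, so that \<open>\<nu>\<^sub>1\<close> is the multiplicity of \<open>k\<close>, it is replaced by
  \<open>\<nu>\<^sub>1 - \<nu>\<^sub>i + r\<close>, where \<open>k - i + 1\<close> is the letter. (If both apply, all multiplicities agree and
  the two rules coincide.)\<close>

definition ot_word :: "nat \<Rightarrow> nat list \<Rightarrow> nat list" where
  "ot_word k w = map (\<lambda>p. (if yamanouchi w then 0 else count_list w k - count_list w (w ! p))
       + count_list (take (Suc p) w) (w ! p)) [0..<length w]"

text \<open>The shape \<open>(outer/inner)\<^sup>t\<^sup>\<bullet>\<close> lives in the transposed rectangle; it is filled so that its
  column word is the given one.\<close>

definition fill_columns :: "skew_tab \<Rightarrow> nat list \<Rightarrow> skew_tab" where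
  "fill_columns S w = S\<lparr>fill := (\<lambda>i j. case map_of (zip (col_boxes S) w) (i, j) of
     None \<Rightarrow> 0 | Some x \<Rightarrow> x)\<rparr>"

definition ot :: "nat \<Rightarrow> skew_tab \<Rightarrow> skew_tab" where
  "ot k T = fill_columns
     \<lparr>nrows = ncols T, ncols = nrows T,
      inner = dual_part (nrows T) (transpose_part (ncols T) (outer T)),
      outer = dual_part (nrows T) (transpose_part (ncols T) (inner T)),
      fill = (\<lambda>_ _. 0)\<rparr>
     (ot_word k (row_word T))"

definition reversal :: "skew_tab \<Rightarrow> skew_tab" where
  "reversal T = reversal_over (nrows T) T"

definition rho :: "skew_tab \<Rightarrow> skew_tab" where
  "rho T = bullet (nrows T) (reversal T)"

definition varrho :: "skew_tab \<Rightarrow> skew_tab" where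
  "varrho T = ot (nrows T) (rho T)"

text \<open>Parentheses matching: \<open>i\<close> opens, \<open>i + 1\<close> closes. The result consists of the positions of the
  unmatched \<open>i + 1\<close> and of the unmatched \<open>i\<close>; the former all precede the latter. The arguments
  \<open>cs\<close> and \<open>os\<close> hold the currently unmatched positions, the latest one first.\<close>

fun unmatched :: "nat \<Rightarrow> nat \<Rightarrow> nat list \<Rightarrow> nat list \<Rightarrow> nat list \<Rightarrow> nat list \<times> nat list" where
  "unmatched i p cs os [] = (rev cs, rev os)"
| "unmatched i p cs os (x # w) =
     (if x = i then unmatched i (Suc p) cs (p # os) w
      else if x = Suc i then
        (case os of [] \<Rightarrow> unmatched i (Suc p) (p # cs) [] w
                  | _ # os' \<Rightarrow> unmatched i (Suc p) cs os' w)
      else unmatched i (Suc p) cs os w)"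

text \<open>The unmatched subword \<open>(i + 1)\<^sup>r i\<^sup>s\<close> is replaced by \<open>(i + 1)\<^sup>s i\<^sup>r\<close>.\<close>

definition crystal_refl :: "nat \<Rightarrow> nat list \<Rightarrow> nat list" where
  "crystal_refl i w = (let (cs, os) = unmatched i 0 [] [] w; ps = cs @ os in
     map (\<lambda>p. if p \<in> set (take (length os) ps) then Suc i
              else if p \<in> set (drop (length os) ps) then i else w ! p) [0..<length w])"

text \<open>The longest element of \<open>\<SS>\<^sub>k\<close>, through its reduced word with the letters
  \<open>1, 2, 1, 3, 2, 1, \<dots>, k - 1, \<dots>, 1\<close>.\<close>

definition sigma0 :: "nat \<Rightarrow> nat list \<Rightarrow> nat list" where
  "sigma0 k = fold crystal_refl (concat (map (\<lambda>j. rev [1..<Suc j]) [1..<k]))"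

text \<open>Data are tuples of arrays of natural numbers. The bit-size of an array \<open>D\<close> of length \<open>l\<close> with
  maximal entry \<open>M\<close> is \<open>l \<lceil>log\<^sub>2 M + 1\<rceil>\<close>, with \<open>M\<close> replaced by \<open>1\<close> if it is \<open>0\<close>.\<close>

definition array_size :: "nat list \<Rightarrow> nat" where
  "array_size D = length D * nat \<lceil>log 2 (real (Max (insert 1 (set D)))) + 1\<rceil>"

definition bit_size :: "nat list list \<Rightarrow> nat" where
  "bit_size x = sum_list (map array_size x)"

text \<open>Running times refer to structured programs of a random access machine with the logarithmic
  cost measure of Cook and Reckhow: an instruction costs the number of bits of the operands and
  addresses it uses. The state consists of registers and of the main memory, which is accessed
  through addresses held in registers. Subtraction is truncated.\<close>

datatype ram =
    Skip
  | Const nat nat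
  | Add nat nat nat
  | Sub nat nat nat
  | Load nat nat
  | Store nat nat
  | Seq ram ram
  | IfPos nat ram ram
  | WhilePos nat ram

type_synonym ram_state = "(nat \<Rightarrow> nat) \<times> (nat \<Rightarrow> nat)"

definition bits :: "nat \<Rightarrow> nat" where
  "bits x = max 1 (floorlog 2 x)"

text \<open>\<open>exec c s t s'\<close>: the program \<open>c\<close> started in \<open>s\<close> halts in \<open>s'\<close> at cost \<open>t\<close>.\<close>

inductive exec :: "ram \<Rightarrow> ram_state \<Rightarrow> nat \<Rightarrow> ram_state \<Rightarrow> bool" where
  "exec Skip s 1 s"
| "exec (Const a n) (r, M) (bits n) (r(a := n), M)"
| "exec (Add a b c) (r, M) (bits (r b) + bits (r c)) (r(a := r b + r c), M)"
| "exec (Sub a b c) (r, M) (bits (r b) + bits (r c)) (r(a := r b - r c), M)"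
| "exec (Load a b) (r, M) (bits (r b) + bits (M (r b))) (r(a := M (r b)), M)"
| "exec (Store a b) (r, M) (bits (r a) + bits (r b)) (r, M(r a := r b))"
| "exec c s t s' \<Longrightarrow> exec c' s' t' s'' \<Longrightarrow> exec (Seq c c') s (t + t') s''"
| "r a > 0 \<Longrightarrow> exec c (r, M) t s' \<Longrightarrow> exec (IfPos a c c') (r, M) (bits (r a) + t) s'"
| "r a = 0 \<Longrightarrow> exec c' (r, M) t s' \<Longrightarrow> exec (IfPos a c c') (r, M) (bits (r a) + t) s'"
| "r a = 0 \<Longrightarrow> exec (WhilePos a c) (r, M) (bits (r a)) (r, M)"
| "r a > 0 \<Longrightarrow> exec c (r, M) t s' \<Longrightarrow> exec (WhilePos a c) s' t' s'' \<Longrightarrow>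
   exec (WhilePos a c) (r, M) (bits (r a) + t + t') s''"

text \<open>A tuple is stored as the number of its arrays, their lengths, and their entries. At the start
  all other cells and all registers are \<open>0\<close>; at the end they are arbitrary.\<close>

definition layout :: "nat list list \<Rightarrow> nat list" where
  "layout x = length x # map length x @ concat x"

definition input_state :: "nat list list \<Rightarrow> ram_state" where
  "input_state x = (\<lambda>_. 0, \<lambda>p. if p < length (layout x) then layout x ! p else 0)"

definition output_in :: "nat list list \<Rightarrow> ram_state \<Rightarrow> bool" where
  "output_in y s \<longleftrightarrow> (\<forall>p<length (layout y). snd s p = layout y ! p)"

definition linear_cost :: "nat list list set \<Rightarrow> (nat list list \<Rightarrow> nat list list) \<Rightarrow> bool" where
  "linear_cost A f \<longleftrightarrow> (\<exists>c K. \<forall>x\<in>A. \<exists>t s. exec c (input_state x) t s \<and> output_in (f x) s \<and>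
     t \<le> K * Suc (bit_size x))"

definition size_neutral :: "nat list list set \<Rightarrow> (nat list list \<Rightarrow> nat list list) \<Rightarrow> bool" where
  "size_neutral A f \<longleftrightarrow> (\<exists>K. \<forall>x\<in>A. bit_size (f x) \<le> K * bit_size x)"

text \<open>A map on arrays is given by its domain, its values on the domain, and its codomain.\<close>

type_synonym array_map =
  "nat list list set \<times> (nat list list \<Rightarrow> nat list list) \<times> nat list list set"

text \<open>\<open>ps_circuit \<alpha> A f B s\<close>: a parallel-sequential circuit composed of linear cost maps and \<open>s\<close>
  copies of \<open>\<alpha>\<close> computes \<open>f : A \<rightarrow> B\<close>. In the parallel composition a pair of tuples is
  represented by their concatenation; the tuples of the first component have a fixed arity.\<close>

inductive ps_circuit ::
  "array_map \<Rightarrow> nat list list set \<Rightarrow> (nat list list \<Rightarrow> nat list list) \<Rightarrow> nat list list set \<Rightarrow> nat \<Rightarrow> bool"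
  for \<alpha> :: array_map where
  linear: "f ` A \<subseteq> B \<Longrightarrow> linear_cost A f \<Longrightarrow> size_neutral A f \<Longrightarrow> ps_circuit \<alpha> A f B 0"
| call: "\<alpha> = (A, f, B) \<Longrightarrow> ps_circuit \<alpha> A f B 1"
| sequential: "ps_circuit \<alpha> A f B s \<Longrightarrow> ps_circuit \<alpha> B g C t \<Longrightarrow> ps_circuit \<alpha> A (g \<circ> f) C (s + t)"
| parallel: "ps_circuit \<alpha> A f B s \<Longrightarrow> ps_circuit \<alpha> A' g B' t \<Longrightarrow> \<forall>x\<in>A. length x = k \<Longrightarrow>
    ps_circuit \<alpha> {x @ y |x y. x \<in> A \<and> y \<in> A'} (\<lambda>z. f (take k z) @ g (drop k z))
      {x @ y |x y. x \<in> B \<and> y \<in> B'} (s + t)"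

definition linearly_reducible :: "array_map \<Rightarrow> array_map \<Rightarrow> bool" where
  "linearly_reducible \<beta> \<alpha> \<longleftrightarrow> (case (\<beta>, \<alpha>) of ((A, f, B), (A', f', B')) \<Rightarrow>
     size_neutral A f \<and> size_neutral A' f' \<and>
     (\<exists>g s. ps_circuit \<alpha> A g B s \<and> (\<forall>x\<in>A. g x = f x)))"

definition linearly_equivalent :: "array_map \<Rightarrow> array_map \<Rightarrow> bool" where
  "linearly_equivalent \<alpha> \<beta> \<longleftrightarrow> linearly_reducible \<alpha> \<beta> \<and> linearly_reducible \<beta> \<alpha>"

text \<open>A tableau is stored as the dimensions of its rectangle followed by the rectangle, row by row.
  Cells in the inner shape hold \<open>0\<close>, cells outside the outer shape hold \<open>nrows + 1\<close>; thus both
  boundary partitions can be read off, as entries are at most \<open>nrows\<close>. The recording matrix of a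
  tableau (numbers of letters \<open>j\<close> in row \<open>i\<close>) is not used, since \<open>ot\<close> is not size-neutral for it:
  a single row with \<open>N\<close> letters 1 has a recording matrix of size \<open>O(log N)\<close>, its transpose one
  with \<open>N\<^sup>2\<close> entries.\<close>

definition cell :: "skew_tab \<Rightarrow> nat \<Rightarrow> nat \<Rightarrow> nat" where
  "cell T i j = (if j \<le> inner T ! (i - 1) then 0
     else if j \<le> outer T ! (i - 1) then fill T i j else Suc (nrows T))"

definition encode :: "skew_tab \<Rightarrow> nat list list" where
  "encode T = [nrows T # ncols T #
     [cell T i j. i \<leftarrow> [1..<Suc (nrows T)], j \<leftarrow> [1..<Suc (ncols T)]]]"

definition tableau_map :: "skew_tab set \<Rightarrow> (skew_tab \<Rightarrow> skew_tab) \<Rightarrow> skew_tab set \<Rightarrow> array_map" where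
  "tableau_map S F S' = (encode ` S, (\<lambda>x. encode (F (the_inv_into S encode x))), encode ` S')"

definition all_LR :: "skew_tab set" where
  "all_LR = {T. \<exists>n d \<mu> \<nu> lam. d \<le> n \<and> part_in d (n - d) \<mu> \<and> part_in d (n - d) \<nu> \<and>
     part_in d (n - d) lam \<and> T \<in> LR d (n - d) \<mu> \<nu> lam}"

definition all_oppLR :: "skew_tab set" where
  "all_oppLR = {T. \<exists>n d \<mu> \<nu> lam. d \<le> n \<and> part_in d (n - d) \<mu> \<and> part_in d (n - d) \<nu> \<and>
     part_in d (n - d) lam \<and> T \<in> oppLR d (n - d) \<mu> (rev \<nu>) lam}"

definition e_map :: array_map where
  "e_map = tableau_map all_LR reversal all_oppLR"

definition e_opp_map :: array_map where
  "e_opp_map = tableau_map all_oppLR reversal all_LR"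

definition rho_map :: array_map where
  "rho_map = tableau_map all_LR rho all_LR"

definition varrho_map :: array_map where
  "varrho_map = tableau_map all_LR varrho all_LR"

end

theory Submission
  imports Defs "HOL-Library.Multiset" "HOL-Library.FuncSet"
begin

text \<open>Standardization turns dual Knuth moves into Knuth moves of inverse permutations. There a crystal
  operator is a sequence of slides between two rows of a skew tableau, so it keeps the dual Knuth
  class, and \<open>\<sigma>\<^sub>0 w\<close> is the word of a tableau dual Knuth equivalent to \<open>T\<close>. Greene's
  invariants show that every word dual Knuth equivalent to a Yamanouchi word and with its
  multiplicities reversed is opposite Yamanouchi; a dual Knuth
  class contains at most one such tableau, and Yamanouchi words of equal weight are Knuth
  equivalent. This identifies the
  reversal with \<open>\<sigma>\<^sub>0\<close> and yields \<open>e\<close> and \<open>\<rho> = \<bullet> e\<close> as involutions.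

  On a Yamanouchi word \<open>ot\<close> takes the occurrence numbers of the letters. Up to dual Knuth
  equivalence this is the complement of the standardization, because the row word and the column
  word of a standard array are Knuth equivalent; so \<open>ot\<close> respects dual Knuth equivalence and, by
  uniqueness, commutes with \<open>e\<close>. Finally \<open>\<bullet>\<close> and \<open>ot\<close> need only a bounded number of
  operations per cell of the rectangle, on numbers whose length is that of the largest entry, and
  each of the involutions arises from any other one by composition with them.\<close>

section \<open>Knuth equivalence\<close>

text \<open>The definition of the reversal by \<open>THE\<close> asks for existence and uniqueness.
  The way around insertion algorithms is that every tableau concerned is LR or opposite LR: for
  Yamanouchi words Knuth equivalence amounts to equal weight, so the reversal of an LR tableau is
  recognized in its dual Knuth class by being opposite Yamanouchi. Greene's invariants enter only as
  colourings of prefixes, which a dual Knuth step transports.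

  Three mismatches shape the rest. Knuth relations refer to reversed words, hence the mirrored
  conditions \<open>slat\<close> and \<open>olat\<close>. \<open>ot\<close> prescribes a column
  word, while LR conditions and dual Knuth equivalence are read off rows, so both have to be carried
  from columns to rows. And \<open>ot\<close> of an opposite tableau has an alphabet of size \<nu>1,
  whereas \<rho> uses the number of rows. For the costs it matters that the dimensions are stored
  with the cells: addresses are at most quadratic in the largest entry, so an instruction costs a
  bounded multiple of the length of that entry.\<close>

lemma equivclp_map:
  assumes "equivclp r x y" "\<And>x y. r x y \<Longrightarrow> equivclp s (f x) (f y)"
  shows "equivclp s (f x) (f y)"
  using assms(1)
proof (induction rule: equivclp_induct)
  case (step y z)
  then show ?case using assms(2) by (meson equivclp_sym equivclp_trans)
qed simp

lemma equivclp_invariant: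
  assumes "equivclp r x y" "\<And>x y. r x y \<Longrightarrow> f x = f y"
  shows "f x = f y"
  using assms(1) by (induction rule: equivclp_induct) (auto dest: assms(2))

abbreviation knuth :: "nat list \<Rightarrow> nat list \<Rightarrow> bool" where
  "knuth \<equiv> equivclp knuth_step"

lemma knuth_step_append:
  assumes "knuth_step u v" shows "knuth_step (a @ u @ b) (a @ v @ b)"
  using assms
proof cases
  case (1 x y z u' v')
  then show ?thesis using knuth_step.intros(1)[of x y z "a @ u'" "v' @ b"] by simp
next
  case (2 x y z u' v')
  then show ?thesis using knuth_step.intros(2)[of x y z "a @ u'" "v' @ b"] by simp
qed

lemma knuth_append: "knuth u v \<Longrightarrow> knuth (a @ u @ b) (a @ v @ b)"
  by (erule equivclp_map[where f = "\<lambda>u. a @ u @ b"]) (auto intro: knuth_step_append)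

lemma knuth_append_left: "knuth u v \<Longrightarrow> knuth (a @ u) (a @ v)"
  using knuth_append[of u v a "[]"] by simp

lemma knuth_append_right: "knuth u v \<Longrightarrow> knuth (u @ b) (v @ b)"
  using knuth_append[of u v "[]" b] by simp

lemma knuth_Cons: "knuth u v \<Longrightarrow> knuth (x # u) (x # v)"
  using knuth_append_left[of u v "[x]"] by simp

lemma knuth_first: "x < y \<Longrightarrow> y \<le> z \<Longrightarrow> knuth (a @ y # x # z # b) (a @ y # z # x # b)"
  using knuth_step.intros(1)[of x y z a b] by auto

lemma knuth_second: "x \<le> y \<Longrightarrow> y < z \<Longrightarrow> knuth (a @ x # z # y # b) (a @ z # x # y # b)"
  using knuth_step.intros(2)[of x y z a b] by auto

lemma knuth_step_mset: "knuth_step u v \<Longrightarrow> mset u = mset v"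
  by (auto elim!: knuth_step.cases)

lemma knuth_mset: "knuth u v \<Longrightarrow> mset u = mset v"
  by (erule equivclp_invariant) (rule knuth_step_mset)

lemma knuth_set: "knuth u v \<Longrightarrow> set u = set v"
  using knuth_mset mset_eq_setD by blast

section \<open>Rotation of words\<close>

lemma bullet_word_append [simp]: "bullet_word k (u @ v) = bullet_word k v @ bullet_word k u"
  by (simp add: bullet_word_def)

lemma bullet_word_Nil [simp]: "bullet_word k [] = []"
  by (simp add: bullet_word_def)

lemma bullet_word_Cons: "bullet_word k (x # v) = bullet_word k v @ [Suc k - x]"
  by (simp add: bullet_word_def)

lemma length_bullet_word [simp]: "length (bullet_word k u) = length u"
  by (simp add: bullet_word_def)

lemma bullet_word_bullet_word: "set u \<subseteq> {..Suc k} \<Longrightarrow> bullet_word k (bullet_word k u) = u"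
  by (auto simp: bullet_word_def rev_map o_def intro!: map_idI)

lemma set_bullet_word: "set u \<subseteq> {1..k} \<Longrightarrow> set (bullet_word k u) \<subseteq> {1..k}"
  by (force simp: bullet_word_def)

lemma rev_bullet_word: "rev (bullet_word k u) = bullet_word k (rev u)"
  by (simp add: bullet_word_def rev_map)

lemma count_list_map_inj:
  assumes "\<And>y. y \<in> set u \<Longrightarrow> f y = z \<longleftrightarrow> y = x"
  shows "count_list (map f u) z = count_list u x"
  using assms by (induction u) auto

lemma count_bullet_word:
  assumes "set u \<subseteq> {1..k}" "1 \<le> i" "i \<le> k"
  shows "count_list (bullet_word k u) i = count_list u (Suc k - i)"
proof -
  have "count_list (map (\<lambda>x. Suc k - x) u) i = count_list u (Suc k - i)"
    using assms by (intro count_list_map_inj) auto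
  then show ?thesis by (simp add: bullet_word_def)
qed

text \<open>Complement and reversal together interchange the two Knuth relations and keep their
  direction. The bound on the letters keeps the truncated difference strictly antitone.\<close>

lemma knuth_step_bullet:
  assumes "knuth_step u v" "set u \<subseteq> {..Suc k}"
  shows "knuth_step (bullet_word k u) (bullet_word k v)"
  using assms(1)
proof cases
  case (1 x y z a b)
  then have "Suc k - z \<le> Suc k - y" "Suc k - y < Suc k - x" using assms(2) by auto
  from knuth_step.intros(2)[OF this, of "bullet_word k b" "bullet_word k a"]
  show ?thesis by (simp add: 1 bullet_word_Cons)
next
  case (2 x y z a b)
  then have "Suc k - z < Suc k - y" "Suc k - y \<le> Suc k - x" using assms(2) by auto
  from knuth_step.intros(1)[OF this, of "bullet_word k b" "bullet_word k a"]
  show ?thesis by (simp add: 2 bullet_word_Cons)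
qed

lemma knuth_bullet:
  assumes "knuth u v" "set u \<subseteq> {..Suc k}"
  shows "knuth (bullet_word k u) (bullet_word k v)"
  using assms(1)
proof (induction rule: equivclp_induct)
  case (step y z)
  have "set y \<subseteq> {..Suc k}" "set z \<subseteq> {..Suc k}"
    using step knuth_set[OF step(1)] assms(2) knuth_step_mset[THEN mset_eq_setD] by blast+
  then show ?case using step knuth_step_bullet by (meson equivclp_into_equivclp)
qed simp

section \<open>Yamanouchi words\<close>

text \<open>\<open>slat u\<close> says that the reverse of \<open>u\<close> is Yamanouchi; Knuth relations refer to the reverses of
  reading words.\<close>

fun slat :: "nat list \<Rightarrow> bool" where
  "slat [] \<longleftrightarrow> True"
| "slat (x # u) \<longleftrightarrow> slat u \<and> (2 \<le> x \<longrightarrow> count_list u x < count_list u (x - 1))"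

lemma yamanouchi_snoc:
  "yamanouchi (w @ [x]) \<longleftrightarrow> yamanouchi w \<and> (2 \<le> x \<longrightarrow> count_list w x < count_list w (x - 1))"
proof
  assume y: "yamanouchi (w @ [x])"
  have "yamanouchi w"
    unfolding yamanouchi_def
  proof (intro allI impI)
    fix p i :: nat assume "p \<le> length w" "1 \<le> i"
    then show "count_list (take p w) (Suc i) \<le> count_list (take p w) i"
      using y[unfolded yamanouchi_def, rule_format, of p i] by simp
  qed
  moreover have "count_list w x < count_list w (x - 1)" if "2 \<le> x"
    using y[unfolded yamanouchi_def, rule_format, of "Suc (length w)" "x - 1"] that
    by (cases x) (auto split: if_splits)
  ultimately show "yamanouchi w \<and> (2 \<le> x \<longrightarrow> count_list w x < count_list w (x - 1))" by blast
next
  assume y: "yamanouchi w \<and> (2 \<le> x \<longrightarrow> count_list w x < count_list w (x - 1))"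
  have c: "count_list w (Suc i) \<le> count_list w i" if "1 \<le> i" for i
    using y that unfolding yamanouchi_def by (metis order_refl take_all)
  show "yamanouchi (w @ [x])"
    unfolding yamanouchi_def
  proof (intro allI impI)
    fix p i :: nat assume p: "p \<le> length (w @ [x])" "1 \<le> i"
    show "count_list (take p (w @ [x])) (Suc i) \<le> count_list (take p (w @ [x])) i"
    proof (cases "p \<le> length w")
      case True
      then show ?thesis using y p unfolding yamanouchi_def by simp
    next
      case False
      then have "take p (w @ [x]) = w @ [x]" using p by simp
      moreover have "x = Suc i \<Longrightarrow> count_list w (Suc i) < count_list w i" using y p by auto
      ultimately show ?thesis using c[OF p(2)] by auto
    qed
  qed
qed

lemma yamanouchi_rev: "yamanouchi (rev u) \<longleftrightarrow> slat u"
proof (induction u)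
  case Nil
  then show ?case by (simp add: yamanouchi_def)
qed (simp add: yamanouchi_snoc)

lemma yamanouchi_count: "yamanouchi w \<Longrightarrow> 1 \<le> i \<Longrightarrow> count_list w (Suc i) \<le> count_list w i"
  unfolding yamanouchi_def by (metis order_refl take_all)

lemma slat_count: "slat u \<Longrightarrow> 1 \<le> i \<Longrightarrow> count_list u (Suc i) \<le> count_list u i"
  using yamanouchi_count[of "rev u" i] by (simp add: yamanouchi_rev)

text \<open>\<open>slat\<close> tests letters from the right end, and a letter sees the word behind
  it only through letter counts.\<close>

lemma slat_append_cong:
  assumes "slat w = slat w'" "mset w = mset w'"
  shows "slat (u @ w) = slat (u @ w')"
  using assms
proof (induction u)
  case (Cons a u)
  have "count_list (u @ w) = count_list (u @ w')"
    using Cons.prems(2) by (metis count_mset ext mset_append)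
  then show ?case using Cons by simp
qed simp

text \<open>The exchanged letters x < z affect each other's condition only if z = x + 1, and then y
  is one of them. In the first relation y = z, and the copy of z that is tested last imposes the
  condition anyway; in the second y = x is counted before z is tested, so the condition on z holds
  in both orders.\<close>

lemma knuth_step_slat:
  assumes "knuth_step u v" shows "slat u \<longleftrightarrow> slat v"
  using assms
proof cases
  case (1 x y z a b)
  have "slat ([y, x, z] @ b) = slat ([y, z, x] @ b)"
  proof (cases "slat b")
    case True
    then have c: "count_list b i \<le> count_list b (i - 1)" if "2 \<le> i" for i
      using slat_count[of b "i - 1"] that by simp
    show ?thesis
    proof (cases "x = z - 1")
      case True
      then have "y = z" "z = Suc x" using 1 by auto
      then show ?thesis using c[of x] by simp linarith?
    next
      case False
      then show ?thesis using 1(3,4) by auto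
    qed
  qed simp
  then show ?thesis unfolding 1 by (intro slat_append_cong) auto
next
  case (2 x y z a b)
  have "slat ([x, z, y] @ b) = slat ([z, x, y] @ b)"
  proof (cases "slat b")
    case True
    then have c: "count_list b i \<le> count_list b (i - 1)" if "2 \<le> i" for i
      using slat_count[of b "i - 1"] that by simp
    show ?thesis
    proof (cases "x = z - 1")
      case True
      then have "y = x" "z = Suc x" using 2 by auto
      then show ?thesis using c[of x] c[of z] by simp linarith?
    next
      case False
      then show ?thesis using 2(3,4) by auto
    qed
  qed simp
  then show ?thesis unfolding 2 by (intro slat_append_cong) auto
qed

lemma knuth_slat: "knuth u v \<Longrightarrow> slat u \<longleftrightarrow> slat v"
  by (erule equivclp_invariant) (rule knuth_step_slat)

section \<open>Normal forms of Yamanouchi words up to Knuth equivalence\<close>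

definition down :: "nat \<Rightarrow> nat list" where
  "down h = rev [1..<Suc h]"

lemma knuth_down_upper:
  assumes "x \<le> h"
  shows "knuth (x # rev [Suc x..<Suc h] @ x # v) (rev [Suc x..<Suc h] @ x # x # v)"
  using assms
proof (induction h rule: dec_induct)
  case (step h)
  have "\<exists>y w. rev [Suc x..<Suc h] @ x # v = y # w \<and> x \<le> y \<and> y < Suc h"
    using step.hyps by (cases "x = h") auto
  then obtain y w where y: "rev [Suc x..<Suc h] @ x # v = y # w" "x \<le> y" "y < Suc h" by blast
  have e: "rev [Suc x..<Suc (Suc h)] = Suc h # rev [Suc x..<Suc h]" using step.hyps by simp
  have "knuth (x # Suc h # rev [Suc x..<Suc h] @ x # v) (Suc h # x # rev [Suc x..<Suc h] @ x # v)"
    using knuth_second[OF y(2,3), of "[]" w] y(1) by simp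
  also have "knuth \<dots> (Suc h # rev [Suc x..<Suc h] @ x # x # v)"
    using step.IH by (rule knuth_Cons)
  finally show ?case by (simp add: e del: upt_Suc)
qed simp

lemma knuth_down_lower:
  "y \<le> x \<Longrightarrow> knuth (y # x # rev [1..<y]) (y # rev [1..<y] @ [x])"
proof (induction y)
  case (Suc y)
  show ?case
  proof (cases "y = 0")
    case False
    then have e: "rev [1..<Suc y] = y # rev [1..<y]" by simp
    have "knuth (Suc y # x # y # rev [1..<y]) (Suc y # y # x # rev [1..<y])"
      using knuth_first[of y "Suc y" x "[]" "rev [1..<y]"] Suc.prems
      by (simp add: equivclp_sym)
    also have "knuth \<dots> (Suc y # y # rev [1..<y] @ [x])"
      using Suc knuth_Cons[of "y # x # rev [1..<y]" "y # rev [1..<y] @ [x]" "Suc y"] by auto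
    finally show ?thesis unfolding e by simp
  qed simp
qed simp

text \<open>x jumps over h, ..., x + 1 by the second relation, with the letter behind the one jumped
  over as middle value. There it meets another x, and the rest is passed by the first relation with
  the letter on the left as middle value.\<close>

lemma knuth_down:
  assumes "1 \<le> x" "x \<le> h"
  shows "knuth (x # down h) (down h @ [x])"
proof -
  have "[1..<Suc h] = [1..<x] @ x # [Suc x..<Suc h]"
    using assms upt_add_eq_append[of 1 x "Suc h - x"] by (simp add: upt_conv_Cons del: upt_Suc)
  then have e: "down h = rev [Suc x..<Suc h] @ x # rev [1..<x]"
    by (simp add: down_def del: upt_Suc)
  have "knuth (x # down h) (rev [Suc x..<Suc h] @ x # x # rev [1..<x])"
    unfolding e using knuth_down_upper[OF assms(2)] .
  also have "knuth \<dots> (rev [Suc x..<Suc h] @ x # rev [1..<x] @ [x])"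
    by (intro knuth_append_left knuth_down_lower) simp
  finally show ?thesis by (simp add: e del: upt_Suc)
qed

lemma knuth_downs:
  assumes "1 \<le> x" "\<forall>h\<in>set hs. x \<le> h"
  shows "knuth (x # concat (map down hs) @ v) (concat (map down hs) @ x # v)"
  using assms(2)
proof (induction hs)
  case (Cons h hs)
  have "knuth ((x # down h) @ concat (map down hs) @ v) ((down h @ [x]) @ concat (map down hs) @ v)"
    using Cons.prems assms(1) by (intro knuth_append_right knuth_down) auto
  also have "knuth \<dots> (down h @ concat (map down hs) @ x # v)"
    using Cons by (simp add: knuth_append_left)
  finally show ?case by simp
qed simp

text \<open>The normal form is the column word of the tableau whose row i is filled with i. A new
  letter x passes all columns of height at least x. The first shorter column must have height x - 1,
  because fewer letters x than x - 1 were present, and x extends it; a letter 1 opens a new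
  column.\<close>

lemma slat_normal_form:
  assumes "slat u" "0 \<notin> set u"
  shows "\<exists>hs. sorted_wrt (\<ge>) hs \<and> 0 \<notin> set hs \<and> knuth u (concat (map down hs)) \<and>
    (\<forall>i\<ge>1. count_list u i = length (filter (\<lambda>h. i \<le> h) hs))"
  using assms
proof (induction u)
  case Nil
  then show ?case by (intro exI[of _ "[]"]) simp
next
  case (Cons x u)
  then obtain hs where hs: "sorted_wrt (\<ge>) hs" "0 \<notin> set hs" "knuth u (concat (map down hs))"
    "\<And>i. i \<ge> 1 \<Longrightarrow> count_list u i = length (filter (\<lambda>h. i \<le> h) hs)" by auto
  have x: "1 \<le> x" using Cons.prems by (cases x) auto
  define hs1 where "hs1 = takeWhile (\<lambda>h. x \<le> h) hs"
  define hs2 where "hs2 = dropWhile (\<lambda>h. x \<le> h) hs"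
  have hs12: "hs = hs1 @ hs2" by (simp add: hs1_def hs2_def)
  have l1: "\<forall>h\<in>set hs1. x \<le> h" using set_takeWhileD by (fastforce simp: hs1_def)
  have l2: "\<forall>h\<in>set hs2. h < x"
  proof (cases hs2)
    case (Cons h hs3)
    then have "h < x" using hd_dropWhile[of "\<lambda>h. x \<le> h" hs] by (auto simp: hs2_def)
    then show ?thesis using hs(1) Cons by (auto simp: hs12 sorted_wrt_append)
  qed simp
  have k1: "knuth (x # u) (concat (map down hs1) @ x # concat (map down hs2))"
  proof -
    have "knuth (x # u) (x # concat (map down hs1) @ concat (map down hs2))"
      using knuth_Cons[OF hs(3)] by (simp add: hs12)
    also have "knuth \<dots> (concat (map down hs1) @ x # concat (map down hs2))"
      by (rule knuth_downs[OF x l1])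
    finally show ?thesis .
  qed
  have f0: "filter (\<lambda>h. i \<le> h) hs2 = []" if "i \<ge> x" for i
    using l2 that by (force simp: filter_empty_conv)
  show ?case
  proof (cases "x = 1")
    case True
    then have "hs2 = []" using l2 hs(2) by (cases hs2) (auto simp: hs12)
    moreover have d1: "down (Suc 0) = [Suc 0]" by (simp add: down_def)
    ultimately show ?thesis using k1 hs True
      by (intro exI[of _ "hs @ [1]"]) (auto simp: hs12 sorted_wrt_append d1 Suc_le_eq intro: gr0I)
  next
    case False
    then have "count_list u x < count_list u (x - 1)" using Cons.prems x by auto
    \<comment> \<open>By the Yamanouchi condition the columns of height at least x - 1 outnumber
      those of height at least x, and all of \<open>hs1\<close> count for both.\<close>
    then have "filter (\<lambda>h. x - 1 \<le> h) hs2 \<noteq> []"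
      using False x hs(4)[of x] hs(4)[of "x - 1"] l1 f0[of x]
        filter_True[of hs1 "\<lambda>h. x \<le> h"] filter_True[of hs1 "\<lambda>h. x - 1 \<le> h"]
      by (fastforce simp: hs12)
    then obtain h0 where "h0 \<in> set hs2" "x - 1 \<le> h0" by (auto simp: filter_empty_conv)
    then obtain h hs3 where hs3: "hs2 = h # hs3" by (cases hs2) auto
    have h: "h = x - 1"
      using \<open>h0 \<in> set hs2\<close> \<open>x - 1 \<le> h0\<close> l2 hs(1) by (force simp: hs12 hs3 sorted_wrt_append)
    have "x # down h = down x" using x by (cases x) (auto simp: h down_def)
    then have "knuth (x # u) (concat (map down (hs1 @ x # hs3)))" 
      using k1 by (simp add: hs3 flip: append_Cons)
    moreover have "sorted_wrt (\<ge>) (hs1 @ x # hs3)"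
      using hs(1) l1 l2 by (auto simp: hs12 hs3 sorted_wrt_append)
    moreover have "count_list (x # u) i = length (filter (\<lambda>h. i \<le> h) (hs1 @ x # hs3))"
      if "i \<ge> 1" for i
      using hs(4)[OF that] x that by (auto simp: hs12 hs3 h)
    ultimately show ?thesis using hs(2) x by (intro exI[of _ "hs1 @ x # hs3"]) (auto simp: hs12 hs3)
  qed
qed

lemma sorted_counts_unique:
  assumes "sorted_wrt (\<ge>) hs" "sorted_wrt (\<ge>) hs'" "0 \<notin> set hs" "0 \<notin> set hs'"
    and c: "\<And>i. 1 \<le> i \<Longrightarrow> length (filter (\<lambda>h. i \<le> h) hs) = length (filter (\<lambda>h. i \<le> h) hs')"
  shows "hs = (hs' :: nat list)"
proof -
  have e: "count_list l i + length (filter (\<lambda>h. Suc i \<le> h) l) = length (filter (\<lambda>h. i \<le> h) l)"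
    for l :: "nat list" and i by (induction l) auto
  have "count_list hs i = count_list hs' i" for i
  proof (cases "i = 0")
    case False
    then show ?thesis using e[of hs i] e[of hs' i] c[of i] c[of "Suc i"] by simp
  qed (use assms(3,4) in \<open>simp add: count_list_0_iff\<close>)
  then have "mset (rev hs) = mset (rev hs')" by (simp add: multiset_eq_iff count_mset)
  moreover have "sorted (rev hs)" "sorted (rev hs')"
    using assms(1,2) by (simp_all add: sorted_wrt_rev)
  ultimately show ?thesis by (metis properties_for_sort rev_is_rev_conv)
qed

text \<open>The weight determines the column heights of the normal form. This turns the Knuth half
  of the reversal into a condition on weights.\<close>

theorem knuth_slat_unique:
  assumes "slat u" "slat u'" "0 \<notin> set u" "0 \<notin> set u'"
    and "\<And>i. 1 \<le> i \<Longrightarrow> count_list u i = count_list u' i"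
  shows "knuth u u'"
proof -
  obtain hs where hs: "sorted_wrt (\<ge>) hs" "0 \<notin> set hs" "knuth u (concat (map down hs))"
    "\<And>i. i \<ge> 1 \<Longrightarrow> count_list u i = length (filter (\<lambda>h. i \<le> h) hs)"
    using slat_normal_form[OF assms(1,3)] by auto
  obtain hs' where hs': "sorted_wrt (\<ge>) hs'" "0 \<notin> set hs'" "knuth u' (concat (map down hs'))"
    "\<And>i. i \<ge> 1 \<Longrightarrow> count_list u' i = length (filter (\<lambda>h. i \<le> h) hs')"
    using slat_normal_form[OF assms(2,4)] by auto
  have "hs = hs'" using hs hs' assms(5) by (intro sorted_counts_unique) auto
  then show ?thesis using hs(3) hs'(3) by (meson equivclp_sym equivclp_trans)
qed

section \<open>Standardization and dual Knuth equivalence\<close>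

abbreviation dual_knuth :: "nat list \<Rightarrow> nat list \<Rightarrow> bool" where
  "dual_knuth \<equiv> equivclp dual_knuth_step"

definition is_perm :: "nat list \<Rightarrow> bool" where
  "is_perm \<sigma> \<longleftrightarrow> distinct \<sigma> \<and> set \<sigma> = {1..length \<sigma>}"

text \<open>Positions are counted from 0, values from 1.\<close>

definition is_inv :: "nat list \<Rightarrow> nat list \<Rightarrow> bool" where
  "is_inv \<pi> \<sigma> \<longleftrightarrow> length \<sigma> = length \<pi> \<and> distinct \<pi> \<and> set \<pi> = {..<length \<pi>} \<and>
     (\<forall>k<length \<pi>. \<sigma> ! (\<pi> ! k) = Suc k)"

lemma is_inv_unique: "is_inv \<pi> \<sigma> \<Longrightarrow> is_inv \<pi> \<sigma>' \<Longrightarrow> \<sigma> = \<sigma>'"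
  unfolding is_inv_def by (intro nth_equalityI) (metis in_set_conv_nth lessThan_iff)+

lemma is_inv_perm:
  assumes "is_inv \<pi> \<sigma>" shows "is_perm \<sigma>"
proof -
  let ?n = "length \<pi>"
  have l: "length \<sigma> = ?n" and s: "set \<pi> = {..<?n}"
    and k: "\<And>k. k < ?n \<Longrightarrow> \<sigma> ! (\<pi> ! k) = Suc k" using assms by (auto simp: is_inv_def)
  have "set \<sigma> = (\<lambda>p. \<sigma> ! p) ` set \<pi>" unfolding s by (auto simp: set_conv_nth l)
  also have "\<dots> = Suc ` {..<?n}" by (force simp: set_conv_nth k)
  finally have s1: "set \<sigma> = {1..?n}" by (simp add: image_Suc_lessThan)
  then have "distinct \<sigma>" using l by (intro card_distinct) simp
  then show ?thesis by (simp add: is_perm_def l s1)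
qed

lemma dual_knuth_step_perm:
  assumes "dual_knuth_step \<sigma> \<sigma>'"
  shows "length \<sigma>' = length \<sigma>" "is_perm \<sigma> \<longleftrightarrow> is_perm \<sigma>'"
proof -
  from assms obtain p q r where "\<sigma>' = \<sigma>[p := \<sigma> ! r, r := \<sigma> ! p]" "p < length \<sigma>" "r < length \<sigma>"
    by cases auto
  then show "length \<sigma>' = length \<sigma>" "is_perm \<sigma> \<longleftrightarrow> is_perm \<sigma>'"
    by (auto simp: is_perm_def)
qed

lemma dual_knuth_perm:
  assumes "dual_knuth \<sigma> \<sigma>'"
  shows "length \<sigma>' = length \<sigma>" "is_perm \<sigma> \<longleftrightarrow> is_perm \<sigma>'"
  using equivclp_invariant[OF assms, of length] equivclp_invariant[OF assms, of is_perm]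
    dual_knuth_step_perm by metis+

lemma dual_knuth_step_sym:
  assumes "dual_knuth_step \<sigma> \<sigma>'" shows "dual_knuth_step \<sigma>' \<sigma>"
  using assms
proof cases
  case (1 p q r a)
  have "\<sigma>' ! p = \<sigma> ! r" "\<sigma>' ! r = \<sigma> ! p" "\<sigma>' ! q = \<sigma> ! q" "length \<sigma>' = length \<sigma>"
    using 1 by auto
  moreover have "\<sigma> = \<sigma>'[p := \<sigma> ! p, r := \<sigma> ! r]"
    using 1 by (auto simp: list_update_swap[of p r])
  ultimately show ?thesis
    using dual_knuth_step.intros[of p q r \<sigma>' a] 1 by (auto simp: insert_commute)
qed

text \<open>The pair of values a, a + 1 becomes n - a, n - a + 1, and a witness a - 1 or a + 2
  becomes n - a + 2 or n - a - 1. Since \<sigma> is a permutation of 1, ..., n, no difference is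
  truncated.\<close>

lemma dual_knuth_step_comp:
  assumes "dual_knuth_step \<sigma> \<sigma>'" "is_perm \<sigma>" and n: "n = length \<sigma>"
  shows "dual_knuth_step (map (\<lambda>x. Suc n - x) \<sigma>) (map (\<lambda>x. Suc n - x) \<sigma>')"
  using assms(1)
proof cases
  case (1 p q r a)
  let ?u = "map (\<lambda>x. Suc n - x) \<sigma>"
  have b: "1 \<le> \<sigma> ! t \<and> \<sigma> ! t \<le> n" if "t < n" for t
    using assms(2) that nth_mem[of t \<sigma>] unfolding is_perm_def n by auto
  have pq: "p < n" "q < n" "r < n" using 1 n by auto
  have "a \<le> n - 1" "1 \<le> a" using 1 b[OF pq(1)] b[OF pq(3)] by (auto simp: doubleton_eq_iff)
  then have "{?u ! p, ?u ! r} = {n - a, Suc (n - a)}"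
    using 1 n by (auto simp: doubleton_eq_iff)
  moreover have "Suc (?u ! q) = n - a \<or> ?u ! q = Suc (Suc (n - a))"
    using 1(6) b[OF pq(2)] pq(2) n \<open>a \<le> n - 1\<close> \<open>1 \<le> a\<close> by (simp; linarith)
  moreover have "map (\<lambda>x. Suc n - x) \<sigma>' = ?u[p := ?u ! r, r := ?u ! p]"
    using 1 n by (simp add: map_update)
  ultimately show ?thesis
    using dual_knuth_step.intros[of p q r ?u "n - a"] 1(2-4) n by (simp only: length_map)
qed

lemma dual_knuth_step_rev:
  assumes "dual_knuth_step \<sigma> \<sigma>'"
  shows "dual_knuth_step (rev \<sigma>) (rev \<sigma>')"
  using assms
proof cases
  case (1 p q r a)
  let ?n = "length \<sigma>"
  let ?p = "?n - Suc r" and ?q = "?n - Suc q" and ?r = "?n - Suc p"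
  have e: "rev \<sigma> ! ?p = \<sigma> ! r" "rev \<sigma> ! ?q = \<sigma> ! q" "rev \<sigma> ! ?r = \<sigma> ! p"
    using 1 by (auto simp: rev_nth)
  have "rev \<sigma>' = (rev \<sigma>)[?r := \<sigma> ! r, ?p := \<sigma> ! p]"
    using 1 by (simp add: rev_update)
  also have "\<dots> = (rev \<sigma>)[?p := \<sigma> ! p, ?r := \<sigma> ! r]"
    using 1 by (intro list_update_swap) auto
  finally show ?thesis
    using dual_knuth_step.intros[of ?p ?q ?r "rev \<sigma>" a] 1 e by (auto simp: insert_commute)
qed

lemma dual_knuth_comp:
  assumes "dual_knuth \<sigma> \<sigma>'" "is_perm \<sigma>" "n = length \<sigma>"
  shows "dual_knuth (map (\<lambda>x. Suc n - x) \<sigma>) (map (\<lambda>x. Suc n - x) \<sigma>')"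
  using assms(1)
proof (induction rule: equivclp_induct)
  case (step y z)
  have "is_perm y" "n = length y" using dual_knuth_perm[OF step(1)] assms by auto
  then show ?case
    using step dual_knuth_step_comp dual_knuth_step_sym by (metis equivclp_into_equivclp)
qed simp

lemma dual_knuth_rev: "dual_knuth \<sigma> \<sigma>' \<Longrightarrow> dual_knuth (rev \<sigma>) (rev \<sigma>')"
  by (erule equivclp_map) (auto intro: dual_knuth_step_rev)

lemma dual_knuth_bullet:
  assumes "dual_knuth \<sigma> \<sigma>'" "is_perm \<sigma>" "n = length \<sigma>"
  shows "dual_knuth (bullet_word n \<sigma>) (bullet_word n \<sigma>')"
  unfolding bullet_word_def using assms by (intro dual_knuth_rev dual_knuth_comp)

text \<open>Counted backwards, a listed position carries the complementary value: reversing a list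
  of positions complements the permutation.\<close>

lemma is_inv_rev:
  assumes "is_inv \<pi> \<sigma>" "n = length \<sigma>"
  shows "is_inv (rev \<pi>) (map (\<lambda>x. Suc n - x) \<sigma>)"
  unfolding is_inv_def
proof (intro conjI allI impI)
  fix k assume k: "k < length (rev \<pi>)"
  then have "\<pi> ! (length \<pi> - Suc k) \<in> set \<pi>" by simp
  then have "\<pi> ! (length \<pi> - Suc k) < length \<sigma>" using assms by (auto simp: is_inv_def)
  then show "map (\<lambda>x. Suc n - x) \<sigma> ! (rev \<pi> ! k) = Suc k"
    using assms k by (auto simp: rev_nth is_inv_def)
qed (use assms in \<open>auto simp: is_inv_def\<close>)

text \<open>Exchanging adjacent entries of the inverse permutation exchanges consecutive values, and the
  neighbour that enables a Knuth relation becomes the value between whose position enables the dual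
  relation.\<close>

lemma dual_knuth_swap:
  assumes inv: "is_inv \<pi> \<sigma>" and k: "Suc k < length \<pi>"
    and j: "j < length \<pi>" "Suc j = k \<or> j = Suc (Suc k)"
    and w: "\<pi> ! k < \<pi> ! j \<and> \<pi> ! j < \<pi> ! Suc k \<or> \<pi> ! Suc k < \<pi> ! j \<and> \<pi> ! j < \<pi> ! k"
  shows "\<exists>\<sigma>'. is_inv (\<pi>[k := \<pi> ! Suc k, Suc k := \<pi> ! k]) \<sigma>' \<and> dual_knuth_step \<sigma> \<sigma>'"
proof (intro exI conjI)
  let ?s = "\<sigma>[\<pi> ! k := Suc (Suc k), \<pi> ! Suc k := Suc k]"
  have d: "distinct \<pi>" and l: "length \<sigma> = length \<pi>" and s: "set \<pi> = {..<length \<pi>}"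
    and i: "\<And>t. t < length \<pi> \<Longrightarrow> \<sigma> ! (\<pi> ! t) = Suc t"
    using inv by (auto simp: is_inv_def)
  have lt: "\<pi> ! t < length \<pi>" if "t < length \<pi>" for t using nth_mem[OF that] s by auto
  show "is_inv (\<pi>[k := \<pi> ! Suc k, Suc k := \<pi> ! k]) ?s"
    unfolding is_inv_def
  proof (intro conjI allI impI)
    fix t assume t: "t < length (\<pi>[k := \<pi> ! Suc k, Suc k := \<pi> ! k])"
    have ne: "\<pi> ! k \<noteq> \<pi> ! Suc k" using d k by (simp add: nth_eq_iff_index_eq)
    consider "t = k" | "t = Suc k" | "t \<noteq> k" "t \<noteq> Suc k" by blast
    then show "?s ! (\<pi>[k := \<pi> ! Suc k, Suc k := \<pi> ! k] ! t) = Suc t"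
    proof cases
      case 3
      then have "\<pi> ! t \<noteq> \<pi> ! k" "\<pi> ! t \<noteq> \<pi> ! Suc k"
        using d k t by (auto simp: nth_eq_iff_index_eq)
      then show ?thesis using 3 t i by simp
    qed (use k l lt ne in auto)
  qed (use d l s k in auto)
  show "dual_knuth_step \<sigma> ?s"
  proof (cases "\<pi> ! k < \<pi> ! Suc k")
    case True
    then show ?thesis
      using dual_knuth_step.intros[of "\<pi> ! k" "\<pi> ! j" "\<pi> ! Suc k" \<sigma> "Suc k"] w j k i l lt by auto
  next
    case False
    then have "\<pi> ! Suc k < \<pi> ! k" using w by auto
    then show ?thesis
      using dual_knuth_step.intros[of "\<pi> ! Suc k" "\<pi> ! j" "\<pi> ! k" \<sigma> "Suc k"] w j k i l lt
      by (auto simp: insert_commute list_update_swap[of "\<pi> ! k" "\<pi> ! Suc k"])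
  qed
qed

text \<open>The entries of \<pi> are distinct, so the inequalities of the Knuth relations become
  strict. Two relations in two directions give four patterns, and in each the entry next to the
  exchanged pair lies between the two in value.\<close>

lemma knuth_step_dual:
  assumes inv: "is_inv \<pi> \<sigma>" and "knuth_step \<pi> \<pi>' \<or> knuth_step \<pi>' \<pi>"
  shows "\<exists>\<sigma>'. is_inv \<pi>' \<sigma>' \<and> dual_knuth_step \<sigma> \<sigma>'"
proof -
  have d: "distinct \<pi>" using inv by (simp add: is_inv_def)
  from assms(2) consider
      (1) u v x y z where "\<pi> = u @ [y, x, z] @ v" "\<pi>' = u @ [y, z, x] @ v" "x < y" "y < z"
    | (2) u v x y z where "\<pi> = u @ [x, z, y] @ v" "\<pi>' = u @ [z, x, y] @ v" "x < y" "y < z"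
    | (3) u v x y z where "\<pi> = u @ [y, z, x] @ v" "\<pi>' = u @ [y, x, z] @ v" "x < y" "y < z"
    | (4) u v x y z where "\<pi> = u @ [z, x, y] @ v" "\<pi>' = u @ [x, z, y] @ v" "x < y" "y < z"
  proof -
    have "\<exists>u v x y z. x < y \<and> y < z \<and>
      (\<pi> = u @ [y, x, z] @ v \<and> \<pi>' = u @ [y, z, x] @ v \<or>
       \<pi> = u @ [x, z, y] @ v \<and> \<pi>' = u @ [z, x, y] @ v \<or>
       \<pi> = u @ [y, z, x] @ v \<and> \<pi>' = u @ [y, x, z] @ v \<or>
       \<pi> = u @ [z, x, y] @ v \<and> \<pi>' = u @ [x, z, y] @ v)"
      using assms(2)
    proof
      assume "knuth_step \<pi> \<pi>'"
      then show ?thesis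
      proof cases
        case (1 x y z u v)
        then have "y \<noteq> z" using d by auto
        then show ?thesis using 1 by (intro exI[of _ u] exI[of _ v] exI[of _ x] exI[of _ y] exI[of _ z]) auto
      next
        case (2 x y z u v)
        then have "x \<noteq> y" using d by auto
        then show ?thesis using 2 by (intro exI[of _ u] exI[of _ v] exI[of _ x] exI[of _ y] exI[of _ z]) auto
      qed
    next
      assume "knuth_step \<pi>' \<pi>"
      then show ?thesis
      proof cases
        case (1 x y z u v)
        then have "y \<noteq> z" using d by auto
        then show ?thesis using 1 by (intro exI[of _ u] exI[of _ v] exI[of _ x] exI[of _ y] exI[of _ z]) auto
      next
        case (2 x y z u v)
        then have "x \<noteq> y" using d by auto
        then show ?thesis using 2 by (intro exI[of _ u] exI[of _ v] exI[of _ x] exI[of _ y] exI[of _ z]) auto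
      qed
    qed
    then show thesis by (elim exE conjE disjE) (rule that; assumption)+
  qed
  then show ?thesis
  proof cases
    case 1
    then have "\<pi>' = \<pi>[Suc (length u) := \<pi> ! Suc (Suc (length u)), Suc (Suc (length u)) := \<pi> ! Suc (length u)]"
      by (simp add: list_update_append nth_append)
    with dual_knuth_swap[OF inv, of "Suc (length u)" "length u"] 1 show ?thesis
      by (simp add: nth_append)
  next
    case 2
    then have "\<pi>' = \<pi>[length u := \<pi> ! Suc (length u), Suc (length u) := \<pi> ! length u]"
      by (simp add: list_update_append nth_append)
    with dual_knuth_swap[OF inv, of "length u" "Suc (Suc (length u))"] 2 show ?thesis
      by (simp add: nth_append)
  next
    case 3
    then have "\<pi>' = \<pi>[Suc (length u) := \<pi> ! Suc (Suc (length u)), Suc (Suc (length u)) := \<pi> ! Suc (length u)]"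
      by (simp add: list_update_append nth_append)
    with dual_knuth_swap[OF inv, of "Suc (length u)" "length u"] 3 show ?thesis
      by (simp add: nth_append)
  next
    case 4
    then have "\<pi>' = \<pi>[length u := \<pi> ! Suc (length u), Suc (length u) := \<pi> ! length u]"
      by (simp add: list_update_append nth_append)
    with dual_knuth_swap[OF inv, of "length u" "Suc (Suc (length u))"] 4 show ?thesis
      by (simp add: nth_append)
  qed
qed

text \<open>Source of the dual Knuth equivalences below: they are proved as Knuth equivalences
  between lists of positions.\<close>

theorem knuth_dual_knuth:
  assumes "knuth \<pi> \<pi>'" "is_inv \<pi> \<sigma>" "is_inv \<pi>' \<sigma>'"
  shows "dual_knuth \<sigma> \<sigma>'"
proof -
  have "\<exists>\<tau>. is_inv \<pi>' \<tau> \<and> dual_knuth \<sigma> \<tau>"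
    using assms(1)
  proof (induction rule: equivclp_induct)
    case base
    then show ?case using assms(2) by (intro exI[of _ \<sigma>]) auto
  next
    case (step y z)
    then obtain \<tau> where \<tau>: "is_inv y \<tau>" "dual_knuth \<sigma> \<tau>" by blast
    obtain \<tau>' where "is_inv z \<tau>'" "dual_knuth_step \<tau> \<tau>'"
      using knuth_step_dual[OF \<tau>(1) step(2)] by blast
    then show ?case using \<tau>(2) by (blast intro: equivclp_into_equivclp)
  qed
  then show ?thesis using is_inv_unique[OF assms(3)] by auto
qed

section \<open>Standardization and its inverse permutation\<close>

lemma length_standardize [simp]: "length (standardize u) = length u"
  by (simp add: standardize_def)

text \<open>The rank of the k-th listed position counts the positions listed up to it. So listing
  positions letter by letter, and from left to right for each letter, inverts the
  standardization.\<close>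

lemma is_inv_standardize:
  assumes s: "sorted_wrt (\<lambda>p q. u ! p < u ! q \<or> u ! p = u ! q \<and> p < q) \<pi>"
    and set: "set \<pi> = {..<length u}"
  shows "is_inv \<pi> (standardize u)"
proof -
  let ?R = "\<lambda>p q. u ! p < u ! q \<or> u ! p = u ! q \<and> p < q"
  have d: "distinct \<pi>"
    using s by (induction \<pi>) auto
  then have l: "length \<pi> = length u" using distinct_card[OF d] set by simp
  have "standardize u ! (\<pi> ! k) = Suc k" if k: "k < length \<pi>" for k
  proof -
    have "\<pi> ! k < length u" using nth_mem[OF k] set by auto
    moreover have "{q. q < length u \<and> (u ! q < u ! (\<pi> ! k) \<or> u ! q = u ! (\<pi> ! k) \<and> q \<le> \<pi> ! k)}
      = (!) \<pi> ` {..k}" (is "?A = ?B")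
    proof
      show "?A \<subseteq> ?B"
      proof
        fix q assume q: "q \<in> ?A"
        then obtain j where j: "j < length \<pi>" "q = \<pi> ! j" using set by (auto simp: set_conv_nth)
        have "\<not> k < j"
        proof
          assume "k < j"
          from sorted_wrt_nth_less[OF s this j(1)] show False using q j by auto
        qed
        then show "q \<in> ?B" using j by auto
      qed
      show "?B \<subseteq> ?A"
      proof
        fix q assume "q \<in> ?B"
        then obtain j where j: "j \<le> k" "q = \<pi> ! j" by auto
        have "j = k \<or> ?R q (\<pi> ! k)"
          using sorted_wrt_nth_less[OF s, of j k] j k by auto
        moreover have "q < length u" using j k nth_mem[of j \<pi>] set by auto
        ultimately show "q \<in> ?A" using j by auto
      qed
    qed
    moreover have "inj_on ((!) \<pi>) {..k}" using d k by (auto simp: inj_on_def nth_eq_iff_index_eq)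
    ultimately show ?thesis by (simp add: standardize_def card_image)
  qed
  then show ?thesis using d l set by (simp add: is_inv_def)
qed

fun occ :: "nat \<Rightarrow> nat \<Rightarrow> nat list \<Rightarrow> nat list" where
  "occ x n [] = []"
| "occ x n (y # u) = (if y = x then n # occ x (Suc n) u else occ x (Suc n) u)"

lemma occ_append [simp]: "occ x n (u @ v) = occ x n u @ occ x (n + length u) v"
  by (induction u arbitrary: n) auto

lemma length_occ [simp]: "length (occ x n u) = count_list u x"
  by (induction u arbitrary: n) auto

lemma set_occ: "set (occ x n u) = {p. n \<le> p \<and> p < n + length u \<and> u ! (p - n) = x}"
proof (induction u arbitrary: n)
  case (Cons y u)
  have "{p. n \<le> p \<and> p < n + length (y # u) \<and> (y # u) ! (p - n) = x} =
    (if y = x then {n} else {}) \<union> {p. Suc n \<le> p \<and> p < Suc n + length u \<and> u ! (p - Suc n) = x}"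
    by (auto simp: nth_Cons' le_Suc_eq split: if_splits)
  then show ?case by (simp add: Cons)
qed simp

lemma sorted_occ: "sorted_wrt (<) (occ x n u)"
  by (induction u arbitrary: n) (auto simp: set_occ)

text \<open>The inverse permutation of the standardization, cut into one increasing block of
  positions per letter. In the Knuth relations the blocks play the part of rows of a
  tableau.\<close>

definition listing :: "nat \<Rightarrow> nat list \<Rightarrow> nat list" where
  "listing k u = concat (map (\<lambda>x. occ x 0 u) [0..<Suc k])"

lemma is_inv_listing:
  assumes "set u \<subseteq> {..k}"
  shows "is_inv (listing k u) (standardize u)"
proof (rule is_inv_standardize)
  have "set (listing k u) = (\<Union>x\<le>k. set (occ x 0 u))"
    by (auto simp: listing_def less_Suc_eq_le simp del: upt_Suc)
  also have "\<dots> = {..<length u}"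
    using assms by (auto simp: set_occ) (meson atMost_iff nth_mem subsetD)
  finally show "set (listing k u) = {..<length u}" .
  have "sorted_wrt (\<lambda>p q. u ! p < u ! q \<or> u ! p = u ! q \<and> p < q)
      (concat (map (\<lambda>x. occ x 0 u) [0..<j]))" for j
  proof (induction j)
    case (Suc j)
    have "sorted_wrt (\<lambda>p q. u ! p < u ! q \<or> u ! p = u ! q \<and> p < q) (occ j 0 u)"
      using sorted_occ[of j 0 u] by (rule sorted_wrt_mono_rel[rotated]) (auto simp: set_occ)
    then show ?case using Suc by (auto simp: sorted_wrt_append set_occ)
  qed simp
  then show "sorted_wrt (\<lambda>p q. u ! p < u ! q \<or> u ! p = u ! q \<and> p < q) (listing k u)"
    unfolding listing_def .
qed

lemma is_perm_standardize: "is_perm (standardize u)"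
proof -
  have "set u \<subseteq> {..sum_list u}" by (auto intro: member_le_sum_list)
  from is_inv_perm[OF is_inv_listing[OF this]] show ?thesis .
qed

text \<open>Equal letters are numbered from left to right, so weakly increasing subsequences of a
  word are the increasing ones of its standardization. This makes colourings of the two
  interchangeable.\<close>

lemma standardize_less:
  assumes "p < q" "q < length u"
  shows "standardize u ! p \<le> standardize u ! q \<longleftrightarrow> u ! p \<le> u ! q"
proof
  assume "u ! p \<le> u ! q"
  then show "standardize u ! p \<le> standardize u ! q"
    unfolding standardize_def using assms by (auto intro!: card_mono)
next
  assume a: "standardize u ! p \<le> standardize u ! q"
  show "u ! p \<le> u ! q"
  proof (rule ccontr)
    assume "\<not> u ! p \<le> u ! q"
    then have "standardize u ! q < standardize u ! p"
    proof -
      have "{t. t < length u \<and> (u ! t < u ! q \<or> u ! t = u ! q \<and> t \<le> q)} \<subset>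
        {t. t < length u \<and> (u ! t < u ! p \<or> u ! t = u ! p \<and> t \<le> p)}" (is "?A \<subset> ?B")
      proof (rule psubsetI)
        show "?A \<subseteq> ?B" using \<open>\<not> u ! p \<le> u ! q\<close> by auto
        have "p \<in> ?B" "p \<notin> ?A" using \<open>\<not> u ! p \<le> u ! q\<close> assms by auto
        then show "?A \<noteq> ?B" by blast
      qed
      then show ?thesis unfolding standardize_def using assms by (simp add: psubset_card_mono)
    qed
    then show False using a by simp
  qed
qed

text \<open>Rotation reverses the order of positions behind the ranks, so rank r becomes n + 1 - r:
  the positions weakly before and those weakly after a given one overlap in that one only.\<close>

lemma standardize_bullet:
  assumes "set u \<subseteq> {..Suc k}"
  shows "standardize (bullet_word k u) = bullet_word (length u) (standardize u)"
proof (rule nth_equalityI)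
  fix p assume "p < length (standardize (bullet_word k u))"
  then have p: "p < length u" by simp
  let ?n = "length u"
  define p' where "p' = ?n - Suc p"
  have p': "p' < ?n" using p by (simp add: p'_def)
  have nth: "bullet_word k u ! q = Suc k - u ! (?n - Suc q)" if "q < ?n" for q
    using that by (simp add: bullet_word_def rev_nth)
  have le: "u ! q \<le> Suc k" if "q < ?n" for q using that assms nth_mem by blast
  let ?A = "{q. q < ?n \<and> (u ! q < u ! p' \<or> u ! q = u ! p' \<and> q \<le> p')}"
  let ?C = "{q. q < ?n \<and> (u ! p' < u ! q \<or> u ! q = u ! p' \<and> p' \<le> q)}"
  have "card {q. q < ?n \<and> (bullet_word k u ! q < bullet_word k u ! p \<or>
      bullet_word k u ! q = bullet_word k u ! p \<and> q \<le> p)} = card ?C"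
  proof (rule bij_betw_same_card[of "\<lambda>q. ?n - Suc q"], rule bij_betwI[where g = "\<lambda>q. ?n - Suc q"])
    show "(\<lambda>q. ?n - Suc q) \<in> {q. q < ?n \<and> (bullet_word k u ! q < bullet_word k u ! p \<or>
      bullet_word k u ! q = bullet_word k u ! p \<and> q \<le> p)} \<rightarrow> ?C"
    proof
      fix q assume "q \<in> {q. q < ?n \<and> (bullet_word k u ! q < bullet_word k u ! p \<or>
        bullet_word k u ! q = bullet_word k u ! p \<and> q \<le> p)}"
      then show "?n - Suc q \<in> ?C"
        using le[of "?n - Suc q"] le[OF p'] p by (auto simp: nth p'_def)
    qed
    show "(\<lambda>q. ?n - Suc q) \<in> ?C \<rightarrow> {q. q < ?n \<and> (bullet_word k u ! q < bullet_word k u ! p \<or>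
      bullet_word k u ! q = bullet_word k u ! p \<and> q \<le> p)}"
    proof
      fix q assume "q \<in> ?C"
      then show "?n - Suc q \<in> {q. q < ?n \<and> (bullet_word k u ! q < bullet_word k u ! p \<or>
        bullet_word k u ! q = bullet_word k u ! p \<and> q \<le> p)}"
        using le[of q] le[OF p'] p by (auto simp: nth p'_def Suc_diff_Suc)
    qed
  qed auto
  moreover have "card ?A + card ?C = Suc ?n"
  proof -
    have "?A \<union> ?C = {..<?n}" "?A \<inter> ?C = {p'}" using p' by auto
    then show ?thesis using card_Un_Int[of ?A ?C] by simp
  qed
  ultimately show "standardize (bullet_word k u) ! p = bullet_word ?n (standardize u) ! p"
    using p p' by (simp add: standardize_def bullet_word_def rev_nth flip: p'_def)
qed simp

section \<open>Greene's invariants\<close>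

text \<open>\<open>f\<close> colours some of the first \<open>l\<close> positions with colours \<open>1..j\<close> such that the entries of one
  colour increase weakly; uncoloured positions have value 0. By Greene's theorem the maximal number of
  coloured positions is a sum of row lengths; only its invariance under dual Knuth steps is needed.\<close>

definition incr_col :: "nat list \<Rightarrow> nat \<Rightarrow> nat \<Rightarrow> (nat \<Rightarrow> nat) \<Rightarrow> bool" where
  "incr_col u j l f \<longleftrightarrow> (\<forall>p. f p \<noteq> 0 \<longrightarrow> p < l \<and> f p \<le> j) \<and>
     (\<forall>p q. p < q \<longrightarrow> f p = f q \<longrightarrow> f p \<noteq> 0 \<longrightarrow> u ! p \<le> u ! q)"

lemma incr_colD:
  assumes "incr_col u j l f"
  shows "f p \<noteq> 0 \<Longrightarrow> p < l" "f p \<le> j" "p < q \<Longrightarrow> f p = f q \<Longrightarrow> f p \<noteq> 0 \<Longrightarrow> u ! p \<le> u ! q"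
proof -
  show "f p \<le> j" using assms unfolding incr_col_def by (cases "f p = 0") auto
qed (use assms in \<open>auto simp: incr_col_def\<close>)

text \<open>A colour class that contains both exchanged entries is repaired by exchanging its tail with
  the tail of the colour class of the witness.\<close>

lemma incr_col_dual_step:
  assumes step: "dual_knuth_step \<sigma> \<sigma>'" and perm: "is_perm \<sigma>" and l: "l \<le> length \<sigma>"
    and f: "incr_col \<sigma> j l f"
  shows "\<exists>f'. incr_col \<sigma>' j l f' \<and> card {p. f' p \<noteq> 0} = card {p. f p \<noteq> 0}"
  using step
proof cases
  case (1 p q r a)
  have d: "distinct \<sigma>" using perm by (simp add: is_perm_def)
  have p': "\<sigma>' ! p = \<sigma> ! r" "\<sigma>' ! r = \<sigma> ! p" using 1 by auto
  have o': "\<sigma>' ! t = \<sigma> ! t" if "t \<noteq> p" "t \<noteq> r" for t using that 1 by auto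
  have ne: "\<sigma> ! t \<noteq> \<sigma> ! s" if "t \<noteq> s" "t < length \<sigma>" "s < length \<sigma>" for t s
    using d that by (simp add: nth_eq_iff_index_eq)
  have lt: "t < length \<sigma>" if "f t \<noteq> 0" for t using incr_colD(1)[OF f that] l by simp
  have na: "\<sigma> ! t \<noteq> a \<and> \<sigma> ! t \<noteq> Suc a" if "f t \<noteq> 0" "t \<noteq> p" "t \<noteq> r" for t
    using ne[of t p] ne[of t r] that lt[OF that(1)] 1 by (auto simp: doubleton_eq_iff)
  show ?thesis
  proof (cases "\<sigma> ! p < \<sigma> ! r \<and> f p \<noteq> 0 \<and> f p = f r")
    \<comment> \<open>The values a and a + 1 compare alike with all other entries, so f itself
      survives unless the exchange inverts an ascending pair of one colour.\<close>
    case False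
    have "\<sigma>' ! x \<le> \<sigma>' ! y" if xy: "x < y" "f x = f y" "f x \<noteq> 0" for x y
    proof -
      have le: "\<sigma> ! x \<le> \<sigma> ! y" using incr_colD(3)[OF f] xy by blast
      have nn: "\<sigma> ! x \<noteq> \<sigma> ! y" using ne[of x y] lt[of x] lt[of y] xy by auto
      have n2: "\<not> (x = p \<and> y = r)" using False le nn xy by auto
      have n3: "\<not> (x = r \<and> y = p)" using xy 1 by auto
      have v: "\<sigma> ! p = a \<and> \<sigma> ! r = Suc a \<or> \<sigma> ! p = Suc a \<and> \<sigma> ! r = a"
        using 1 by (auto simp: doubleton_eq_iff)
      consider "x = p" "y \<noteq> p" "y \<noteq> r" | "x = r" "y \<noteq> p" "y \<noteq> r" | "y = p" "x \<noteq> p" "x \<noteq> r"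
        | "y = r" "x \<noteq> p" "x \<noteq> r" | "x \<noteq> p" "x \<noteq> r" "y \<noteq> p" "y \<noteq> r"
        using n2 n3 xy by blast
      then show ?thesis
      proof cases
        case 1 then show ?thesis using na[of y] p' o' v le xy by auto
      next
        case 2 then show ?thesis using na[of y] p' o' v le xy by auto
      next
        case 3 then show ?thesis using na[of x] p' o' v le xy by auto
      next
        case 4 then show ?thesis using na[of x] p' o' v le xy by auto
      qed (use o' le in auto)
    qed
    then have "incr_col \<sigma>' j l f" using f unfolding incr_col_def by blast
    then show ?thesis by blast
  next
    case True
    define s where "s = f p"
    have s: "s \<noteq> 0" "f p = s" "f r = s" using True s_def by auto
    have v: "\<sigma> ! p = a" "\<sigma> ! r = Suc a" using 1 True by (auto simp: doubleton_eq_iff)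
    have pr: "p < l" "r < l" "q < l" using s incr_colD(1)[OF f, of p] incr_colD(1)[OF f, of r] 1 by auto
    have sj: "s \<le> j" using incr_colD(2)[OF f] s by auto
    have S1: "\<sigma> ! t < a" if "f t = s" "t < p" for t
      using incr_colD(3)[OF f, of t p] that s v na[of t] 1 by force
    have S2: "Suc a < \<sigma> ! t" if "f t = s" "t > r" for t
      using incr_colD(3)[OF f, of r t] that s v na[of t] 1 by force
    have S3: "t \<le> p \<or> t \<ge> r" if "f t = s" for t
    proof (rule ccontr)
      assume nt: "\<not> (t \<le> p \<or> t \<ge> r)"
      then have "a \<le> \<sigma> ! t" "\<sigma> ! t \<le> Suc a"
        using incr_colD(3)[OF f, of p t] incr_colD(3)[OF f, of t r] that s v by auto
      then show False using na[of t] that s nt by force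
    qed
    have fin: "finite {t. f t \<noteq> 0}"
      by (rule finite_subset[of _ "{..<l}"]) (use incr_colD(1)[OF f] in auto)
    have qs: "f q \<noteq> s" using S3[of q] 1 by auto
    have nq: "\<sigma> ! t \<noteq> \<sigma> ! q" if "f t \<noteq> 0" "t \<noteq> q" for t using ne[of t q] that lt[of t] 1 by auto
    define \<rho> where "\<rho> = f q"
    show ?thesis
    proof (cases "\<rho> = 0")
      case True
      \<comment> \<open>The uncoloured witness replaces one of the exchanged entries. After the
        exchange p holds a + 1 and r holds a: a witness a - 1 can precede r, and a witness a + 2 can
        follow p.\<close>
      define z where "z = (if Suc (\<sigma> ! q) = a then p else r)"
      define f' where "f' = f(z := 0, q := s)"
      have z: "f z = s" "z \<noteq> q" using s 1 by (auto simp: z_def)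
      have "{t. f' t \<noteq> 0} = insert q ({t. f t \<noteq> 0} - {z})"
        using s z by (auto simp: f'_def)
      moreover have "q \<notin> {t. f t \<noteq> 0}" using True \<rho>_def by simp
      moreover have "z \<in> {t. f t \<noteq> 0}" using z s by simp
      ultimately have c: "card {t. f' t \<noteq> 0} = card {t. f t \<noteq> 0}"
        using fin card_Suc_Diff1[of "{t. f t \<noteq> 0}" z] by (simp only: card_insert_disjoint finite_Diff Diff_iff) simp
      have "\<sigma>' ! x \<le> \<sigma>' ! y" if xy: "x < y" "f' x = f' y" "f' x \<noteq> 0" for x y
      proof (cases "f' x = s")
        case False
        then have f: "f x = f y" "f x \<noteq> 0" "x \<noteq> q" "y \<noteq> q" "f x \<noteq> s"
          using xy s z by (auto simp: f'_def split: if_splits)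
        then have "x \<noteq> p" "x \<noteq> r" "y \<noteq> p" "y \<noteq> r" using s by auto
        then show ?thesis using incr_colD(3)[OF \<open>incr_col \<sigma> j l f\<close> xy(1)] f o' by auto
      next
        case True
        have o: "\<sigma>' ! q = \<sigma> ! q" using o' 1 by auto
        have w: "w = q \<or> f w = s \<and> w \<noteq> q \<and> w \<noteq> z \<and> (w < p \<and> \<sigma>' ! w = \<sigma> ! w \<and> \<sigma> ! w < a \<or> w = p \<or> w = r \<or>
            r < w \<and> \<sigma>' ! w = \<sigma> ! w \<and> Suc a < \<sigma> ! w) \<and> \<sigma> ! w \<noteq> \<sigma> ! q" if "f' w = s" for w
        proof (cases "w = q")
          case False
          then have w: "f w = s" "w \<noteq> z" using that s by (auto simp: f'_def split: if_splits)
          then show ?thesis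
            using S3[OF w(1)] S1[OF w(1)] S2[OF w(1)] o'[of w] nq[of w] s False 1(2,3)
            by (cases "w = p"; cases "w = r") auto
        qed simp
        have ff: "f x = s \<Longrightarrow> f y = s \<Longrightarrow> \<sigma> ! x \<le> \<sigma> ! y"
          using incr_colD(3)[OF f xy(1)] s by auto
        have wx: "f' x = s" and wy: "f' y = s" using True xy(2) by auto
        show ?thesis
        proof (cases "Suc (\<sigma> ! q) = a")
          case True
          then have zp: "z = p" by (simp add: z_def)
          have w': "w = q \<or> w = r \<or> f w = s \<and> w < p \<and> \<sigma>' ! w = \<sigma> ! w \<and> Suc (\<sigma> ! w) < a \<or>
            f w = s \<and> r < w \<and> \<sigma>' ! w = \<sigma> ! w \<and> Suc a < \<sigma> ! w" if "f' w = s" for w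
            using w[OF that] zp True by auto
          show ?thesis
            using w'[OF wx] w'[OF wy]
            by (elim disjE conjE) (use ff o p' v True 1(2,3) xy(1) in auto)
        next
          case False
          then have zr: "z = r" "\<sigma> ! q = Suc (Suc a)" using 1 by (auto simp: z_def)
          have w': "w = q \<or> w = p \<or> f w = s \<and> w < p \<and> \<sigma>' ! w = \<sigma> ! w \<and> \<sigma> ! w < a \<or>
            f w = s \<and> r < w \<and> \<sigma>' ! w = \<sigma> ! w \<and> Suc (Suc a) < \<sigma> ! w" if "f' w = s" for w
            using w[OF that] zr by auto
          show ?thesis
            using w'[OF wx] w'[OF wy]
            by (elim disjE conjE) (use ff o p' v zr 1(2,3) xy(1) in auto)
        qed
      qed
      moreover have "f' t \<noteq> 0 \<longrightarrow> t < l \<and> f' t \<le> j" for t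
        using f pr sj unfolding incr_col_def f'_def by auto
      ultimately have "incr_col \<sigma>' j l f'" unfolding incr_col_def by blast
      then show ?thesis using c by blast
    next
      case False
      \<comment> \<open>Behind the witness the two colours are exchanged. A witness a - 1 stays in
        front and is followed by r, which now holds a; a witness a + 2 moves into the colour of p,
        which now holds a + 1.\<close>
      define Z where "Z t \<longleftrightarrow> (if Suc (\<sigma> ! q) = a then q < t else q \<le> t)" for t
      define f' where "f' t = (if Z t \<and> f t = s then \<rho> else if Z t \<and> f t = \<rho> then s else f t)" for t
      have n: "s \<noteq> \<rho>" using qs \<rho>_def by simp
      have R1: "\<sigma> ! t < \<sigma> ! q \<and> t \<noteq> p \<and> t \<noteq> r" if "f t = \<rho>" "t < q" for t
        using incr_colD(3)[OF f, of t q] that nq[of t] False n s by (force simp: \<rho>_def)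
      have R2: "\<sigma> ! q < \<sigma> ! t \<and> t \<noteq> p \<and> t \<noteq> r" if "f t = \<rho>" "t > q" for t
        using incr_colD(3)[OF f, of q t] that nq[of t] False n s by (force simp: \<rho>_def)
      have Rn: "\<sigma> ! t \<noteq> a \<and> \<sigma> ! t \<noteq> Suc a" if "f t = \<rho>" for t
        using na[of t] that False n s by (cases "t = p"; cases "t = r") auto
      have c: "{t. f' t \<noteq> 0} = {t. f t \<noteq> 0}" using s False by (auto simp: f'_def)
      have o: "\<sigma>' ! q = \<sigma> ! q" using o' 1 by auto
      have "\<sigma>' ! x \<le> \<sigma>' ! y" if xy: "x < y" "f' x = f' y" "f' x \<noteq> 0" for x y
      proof (cases "f' x = s \<or> f' x = \<rho>")
        case False
        then have f: "f x = f y" "f x \<noteq> 0" "f x \<noteq> s" "f x \<noteq> \<rho>"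
          using xy by (auto simp: f'_def split: if_splits)
        then have "x \<noteq> p" "x \<noteq> r" "y \<noteq> p" "y \<noteq> r" using s by auto
        then show ?thesis using incr_colD(3)[OF \<open>incr_col \<sigma> j l f\<close> xy(1)] f o' by auto
      next
        case True
        have c4: "(f x = s \<and> f y = s \<and> (Z x \<longleftrightarrow> Z y)) \<or> (f x = \<rho> \<and> f y = \<rho> \<and> (Z x \<longleftrightarrow> Z y)) \<or>
          (f x = s \<and> \<not> Z x \<and> f y = \<rho> \<and> Z y) \<or> (f x = \<rho> \<and> \<not> Z x \<and> f y = s \<and> Z y)"
        proof -
          have "Z x \<Longrightarrow> Z y" using xy(1) by (auto simp: Z_def split: if_splits)
          then show ?thesis using True xy(2) n by (auto simp: f'_def split: if_splits)
        qed
        have ff: "f x = f y \<Longrightarrow> \<sigma> ! x \<le> \<sigma> ! y"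
          using incr_colD(3)[OF f xy(1)] s False c4 n by auto
        have x3: "f x = s \<Longrightarrow> x < p \<or> x = p \<or> x = r \<or> x > r" and
          y3: "f y = s \<Longrightarrow> y < p \<or> y = p \<or> y = r \<or> y > r" using S3[of x] S3[of y] by auto
        have ux: "x \<noteq> p \<Longrightarrow> x \<noteq> r \<Longrightarrow> \<sigma>' ! x = \<sigma> ! x"
          and uy: "y \<noteq> p \<Longrightarrow> y \<noteq> r \<Longrightarrow> \<sigma>' ! y = \<sigma> ! y" using o' by auto
        have rx: "f x = \<rho> \<Longrightarrow> x \<noteq> p \<and> x \<noteq> r" and ry: "f y = \<rho> \<Longrightarrow> y \<noteq> p \<and> y \<noteq> r" using s n by auto
        show ?thesis
          using c4
        proof (elim disjE conjE)
          assume e: "f x = s" "f y = s" "Z x = Z y"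
          have "\<not> (x = p \<and> y = r)" using e 1(2,3) by (auto simp: Z_def split: if_splits)
          then show ?thesis
            using x3[OF e(1)] y3[OF e(2)] ux uy S1[OF e(1)] S1[OF e(2)] S2[OF e(1)] S2[OF e(2)] ff e p' v 1(2,3) xy(1)
            by (elim disjE; simp)
        next
          assume e: "f x = \<rho>" "f y = \<rho>"
          then show ?thesis using rx ry ux uy ff by simp
        next
          assume e: "f x = s" "\<not> Z x" "f y = \<rho>" "Z y"
          have xp: "x < p \<or> x = p" using x3[OF e(1)] e(2) 1(2,3) by (auto simp: Z_def split: if_splits)
          have "y = q \<or> y > q" using e(4) by (auto simp: Z_def split: if_splits)
          then have "\<sigma> ! q \<le> \<sigma> ! y" using R2[OF e(3)] by auto
          moreover have "y = q \<Longrightarrow> \<sigma> ! q = Suc (Suc a)" using e(4) 1 by (auto simp: Z_def split: if_splits)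
          ultimately have "Suc a \<le> \<sigma> ! y \<and> a < \<sigma> ! y"
            using 1(6) Rn[OF e(3)] R2[OF e(3)] \<open>y = q \<or> y > q\<close> by auto
          then show ?thesis using xp S1[OF e(1)] ux uy ry[OF e(3)] p' v 1(2,3) by (elim disjE; simp)
        next
          assume e: "f x = \<rho>" "\<not> Z x" "f y = s" "Z y"
          have yr: "y = r \<or> y > r" using y3[OF e(3)] e(4) 1(2,3) by (auto simp: Z_def split: if_splits)
          have "x = q \<or> x < q" using e(2) by (auto simp: Z_def split: if_splits)
          then have "\<sigma> ! x \<le> \<sigma> ! q" using R1[OF e(1)] by auto
          moreover have "x = q \<Longrightarrow> Suc (\<sigma> ! q) = a" using e(2) 1 by (auto simp: Z_def split: if_splits)
          ultimately have "\<sigma> ! x < a" using 1(6) Rn[OF e(1)] R1[OF e(1)] \<open>x = q \<or> x < q\<close> by auto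
          then show ?thesis using yr S2[OF e(3)] ux uy rx[OF e(1)] p' v 1(2,3) by (elim disjE; simp)
        qed
      qed
      moreover have "f' t \<noteq> 0 \<longrightarrow> t < l \<and> f' t \<le> j" for t
        using incr_colD(1,2)[OF f, of t] incr_colD(2)[OF f, of q] sj s False
        by (auto simp: f'_def \<rho>_def split: if_splits)
      ultimately have "incr_col \<sigma>' j l f'" unfolding incr_col_def by blast
      then show ?thesis using c by auto
    qed
  qed
qed

lemma incr_col_dual:
  assumes "dual_knuth \<sigma> \<sigma>'" "is_perm \<sigma>" "l \<le> length \<sigma>" "incr_col \<sigma> j l f"
  shows "\<exists>f'. incr_col \<sigma>' j l f' \<and> card {p. f' p \<noteq> 0} = card {p. f p \<noteq> 0}"
  using assms(1)
proof (induction rule: equivclp_induct)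
  case base
  then show ?case using assms(4) by blast
next
  case (step y z)
  then obtain g where g: "incr_col y j l g" "card {p. g p \<noteq> 0} = card {p. f p \<noteq> 0}" by blast
  have "is_perm y" "l \<le> length y" "dual_knuth_step y z"
    using dual_knuth_perm[OF step(1)] assms(2,3) step(2) dual_knuth_step_sym by auto
  from incr_col_dual_step[OF this(3,1,2) g(1)] show ?case using g(2) by auto
qed

lemma incr_col_standardize:
  assumes "l \<le> length u"
  shows "incr_col (standardize u) j l f \<longleftrightarrow> incr_col u j l f"
proof -
  have "(standardize u ! p \<le> standardize u ! q) = (u ! p \<le> u ! q)"
    if "\<forall>p. f p \<noteq> 0 \<longrightarrow> p < l \<and> f p \<le> j" "p < q" "f p = f q" "f p \<noteq> 0" for p q
    using standardize_less[of p q u] that assms by (metis order_less_le_trans)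
  then show ?thesis unfolding incr_col_def by blast
qed

theorem incr_col_words:
  assumes "dual_knuth (standardize u) (standardize u')" "l \<le> length u" "incr_col u j l f"
  shows "\<exists>f'. incr_col u' j l f' \<and> card {p. f' p \<noteq> 0} = card {p. f p \<noteq> 0}"
proof -
  have "length u' = length u" using dual_knuth_perm(1)[OF assms(1)] by simp
  then show ?thesis
    using incr_col_dual[OF assms(1) is_perm_standardize, of l j f] assms(2,3)
    by (auto simp: incr_col_standardize)
qed

section \<open>Opposite Yamanouchi words\<close>

text \<open>\<open>olat k u\<close> says that the reverse of \<open>u\<close> is opposite Yamanouchi.\<close>

definition olat :: "nat \<Rightarrow> nat list \<Rightarrow> bool" where
  "olat k u \<longleftrightarrow> slat (bullet_word k u)"

lemma opp_yamanouchi_rev: "opp_yamanouchi k (rev u) \<longleftrightarrow> olat k u"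
  by (simp add: opp_yamanouchi_def olat_def flip: rev_bullet_word yamanouchi_rev)

text \<open>\<open>bullet_word\<close> and \<open>slat\<close> both reverse the word, so the
  condition concerns prefixes of u itself, with complemented letters.\<close>

lemma olat_iff:
  assumes "set u \<subseteq> {1..k}"
  shows "olat k u \<longleftrightarrow> (\<forall>l\<le>length u. \<forall>x. 1 \<le> x \<and> x < k \<longrightarrow>
    count_list (take l u) x \<le> count_list (take l u) (Suc x))"
proof -
  have c: "count_list (map (\<lambda>x. Suc k - x) (take l u)) i = count_list (take l u) (Suc k - i)"
    if "1 \<le> i" for l i
  proof (cases "i \<le> k")
    case True
    have "set (take l u) \<subseteq> {1..k}"
      using set_take_subset[of l u] assms by (rule order_trans)
    then have "set (bullet_word k (take l u)) \<subseteq> {1..k}"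
      "count_list (bullet_word k (take l u)) i = count_list (take l u) (Suc k - i)"
      using set_bullet_word count_bullet_word that True by auto
    then show ?thesis by (simp add: bullet_word_def)
  next
    case False
    have "0 \<notin> set (take l u)" using assms set_take_subset[of l u] by auto
    then have "count_list (take l u) (Suc k - i) = 0" using False by (simp add: count_list_0_iff)
    moreover have "i \<notin> set (map (\<lambda>x. Suc k - x) (take l u))"
    proof
      assume "i \<in> set (map (\<lambda>x. Suc k - x) (take l u))"
      then obtain x where "x \<in> set (take l u)" "i = Suc k - x" by auto
      moreover from this have "x \<noteq> 0" using \<open>0 \<notin> set (take l u)\<close> by metis
      ultimately show False using False by simp
    qed
    ultimately show ?thesis by (simp add: count_list_0_iff)
  qed
  have "olat k u \<longleftrightarrow> yamanouchi (map (\<lambda>x. Suc k - x) u)"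
    by (simp add: olat_def bullet_word_def flip: yamanouchi_rev)
  also have "\<dots> \<longleftrightarrow> (\<forall>l\<le>length u. \<forall>i\<ge>1.
      count_list (take l u) (Suc k - Suc i) \<le> count_list (take l u) (Suc k - i))"
    unfolding yamanouchi_def by (simp add: take_map c)
  also have "\<dots> \<longleftrightarrow> (\<forall>l\<le>length u. \<forall>x. 1 \<le> x \<and> x < k \<longrightarrow>
    count_list (take l u) x \<le> count_list (take l u) (Suc x))"
  proof (intro iffI allI impI)
    fix l x assume a: "\<forall>l\<le>length u. \<forall>i\<ge>1. count_list (take l u) (Suc k - Suc i) \<le> count_list (take l u) (Suc k - i)"
      "l \<le> length u" "1 \<le> x \<and> x < k"
    then show "count_list (take l u) x \<le> count_list (take l u) (Suc x)"
      using a(1)[rule_format, of l "k - x"] by (auto simp: Suc_diff_le)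
  next
    fix l i :: nat assume a: "\<forall>l\<le>length u. \<forall>x. 1 \<le> x \<and> x < k \<longrightarrow>
      count_list (take l u) x \<le> count_list (take l u) (Suc x)" "l \<le> length u" "1 \<le> i"
    have "0 \<notin> set (take l u)" using assms set_take_subset[of l u] by auto
    then have "k \<le> i \<Longrightarrow> count_list (take l u) (Suc k - Suc i) = 0" by (simp add: count_list_0_iff)
    then show "count_list (take l u) (Suc k - Suc i) \<le> count_list (take l u) (Suc k - i)"
      using a(1)[rule_format, of l "k - i"] a(2,3) by (cases "k \<le> i") (auto simp: Suc_diff_le)
  qed
  finally show ?thesis .
qed

lemma letter_bounds: "set u \<subseteq> {1..k} \<Longrightarrow> p < length u \<Longrightarrow> 1 \<le> u ! p \<and> u ! p \<le> k"
  by (meson atLeastAtMost_iff nth_mem subsetD)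

lemma count_take_card:
  "l \<le> length u \<Longrightarrow> count_list (take l u) x = card {p. p < l \<and> u ! p = x}"
proof (induction l)
  case (Suc l)
  have "{p. p < Suc l \<and> u ! p = x} = {p. p < l \<and> u ! p = x} \<union> (if u ! l = x then {l} else {})"
    by (auto simp: less_Suc_eq)
  then show ?case using Suc by (simp add: take_Suc_conv_app_nth)
qed simp

text \<open>For an opposite Yamanouchi word the first \<open>l\<close> letters are partitioned into strictly decreasing
  sequences, the \<open>r\<close>-th one consisting of the \<open>r\<close>-th occurrences of the letters; each of them meets
  a colour class at most once.\<close>

lemma incr_col_olat_bound:
  assumes u: "set u \<subseteq> {1..k}" "olat k u" and l: "l \<le> length u" and f: "incr_col u j l f" and j: "j \<le> k"
  shows "card {p. f p \<noteq> 0} \<le> card {p. p < l \<and> k - j < u ! p}"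
proof -
  \<comment> \<open>Positions with equal g form one of the sequences; g numbers the occurrences of
    each letter, starting from 0.\<close>
  define g where "g p = count_list (take p u) (u ! p)" for p
  have lat: "count_list (take l u) x \<le> count_list (take l u) y"
    if "l \<le> length u" "1 \<le> x" "x \<le> y" "y \<le> k" for l x y
    using that(3,4)
  proof (induction y rule: dec_induct)
    case (step y)
    then have "count_list (take l u) y \<le> count_list (take l u) (Suc y)"
      using u(2)[unfolded olat_iff[OF u(1)]] that by simp
    then show ?case using step by simp
  qed simp
  have cnt_mono: "count_list (take p u) x + (if u ! p = x then 1 else 0) \<le> count_list (take q u) x"
    if "p < q" "q \<le> length u" for p q x
  proof -
    have "take q u = take p u @ take (q - p) (drop p u)" using take_add[of p "q - p" u] that by simp
    moreover have "drop p u = u ! p # drop (Suc p) u" using that by (simp add: Cons_nth_drop_Suc)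
    moreover have "q - p = Suc (q - Suc p)" using that by simp
    ultimately show ?thesis by simp
  qed
  have range: "1 \<le> u ! p \<and> u ! p \<le> k" if "p < length u" for p using letter_bounds[OF u(1) that] .
  have dec: "u ! q < u ! p" if "p < q" "q < length u" "g p = g q" for p q
  proof (rule ccontr)
    assume "\<not> u ! q < u ! p"
    then have "count_list (take (Suc p) u) (u ! p) \<le> count_list (take (Suc p) u) (u ! q)"
      using that range[of p] range[of q] by (intro lat) auto
    moreover have "count_list (take (Suc p) u) (u ! p) = Suc (g p)"
      using that by (simp add: g_def take_Suc_conv_app_nth)
    moreover have "count_list (take (Suc p) u) (u ! q) \<le> g q"
    proof (cases "Suc p = q")
      case False
      then show ?thesis using cnt_mono[of "Suc p" q "u ! q"] that unfolding g_def by auto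
    qed (simp add: g_def)
    ultimately show False using that by simp
  qed
  \<comment> \<open>A sequence that contains a letter contains every larger letter up to k, since
    larger letters occur at least as often in each prefix.\<close>
  have ex: "\<exists>q<l. u ! q = y \<and> g q = g p" if p: "p < l" "u ! p \<le> y" "y \<le> k" for p y
  proof -
    have "g p < count_list (take (Suc p) u) (u ! p)"
      using p l by (simp add: g_def take_Suc_conv_app_nth)
    also have "\<dots> \<le> count_list (take (Suc p) u) y"
      using p l range[of p] by (intro lat) auto
    also have "\<dots> \<le> count_list (take l u) y"
      using cnt_mono[of "Suc p" l y] p l by (cases "Suc p = l") auto
    finally have "g p < count_list (take l u) y" .
    moreover have "c < count_list (take l u) y \<Longrightarrow> \<exists>q<l. u ! q = y \<and> count_list (take q u) y = c"
      if "l \<le> length u" for l c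
      using that
    proof (induction l)
      case (Suc l)
      show ?case
      proof (cases "c < count_list (take l u) y")
        case True
        then show ?thesis using Suc by (meson Suc_leD less_SucI)
      next
        case False
        then have "u ! l = y" "count_list (take l u) y = c"
          using Suc.prems by (auto simp: take_Suc_conv_app_nth split: if_splits)
        then show ?thesis by auto
      qed
    qed simp
    ultimately show ?thesis unfolding g_def using l by metis
  qed
  define S where "S = {p. f p \<noteq> 0}"
  define T where "T = {p. p < l \<and> k - j < u ! p}"
  have Sl: "S \<subseteq> {..<l}" using incr_colD(1)[OF f] by (auto simp: S_def)
  have fin: "finite S" "finite T" using Sl finite_subset by (auto simp: T_def)
  \<comment> \<open>Either all letters of the sequence exceed k - j, or it contains all of the j
    letters k - j + 1, ..., k by the previous step, while each of the j colours meets it at most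
    once.\<close>
  have cls: "card {p\<in>S. g p = c} \<le> card {p\<in>T. g p = c}" for c
  proof (cases "{p. p < l \<and> g p = c} \<subseteq> T")
    case True
    then have "{p\<in>S. g p = c} \<subseteq> {p\<in>T. g p = c}" using Sl by auto
    then show ?thesis using fin by (intro card_mono) auto
  next
    case False
    then obtain p where p: "p < l" "g p = c" "p \<notin> T" by auto
    then have p': "u ! p \<le> k - j" by (auto simp: T_def)
    have "\<forall>y\<in>{k-j<..k}. \<exists>q. q \<in> T \<and> g q = c \<and> u ! q = y"
    proof
      fix y assume y: "y \<in> {k-j<..k}"
      then obtain q where "q < l" "u ! q = y" "g q = g p" using ex[of p y] p p' by auto
      then show "\<exists>q. q \<in> T \<and> g q = c \<and> u ! q = y" using y p by (auto simp: T_def)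
    qed
    then have "{k-j<..k} \<subseteq> (!) u ` {p\<in>T. g p = c}" by force
    then have "card {k-j<..k} \<le> card {p\<in>T. g p = c}"
      using fin by (intro surj_card_le) auto
    then have "j \<le> card {p\<in>T. g p = c}" using j by simp
    moreover have "card {p\<in>S. g p = c} \<le> card {1..j}"
    proof (rule card_inj_on_le[of f])
      show "inj_on f {p\<in>S. g p = c}"
      proof (rule inj_onI, rule ccontr)
        fix p q assume a: "p \<in> {p\<in>S. g p = c}" "q \<in> {p\<in>S. g p = c}" "f p = f q" "p \<noteq> q"
        have "u ! x \<le> u ! y \<and> u ! y < u ! x"
          if "x \<in> {p\<in>S. g p = c}" "y \<in> {p\<in>S. g p = c}" "f x = f y" "x < y" for x y
          using incr_colD(3)[OF f that(4,3)] dec[of x y] that Sl l by (auto simp: S_def)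
        from this[of p q] this[of q p] show False using a by (cases "p < q") auto
      qed
      show "f ` {p\<in>S. g p = c} \<subseteq> {1..j}"
        using incr_colD(2)[OF f] by (auto simp: S_def Suc_le_eq)
    qed simp
    ultimately show ?thesis by simp
  qed
  have part: "card A = (\<Sum>c\<le>length u. card {p\<in>A. g p = c})" if "A \<subseteq> {..<l}" for A
  proof -
    have fA: "finite A" using that finite_subset by blast
    have "g p \<le> length u" for p
      unfolding g_def using count_le_length[of "take p u" "u ! p"] by simp
    then have "A = (\<Union>c\<in>{..length u}. {p\<in>A. g p = c})" by auto
    moreover have "card (\<Union>c\<in>{..length u}. {p\<in>A. g p = c}) = (\<Sum>c\<in>{..length u}. card {p\<in>A. g p = c})"
      using fA by (intro card_UN_disjoint) auto
    ultimately show ?thesis by simp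
  qed
  have "T \<subseteq> {..<l}" by (auto simp: T_def)
  then have "card S \<le> card T"
    unfolding part[OF Sl] part[OF \<open>T \<subseteq> {..<l}\<close>] by (intro sum_mono cls)
  then show ?thesis by (simp add: S_def T_def)
qed

text \<open>Each of the j largest letters is a colour class of its own. For opposite Yamanouchi
  words this attains the bound of \<open>incr_col_olat_bound\<close>.\<close>

lemma incr_col_top:
  assumes "set u \<subseteq> {1..k}" "l \<le> length u" "j \<le> k"
  shows "\<exists>f. incr_col u j l f \<and> {p. f p \<noteq> 0} = {p. p < l \<and> k - j < u ! p}"
proof -
  define f where "f p = (if p < l \<and> k - j < u ! p then Suc k - u ! p else 0)" for p
  have r: "u ! p \<le> k" if "p < l" for p using letter_bounds[OF assms(1), of p] assms(2) that by simp
  have "u ! p \<le> u ! q" if "f p = f q" "f p \<noteq> 0" for p q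
    using that r[of p] r[of q] by (auto simp: f_def split: if_splits)
  then have "incr_col u j l f" using assms(3) by (auto simp: incr_col_def f_def split: if_splits)
  moreover have "{p. f p \<noteq> 0} = {p. p < l \<and> k - j < u ! p}" using r by (force simp: f_def)
  ultimately show ?thesis by blast
qed

text \<open>For every prefix, the colouring by the largest letters of one word is compared with the
  bound for the other. This gives equal numbers of letters above each threshold, and consecutive
  prefixes then yield the letters one by one.\<close>

theorem olat_dual_unique:
  assumes u: "set u \<subseteq> {1..k}" "olat k u" and u': "set u' \<subseteq> {1..k}" "olat k u'"
    and d: "dual_knuth (standardize u) (standardize u')"
  shows "u = u'"
proof -
  have len: "length u' = length u" using dual_knuth_perm(1)[OF d] by simp
  have le: "card {p. p < l \<and> k - j < u ! p} \<le> card {p. p < l \<and> k - j < u' ! p}"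
    if u: "set u \<subseteq> {1..k}" and u': "set u' \<subseteq> {1..k}" "olat k u'"
      and d: "dual_knuth (standardize u) (standardize u')" and l: "l \<le> length u" and j: "j \<le> k"
    for u u' :: "nat list" and l j
  proof -
    obtain f where f: "incr_col u j l f" "{p. f p \<noteq> 0} = {p. p < l \<and> k - j < u ! p}"
      using incr_col_top[OF u l j] by blast
    obtain f' where "incr_col u' j l f'" "card {p. f' p \<noteq> 0} = card {p. f p \<noteq> 0}"
      using incr_col_words[OF d l f(1)] by blast
    then show ?thesis
      using incr_col_olat_bound[OF u' _ _ j, of l f'] l dual_knuth_perm(1)[OF d] f(2) by simp
  qed
  have eq: "card {p. p < l \<and> t < u ! p} = card {p. p < l \<and> t < u' ! p}"
    if "l \<le> length u" "t \<le> k" for l t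
    using le[OF u(1) u' d, of l "k - t"] le[OF u'(1) u equivclp_sym[OF d], of l "k - t"] that len by simp
  have "t < u ! p \<longleftrightarrow> t < u' ! p" if "p < length u" "t \<le> k" for p t
  proof -
    have "card {q. q < Suc p \<and> t < v ! q} = card {q. q < p \<and> t < v ! q} + (if t < v ! p then 1 else 0)"
      for v :: "nat list"
    proof -
      have "{q. q < Suc p \<and> t < v ! q} = {q. q < p \<and> t < v ! q} \<union> (if t < v ! p then {p} else {})"
        by (auto simp: less_Suc_eq)
      then show ?thesis by simp
    qed
    from this[of u] this[of u'] show ?thesis
      using eq[of p t] eq[of "Suc p" t] that by (auto split: if_splits)
  qed
  moreover have "u ! p \<le> k \<and> u' ! p \<le> k" if "p < length u" for p
    using letter_bounds[OF u(1)] letter_bounds[OF u'(1)] len that by simp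
  ultimately show ?thesis
    using len by (intro nth_equalityI) (auto, metis linorder_neq_iff order_less_le_trans less_imp_le)
qed

text \<open>Reversing positions and values at the same time keeps weakly increasing
  subsequences.\<close>

lemma incr_col_bullet:
  assumes "incr_col u j (length u) f" "set u \<subseteq> {1..k}"
  shows "\<exists>f'. incr_col (bullet_word k u) j (length u) f' \<and> card {p. f' p \<noteq> 0} = card {p. f p \<noteq> 0}"
proof -
  let ?n = "length u"
  define f' where "f' p = (if p < ?n then f (?n - Suc p) else 0)" for p
  have "bullet_word k u ! p \<le> bullet_word k u ! q" if "p < q" "f' p = f' q" "f' p \<noteq> 0" for p q
  proof -
    have "p < ?n" "q < ?n" using that by (auto simp: f'_def split: if_splits)
    then have "u ! (?n - Suc q) \<le> u ! (?n - Suc p)"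
      using that by (intro incr_colD(3)[OF assms(1)]) (auto simp: f'_def)
    then show ?thesis using \<open>p < ?n\<close> \<open>q < ?n\<close> by (simp add: bullet_word_def rev_nth)
  qed
  then have "incr_col (bullet_word k u) j ?n f'"
    using incr_colD(2)[OF assms(1)] by (auto simp: incr_col_def f'_def split: if_splits)
  moreover have "bij_betw (\<lambda>p. ?n - Suc p) {p. f' p \<noteq> 0} {p. f p \<noteq> 0}"
  proof (intro bij_betwI[where g = "\<lambda>p. ?n - Suc p"])
    have lt: "p < ?n" if "f p \<noteq> 0" for p using incr_colD(1)[OF assms(1) that] .
    show "?n - Suc (?n - Suc p) = p" if "p \<in> {p. f p \<noteq> 0}" for p
      using that lt[of p] by simp
    show "(\<lambda>p. ?n - Suc p) \<in> {p. f p \<noteq> 0} \<rightarrow> {p. f' p \<noteq> 0}"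
    proof
      fix p assume "p \<in> {p. f p \<noteq> 0}"
      moreover from this have "p < ?n" using lt by simp
      ultimately show "?n - Suc p \<in> {p. f' p \<noteq> 0}" by (simp add: f'_def)
    qed
  qed (auto simp: f'_def split: if_splits)
  ultimately show ?thesis using bij_betw_same_card by blast
qed

text \<open>If the multiplicities of \<open>u\<close> are those of the Yamanouchi word in reversed order, then a prefix
  violating the opposite Yamanouchi condition would allow to colour too many positions: the letters
  \<open>y\<close> of the prefix and the letters \<open>y + 1\<close> behind it may share a colour.\<close>

theorem slat_dual_olat:
  assumes u: "slat u" "set u \<subseteq> {1..k}" and u': "set u' \<subseteq> {1..k}"
    and c: "\<And>x. 1 \<le> x \<Longrightarrow> x \<le> k \<Longrightarrow> count_list u' x = count_list u (Suc k - x)"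
    and d: "dual_knuth (standardize u) (standardize u')"
  shows "olat k u'"
  unfolding olat_iff[OF u']
proof (intro allI impI, rule ccontr)
  fix l y assume l: "l \<le> length u'" and y: "1 \<le> y \<and> y < k"
    and viol: "\<not> count_list (take l u') y \<le> count_list (take l u') (Suc y)"
  let ?n = "length u'"
  have len: "length u' = length u" using dual_knuth_perm(1)[OF d] by simp
  have r: "u' ! p \<le> k" if "p < ?n" for p using letter_bounds[OF u' that] by simp
  \<comment> \<open>The letters k, ..., y + 2 take the colours 1, ..., j - 1, one each, and colour j
    is left for y and y + 1.\<close>
  define j where "j = k - y"
  define f where "f p = (if p < ?n \<and> Suc y < u' ! p then Suc k - u' ! p
    else if p < l \<and> u' ! p = y \<or> l \<le> p \<and> p < ?n \<and> u' ! p = Suc y then j else 0)" for p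
  have j: "1 \<le> j" "j \<le> k" using y by (auto simp: j_def)
  have "u' ! p \<le> u' ! q" if "p < q" "f p = f q" "f p \<noteq> 0" for p q
    using that r[of p] r[of q] y l by (auto simp: f_def j_def split: if_splits)
  moreover have "p < ?n \<and> f p \<le> j" if "f p \<noteq> 0" for p
  proof (cases "p < ?n \<and> Suc y < u' ! p")
    case True
    then have "Suc k - u' ! p \<le> k - y" by linarith
    then show ?thesis using True by (simp add: f_def j_def)
  next
    case False
    then have "f p = j" "p < l \<or> p < ?n" using that by (auto simp: f_def split: if_splits)
    then show ?thesis using l by auto
  qed
  ultimately have f: "incr_col u' j ?n f" unfolding incr_col_def by blast
  have eq: "{p. f p \<noteq> 0} = {p. p < ?n \<and> Suc y < u' ! p} \<union> ({p. p < l \<and> u' ! p = y} \<union>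
      ({p. p < ?n \<and> u' ! p = Suc y} - {p. p < l \<and> u' ! p = Suc y}))"
    (is "?L = ?R")
  proof (rule set_eqI)
    fix p
    have "p < ?n \<Longrightarrow> Suc k - u' ! p \<noteq> 0" using r[of p] by simp
    then show "p \<in> ?L \<longleftrightarrow> p \<in> ?R"
      using l j(1) unfolding f_def by (cases "p < ?n"; cases "p < l"; cases "Suc y < u' ! p") auto
  qed
  have cf: "card {p. f p \<noteq> 0} = card {p. p < ?n \<and> Suc y < u' ! p} + (card {p. p < l \<and> u' ! p = y} +
      (card {p. p < ?n \<and> u' ! p = Suc y} - card {p. p < l \<and> u' ! p = Suc y}))"
  proof -
    have "card ({p. p < ?n \<and> u' ! p = Suc y} - {p. p < l \<and> u' ! p = Suc y}) =
      card {p. p < ?n \<and> u' ! p = Suc y} - card {p. p < l \<and> u' ! p = Suc y}"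
      using l by (intro card_Diff_subset) auto
    moreover have "card ({p. p < l \<and> u' ! p = y} \<union> ({p. p < ?n \<and> u' ! p = Suc y} - {p. p < l \<and> u' ! p = Suc y}))
      = card {p. p < l \<and> u' ! p = y} + card ({p. p < ?n \<and> u' ! p = Suc y} - {p. p < l \<and> u' ! p = Suc y})"
      by (intro card_Un_disjoint) auto
    ultimately show ?thesis
      unfolding eq by (subst card_Un_disjoint) auto
  qed
  have cm: "card {p. p < l \<and> u' ! p = Suc y} \<le> card {p. p < ?n \<and> u' ! p = Suc y}"
    using l by (intro card_mono) auto
  have un: "{p. p < ?n \<and> y < u' ! p} = {p. p < ?n \<and> Suc y < u' ! p} \<union> {p. p < ?n \<and> u' ! p = Suc y}"
    by auto
  have "card {p. p < ?n \<and> y < u' ! p} =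
      card {p. p < ?n \<and> Suc y < u' ! p} + card {p. p < ?n \<and> u' ! p = Suc y}"
    unfolding un by (intro card_Un_disjoint) auto
  then have "card {p. p < ?n \<and> y < u' ! p} < card {p. f p \<noteq> 0}"
    using cf cm viol l by (simp add: count_take_card)
  moreover obtain g where g: "incr_col u j (length u) g" "card {p. g p \<noteq> 0} = card {p. f p \<noteq> 0}"
    using incr_col_words[OF equivclp_sym[OF d] _ f] len by auto
  obtain h where h: "incr_col (bullet_word k u) j (length u) h" "card {p. h p \<noteq> 0} = card {p. f p \<noteq> 0}"
    using incr_col_bullet[OF g(1) u(2)] g(2) by auto
  \<comment> \<open>The rotation of u is opposite Yamanouchi and has the weight of
    \<open>u'\<close>; it bounds the colouring by the number of its letters above y.\<close>
  have "card {p. h p \<noteq> 0} \<le> card {p. p < length u \<and> k - j < bullet_word k u ! p}"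
  proof -
    have "bullet_word k (bullet_word k u) = u" using u(2) by (intro bullet_word_bullet_word) auto
    then show ?thesis
      using incr_col_olat_bound[OF set_bullet_word[OF u(2)] _ _ h(1) j(2)] u(1) by (simp add: olat_def)
  qed
  moreover have sm: "card {p. p < length v \<and> y < v ! p} = (\<Sum>x\<in>{y<..k}. count_list v x)"
    if "set v \<subseteq> {1..k}" for v
  proof -
    have "{p. p < length v \<and> y < v ! p} = (\<Union>x\<in>{y<..k}. {p. p < length v \<and> v ! p = x})"
      using that nth_mem by fastforce
    also have "card \<dots> = (\<Sum>x\<in>{y<..k}. card {p. p < length v \<and> v ! p = x})"
      by (intro card_UN_disjoint) auto
    finally show ?thesis using count_take_card[of "length v" v] by simp
  qed
  ultimately have "(\<Sum>x\<in>{y<..k}. count_list u' x) < (\<Sum>x\<in>{y<..k}. count_list (bullet_word k u) x)"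
    using h(2) sm[OF u'] sm[OF set_bullet_word[OF u(2)]] y by (simp add: j_def)
  also have "\<dots> = (\<Sum>x\<in>{y<..k}. count_list u' x)"
    using c count_bullet_word[OF u(2)] y by (intro sum.cong) auto
  finally show False by simp
qed

section \<open>Crystal operators\<close>

text \<open>b travels to the left through Z. Each time the left neighbour of the letter passed is
  the middle value of the first relation.\<close>

lemma knuth_move:
  "sorted_wrt (<) (a # Z) \<Longrightarrow> b < a \<Longrightarrow> knuth (a # Z @ [b]) (a # b # Z)"
proof (induction Z rule: rev_induct)
  case (snoc z Z)
  define y where "y = last (a # Z)"
  have e: "a # Z = butlast (a # Z) @ [y]" by (simp add: y_def)
  have "y \<in> set (a # Z)" unfolding y_def by (rule last_in_set) simp
  then have y: "b < y" "y \<le> z" using snoc.prems by (auto simp: sorted_wrt_append)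
  have "a # (Z @ [z]) @ [b] = butlast (a # Z) @ y # z # b # []"
    using e by (metis append.assoc append_Cons append_Nil)
  also have "knuth \<dots> (butlast (a # Z) @ y # b # z # [])"
    by (rule equivclp_sym[OF knuth_first[OF y]])
  also have "butlast (a # Z) @ y # b # z # [] = (a # Z @ [b]) @ [z]"
    using e by (metis append.assoc append_Cons append_Nil)
  also have "knuth \<dots> ((a # b # Z) @ [z])"
    using snoc by (intro knuth_append_right) (auto simp: sorted_wrt_append)
  finally show ?case by simp
qed simp

text \<open>Column reading of a two-row rectangle with upper row B and lower row A: columns from
  left to right, each from bottom to top.\<close>

fun inter :: "nat list \<Rightarrow> nat list \<Rightarrow> nat list" where
  "inter (a # A) (b # B) = a # b # inter A B"
| "inter _ _ = []"

text \<open>Each entry of B is brought directly behind the entry of A below it by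
  \<open>knuth_move\<close>; X is the part of the lower row that sticks out to the right.\<close>

lemma knuth_inter:
  assumes "list_all2 (<) B A" "sorted_wrt (<) (A @ X)"
  shows "knuth (A @ X @ B) (inter A B @ X)"
  using assms
proof (induction rule: list_all2_induct)
  case (Cons b B a A)
  have "knuth ((a # (A @ X) @ [b]) @ B) ((a # b # A @ X) @ B)"
    using Cons by (intro knuth_append_right knuth_move) auto
  also have "knuth \<dots> ([a, b] @ inter A B @ X)"
    using Cons knuth_append_left[of "A @ X @ B" "inter A B @ X" "[a, b]"] by auto
  finally show ?case by simp
qed simp

text \<open>To pass a, the small entry p needs a middle value between them. The entry b above a is
  brought next to a, p passes a with its help, and b is put back; the way back is the claim itself
  with b in the role of p.\<close>

lemma knuth_through:
  assumes "sorted_wrt (<) A" "sorted_wrt (<) B" "list_all2 (<) (take (length A) B) A"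
    and "\<forall>x\<in>set A \<union> set B. p < x"
  shows "knuth (p # A @ B) (A @ p # B)"
  using assms
proof (induction A arbitrary: p B)
  case (Cons a A)
  then obtain b B' where B: "B = b # B'" by (cases B) auto
  have ba: "b < a" "list_all2 (<) (take (length A) B') A" using Cons.prems(3) by (auto simp: B)
  have pb: "p < b" using Cons.prems(4) by (simp add: B)
  have "knuth ([p] @ (a # A @ [b]) @ B') ([p] @ (a # b # A) @ B')"
    using Cons.prems ba by (intro knuth_append knuth_move) auto
  also have "[p] @ (a # b # A) @ B' = [] @ p # a # b # A @ B'" by simp
  also have "knuth \<dots> ([] @ a # p # b # A @ B')"
    using pb ba by (intro knuth_second) auto
  also have "[] @ a # p # b # A @ B' = [a, p] @ b # A @ B'" by simp
  also have "knuth \<dots> ([a, p] @ A @ b # B')"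
    using Cons.prems ba by (intro knuth_append_left Cons.IH) (auto simp: B)
  also have "[a, p] @ A @ b # B' = [a] @ p # A @ (b # B')" by simp
  also have "knuth \<dots> ([a] @ A @ p # b # B')"
  proof (intro knuth_append_left Cons.IH)
    show "list_all2 (<) (take (length A) (b # B')) A"
      unfolding list_all2_conv_all_nth
    proof (intro conjI allI impI)
      show l: "length (take (length A) (b # B')) = length A"
        using list_all2_lengthD[OF ba(2)] by simp
      fix j assume j: "j < length (take (length A) (b # B'))"
      show "take (length A) (b # B') ! j < A ! j"
      proof (cases j)
        case 0
        then show ?thesis using j l ba(1) Cons.prems(1) by (cases A) auto
      next
        case (Suc i)
        have "B' ! i < A ! i" using ba(2) Suc j l by (auto simp: list_all2_conv_all_nth)
        also have "A ! i < A ! Suc i"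
          using Cons.prems(1) Suc j l by (auto intro: sorted_wrt_nth_less)
        finally show ?thesis using Suc j l by simp
      qed
    qed
  qed (use Cons.prems in \<open>auto simp: B\<close>)
  finally show ?case by (simp add: B)
qed simp

text \<open>A jeu de taquin slide of \<open>p\<close> in a skew tableau with two rows.\<close>

lemma knuth_slide:
  assumes A: "sorted_wrt (<) (A1 @ p # A2)" and B: "sorted_wrt (<) (B1 @ p # B2)"
    and 1: "list_all2 (<) B1 (drop (length A1 - length B1) A1)"
    and 2: "list_all2 (<) (take (length A2) B2) A2"
  shows "knuth (A1 @ p # A2 @ B1 @ B2) (A1 @ A2 @ B1 @ p # B2)"
proof -
  \<comment> \<open>The last entries of \<open>A1\<close> share their columns with
    \<open>B1\<close>; \<open>A0\<close> sticks out to the left.\<close>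
  define A0 where "A0 = take (length A1 - length B1) A1"
  define A3 where "A3 = drop (length A1 - length B1) A1"
  have e: "A1 = A0 @ A3" by (simp add: A0_def A3_def)
  have l: "list_all2 (<) B1 A3" using 1 by (simp add: A3_def)
  have k1: "knuth (A3 @ (p # A2) @ B1) (inter A3 B1 @ p # A2)"
    using A by (intro knuth_inter l) (auto simp: e sorted_wrt_append)
  have k2: "knuth (A3 @ A2 @ B1) (inter A3 B1 @ A2)"
    using A by (intro knuth_inter l) (auto simp: e sorted_wrt_append)
  have k3: "knuth (p # A2 @ B2) (A2 @ p # B2)"
    using A B 2 by (intro knuth_through) (auto simp: sorted_wrt_append)
  have "A1 @ p # A2 @ B1 @ B2 = A0 @ (A3 @ (p # A2) @ B1) @ B2" by (simp add: e)
  also have "knuth \<dots> (A0 @ (inter A3 B1 @ p # A2) @ B2)" by (rule knuth_append[OF k1])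
  also have "A0 @ (inter A3 B1 @ p # A2) @ B2 = (A0 @ inter A3 B1) @ p # A2 @ B2" by simp
  also have "knuth \<dots> ((A0 @ inter A3 B1) @ A2 @ p # B2)" by (rule knuth_append_left[OF k3])
  also have "(A0 @ inter A3 B1) @ A2 @ p # B2 = A0 @ (inter A3 B1 @ A2) @ p # B2" by simp
  also have "knuth \<dots> (A0 @ (A3 @ A2 @ B1) @ p # B2)"
    by (rule knuth_append[OF equivclp_sym[OF k2]])
  finally show ?thesis by (simp add: e)
qed

text \<open>With i as opening and i + 1 as closing parenthesis, \<open>sfx i a\<close> says that a
  has no unmatched i, and \<open>pfx i b\<close> that b has no unmatched i + 1.\<close>

definition sfx :: "nat \<Rightarrow> nat list \<Rightarrow> bool" where
  "sfx i a \<longleftrightarrow> (\<forall>m. count_list (drop m a) i \<le> count_list (drop m a) (Suc i))"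

definition pfx :: "nat \<Rightarrow> nat list \<Rightarrow> bool" where
  "pfx i b \<longleftrightarrow> (\<forall>m. count_list (take m b) (Suc i) \<le> count_list (take m b) i)"

text \<open>The action of a crystal operator: the leftmost unmatched \<open>i\<close> becomes \<open>i + 1\<close>.\<close>

definition flip :: "nat \<Rightarrow> nat list \<Rightarrow> nat list \<Rightarrow> bool" where
  "flip i w w' \<longleftrightarrow> (\<exists>a b. w = a @ i # b \<and> w' = a @ Suc i # b \<and> sfx i a \<and> pfx i b)"

text \<open>The ballot condition on suffixes says that the t-th y from the right has the t-th x from
  the right behind it. This is column strictness for two right-justified rows of positions;
  \<open>occ_dominance_right\<close> is the left-justified form for prefixes.\<close>

lemma occ_dominance_left:
  assumes "x \<noteq> y" "\<And>m. count_list (drop m v) y \<le> count_list (drop m v) x"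
  shows "list_all2 (<) (occ y n v) (drop (count_list v x - count_list v y) (occ x n v))"
  using assms(2)
proof (induction v arbitrary: n)
  case (Cons z v)
  have c: "count_list (drop m v) y \<le> count_list (drop m v) x" for m
    using Cons.prems[of "Suc m"] by simp
  have IH: "list_all2 (<) (occ y (Suc n) v) (drop (count_list v x - count_list v y) (occ x (Suc n) v))"
    by (rule Cons.IH) (rule c)
  consider "z = x" | "z = y" | "z \<noteq> x" "z \<noteq> y" by blast
  then show ?case
  proof cases
    case 1
    then show ?thesis using IH c[of 0] assms(1) by (simp add: Suc_diff_le)
  next
    case 2
    then have lt: "count_list v y < count_list v x" using Cons.prems[of 0] assms(1) by simp
    define j where "j = count_list v x - Suc (count_list v y)"
    have j: "j < length (occ x (Suc n) v)" using lt by (simp add: j_def)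
    have "count_list v x - count_list v y = Suc j" using lt by (simp add: j_def)
    moreover have "occ x (Suc n) v ! j > n" using nth_mem[OF j] by (auto simp: set_occ)
    ultimately show ?thesis
      using IH 2 assms(1) Cons_nth_drop_Suc[OF j, symmetric] by (simp add: j_def[symmetric])
  qed (use IH in auto)
qed simp

lemma occ_dominance_right:
  assumes "x \<noteq> y" "\<And>m. count_list (take m v) x \<le> count_list (take m v) y"
  shows "list_all2 (<) (take (count_list v x) (occ y n v)) (occ x n v)"
  using assms(2)
proof (induction v rule: rev_induct)
  case (snoc z v)
  have c: "count_list (take m v) x \<le> count_list (take m v) y" for m
  proof (cases "m \<le> length v")
    case True
    then show ?thesis using snoc.prems[of m] by simp
  next
    case False
    then show ?thesis using snoc.prems[of "length v"] by simp
  qed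
  have IH: "list_all2 (<) (take (count_list v x) (occ y n v)) (occ x n v)"
    by (rule snoc.IH) (rule c)
  have cv: "count_list v x \<le> count_list v y" using c[of "length v"] by simp
  consider "z = x" | "z = y" | "z \<noteq> x" "z \<noteq> y" by blast
  then show ?case
  proof cases
    case 1
    then have j: "count_list v x < length (occ y n v)"
      using snoc.prems[of "length (v @ [z])"] assms(1) by simp
    have "occ y n v ! count_list v x < n + length v" using nth_mem[OF j] by (auto simp: set_occ)
    then show ?thesis
      using IH 1 assms(1) j by (simp add: take_Suc_conv_app_nth list_all2_appendI)
  qed (use IH cv assms(1) in auto)
qed simp

text \<open>Changing one i into i + 1 moves its position from the block of i to the block of i + 1
  in the listing. The conditions on a and b are the column conditions that make this move a
  slide.\<close>

lemma flip_dual_knuth: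
  assumes "flip i w w'" "set w \<subseteq> {..k}" "i < k"
  shows "dual_knuth (standardize (rev w)) (standardize (rev w'))"
proof -
  obtain a b where w: "w = a @ i # b" "w' = a @ Suc i # b" and s: "sfx i a" and p: "pfx i b"
    using assms(1) unfolding flip_def by blast
  define b' a' where "b' = rev b" and "a' = rev a"
  have u: "rev w = b' @ i # a'" "rev w' = b' @ Suc i # a'" by (simp_all add: w a'_def b'_def)
  have cb: "count_list (drop m b') (Suc i) \<le> count_list (drop m b') i" for m
    using p[unfolded pfx_def, rule_format, of "length b - m"] by (simp add: b'_def drop_rev)
  have ca: "count_list (take m a') i \<le> count_list (take m a') (Suc i)" for m
    using s[unfolded sfx_def, rule_format, of "length a - m"] by (simp add: a'_def take_rev)
  let ?p = "length b'"
  define A1 A2 B1 B2 where "A1 = occ i 0 b'" and "A2 = occ i (Suc ?p) a'"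
    and "B1 = occ (Suc i) 0 b'" and "B2 = occ (Suc i) (Suc ?p) a'"
  have "knuth (A1 @ ?p # A2 @ B1 @ B2) (A1 @ A2 @ B1 @ ?p # B2)"
  proof (rule knuth_slide)
    show "sorted_wrt (<) (A1 @ ?p # A2)" "sorted_wrt (<) (B1 @ ?p # B2)"
      by (auto simp: sorted_wrt_append sorted_occ A1_def A2_def B1_def B2_def set_occ)
    show "list_all2 (<) B1 (drop (length A1 - length B1) A1)"
      using occ_dominance_left[of i "Suc i" b' 0] cb by (simp add: A1_def B1_def)
    show "list_all2 (<) (take (length A2) B2) A2"
      using occ_dominance_right[of i "Suc i" a'] ca by (simp add: A2_def B2_def)
  qed
  moreover define X where "X = concat (map (\<lambda>x. occ x 0 (rev w)) [0..<i])"
  moreover define Y where "Y = concat (map (\<lambda>x. occ x 0 (rev w)) [Suc (Suc i)..<Suc k])"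
  moreover have split: "[0..<Suc k] = [0..<i] @ i # Suc i # [Suc (Suc i)..<Suc k]"
    using assms(3) upt_add_eq_append[of 0 i "Suc k - i"] by (simp add: upt_conv_Cons del: upt_Suc)
  have "listing k (rev w) = X @ (A1 @ ?p # A2 @ B1 @ B2) @ Y"
    unfolding listing_def split
    by (simp add: X_def Y_def A1_def A2_def B1_def B2_def u del: upt_Suc)
  moreover have "X = concat (map (\<lambda>x. occ x 0 (rev w')) [0..<i])"
    unfolding X_def u by (intro arg_cong[where f = concat] map_cong) auto
  moreover have "Y = concat (map (\<lambda>x. occ x 0 (rev w')) [Suc (Suc i)..<Suc k])"
    unfolding Y_def u by (intro arg_cong[where f = concat] map_cong) auto
  moreover from calculation have "listing k (rev w') = X @ (A1 @ A2 @ B1 @ ?p # B2) @ Y"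
    unfolding listing_def split by (simp add: A1_def A2_def B1_def B2_def u del: upt_Suc)
  ultimately have "knuth (listing k (rev w)) (listing k (rev w'))"
    by (simp only: knuth_append)
  moreover have "set (rev w) \<subseteq> {..k}" "set (rev w') \<subseteq> {..k}" using assms by (auto simp: w)
  ultimately show ?thesis using knuth_dual_knuth is_inv_listing by blast
qed

section \<open>Decomposition of a word at its unmatched letters\<close>

definition bal :: "nat \<Rightarrow> nat list \<Rightarrow> bool" where
  "bal i b \<longleftrightarrow> pfx i b \<and> count_list b i = count_list b (Suc i)"

lemma pfx_append: "pfx i a \<Longrightarrow> pfx i b \<Longrightarrow> pfx i (a @ b)"
  unfolding pfx_def by (simp add: add_mono)

lemma sfx_append: "sfx i a \<Longrightarrow> sfx i b \<Longrightarrow> sfx i (a @ b)"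
  unfolding sfx_def by (simp add: add_mono)

lemma bal_append: "bal i a \<Longrightarrow> bal i b \<Longrightarrow> bal i (a @ b)"
  unfolding bal_def by (simp add: pfx_append)

lemma bal_sfx:
  assumes "bal i b" shows "sfx i b"
  unfolding sfx_def
proof
  fix m
  have "count_list b x = count_list (take m b) x + count_list (drop m b) x" for x
    by (metis append_take_drop_id count_list_append)
  from this[of i] this[of "Suc i"] show "count_list (drop m b) i \<le> count_list (drop m b) (Suc i)"
    using assms unfolding bal_def pfx_def by (metis add_le_mono1 le_diff_conv nat_add_left_cancel_le add.commute)
qed

lemma bal_Nil [simp]: "bal i []"
  by (simp add: bal_def pfx_def)

lemma bal_other: "x \<noteq> i \<Longrightarrow> x \<noteq> Suc i \<Longrightarrow> bal i [x]"
  by (simp add: bal_def pfx_def take_Cons' )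

lemma bal_wrap:
  assumes "bal i b" shows "bal i (i # b @ [Suc i])"
proof -
  have "count_list (take m (i # b @ [Suc i])) (Suc i) \<le> count_list (take m (i # b @ [Suc i])) i" for m
  proof (cases m)
    case (Suc n)
    have "count_list (take n b) (Suc i) \<le> count_list (take n b) i"
      using assms by (auto simp: bal_def pfx_def)
    then show ?thesis by (cases "n - length b") (auto simp: Suc)
  qed simp
  then show ?thesis using assms by (simp add: bal_def pfx_def)
qed

text \<open>Words are decomposed as \<open>b\<^sub>0 x\<^sub>1 b\<^sub>1 x\<^sub>2 b\<^sub>2 \<dots>\<close> with unmatched letters \<open>x\<^sub>j\<close> and balanced words \<open>b\<^sub>j\<close>.\<close>

definition pieces :: "(nat \<times> nat list) list \<Rightarrow> nat list" where
  "pieces ps = concat (map (\<lambda>(x, b). x # b) ps)"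

fun piece_pos :: "nat \<Rightarrow> (nat \<times> nat list) list \<Rightarrow> nat list" where
  "piece_pos n [] = []"
| "piece_pos n ((x, b) # ps) = n # piece_pos (Suc (n + length b)) ps"

lemma pieces_simps [simp]:
  "pieces [] = []" "pieces ((x, b) # ps) = x # b @ pieces ps" "pieces (ps @ qs) = pieces ps @ pieces qs"
  by (auto simp: pieces_def)

lemma length_piece_pos [simp]: "length (piece_pos n ps) = length ps"
  by (induction n ps rule: piece_pos.induct) auto

lemma piece_pos_append [simp]:
  "piece_pos n (ps @ qs) = piece_pos n ps @ piece_pos (n + length (pieces ps)) qs"
  by (induction n ps rule: piece_pos.induct) (auto simp: add_ac)

lemma piece_pos_ge: "p \<in> set (piece_pos n ps) \<Longrightarrow> n \<le> p"
  by (induction n ps rule: piece_pos.induct) fastforce+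

lemma distinct_piece_pos: "distinct (piece_pos n ps)"
  by (induction n ps rule: piece_pos.induct) (auto dest: piece_pos_ge)

definition decomp :: "nat \<Rightarrow> nat list \<Rightarrow> nat list \<Rightarrow> (nat \<times> nat list) list \<Rightarrow> bool" where
  "decomp i w b0 ps \<longleftrightarrow> w = b0 @ pieces ps \<and> bal i b0 \<and> (\<forall>b\<in>set (map snd ps). bal i b)"

text \<open>The last piece absorbs a balanced word at the end, so the unmatched letters keep their
  positions.\<close>

lemma decomp_extend:
  assumes "decomp i w b0 ps" "bal i c"
  shows "\<exists>b0' ps'. decomp i (w @ c) b0' ps' \<and> map fst ps' = map fst ps \<and>
    piece_pos (length b0') ps' = piece_pos (length b0) ps"
proof (cases ps rule: rev_cases)
  case Nil
  then have "decomp i (w @ c) (b0 @ c) []" using assms by (auto simp: decomp_def bal_append)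
  then show ?thesis using Nil by (intro exI[of _ "b0 @ c"] exI[of _ "[]"]) auto
next
  case (snoc qs q)
  obtain x b where q: "q = (x, b)" by (cases q)
  have "decomp i (w @ c) b0 (qs @ [(x, b @ c)])"
    using assms by (auto simp: decomp_def snoc q bal_append)
  then show ?thesis
    by (intro exI[of _ b0] exI[of _ "qs @ [(x, b @ c)]"]) (auto simp: snoc q)
qed

text \<open>Invariant of the scan. If i + 1 closes the latest open i, then this i, the balanced word
  behind it and the i + 1 form a balanced word, which the preceding piece absorbs.\<close>

lemma unmatched_decomp:
  assumes "decomp i v b0 ps" "map fst ps = replicate (length cs) (Suc i) @ replicate (length os) i"
    and "piece_pos (length b0) ps = rev cs @ rev os"
    and "unmatched i (length v) cs os w = (cs', os')"
  shows "\<exists>b0' ps'. decomp i (v @ w) b0' ps' \<and>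
    map fst ps' = replicate (length cs') (Suc i) @ replicate (length os') i \<and>
    piece_pos (length b0') ps' = cs' @ os'"
  using assms
proof (induction w arbitrary: v b0 ps cs os)
  case Nil
  then show ?case by (intro exI[of _ b0] exI[of _ ps]) auto
next
  case (Cons x w)
  have len: "length v = length b0 + length (pieces ps)" using Cons.prems(1) by (simp add: decomp_def)
  consider "x = i" | "x = Suc i" "os = []" | p os' where "x = Suc i" "os = p # os'" | "x \<noteq> i" "x \<noteq> Suc i"
    by (cases os) auto
  then show ?case
  proof cases
    case 1
    have "decomp i (v @ [x]) b0 (ps @ [(i, [])])" using Cons.prems(1) 1 by (simp add: decomp_def)
    from Cons.IH[OF this, of cs "length v # os"] show ?thesis
      using Cons.prems 1 len by (simp add: replicate_append_same)
  next
    case 2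
    have "decomp i (v @ [x]) b0 (ps @ [(Suc i, [])])" using Cons.prems(1) 2 by (simp add: decomp_def)
    from Cons.IH[OF this, of "length v # cs" "[]"] show ?thesis
      using Cons.prems 2 len by (simp add: replicate_append_same)
  next
    case 3
    then have "map fst ps = (replicate (length cs) (Suc i) @ replicate (length os') i) @ [i]"
      using Cons.prems(2) by (simp add: replicate_append_same)
    then obtain qs b where ps: "ps = qs @ [(i, b)]"
      and qs: "map fst qs = replicate (length cs) (Suc i) @ replicate (length os') i"
      by (cases ps rule: rev_cases) auto
    have "decomp i (b0 @ pieces qs) b0 qs" "bal i (i # b @ [Suc i])"
      using Cons.prems(1) by (auto simp: decomp_def ps intro: bal_wrap)
    from decomp_extend[OF this] obtain b0' ps' where *:
      "decomp i (v @ [x]) b0' ps'" "map fst ps' = map fst qs"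
      "piece_pos (length b0') ps' = piece_pos (length b0) qs"
      using Cons.prems(1) 3 by (auto simp: decomp_def ps)
    have "piece_pos (length b0) qs = rev cs @ rev os'"
      using Cons.prems(3) 3 by (simp add: ps)
    with Cons.IH[OF *(1), of cs os'] * qs show ?thesis using Cons.prems 3 by simp
  next
    case 4
    from decomp_extend[OF Cons.prems(1) bal_other[OF 4]] obtain b0' ps' where *:
      "decomp i (v @ [x]) b0' ps'" "map fst ps' = map fst ps"
      "piece_pos (length b0') ps' = piece_pos (length b0) ps" by blast
    with Cons.IH[OF *(1), of cs os] show ?thesis using Cons.prems 4 by simp
  qed
qed

lemma map_piece_pos:
  assumes "length ys = length ps" "\<And>t. t < length ps \<Longrightarrow> F (piece_pos n ps ! t) = ys ! t"
    and "\<And>p. n \<le> p \<Longrightarrow> p < n + length (pieces ps) \<Longrightarrow> p \<notin> set (piece_pos n ps) \<Longrightarrow>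
      F p = pieces ps ! (p - n)"
  shows "map F [n..<n + length (pieces ps)] = pieces (zip ys (map snd ps))"
  using assms
proof (induction n ps arbitrary: ys rule: piece_pos.induct)
  case (2 n x b ps)
  then obtain y ys' where ys: "ys = y # ys'" "length ys' = length ps" by (cases ys) auto
  let ?m = "Suc (n + length b)"
  have e: "[n..<n + length (pieces ((x, b) # ps))] =
      n # [Suc n..<?m] @ [?m..<?m + length (pieces ps)]"
    using upt_add_eq_append[of "Suc n" ?m "length (pieces ps)"]
    by (simp add: upt_conv_Cons add_ac del: upt_Suc)
  have "F n = y" using 2(3)[of 0] by (simp add: ys)
  moreover have "map F [Suc n..<?m] = b"
  proof (rule nth_equalityI)
    fix j assume "j < length (map F [Suc n..<?m])"
    then have j: "j < length b" by (simp del: upt_Suc)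
    have "Suc (n + j) \<notin> set (piece_pos n ((x, b) # ps))" using j by (auto dest: piece_pos_ge)
    from 2(4)[OF _ _ this] show "map F [Suc n..<?m] ! j = b ! j"
      using j by (simp add: nth_append del: upt_Suc)
  qed (simp del: upt_Suc)
  moreover have "map F [?m..<?m + length (pieces ps)] = pieces (zip ys' (map snd ps))"
  proof (rule 2(1))
    show "length ys' = length ps" by (rule ys)
    fix t assume "t < length ps"
    then show "F (piece_pos ?m ps ! t) = ys' ! t" using 2(3)[of "Suc t"] by (simp add: ys)
  next
    fix p assume p: "?m \<le> p" "p < ?m + length (pieces ps)" "p \<notin> set (piece_pos ?m ps)"
    then have "p \<notin> set (piece_pos n ((x, b) # ps))" by auto
    from 2(4)[OF _ _ this] p have "F p = pieces ((x, b) # ps) ! (p - n)" by simp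
    also have "p - n = Suc (length b + (p - ?m))" using p by simp
    finally show "F p = pieces ps ! (p - ?m)" by (simp add: nth_append)
  qed
  ultimately show ?case unfolding e by (simp add: ys del: upt_Suc)
qed simp

text \<open>Replaces the sets of positions in the definition of \<open>crystal_refl\<close> by the
  form of the word: balanced words stay, and r and s change places.\<close>

lemma crystal_refl_pieces:
  "\<exists>b0 bs r s. bal i b0 \<and> (\<forall>b\<in>set bs. bal i b) \<and> length bs = r + s \<and>
    w = b0 @ pieces (zip (replicate r (Suc i) @ replicate s i) bs) \<and>
    crystal_refl i w = b0 @ pieces (zip (replicate s (Suc i) @ replicate r i) bs)"
proof -
  obtain cs os where u: "unmatched i 0 [] [] w = (cs, os)" by (cases "unmatched i 0 [] [] w")
  have "decomp i [] [] []" by (simp add: decomp_def)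
  from unmatched_decomp[OF this, of "[]" "[]" w cs os] u obtain b0 ps where
    d: "decomp i w b0 ps" and f: "map fst ps = replicate (length cs) (Suc i) @ replicate (length os) i"
    and pos: "piece_pos (length b0) ps = cs @ os" by auto
  define r s where "r = length cs" and "s = length os"
  have lps: "length ps = r + s" using arg_cong[OF f, of length] by (simp add: r_def s_def)
  let ?P = "cs @ os" and ?ys = "replicate s (Suc i) @ replicate r i"
  define F where "F p = (if p \<in> set (take s ?P) then Suc i else if p \<in> set (drop s ?P) then i else w ! p)" for p
  have w: "w = b0 @ pieces ps" using d by (simp add: decomp_def)
  have dist: "distinct ?P" using distinct_piece_pos[of "length b0" ps] by (simp add: pos)
  have lP: "length ?P = r + s" by (simp add: r_def s_def)
  have sP: "set (take s ?P) \<union> set (drop s ?P) = set ?P" by (metis append_take_drop_id set_append)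
  have "crystal_refl i w = map F [0..<length w]"
    by (simp add: crystal_refl_def u F_def s_def Let_def)
  also have "[0..<length w] = [0..<length b0] @ [length b0..<length b0 + length (pieces ps)]"
    unfolding w length_append by (rule upt_add_eq_append) simp
  also have "map F \<dots> = b0 @ pieces (zip ?ys (map snd ps))"
  proof -
    have "F p = b0 ! p" if "p < length b0" for p
    proof -
      have "p \<notin> set ?P" using that piece_pos_ge[of p "length b0" ps] by (auto simp: pos)
      then show ?thesis using sP that by (auto simp: F_def w nth_append)
    qed
    then have "map F [0..<length b0] = b0" by (auto intro: nth_equalityI)
    moreover have "map F [length b0..<length b0 + length (pieces ps)] = pieces (zip ?ys (map snd ps))"
    proof (rule map_piece_pos)
      show "length ?ys = length ps" by (simp add: lps)
      fix t assume t: "t < length ps"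
      show "F (piece_pos (length b0) ps ! t) = ?ys ! t"
      proof (cases "t < s")
        case True
        have "?P ! t = take s ?P ! t" using True by (simp only: nth_take)
        also have "\<dots> \<in> set (take s ?P)" using True t lps lP by (intro nth_mem) (simp del: take_append)
        finally show ?thesis using True by (simp add: F_def pos nth_append)
      next
        case False
        have "?P ! t = drop s ?P ! (t - s)" using False t lps lP by (simp del: drop_append)
        also have "\<dots> \<in> set (drop s ?P)" using False t lps lP by (intro nth_mem) (simp del: drop_append)
        finally have "?P ! t \<in> set (drop s ?P)" .
        moreover from this have "?P ! t \<notin> set (take s ?P)"
          using set_take_disj_set_drop_if_distinct[OF dist, of s s] by blast
        ultimately show ?thesis using False t lps by (simp add: F_def pos nth_append del: take_append drop_append)
      qed
    next
      fix p assume "length b0 \<le> p" "p < length b0 + length (pieces ps)"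
        "p \<notin> set (piece_pos (length b0) ps)"
      then show "F p = pieces ps ! (p - length b0)"
        using sP by (auto simp: F_def w nth_append pos simp del: take_append drop_append)
    qed
    ultimately show ?thesis by simp
  qed
  finally have c: "crystal_refl i w = b0 @ pieces (zip ?ys (map snd ps))" .
  have "ps = zip (map fst ps) (map snd ps)" by (simp add: zip_map_fst_snd)
  then have "w = b0 @ pieces (zip (replicate r (Suc i) @ replicate s i) (map snd ps))"
    using w f by (simp add: r_def s_def)
  then show ?thesis
    using c d lps by (intro exI[of _ b0] exI[of _ "map snd ps"] exI[of _ r] exI[of _ s]) (auto simp: decomp_def)
qed

text \<open>The unmatched letters i are raised one at a time, the leftmost first, up to the end of
  the i-string. A word and its reflection have this end in common, which connects them by
  flips.\<close>

lemma pieces_flips: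
  assumes "bal i b0" "\<forall>b\<in>set bs. bal i b" "length bs = r + s"
  shows "equivclp (flip i) (b0 @ pieces (zip (replicate r (Suc i) @ replicate s i) bs))
    (b0 @ pieces (zip (replicate (r + s) (Suc i)) bs))"
  using assms(3)
proof (induction s arbitrary: r)
  case (Suc s)
  define bs1 bs2 where "bs1 = take r bs" and "bs2 = drop r bs"
  have bs: "bs = bs1 @ bs2" "length bs1 = r" using Suc.prems by (auto simp: bs1_def bs2_def)
  then obtain b bs3 where bs2: "bs2 = b # bs3" using Suc.prems by (cases bs2) auto
  have s: "sfx i (pieces (zip (replicate r (Suc i)) bs1))"
    if "\<forall>b\<in>set bs1. bal i b" for r bs1
    using that
  proof (induction r arbitrary: bs1)
    case (Suc r)
    show ?case
    proof (cases bs1)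
      case (Cons b bs)
      have "sfx i [Suc i]" by (simp add: sfx_def drop_Cons')
      from sfx_append[OF this sfx_append[OF bal_sfx[of i b] Suc.IH[of bs]]] show ?thesis
        using Suc.prems by (simp add: Cons)
    qed (simp add: sfx_def)
  qed (simp add: sfx_def)
  have p: "pfx i (pieces (zip (replicate r i) bs1))"
    if "\<forall>b\<in>set bs1. bal i b" for r bs1
    using that
  proof (induction r arbitrary: bs1)
    case (Suc r)
    show ?case
    proof (cases bs1)
      case (Cons b bs)
      have "pfx i [i]" by (simp add: pfx_def take_Cons')
      from pfx_append[OF this pfx_append[OF _ Suc.IH[of bs]], of b] show ?thesis
        using Suc.prems by (simp add: Cons bal_def)
    qed (simp add: pfx_def)
  qed (simp add: pfx_def)
  have "flip i (b0 @ pieces (zip (replicate r (Suc i) @ replicate (Suc s) i) bs))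
      (b0 @ pieces (zip (replicate (Suc r) (Suc i) @ replicate s i) bs))"
    unfolding flip_def
  proof (intro exI conjI)
    have e: "replicate (Suc r) (Suc i) = replicate r (Suc i) @ [Suc i]"
      by (simp add: replicate_append_same)
    show "b0 @ pieces (zip (replicate r (Suc i) @ replicate (Suc s) i) bs) =
        (b0 @ pieces (zip (replicate r (Suc i)) bs1)) @ i # (b @ pieces (zip (replicate s i) bs3))"
      using bs by (simp add: bs2)
    show "b0 @ pieces (zip (replicate (Suc r) (Suc i) @ replicate s i) bs) =
        (b0 @ pieces (zip (replicate r (Suc i)) bs1)) @ Suc i # (b @ pieces (zip (replicate s i) bs3))"
      unfolding e using bs by (simp add: bs2)
    show "sfx i (b0 @ pieces (zip (replicate r (Suc i)) bs1))"
      using assms bs by (intro sfx_append bal_sfx s) auto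
    show "pfx i (b @ pieces (zip (replicate s i) bs3))"
      using assms bs by (intro pfx_append p) (auto simp: bs2 bal_def)
  qed
  then show ?case using Suc.IH[of "Suc r"] Suc.prems by (metis add_Suc_shift equivclp_trans r_into_equivclp)
qed simp

lemma crystal_refl_flips: "equivclp (flip i) w (crystal_refl i w)"
proof -
  obtain b0 bs r s where *: "bal i b0" "\<forall>b\<in>set bs. bal i b" "length bs = r + s"
    and w: "w = b0 @ pieces (zip (replicate r (Suc i) @ replicate s i) bs)"
    "crystal_refl i w = b0 @ pieces (zip (replicate s (Suc i) @ replicate r i) bs)"
    using crystal_refl_pieces by blast
  show ?thesis
    using pieces_flips[OF *] equivclp_sym[OF pieces_flips[OF *(1,2), of s r]] *(3)
    unfolding w(1)[symmetric] w(2)[symmetric] by (auto simp: add.commute intro: equivclp_trans)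
qed

lemma count_pieces:
  "length ys = length bs \<Longrightarrow>
    count_list (pieces (zip ys bs)) z = count_list ys z + sum_list (map (\<lambda>b. count_list b z) bs)"
  by (induction ys bs rule: list_induct2) auto

lemma count_list_replicate [simp]: "count_list (replicate n x) y = (if x = y then n else 0)"
  by (induction n) auto

lemma count_crystal_refl:
  "count_list (crystal_refl i w) x =
    count_list w (if x = i then Suc i else if x = Suc i then i else x)"
proof -
  obtain b0 bs r s where *: "bal i b0" "\<forall>b\<in>set bs. bal i b" "length bs = r + s"
    and w: "w = b0 @ pieces (zip (replicate r (Suc i) @ replicate s i) bs)"
    "crystal_refl i w = b0 @ pieces (zip (replicate s (Suc i) @ replicate r i) bs)"
    using crystal_refl_pieces by blast
  have "sum_list (map (\<lambda>b. count_list b i) bs) = sum_list (map (\<lambda>b. count_list b (Suc i)) bs)"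
    by (intro arg_cong[where f = sum_list] map_cong refl) (use *(2) in \<open>auto simp: bal_def\<close>)
  moreover have "count_list b0 i = count_list b0 (Suc i)" using *(1) by (simp add: bal_def)
  moreover have "count_list w z = count_list b0 z + ((if z = Suc i then r else 0) + (if z = i then s else 0) +
      sum_list (map (\<lambda>b. count_list b z) bs))" for z
    by (subst w(1)) (simp add: count_pieces *(3))
  moreover have "count_list (crystal_refl i w) z = count_list b0 z + ((if z = Suc i then s else 0) +
      (if z = i then r else 0) + sum_list (map (\<lambda>b. count_list b z) bs))" for z
    by (subst w(2)) (simp add: count_pieces *(3))
  ultimately show ?thesis by simp
qed

text \<open>A cycle on the multiplicities. Applied after the reversal of the first k of them, it
  yields the reversal of k + 1, which is the induction for \<open>count_sigma0\<close>.\<close>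

lemma count_crystal_block:
  "count_list (fold crystal_refl (rev [1..<Suc j]) w) x =
    (if x = 1 then count_list w (Suc j) else if 2 \<le> x \<and> x \<le> Suc j then count_list w (x - 1)
     else count_list w x)"
proof (induction j arbitrary: w)
  case (Suc j)
  have "rev [1..<Suc (Suc j)] = Suc j # rev [1..<Suc j]" by simp
  then show ?case by (simp only: fold_simps Suc count_crystal_refl) (auto simp: le_Suc_eq)
qed simp

lemma sigma0_Suc: "1 \<le> k \<Longrightarrow> sigma0 (Suc k) w = fold crystal_refl (rev [1..<Suc k]) (sigma0 k w)"
  by (simp add: sigma0_def)

lemma sigma0_1 [simp]: "sigma0 0 w = w" "sigma0 (Suc 0) w = w"
  by (simp_all add: sigma0_def)

lemma count_sigma0:
  "count_list (sigma0 k w) x = count_list w (if 1 \<le> x \<and> x \<le> k then Suc k - x else x)"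
proof (induction k arbitrary: x)
  case (Suc k)
  show ?case
  proof (cases "k = 0")
    case False
    then show ?thesis
      by (subst sigma0_Suc, simp, subst count_crystal_block) (auto simp: Suc le_Suc_eq Suc_diff_le)
  qed auto
qed simp

text \<open>The bounds on i keep words inside the alphabet {1..k} in both directions.\<close>

definition flips :: "nat \<Rightarrow> nat list \<Rightarrow> nat list \<Rightarrow> bool" where
  "flips k w w' \<longleftrightarrow> (\<exists>i. 1 \<le> i \<and> i < k \<and> flip i w w')"

lemma flips_set: "flips k w w' \<Longrightarrow> set w \<subseteq> {1..k} \<longleftrightarrow> set w' \<subseteq> {1..k}"
proof -
  assume "flips k w w'"
  then obtain i a b where i: "1 \<le> i" "i < k" and w: "w = a @ i # b" "w' = a @ Suc i # b"
    by (auto simp: flips_def flip_def)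
  have "i \<in> {1..k}" "Suc i \<in> {1..k}" using i by auto
  then show ?thesis unfolding w by (simp only: set_append list.set Un_subset_iff insert_subset)
qed

lemma sigma0_flips: "equivclp (flips k) w (sigma0 k w)"
proof -
  have c: "equivclp (flips k) w (crystal_refl i w)" if "1 \<le> i" "i < k" for i w
  proof (rule equivclp_map[OF crystal_refl_flips, where f = "\<lambda>w. w"])
    fix x y assume "flip i x y"
    then have "flips k x y" using that by (auto simp: flips_def)
    then show "equivclp (flips k) x y" by (rule r_into_equivclp)
  qed
  have h: "set is \<subseteq> {1..<k} \<Longrightarrow> equivclp (flips k) w (fold crystal_refl is w)" for "is" w
    by (induction "is" arbitrary: w) (auto intro: equivclp_trans[OF c])
  show ?thesis unfolding sigma0_def by (rule h) (auto simp del: upt_Suc)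
qed

lemma flips_dual_knuth:
  assumes "equivclp (flips k) w w'" "set w \<subseteq> {1..k}"
  shows "set w' \<subseteq> {1..k} \<and> dual_knuth (standardize (rev w)) (standardize (rev w'))"
  using assms(1)
proof (induction rule: equivclp_induct)
  case (step y z)
  have f: "set y \<subseteq> {1..k} \<longleftrightarrow> set z \<subseteq> {1..k}" using step(2) flips_set by blast
  have *: "dual_knuth (standardize (rev x)) (standardize (rev x'))"
    if "flips k x x'" "set x \<subseteq> {1..k}" for x x'
  proof -
    have "set x \<subseteq> {..k}" using that by auto
    then show ?thesis using that(1) flip_dual_knuth unfolding flips_def by blast
  qed
  have "dual_knuth (standardize (rev y)) (standardize (rev z))"
    using step(2) *[of y z] *[of z y] f step.IH by (auto intro: equivclp_sym)
  then show ?case using step.IH f by (blast intro: equivclp_trans)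
qed (use assms in auto)

section \<open>Reading words of tableaux\<close>

lemma sorted_wrt_concat_map:
  assumes "sorted_wrt (\<lambda>x y. \<forall>a\<in>set (f x). \<forall>b\<in>set (f y). R a b) xs"
    and "\<And>x. x \<in> set xs \<Longrightarrow> sorted_wrt R (f x)"
  shows "sorted_wrt R (concat (map f xs))"
  using assms by (induction xs) (auto simp: sorted_wrt_append)

text \<open>Identifies the box lists of rotated and transposed shapes: only their order and their
  set have to be checked.\<close>

lemma sorted_wrt_set_unique:
  assumes asym: "\<And>x y. R x y \<Longrightarrow> \<not> R y x"
  shows "sorted_wrt R xs \<Longrightarrow> sorted_wrt R ys \<Longrightarrow> set xs = set ys \<Longrightarrow> xs = ys"
proof (induction xs arbitrary: ys)
  case (Cons x xs)
  then obtain y ys' where ys: "ys = y # ys'" by (cases ys) auto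
  have irr: "\<not> R z z" for z using asym by blast
  have "x = y"
  proof (rule ccontr)
    assume "x \<noteq> y"
    then have "x \<in> set ys'" "y \<in> set xs" using Cons.prems(3) by (auto simp: ys)
    then show False using Cons.prems(1,2) asym by (auto simp: ys)
  qed
  moreover have "x \<notin> set xs" "y \<notin> set ys'" using Cons.prems irr by (auto simp: ys)
  ultimately have "set xs = set ys'" using Cons.prems by (auto simp: ys)
  then show ?case using Cons \<open>x = y\<close> by (simp add: ys)
qed simp

lemma sorted_wrt_distinct: "(\<And>x. \<not> R x x) \<Longrightarrow> sorted_wrt R xs \<Longrightarrow> distinct xs"
  by (induction xs) auto

lemma sorted_wrt_split:
  assumes asym: "\<And>x y. R x y \<Longrightarrow> \<not> R y x" and s: "sorted_wrt R (xs @ b # ys)"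
  shows "set xs = {x \<in> set (xs @ b # ys). R x b}" "set ys = {x \<in> set (xs @ b # ys). R b x}"
  using s asym by (auto simp: sorted_wrt_append)

fun row_less :: "nat \<times> nat \<Rightarrow> nat \<times> nat \<Rightarrow> bool" where
  "row_less (i, j) (i', j') \<longleftrightarrow> i < i' \<or> i = i' \<and> j' < j"

fun col_less :: "nat \<times> nat \<Rightarrow> nat \<times> nat \<Rightarrow> bool" where
  "col_less (i, j) (i', j') \<longleftrightarrow> j' < j \<or> j = j' \<and> i < i'"

lemma row_less_asym: "row_less x y \<Longrightarrow> \<not> row_less y x"
  by (cases x; cases y) auto

lemma col_less_asym: "col_less x y \<Longrightarrow> \<not> col_less y x"
  by (cases x; cases y) auto

definition boxes :: "skew_tab \<Rightarrow> (nat \<times> nat) set" where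
  "boxes T = {(i, j). box T i j}"

lemma sorted_row_boxes: "sorted_wrt row_less (row_boxes T)"
  unfolding row_boxes_def
proof (intro sorted_wrt_filter sorted_wrt_concat_map)
  show "sorted_wrt (\<lambda>x y. \<forall>a\<in>set (map (Pair x) (rev [1..<Suc (ncols T)])).
      \<forall>b\<in>set (map (Pair y) (rev [1..<Suc (ncols T)])). row_less a b) [1..<Suc (nrows T)]"
    using sorted_wrt_upt[of 1 "Suc (nrows T)"]
    by (rule sorted_wrt_mono_rel[rotated]) auto
  show "sorted_wrt row_less (map (Pair x) (rev [1..<Suc (ncols T)]))" for x
    using sorted_wrt_upt[of 1 "Suc (ncols T)"] by (simp add: sorted_wrt_map sorted_wrt_rev)
qed

lemma sorted_col_boxes: "sorted_wrt col_less (col_boxes T)"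
  unfolding col_boxes_def
proof (intro sorted_wrt_filter sorted_wrt_concat_map)
  show "sorted_wrt (\<lambda>x y. \<forall>a\<in>set (map (\<lambda>i. (i, x)) [1..<Suc (nrows T)]).
      \<forall>b\<in>set (map (\<lambda>i. (i, y)) [1..<Suc (nrows T)]). col_less a b) (rev [1..<Suc (ncols T)])"
    unfolding sorted_wrt_rev using sorted_wrt_upt[of 1 "Suc (ncols T)"]
    by (rule sorted_wrt_mono_rel[rotated]) auto
  show "sorted_wrt col_less (map (\<lambda>i. (i, x)) [1..<Suc (nrows T)])" for x
    using sorted_wrt_upt[of 1 "Suc (nrows T)"] by (simp add: sorted_wrt_map)
qed

lemma part_in_le:
  assumes "part_in d m p" shows "i \<le> j \<Longrightarrow> j < d \<Longrightarrow> p ! j \<le> p ! i" "i < d \<Longrightarrow> p ! i \<le> m"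
  using assms sorted_wrt_nth_less[of "(\<ge>)" p i j] nth_mem[of i p]
  by (auto simp: part_in_def le_less)

definition skew_shape :: "skew_tab \<Rightarrow> bool" where
  "skew_shape T \<longleftrightarrow> part_in (nrows T) (ncols T) (inner T) \<and> part_in (nrows T) (ncols T) (outer T) \<and>
     list_all2 (\<le>) (inner T) (outer T)"

lemma semistandard_iff:
  "semistandard T \<longleftrightarrow> skew_shape T \<and> (\<forall>i j. box T i j \<longleftrightarrow> fill T i j \<noteq> 0) \<and>
     (\<forall>i j j'. box T i j \<and> box T i j' \<and> j < j' \<longrightarrow> fill T i j \<le> fill T i j') \<and>
     (\<forall>i i' j. box T i j \<and> box T i' j \<and> i < i' \<longrightarrow> fill T i j < fill T i' j)"
  by (auto simp: semistandard_def skew_shape_def)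

lemma box_bounds:
  assumes "skew_shape T" "box T i j"
  shows "1 \<le> i" "i \<le> nrows T" "1 \<le> j" "j \<le> ncols T"
proof -
  have b: "1 \<le> i" "i \<le> nrows T" "inner T ! (i - 1) < j" "j \<le> outer T ! (i - 1)"
    using assms(2) by (auto simp: box_def)
  then show "1 \<le> i" "i \<le> nrows T" "1 \<le> j" by auto
  have "outer T ! (i - 1) \<le> ncols T"
    using assms(1) b by (intro part_in_le(2)) (auto simp: skew_shape_def)
  then show "j \<le> ncols T" using b by simp
qed

lemma set_row_boxes: "skew_shape T \<Longrightarrow> set (row_boxes T) = boxes T"
  by (auto simp: row_boxes_def boxes_def dest: box_bounds simp del: upt_Suc) (fastforce dest: box_bounds)+

lemma set_col_boxes: "skew_shape T \<Longrightarrow> set (col_boxes T) = boxes T"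
  by (auto simp: col_boxes_def boxes_def dest: box_bounds simp del: upt_Suc) (fastforce dest: box_bounds)+

lemma distinct_row_boxes: "distinct (row_boxes T)"
  using sorted_wrt_distinct[OF _ sorted_row_boxes] row_less_asym by blast

lemma distinct_col_boxes: "distinct (col_boxes T)"
  using sorted_wrt_distinct[OF _ sorted_col_boxes] col_less_asym by blast

lemma finite_boxes: "skew_shape T \<Longrightarrow> finite (boxes T)"
  using set_row_boxes[of T] by (metis List.finite_set)

lemma row_boxes_eqI:
  "skew_shape T \<Longrightarrow> sorted_wrt row_less xs \<Longrightarrow> set xs = boxes T \<Longrightarrow> row_boxes T = xs"
  using sorted_wrt_set_unique[OF row_less_asym sorted_row_boxes] set_row_boxes by blast

lemma col_boxes_eqI:
  "skew_shape T \<Longrightarrow> sorted_wrt col_less xs \<Longrightarrow> set xs = boxes T \<Longrightarrow> col_boxes T = xs"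
  using sorted_wrt_set_unique[OF col_less_asym sorted_col_boxes] set_col_boxes by blast

lemma box_cong: "same_shape S T \<Longrightarrow> box S = box T"
  by (auto simp: same_shape_def box_def fun_eq_iff)

lemma same_shape_cong:
  assumes "same_shape S T"
  shows "row_boxes S = row_boxes T" "col_boxes S = col_boxes T" "skew_shape S = skew_shape T"
    "boxes S = boxes T"
  using assms box_cong[OF assms]
  by (auto simp: row_boxes_def col_boxes_def skew_shape_def same_shape_def boxes_def)

lemma same_shape_refl [simp]: "same_shape T T"
  by (simp add: same_shape_def)

lemma same_shape_sym: "same_shape S T \<Longrightarrow> same_shape T S"
  by (simp add: same_shape_def)

lemma same_shape_trans: "same_shape R S \<Longrightarrow> same_shape S T \<Longrightarrow> same_shape R T"
  by (simp add: same_shape_def)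

lemma semistandard_eqI:
  assumes "semistandard S" "semistandard T" "same_shape S T"
    and "row_word S = row_word T \<or> col_word S = col_word T"
  shows "S = T"
proof -
  have sh: "skew_shape S" "skew_shape T" using assms by (auto simp: semistandard_iff)
  have "fill S i j = fill T i j" if "box T i j" for i j
  proof -
    have "(i, j) \<in> boxes T" using that by (simp add: boxes_def)
    then have m: "(i, j) \<in> set (row_boxes T)" "(i, j) \<in> set (col_boxes T)"
      using sh by (auto simp: set_row_boxes set_col_boxes)
    show ?thesis using assms(4)
    proof
      assume "row_word S = row_word T"
      then show ?thesis using m(1) same_shape_cong(1)[OF assms(3)] by (auto simp: row_word_def)
    next
      assume "col_word S = col_word T"
      then show ?thesis using m(2) same_shape_cong(2)[OF assms(3)] by (auto simp: col_word_def)
    qed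
  qed
  moreover have "fill S i j = fill T i j" if "\<not> box T i j" for i j
    using that assms(1,2) box_cong[OF assms(3)] by (metis semistandard_iff)
  ultimately have "fill S = fill T" by blast
  then show ?thesis using assms(3) by (auto simp: same_shape_def)
qed

lemma box_convex:
  assumes "skew_shape T" "box T i j" "box T i' j'" "i \<le> x" "x \<le> i'" "j \<le> y" "y \<le> j'"
  shows "box T x y"
proof -
  have "inner T ! (x - 1) \<le> inner T ! (i - 1)" "outer T ! (i' - 1) \<le> outer T ! (x - 1)"
    using assms by (auto simp: skew_shape_def box_def intro!: part_in_le(1))
  then show ?thesis using assms by (auto simp: box_def)
qed

text \<open>Walk down column j and then to the right along row \<open>i'\<close>. Convexity of the
  shape keeps the walk inside, and each step down adds at least 1.\<close>

lemma fill_mono: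
  assumes "semistandard T" "box T i j" "box T i' j'" "i \<le> i'" "j \<le> j'"
  shows "fill T i j + (i' - i) \<le> fill T i' j'"
proof -
  have sh: "skew_shape T" using assms(1) by (simp add: semistandard_iff)
  have "fill T i j + (x - i) \<le> fill T x j" if "i \<le> x" "x \<le> i'" for x
    using that
  proof (induction x rule: dec_induct)
    case (step x)
    then have "box T x j" "box T (Suc x) j"
      using box_convex[OF sh assms(2,3)] assms by auto
    then have "fill T x j < fill T (Suc x) j"
      using assms(1) unfolding semistandard_iff by blast
    then show ?case using step by simp
  qed simp
  moreover have "fill T i' j \<le> fill T i' j'"
  proof (cases "j = j'")
    case False
    then show ?thesis
      using assms box_convex[OF sh assms(2,3), of i' j] unfolding semistandard_iff by auto
  qed simp
  ultimately show ?thesis using assms(4) by (meson le_refl order_trans)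
qed

lemma fill_less:
  assumes "semistandard T" "box T i j" "box T i' j'" "i < i'" "j \<le> j'"
  shows "fill T i j < fill T i' j'"
  using fill_mono[OF assms(1-3) less_imp_le[OF assms(4)] assms(5)] assms(4) by simp

lemma fill_pos: "semistandard T \<Longrightarrow> box T i j \<Longrightarrow> 1 \<le> fill T i j"
  by (auto simp: semistandard_iff Suc_le_eq)

lemma set_row_word: "skew_shape T \<Longrightarrow> set (row_word T) = (\<lambda>(i, j). fill T i j) ` boxes T"
  by (simp add: row_word_def set_row_boxes)

lemma set_col_word: "skew_shape T \<Longrightarrow> set (col_word T) = (\<lambda>(i, j). fill T i j) ` boxes T"
  by (simp add: col_word_def set_col_boxes)

lemma mset_col_word: "skew_shape T \<Longrightarrow> mset (col_word T) = mset (row_word T)"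
proof -
  assume "skew_shape T"
  then have "mset (col_boxes T) = mset (row_boxes T)"
    by (simp add: set_eq_iff_mset_eq_distinct[symmetric] distinct_row_boxes distinct_col_boxes
        set_row_boxes set_col_boxes)
  then show ?thesis by (simp add: col_word_def row_word_def)
qed

lemma count_col_word: "skew_shape T \<Longrightarrow> count_list (col_word T) x = count_list (row_word T) x"
  using mset_col_word by (metis count_mset)

section \<open>Rotation of tableaux\<close>

lemma length_dual_part [simp]: "length (dual_part m p) = length p"
  by (simp add: dual_part_def)

lemma nth_dual_part: "i < length p \<Longrightarrow> dual_part m p ! i = m - p ! (length p - Suc i)"
  by (simp add: dual_part_def rev_nth)

lemma part_in_dual: "part_in d m p \<Longrightarrow> part_in d m (dual_part m p)"
  by (auto simp: part_in_def dual_part_def sorted_wrt_rev sorted_wrt_map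
      intro: sorted_wrt_mono_rel[rotated])

lemma dual_part_dual_part: "part_in d m p \<Longrightarrow> dual_part m (dual_part m p) = p"
  by (auto simp: part_in_def dual_part_def rev_map o_def intro!: map_idI)

lemma bullet_sel [simp]:
  "nrows (bullet k T) = nrows T" "ncols (bullet k T) = ncols T"
  "inner (bullet k T) = dual_part (ncols T) (outer T)"
  "outer (bullet k T) = dual_part (ncols T) (inner T)"
  by (auto simp: bullet_def)

lemma skew_shape_bullet:
  assumes "skew_shape T" shows "skew_shape (bullet k T)"
proof -
  have "list_all2 (\<le>) (dual_part m q) (dual_part m p)" if "list_all2 (\<le>) p q" for m p q
    using that by (auto simp: list_all2_conv_all_nth nth_dual_part intro!: diff_le_mono2)
  then show ?thesis using assms by (simp add: skew_shape_def part_in_dual)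
qed

lemma box_bullet:
  assumes "skew_shape T"
  shows "box (bullet k T) i j \<longleftrightarrow> box T (Suc (nrows T) - i) (Suc (ncols T) - j)"
proof (cases "1 \<le> i \<and> i \<le> nrows T")
  case True
  have l: "length (inner T) = nrows T" "length (outer T) = nrows T"
    using assms by (auto simp: skew_shape_def part_in_def)
  have o: "outer T ! (nrows T - i) \<le> ncols T" "inner T ! (nrows T - i) \<le> ncols T"
    using assms True by (auto simp: skew_shape_def intro!: part_in_le(2))
  have "nrows T - Suc (i - Suc 0) = nrows T - i" using True by simp
  then show ?thesis
    using True o by (auto simp: box_def nth_dual_part l)
qed (auto simp: box_def)

lemma fill_bullet:
  assumes "skew_shape T"
  shows "fill (bullet k T) i j = (if box (bullet k T) i j
    then Suc k - fill T (Suc (nrows T) - i) (Suc (ncols T) - j) else 0)"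
  using box_bounds[OF skew_shape_bullet[OF assms, of k], of i j] box_bullet[OF assms, of k i j]
  by (auto simp: bullet_def)

lemma semistandard_bullet:
  assumes "semistandard T" "set (row_word T) \<subseteq> {..k}"
  shows "semistandard (bullet k T)"
proof -
  have sh: "skew_shape T" using assms by (simp add: semistandard_iff)
  let ?i = "\<lambda>i. Suc (nrows T) - i" and ?j = "\<lambda>j. Suc (ncols T) - j"
  have le: "fill T i j \<le> k" if "box T i j" for i j
    using assms(2) that by (auto simp: set_row_word[OF sh] boxes_def)
  note bb = box_bounds[OF skew_shape_bullet[OF sh, of k], simplified]
  show ?thesis
    unfolding semistandard_iff
  proof (intro conjI allI impI)
    show "skew_shape (bullet k T)" by (rule skew_shape_bullet[OF sh])
    show "box (bullet k T) i j \<longleftrightarrow> fill (bullet k T) i j \<noteq> 0" for i j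
      using le[of "?i i" "?j j"] by (auto simp: fill_bullet[OF sh] box_bullet[OF sh])
    fix i j j' assume a: "box (bullet k T) i j \<and> box (bullet k T) i j' \<and> j < j'"
    then have "fill T (?i i) (?j j') \<le> fill T (?i i) (?j j)"
      using fill_mono[OF assms(1), of "?i i" "?j j'" "?i i" "?j j"] by (auto simp: box_bullet[OF sh])
    then show "fill (bullet k T) i j \<le> fill (bullet k T) i j'" 
      using a by (simp add: fill_bullet[OF sh] diff_le_mono2)
  next
    fix i i' j assume a: "box (bullet k T) i j \<and> box (bullet k T) i' j \<and> i < i'"
    then have b: "box T (?i i) (?j j)" "box T (?i i') (?j j)" by (auto simp: box_bullet[OF sh])
    have "?i i' < ?i i" using a bb(1,2) by (meson diff_less_mono2 le_imp_less_Suc order_less_le_trans)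
    then have "fill T (?i i') (?j j) < fill T (?i i) (?j j)"
      using fill_less[OF assms(1) b(2,1)] by simp
    then show "fill (bullet k T) i j < fill (bullet k T) i' j"
      using a le[OF b(1)] by (auto simp: fill_bullet[OF sh] intro!: diff_less_mono2)
  qed
qed

definition rot :: "skew_tab \<Rightarrow> nat \<times> nat \<Rightarrow> nat \<times> nat" where
  "rot T = (\<lambda>(i, j). (Suc (nrows T) - i, Suc (ncols T) - j))"

lemma rot_image_boxes:
  assumes "skew_shape T" shows "rot T ` boxes T = boxes (bullet k T)"
proof (intro equalityI subsetI)
  fix b assume "b \<in> rot T ` boxes T"
  then obtain i j where b: "box T i j" "b = (Suc (nrows T) - i, Suc (ncols T) - j)"
    by (auto simp: boxes_def rot_def)
  then show "b \<in> boxes (bullet k T)"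
    using box_bounds[OF assms b(1)] by (simp add: boxes_def box_bullet[OF assms])
next
  fix b assume "b \<in> boxes (bullet k T)"
  then obtain i j where b: "box (bullet k T) i j" "b = (i, j)" by (auto simp: boxes_def)
  have "(Suc (nrows T) - i, Suc (ncols T) - j) \<in> boxes T"
    using b by (simp add: boxes_def box_bullet[OF assms])
  moreover have "b = rot T (Suc (nrows T) - i, Suc (ncols T) - j)"
    using box_bounds[OF skew_shape_bullet[OF assms] b(1)] b(2) by (simp add: rot_def)
  ultimately show "b \<in> rot T ` boxes T" by blast
qed

lemma boxes_bounds: "skew_shape T \<Longrightarrow> b \<in> boxes T \<Longrightarrow>
    1 \<le> fst b \<and> fst b \<le> nrows T \<and> 1 \<le> snd b \<and> snd b \<le> ncols T"
  using box_bounds[of T "fst b" "snd b"] by (auto simp: boxes_def)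

lemma row_boxes_bullet:
  assumes sh: "skew_shape T" shows "row_boxes (bullet k T) = rev (map (rot T) (row_boxes T))"
proof (rule row_boxes_eqI)
  have "row_less (rot T y) (rot T x)"
    if "x \<in> set (row_boxes T)" "y \<in> set (row_boxes T)" "row_less x y" for x y
  proof -
    obtain a b c d where "x = (a, b)" "y = (c, d)" by (cases x; cases y)
    then show ?thesis
      using that boxes_bounds[OF sh, of x] boxes_bounds[OF sh, of y]
      by (auto simp: set_row_boxes[OF sh] rot_def)
  qed
  with sorted_row_boxes[of T] show "sorted_wrt row_less (rev (map (rot T) (row_boxes T)))"
    by (auto simp: sorted_wrt_rev sorted_wrt_map intro: sorted_wrt_mono_rel[rotated])
qed (use sh in \<open>simp_all add: skew_shape_bullet rot_image_boxes set_row_boxes\<close>)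

lemma col_boxes_bullet:
  assumes sh: "skew_shape T" shows "col_boxes (bullet k T) = rev (map (rot T) (col_boxes T))"
proof (rule col_boxes_eqI)
  have "col_less (rot T y) (rot T x)"
    if "x \<in> set (col_boxes T)" "y \<in> set (col_boxes T)" "col_less x y" for x y
  proof -
    obtain a b c d where "x = (a, b)" "y = (c, d)" by (cases x; cases y)
    then show ?thesis
      using that boxes_bounds[OF sh, of x] boxes_bounds[OF sh, of y]
      by (auto simp: set_col_boxes[OF sh] rot_def)
  qed
  with sorted_col_boxes[of T] show "sorted_wrt col_less (rev (map (rot T) (col_boxes T)))"
    by (auto simp: sorted_wrt_rev sorted_wrt_map intro: sorted_wrt_mono_rel[rotated])
qed (use sh in \<open>simp_all add: skew_shape_bullet rot_image_boxes set_col_boxes\<close>)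

lemma fill_bullet_rot:
  assumes "skew_shape T" "b \<in> boxes T"
  shows "(case rot T b of (i, j) \<Rightarrow> fill (bullet k T) i j) = Suc k - (case b of (i, j) \<Rightarrow> fill T i j)"
proof -
  obtain i j where b: "b = (i, j)" "box T i j" using assms(2) by (auto simp: boxes_def)
  show ?thesis
    using box_bounds[OF assms(1) b(2)] b(2) by (simp add: b(1) rot_def fill_bullet[OF assms(1)] box_bullet[OF assms(1)])
qed

lemma row_word_bullet:
  assumes "skew_shape T" shows "row_word (bullet k T) = bullet_word k (row_word T)"
  using fill_bullet_rot[OF assms]
  by (auto simp: row_word_def row_boxes_bullet[OF assms] bullet_word_def rev_map set_row_boxes[OF assms]
      intro!: arg_cong[where f = rev])

lemma col_word_bullet:
  assumes "skew_shape T" shows "col_word (bullet k T) = bullet_word k (col_word T)"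
  using fill_bullet_rot[OF assms]
  by (auto simp: col_word_def col_boxes_bullet[OF assms] bullet_word_def rev_map set_col_boxes[OF assms]
      intro!: arg_cong[where f = rev])

lemma same_shape_bullet: "same_shape S T \<Longrightarrow> same_shape (bullet k S) (bullet l T)"
  by (simp add: same_shape_def)

lemma same_shape_bullet_bullet: "skew_shape T \<Longrightarrow> same_shape (bullet k (bullet l T)) T"
  by (auto simp: same_shape_def skew_shape_def dual_part_dual_part)

lemma bullet_bullet:
  assumes "semistandard T" "set (row_word T) \<subseteq> {1..k}"
  shows "bullet k (bullet k T) = T"
proof (rule semistandard_eqI)
  have sh: "skew_shape T" using assms by (simp add: semistandard_iff)
  have s: "set (row_word T) \<subseteq> {..k}" using assms(2) by auto
  have s': "set (row_word (bullet k T)) \<subseteq> {..k}"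
    using set_bullet_word[OF assms(2)] by (auto simp: row_word_bullet[OF sh])
  show "semistandard (bullet k (bullet k T))" by (intro semistandard_bullet assms s s')
  show "same_shape (bullet k (bullet k T)) T" by (rule same_shape_bullet_bullet[OF sh])
  have "set (row_word T) \<subseteq> {..Suc k}" using assms(2) by auto
  then show "row_word (bullet k (bullet k T)) = row_word T \<or> col_word (bullet k (bullet k T)) = col_word T"
    by (simp add: row_word_bullet skew_shape_bullet sh bullet_word_bullet_word)
qed (use assms in simp)

section \<open>Crystal operators on tableaux\<close>

text \<open>Raising the leftmost unmatched i can only clash with an i to its right or an i + 1
  below. The former makes the right neighbour an i, which is read immediately before and ends a with
  an unmatched i. The latter forces a run of i + 1 under the run of i, which is too long for
  b.\<close>

lemma flip_semistandard:
  assumes T: "semistandard T" and fl: "flip i (row_word T) v" and i: "1 \<le> i"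
  shows "\<exists>T'. semistandard T' \<and> same_shape T' T \<and> row_word T' = v"
proof -
  have sh: "skew_shape T" using T by (simp add: semistandard_iff)
  obtain a b where w: "row_word T = a @ i # b" and v: "v = a @ Suc i # b"
    and sf: "sfx i a" and pf: "pfx i b" using fl unfolding flip_def by blast
  let ?f = "\<lambda>(x, y). fill T x y"
  obtain l1 r c l2 where rb: "row_boxes T = l1 @ (r, c) # l2" and l12: "map ?f l1 = a" "map ?f l2 = b"
    and fi: "fill T r c = i"
  proof -
    have "map ?f (row_boxes T) = a @ i # b" using w by (simp add: row_word_def)
    then obtain l1 q l2 where "row_boxes T = l1 @ q # l2" "map ?f l1 = a" "?f q = i" "map ?f l2 = b"
      unfolding map_eq_append_conv map_eq_Cons_conv by blast
    then show thesis using that[of l1 "fst q" "snd q" l2] by (cases q) auto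
  qed
  have sb: "sorted_wrt row_less (l1 @ (r, c) # l2)" using sorted_row_boxes[of T] by (simp add: rb)
  have bset: "set (l1 @ (r, c) # l2) = boxes T" using set_row_boxes[OF sh] by (simp add: rb)
  have s1: "set l1 = {x \<in> boxes T. row_less x (r, c)}" and s2: "set l2 = {x \<in> boxes T. row_less (r, c) x}"
    using sorted_wrt_split[OF _ sb, unfolded bset] row_less_asym by metis+
  have brc: "box T r c" using bset by (auto simp: boxes_def)
  have dist: "distinct (l1 @ (r, c) # l2)" using distinct_row_boxes[of T] by (simp add: rb)
  have cnt: "count_list (map ?f l) x = card {q \<in> set l. ?f q = x}" if "distinct l" for l x
  proof -
    have "count_list (map ?f l) x = length (filter (\<lambda>q. ?f q = x) l)" by (induction l) auto
    also have "\<dots> = card (set (filter (\<lambda>q. ?f q = x) l))"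
      using that by (metis distinct_card distinct_filter)
    finally show ?thesis by simp
  qed
  have right: "fill T r c' \<noteq> i" if "box T r c'" "c < c'" for c'
  proof
    assume fc: "fill T r c' = i"
    have bs: "box T r (Suc c)" by (rule box_convex[OF sh brc that(1)]) (use that in auto)
    then have fs: "fill T r (Suc c) = i"
      using fill_mono[OF T brc bs] fill_mono[OF T bs that(1)] that fc fi by simp
    have "(r, Suc c) \<in> set l1" using bs by (simp add: s1 boxes_def)
    then obtain m1 m2 where m: "l1 = m1 @ (r, Suc c) # m2" by (meson split_list)
    have "set m2 = {}"
    proof -
      have "set m2 = {x \<in> set l1. row_less (r, Suc c) x}"
        using sorted_wrt_split(2)[of row_less m1 "(r, Suc c)" m2] row_less_asym sb
        by (simp add: m sorted_wrt_append)
      also have "\<dots> = {}" by (auto simp: s1)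
      finally show ?thesis .
    qed
    then have "a = map ?f m1 @ [i]" using l12 m fs by simp
    then have "drop (length (map ?f m1)) a = [i]" by simp
    then show False using sf unfolding sfx_def by (metis count_list.simps n_not_Suc_n not_one_le_zero le_add1 One_nat_def add_0)
  qed
  have below: "fill T r' c \<noteq> Suc i" if "box T r' c" "r < r'" for r'
  proof
    assume fr: "fill T r' c = Suc i"
    have bs: "box T (Suc r) c" by (rule box_convex[OF sh brc that(1)]) (use that in auto)
    then have fs: "fill T (Suc r) c = Suc i"
      using fill_less[OF T brc bs] fill_mono[OF T bs that(1)] that fr fi by simp
    \<comment> \<open>Row r holds i from column j0 to c, so row r + 1 holds i + 1 there. Up to box
      (r + 1, j0) the word b has at most c - j0 letters i, but at least c - j0 + 1 letters i +
      1.\<close>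
    define j0 where "j0 = (LEAST j. box T r j \<and> fill T r j = i)"
    have j0: "box T r j0" "fill T r j0 = i" "j0 \<le> c"
      using LeastI[of "\<lambda>j. box T r j \<and> fill T r j = i" c] Least_le[of "\<lambda>j. box T r j \<and> fill T r j = i" c]
        brc fi by (auto simp: j0_def)
    have j0_le: "j0 \<le> j" if "box T r j" "fill T r j = i" for j
      unfolding j0_def using that by (intro Least_le) simp
    have rowb: "box T r j" if "j0 \<le> j" "j \<le> c" for j
      using box_convex[OF sh j0(1) brc _ _ that] by simp
    have rowb': "box T (Suc r) j" if "j0 \<le> j" "j \<le> c" for j
      using box_convex[OF sh j0(1) bs _ _ that] by simp
    have fs': "fill T (Suc r) j = Suc i" if "j0 \<le> j" "j \<le> c" for j
      using fill_less[OF T j0(1) rowb'[OF that]] fill_mono[OF T rowb'[OF that] bs] that j0 fs by simp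
    have "(Suc r, j0) \<in> set l2" using rowb'[of j0] j0(3) by (simp add: s2 boxes_def)
    then obtain m1 m2 where m: "l2 = m1 @ (Suc r, j0) # m2" by (meson split_list)
    let ?l = "m1 @ [(Suc r, j0)]"
    have sl: "set ?l = {x \<in> boxes T. row_less (r, c) x \<and> (x = (Suc r, j0) \<or> row_less x (Suc r, j0))}"
    proof -
      have "set m1 = {x \<in> set l2. row_less x (Suc r, j0)}"
      proof -
        have "sorted_wrt row_less (m1 @ (Suc r, j0) # m2)" using sb by (simp add: m sorted_wrt_append)
        from sorted_wrt_split(1)[OF _ this] show ?thesis
          unfolding m by (simp only: row_less_asym not_False_eq_True)
      qed
      then have "set ?l = insert (Suc r, j0) {x \<in> set l2. row_less x (Suc r, j0)}"
        by (simp del: row_less.simps)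
      moreover have "(Suc r, j0) \<in> boxes T" "row_less (r, c) (Suc r, j0)"
        using rowb'[of j0] j0(3) by (simp_all add: boxes_def)
      ultimately show ?thesis unfolding s2 by (simp del: row_less.simps) fast
    qed
    have dl: "distinct ?l" using dist by (simp add: m)
    have fin: "finite (set ?l)" by simp
    have "{q \<in> set ?l. ?f q = i} \<subseteq> Pair r ` {j0..<c}"
    proof
      fix q assume q: "q \<in> {q \<in> set ?l. ?f q = i}"
      obtain x y where xy: "q = (x, y)" by (cases q)
      have "q \<in> set ?l" using q by blast
      then have qs: "(x, y) \<in> boxes T" "row_less (r, c) (x, y)"
        "(x, y) = (Suc r, j0) \<or> row_less (x, y) (Suc r, j0)"
        unfolding sl xy by blast+
      have bq: "box T x y" "fill T x y = i" using qs q by (auto simp: xy boxes_def)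
      have "x = r \<and> y < c \<or> x = Suc r \<and> j0 \<le> y" using qs(2,3) by auto
      then show "q \<in> Pair r ` {j0..<c}"
      proof
        assume "x = r \<and> y < c"
        then show ?thesis using j0_le[of y] bq by (auto simp: xy)
      next
        assume "x = Suc r \<and> j0 \<le> y"
        then show ?thesis using fill_less[OF T j0(1) bq(1)] bq(2) j0(2) by auto
      qed
    qed
    then have "card {q \<in> set ?l. ?f q = i} \<le> card (Pair r ` {j0..<c})" by (intro card_mono) auto
    also have "\<dots> = c - j0" by (simp add: card_image inj_on_def)
    finally have 1: "card {q \<in> set ?l. ?f q = i} \<le> c - j0" .
    have "Pair (Suc r) ` {j0..c} \<subseteq> {q \<in> set ?l. ?f q = Suc i}"
    proof (intro image_subsetI CollectI conjI)
      fix x assume x: "x \<in> {j0..c}"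
      then show "(Suc r, x) \<in> set ?l"
        unfolding sl using rowb'[of x] by (auto simp: boxes_def)
      show "?f (Suc r, x) = Suc i" using fs'[of x] x by simp
    qed
    then have "card (Pair (Suc r) ` {j0..c}) \<le> card {q \<in> set ?l. ?f q = Suc i}"
      using fin by (intro card_mono) auto
    then have 2: "Suc c - j0 \<le> card {q \<in> set ?l. ?f q = Suc i}" by (simp add: card_image inj_on_def)
    have "take (Suc (length m1)) b = map ?f ?l" unfolding l12(2)[symmetric] by (simp add: m)
    then have "count_list (map ?f ?l) (Suc i) \<le> count_list (map ?f ?l) i"
      using pf unfolding pfx_def by metis
    then show False using 1 2 j0(3) unfolding cnt[OF dl] by simp
  qed
  define T' where "T' = T\<lparr>fill := (fill T)(r := (fill T r)(c := Suc i))\<rparr>"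
  have ss: "same_shape T' T" by (simp add: T'_def same_shape_def)
  have bx: "box T' = box T" by (rule box_cong[OF ss])
  have f': "fill T' x y = (if x = r \<and> y = c then Suc i else fill T x y)" for x y by (simp add: T'_def)
  have "semistandard T'"
    unfolding semistandard_iff bx
  proof (intro conjI allI impI)
    show "skew_shape T'" using same_shape_cong(3)[OF ss] sh by simp
    show "box T x y \<longleftrightarrow> fill T' x y \<noteq> 0" for x y using T brc by (auto simp: f' semistandard_iff)
  next
    fix x y y' assume a: "box T x y \<and> box T x y' \<and> y < y'"
    then have "fill T x y \<le> fill T x y'" using fill_mono[OF T, of x y x y'] by simp
    then show "fill T' x y \<le> fill T' x y'" using right[of y'] a fi by (auto simp: f')
  next
    fix x x' y assume a: "box T x y \<and> box T x' y \<and> x < x'"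
    then have "fill T x y < fill T x' y" using fill_less[OF T, of x y x' y] by simp
    then show "fill T' x y < fill T' x' y" using below[of x'] a fi by (auto simp: f')
  qed
  moreover have "row_word T' = v"
  proof -
    have "map (\<lambda>(x, y). fill T' x y) l1 = a" "map (\<lambda>(x, y). fill T' x y) l2 = b"
      using dist l12 by (auto simp: f' intro!: map_cong)
    then show ?thesis using same_shape_cong(1)[OF ss] by (simp add: row_word_def rb v f')
  qed
  ultimately show ?thesis using ss by blast
qed

text \<open>Rotation reverses the direction of a flip. Thus lowering operators on tableaux are
  treated as raising operators on rotated tableaux.\<close>

lemma flip_bullet:
  assumes fl: "flip i w w'" and w: "set w \<subseteq> {1..k}" and i: "1 \<le> i" "i < k"
  shows "flip (k - i) (bullet_word k w') (bullet_word k w)"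
proof -
  obtain a b where e: "w = a @ i # b" "w' = a @ Suc i # b" and s: "sfx i a" and p: "pfx i b"
    using fl unfolding flip_def by blast
  have ab: "set a \<subseteq> {1..k}" "set b \<subseteq> {1..k}" using w by (simp_all add: e)
  have c: "count_list (bullet_word k v) (k - i) = count_list v (Suc i)"
    "count_list (bullet_word k v) (Suc (k - i)) = count_list v i" if "set v \<subseteq> {1..k}" for v
    using count_bullet_word[OF that, of "k - i"] count_bullet_word[OF that, of "Suc (k - i)"] i by auto
  have d: "drop m (bullet_word k v) = bullet_word k (take (length v - m) v)"
    "take m (bullet_word k v) = bullet_word k (drop (length v - m) v)" for m v
    by (simp_all add: bullet_word_def take_map drop_map drop_rev take_rev)
  have "sfx (k - i) (bullet_word k b)"
    unfolding sfx_def
  proof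
    fix m
    have "set (take (length b - m) b) \<subseteq> {1..k}"
      using set_take_subset ab(2) by (rule order_trans)
    then show "count_list (drop m (bullet_word k b)) (k - i) \<le> count_list (drop m (bullet_word k b)) (Suc (k - i))"
      using p by (simp add: d c pfx_def del: One_nat_def)
  qed
  moreover have "pfx (k - i) (bullet_word k a)"
    unfolding pfx_def
  proof
    fix m
    have "set (drop (length a - m) a) \<subseteq> {1..k}"
      using set_drop_subset ab(1) by (rule order_trans)
    then show "count_list (take m (bullet_word k a)) (Suc (k - i)) \<le> count_list (take m (bullet_word k a)) (k - i)"
      using s by (simp add: d c sfx_def del: One_nat_def)
  qed
  ultimately show ?thesis
    unfolding flip_def using i
    by (intro exI[of _ "bullet_word k b"] exI[of _ "bullet_word k a"]) (simp add: e bullet_word_Cons Suc_diff_le)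
qed

theorem flips_semistandard:
  assumes "equivclp (flips k) (row_word T) v" "semistandard T" "set (row_word T) \<subseteq> {1..k}"
  shows "\<exists>T'. semistandard T' \<and> same_shape T' T \<and> row_word T' = v"
  using assms(1)
proof (induction rule: equivclp_induct)
  case base
  then show ?case using assms(2) by (intro exI[of _ T]) simp
next
  case (step y z)
  then obtain T' where T': "semistandard T'" "same_shape T' T" "row_word T' = y" by blast
  have y: "set y \<subseteq> {1..k}" using flips_dual_knuth[OF step(1) assms(3)] by blast
  show ?case
    using step(2)
  proof
    assume "flips k y z"
    then obtain i where "1 \<le> i" "flip i (row_word T') z" using T' by (auto simp: flips_def)
    from flip_semistandard[OF T'(1) this(2,1)] show ?thesis using T' same_shape_trans by blast
  next
    assume zy: "flips k z y"
    then obtain i where i: "1 \<le> i" "i < k" "flip i z y" by (auto simp: flips_def)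
    have sh: "skew_shape T'" using T'(1) by (simp add: semistandard_iff)
    have z: "set z \<subseteq> {1..k}" using flips_set[OF zy] y by blast
    have y': "set y \<subseteq> {..k}" "set z \<subseteq> {..Suc k}" using y z by auto
    \<comment> \<open>A backward flip is carried out on the rotated tableau, where it is a forward
      one.\<close>
    have "flip (k - i) (row_word (bullet k T')) (bullet_word k z)"
      using flip_bullet[OF i(3) z i(1,2)] by (simp add: row_word_bullet[OF sh] T')
    moreover have "semistandard (bullet k T')" using semistandard_bullet[OF T'(1)] y' T' by simp
    ultimately obtain S where S: "semistandard S" "same_shape S (bullet k T')" "row_word S = bullet_word k z"
      using flip_semistandard[of "bullet k T'" "k - i"] i by fastforce
    have shS: "skew_shape S" using S(1) by (simp add: semistandard_iff)
    have "semistandard (bullet k S)"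
      using semistandard_bullet[OF S(1)] set_bullet_word[OF z] by (auto simp: S subset_iff)
    moreover have "row_word (bullet k S) = z"
      using y' by (simp add: row_word_bullet[OF shS] S bullet_word_bullet_word)
    moreover have "same_shape (bullet k S) T"
      using same_shape_bullet[OF S(2), of k k] same_shape_bullet_bullet[OF sh, of k k] T'(2) same_shape_trans by blast
    ultimately show ?thesis by blast
  qed
qed

section \<open>The reversal\<close>

definition is_reversal :: "nat \<Rightarrow> skew_tab \<Rightarrow> skew_tab \<Rightarrow> bool" where
  "is_reversal k T T' \<longleftrightarrow> semistandard T' \<and> set (row_word T') \<subseteq> {1..k} \<and>
     dual_knuth_equiv T T' \<and> knuth_equiv T' (bullet k T)"

definition tab_over :: "nat \<Rightarrow> skew_tab \<Rightarrow> bool" where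
  "tab_over k T \<longleftrightarrow> semistandard T \<and> set (row_word T) \<subseteq> {1..k}"

lemma tab_overD:
  assumes "tab_over k T"
  shows "semistandard T" "skew_shape T" "set (row_word T) \<subseteq> {1..k}"
  using assms by (auto simp: tab_over_def semistandard_iff)

lemma tab_over_bullet:
  assumes "tab_over k T" shows "tab_over k (bullet k T)" "bullet k (bullet k T) = T"
proof -
  note T = tab_overD[OF assms]
  have "set (row_word T) \<subseteq> {..k}" using T(3) by auto
  then show "tab_over k (bullet k T)"
    unfolding tab_over_def row_word_bullet[OF T(2)]
    using semistandard_bullet[OF T(1)] set_bullet_word[OF T(3)] by simp
  show "bullet k (bullet k T) = T" by (rule bullet_bullet[OF T(1,3)])
qed

lemma rev_row_word_bullet:
  "skew_shape T \<Longrightarrow> rev (row_word (bullet k T)) = bullet_word k (rev (row_word T))"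
  by (simp add: row_word_bullet rev_bullet_word)

lemma bullet_bullet_over: "set u \<subseteq> {1..k} \<Longrightarrow> bullet_word k (bullet_word k u) = u"
  by (rule bullet_word_bullet_word) auto

lemma dual_knuth_equiv_bullet:
  assumes "dual_knuth_equiv S T" "tab_over k S" "tab_over k T"
  shows "dual_knuth_equiv (bullet k S) (bullet k T)"
proof -
  have d: "dual_knuth (standardize (rev (row_word S))) (standardize (rev (row_word T)))"
    and ss: "same_shape S T" using assms(1) by (auto simp: dual_knuth_equiv_def)
  have "length (row_word T) = length (row_word S)" using dual_knuth_perm(1)[OF d] by simp
  moreover have "set (rev (row_word S)) \<subseteq> {..Suc k}" "set (rev (row_word T)) \<subseteq> {..Suc k}"
    using tab_overD(3)[OF assms(2)] tab_overD(3)[OF assms(3)] by auto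
  ultimately show ?thesis
    using dual_knuth_bullet[OF d is_perm_standardize] ss
    by (simp add: dual_knuth_equiv_def same_shape_bullet rev_row_word_bullet standardize_bullet
        tab_overD(2)[OF assms(2)] tab_overD(2)[OF assms(3)])
qed

lemma knuth_equiv_bullet:
  assumes "knuth_equiv S T" "tab_over k S" "tab_over k T"
  shows "knuth_equiv (bullet k S) (bullet k T)"
proof -
  have "set (rev (row_word S)) \<subseteq> {..Suc k}" using tab_overD(3)[OF assms(2)] by auto
  then show ?thesis
    using assms(1) knuth_bullet unfolding knuth_equiv_def
    by (simp add: rev_row_word_bullet tab_overD(2)[OF assms(2)] tab_overD(2)[OF assms(3)])
qed

lemma dual_knuth_equiv_sym: "dual_knuth_equiv S T \<Longrightarrow> dual_knuth_equiv T S"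
  unfolding dual_knuth_equiv_def by (auto intro: same_shape_sym equivclp_sym)

lemma dual_knuth_equiv_trans: "dual_knuth_equiv R S \<Longrightarrow> dual_knuth_equiv S T \<Longrightarrow> dual_knuth_equiv R T"
  unfolding dual_knuth_equiv_def by (auto intro: same_shape_trans equivclp_trans)

lemma is_reversal_bullet:
  assumes "is_reversal k T T'" "tab_over k T"
  shows "is_reversal k (bullet k T) (bullet k T')"
proof -
  have T': "tab_over k T'" using assms(1) by (simp add: is_reversal_def tab_over_def)
  show ?thesis
    using assms tab_over_bullet[OF T'] tab_over_bullet[OF assms(2)] T'
      dual_knuth_equiv_bullet[of T T' k] knuth_equiv_bullet[of T' "bullet k T" k]
    by (simp add: is_reversal_def tab_over_def)
qed

text \<open>Rotating the Knuth condition exchanges the roles of T and \<open>T'\<close>. This is why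
  e is an involution.\<close>

lemma is_reversal_sym:
  assumes "is_reversal k T T'" "tab_over k T"
  shows "is_reversal k T' T"
proof -
  have T': "tab_over k T'" using assms(1) by (simp add: is_reversal_def tab_over_def)
  have "knuth_equiv (bullet k T') T"
    using knuth_equiv_bullet[of T' "bullet k T" k] assms T' tab_over_bullet[OF assms(2)]
    by (simp add: is_reversal_def)
  then have "knuth_equiv T (bullet k T')" unfolding knuth_equiv_def by (rule equivclp_sym)
  then show ?thesis
    using assms by (auto simp: is_reversal_def tab_over_def intro: dual_knuth_equiv_sym)
qed

lemma yamanouchi_slat: "yamanouchi w \<longleftrightarrow> slat (rev w)"
  by (simp flip: yamanouchi_rev)

lemma opp_yamanouchi_olat: "opp_yamanouchi k w \<longleftrightarrow> olat k (rev w)"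
  by (simp flip: opp_yamanouchi_rev)

lemma is_reversal_opp:
  assumes T: "tab_over k T" "yamanouchi (row_word T)" and r: "is_reversal k T T'"
  shows "opp_yamanouchi k (row_word T')"
proof -
  note D = tab_overD[OF T(1)]
  have w': "set (rev (row_word T')) \<subseteq> {1..k}" using r by (simp add: is_reversal_def)
  have "knuth (rev (row_word T')) (bullet_word k (rev (row_word T)))"
    using r by (simp add: is_reversal_def knuth_equiv_def rev_row_word_bullet[OF D(2)])
  then have "knuth (bullet_word k (rev (row_word T'))) (bullet_word k (bullet_word k (rev (row_word T))))"
    using w' by (intro knuth_bullet) auto
  also have "bullet_word k (bullet_word k (rev (row_word T))) = rev (row_word T)"
    using D(3) by (intro bullet_bullet_over) simp
  finally have "slat (bullet_word k (rev (row_word T')))"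
    using T(2) knuth_slat by (simp add: yamanouchi_slat)
  then show ?thesis by (simp add: opp_yamanouchi_olat olat_def)
qed

text \<open>Flips preserve the shape and the dual Knuth class, and \<sigma>0 reverses the
  multiplicities, so \<sigma>0 w is opposite Yamanouchi. Its rotation is a Yamanouchi word with the
  weight of w, hence Knuth equivalent to w; rotating both gives the Knuth half.\<close>

theorem reversal_exists:
  assumes T: "tab_over k T" "yamanouchi (row_word T)"
  shows "\<exists>T'. is_reversal k T T' \<and> row_word T' = sigma0 k (row_word T)"
proof -
  note D = tab_overD[OF T(1)]
  let ?w = "row_word T" let ?w' = "sigma0 k ?w"
  obtain T' where T': "semistandard T'" "same_shape T' T" "row_word T' = ?w'"
    using flips_semistandard[OF sigma0_flips D(1,3)] by blast
  have d: "set ?w' \<subseteq> {1..k}" "dual_knuth (standardize (rev ?w)) (standardize (rev ?w'))"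
    using flips_dual_knuth[OF sigma0_flips D(3)] by auto
  have "olat k (rev ?w')"
    by (rule slat_dual_olat[of "rev ?w"]) (use T(2) D(3) d in \<open>auto simp: yamanouchi_slat count_sigma0\<close>)
  then have "knuth (bullet_word k (rev ?w')) (rev ?w)"
  proof (intro knuth_slat_unique)
    have s: "set (bullet_word k (rev ?w')) \<subseteq> {1..k}" using d(1) by (intro set_bullet_word) simp
    then show "0 \<notin> set (bullet_word k (rev ?w'))" by auto
    show "0 \<notin> set (rev ?w)" using D(3) by auto
    fix i :: nat assume i: "1 \<le> i"
    show "count_list (bullet_word k (rev ?w')) i = count_list (rev ?w) i"
    proof (cases "i \<le> k")
      case True
      have "set (rev ?w') \<subseteq> {1..k}" using d(1) by simp
      moreover have "1 \<le> Suc k - i" "Suc k - i \<le> k" "Suc k - (Suc k - i) = i" using True i by auto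
      ultimately show ?thesis using count_bullet_word[OF _ i True] by (simp add: count_sigma0)
    next
      case False
      then have "i \<notin> set (bullet_word k (rev ?w'))" "i \<notin> set (rev ?w)" using s D(3) by auto
      then show ?thesis by (simp add: count_list_0_iff)
    qed
  qed (use T(2) in \<open>auto simp: olat_def yamanouchi_slat\<close>)
  then have "knuth (bullet_word k (bullet_word k (rev ?w'))) (bullet_word k (rev ?w))"
    using set_bullet_word[of "rev ?w'" k] d(1) by (intro knuth_bullet) auto
  then have "knuth (rev ?w') (bullet_word k (rev ?w))"
    using d(1) by (simp add: bullet_bullet_over)
  then have "is_reversal k T T'"
    using T' d by (auto simp: is_reversal_def knuth_equiv_def dual_knuth_equiv_def
        rev_row_word_bullet[OF D(2)] same_shape_sym)
  then show ?thesis using T'(3) by blast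
qed

lemma opp_yamanouchi_unique:
  assumes "tab_over k S" "tab_over k T" "opp_yamanouchi k (row_word S)" "opp_yamanouchi k (row_word T)"
    and "dual_knuth_equiv S T"
  shows "S = T"
proof -
  have "rev (row_word S) = rev (row_word T)"
    by (rule olat_dual_unique[of _ k])
       (use assms tab_overD(3) in \<open>auto simp: opp_yamanouchi_olat dual_knuth_equiv_def\<close>)
  then show ?thesis
    using assms tab_overD(1) by (intro semistandard_eqI) (auto simp: dual_knuth_equiv_def)
qed

lemma is_reversal_unique:
  assumes T: "tab_over k T" "yamanouchi (row_word T)" and r: "is_reversal k T T'" "is_reversal k T T''"
  shows "T' = T''"
proof (rule opp_yamanouchi_unique[of k])
  show "dual_knuth_equiv T' T''"
    using r dual_knuth_equiv_sym dual_knuth_equiv_trans unfolding is_reversal_def by blast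
qed (use is_reversal_opp[OF T] r in \<open>auto simp: is_reversal_def tab_over_def\<close>)

lemma reversal_over_def': "reversal_over k T = (THE T'. is_reversal k T T')"
  by (simp add: reversal_over_def is_reversal_def)

lemma opp_yamanouchi_bullet:
  assumes "tab_over k T" "opp_yamanouchi k (row_word T)"
  shows "yamanouchi (row_word (bullet k T))"
  using assms by (simp add: row_word_bullet tab_overD opp_yamanouchi_def)

lemma yamanouchi_bullet:
  assumes "tab_over k T" "yamanouchi (row_word T)"
  shows "opp_yamanouchi k (row_word (bullet k T))"
  using assms bullet_bullet_over[OF tab_overD(3)[OF assms(1)]]
  by (simp add: row_word_bullet tab_overD opp_yamanouchi_def)

text \<open>The opposite case is reduced to the Yamanouchi case by rotation, which maps reversals to
  reversals.\<close>

lemma reversal_over_eqI: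
  assumes T: "tab_over k T" "yamanouchi (row_word T) \<or> opp_yamanouchi k (row_word T)"
    and r: "is_reversal k T T'"
  shows "reversal_over k T = T'"
  unfolding reversal_over_def'
proof (rule the_equality)
  fix T'' assume r': "is_reversal k T T''"
  show "T'' = T'"
    using T(2)
  proof
    assume "opp_yamanouchi k (row_word T)"
    then have "yamanouchi (row_word (bullet k T))" by (rule opp_yamanouchi_bullet[OF T(1)])
    then have "bullet k T'' = bullet k T'"
      using is_reversal_unique[OF tab_over_bullet(1)[OF T(1)]] is_reversal_bullet r r' T(1) by blast
    then have "bullet k (bullet k T'') = bullet k (bullet k T')" by simp
    then show ?thesis
      using r r' by (simp add: is_reversal_def bullet_bullet)
  qed (use is_reversal_unique T(1) r r' in blast)
qed fact

lemma reversal_over_yamanouchi: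
  assumes T: "tab_over k T" "yamanouchi (row_word T)"
  shows "is_reversal k T (reversal_over k T)" "row_word (reversal_over k T) = sigma0 k (row_word T)"
    "opp_yamanouchi k (row_word (reversal_over k T))" "reversal_over k (reversal_over k T) = T"
    "tab_over k (reversal_over k T)" "same_shape (reversal_over k T) T"
proof -
  obtain T' where r: "is_reversal k T T'" "row_word T' = sigma0 k (row_word T)"
    using reversal_exists[OF T] by blast
  then have e: "reversal_over k T = T'" using reversal_over_eqI T by blast
  show "is_reversal k T (reversal_over k T)" "row_word (reversal_over k T) = sigma0 k (row_word T)"
    using r e by auto
  show o: "opp_yamanouchi k (row_word (reversal_over k T))"
    using is_reversal_opp[OF T r(1)] e by simp
  show t: "tab_over k (reversal_over k T)" using r e by (simp add: is_reversal_def tab_over_def)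
  show "reversal_over k (reversal_over k T) = T"
    using reversal_over_eqI[OF t disjI2[OF o]] is_reversal_sym[OF r(1) T(1)] e by simp
  show "same_shape (reversal_over k T) T"
    using r(1) e by (auto simp: is_reversal_def dual_knuth_equiv_def intro: same_shape_sym)
qed

lemma reversal_over_bullet:
  assumes T: "tab_over k T" "yamanouchi (row_word T)"
  shows "reversal_over k (bullet k T) = bullet k (reversal_over k T)"
  using reversal_over_eqI[OF tab_over_bullet(1)[OF T(1)] disjI2[OF yamanouchi_bullet[OF T]]]
    is_reversal_bullet[OF reversal_over_yamanouchi(1)[OF T] T(1)] by blast

section \<open>The symmetries given by the reversal\<close>

lemma skew_tabsD:
  assumes "T \<in> skew_tabs d m \<mu> \<kappa> lam" "length \<kappa> = d"
  shows "tab_over d T" "nrows T = d" "ncols T = m" "inner T = \<mu>" "outer T = dual_part m lam"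
    "i < d \<Longrightarrow> count_list (row_word T) (Suc i) = \<kappa> ! i"
  using assms by (auto simp: skew_tabs_def tab_over_def has_content_def)

lemma skew_tabsI:
  assumes "tab_over d T" "nrows T = d" "ncols T = m" "inner T = \<mu>" "outer T = dual_part m lam"
    "length \<kappa> = d" "\<And>i. i < d \<Longrightarrow> count_list (row_word T) (Suc i) = \<kappa> ! i"
  shows "T \<in> skew_tabs d m \<mu> \<kappa> lam"
  using assms by (simp add: skew_tabs_def tab_over_def has_content_def)

lemma reversal_LR:
  assumes "T \<in> LR d m \<mu> \<nu> lam" "length \<nu> = d"
  shows "reversal T \<in> oppLR d m \<mu> (rev \<nu>) lam" "row_word (reversal T) = sigma0 d (row_word T)"
    "reversal (reversal T) = T"
proof -
  have T: "T \<in> skew_tabs d m \<mu> \<nu> lam" "yamanouchi (row_word T)" using assms by (auto simp: LR_def)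
  note D = skew_tabsD[OF T(1) assms(2)]
  note R = reversal_over_yamanouchi[OF D(1) T(2)]
  have e: "reversal T = reversal_over d T" by (simp add: reversal_def D(2))
  have n: "nrows (reversal_over d T) = d" using R(6) D(2) by (simp add: same_shape_def)
  show w: "row_word (reversal T) = sigma0 d (row_word T)" using R(2) by (simp add: e)
  show "reversal (reversal T) = T" using R(4) by (simp add: e) (simp add: reversal_def n)
  have "reversal_over d T \<in> skew_tabs d m \<mu> (rev \<nu>) lam"
  proof (rule skew_tabsI)
    fix i assume i: "i < d"
    then show "count_list (row_word (reversal_over d T)) (Suc i) = rev \<nu> ! i"
      using D(6)[of "d - Suc i"] w assms(2) by (simp add: e count_sigma0 rev_nth Suc_diff_Suc)
  qed (use R D assms in \<open>simp_all add: same_shape_def\<close>)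
  then show "reversal T \<in> oppLR d m \<mu> (rev \<nu>) lam" using R(3) by (simp add: e oppLR_def)
qed

lemma bullet_LR:
  assumes "T \<in> LR d m \<mu> \<nu> lam" "length \<nu> = d" "part_in d m lam"
  shows "bullet d T \<in> oppLR d m lam (rev \<nu>) \<mu>" "bullet d (bullet d T) = T"
    "reversal (bullet d T) = bullet d (reversal T)"
proof -
  have T: "T \<in> skew_tabs d m \<mu> \<nu> lam" "yamanouchi (row_word T)" using assms by (auto simp: LR_def)
  note D = skew_tabsD[OF T(1) assms(2)]
  show "bullet d (bullet d T) = T" by (rule tab_over_bullet(2)[OF D(1)])
  show "reversal (bullet d T) = bullet d (reversal T)"
    using reversal_over_bullet[OF D(1) T(2)] by (simp add: reversal_def D(2))
  have "bullet d T \<in> skew_tabs d m lam (rev \<nu>) \<mu>"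
  proof (rule skew_tabsI)
    fix i assume i: "i < d"
    then show "count_list (row_word (bullet d T)) (Suc i) = rev \<nu> ! i"
      using D(6)[of "d - Suc i"] count_bullet_word[OF tab_overD(3)[OF D(1)], of "Suc i"] assms(2)
      by (simp add: row_word_bullet tab_overD(2)[OF D(1)] rev_nth Suc_diff_Suc)
  qed (use D assms tab_over_bullet(1)[OF D(1)] in \<open>simp_all add: dual_part_dual_part\<close>)
  then show "bullet d T \<in> oppLR d m lam (rev \<nu>) \<mu>"
    using yamanouchi_bullet[OF D(1) T(2)] by (simp add: oppLR_def)
qed

lemma bullet_oppLR:
  assumes "T \<in> oppLR d m \<mu> (rev \<nu>) lam" "length \<nu> = d" "part_in d m lam"
  shows "bullet d T \<in> LR d m lam \<nu> \<mu>" "bullet d (bullet d T) = T"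
proof -
  have T: "T \<in> skew_tabs d m \<mu> (rev \<nu>) lam" "opp_yamanouchi d (row_word T)"
    using assms by (auto simp: oppLR_def)
  have l: "length (rev \<nu>) = d" using assms(2) by simp
  note D = skew_tabsD[OF T(1) l]
  show "bullet d (bullet d T) = T" by (rule tab_over_bullet(2)[OF D(1)])
  have "bullet d T \<in> skew_tabs d m lam \<nu> \<mu>"
  proof (rule skew_tabsI)
    fix i assume i: "i < d"
    then show "count_list (row_word (bullet d T)) (Suc i) = \<nu> ! i"
      using D(6)[of "d - Suc i"] count_bullet_word[OF tab_overD(3)[OF D(1)], of "Suc i"] assms(2)
      by (simp add: row_word_bullet tab_overD(2)[OF D(1)] rev_nth Suc_diff_Suc)
  qed (use D assms tab_over_bullet(1)[OF D(1)] in \<open>simp_all add: dual_part_dual_part\<close>)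
  then show "bullet d T \<in> LR d m lam \<nu> \<mu>"
    using opp_yamanouchi_bullet[OF D(1) T(2)] by (simp add: LR_def)
qed

text \<open>\<rho> is an involution because e commutes with \<bullet>: \<bullet> e \<rho> T = e
  \<bullet> \<rho> T = e e T.\<close>

lemma rho_LR:
  assumes "T \<in> LR d m \<mu> \<nu> lam" "length \<nu> = d" "part_in d m \<mu>" "part_in d m lam"
  shows "rho T = bullet d (reversal T)" "rho T \<in> LR d m lam \<nu> \<mu>" "rho (rho T) = T"
    "row_word (rho T) = bullet_word d (sigma0 d (row_word T))"
proof -
  note R = reversal_LR[OF assms(1,2)]
  have n: "nrows T = d" using assms by (auto simp: LR_def skew_tabs_def)
  show e: "rho T = bullet d (reversal T)" by (simp add: rho_def n)
  note B = bullet_oppLR[OF R(1) assms(2,4)]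
  show l: "rho T \<in> LR d m lam \<nu> \<mu>" using B(1) e by simp
  then have n': "nrows (rho T) = d" by (auto simp: LR_def skew_tabs_def)
  have "rho (rho T) = bullet d (reversal (rho T))" by (simp add: rho_def[of "rho T"] n')
  also have "\<dots> = reversal (bullet d (rho T))" using bullet_LR(3)[OF l assms(2,3)] by simp
  also have "\<dots> = T" using B(2) R(3) by (simp add: e)
  finally show "rho (rho T) = T" .
  have "skew_shape (reversal T)" using R(1) by (auto simp: oppLR_def skew_tabs_def semistandard_iff)
  then show "row_word (rho T) = bullet_word d (sigma0 d (row_word T))"
    by (simp add: e row_word_bullet R(2))
qed

text \<open>On opposite tableaux e is \<rho> after \<bullet>, so its properties come from those of
  \<rho> on LR tableaux.\<close>

lemma reversal_oppLR:
  assumes "T \<in> oppLR d m \<mu> (rev \<nu>) lam" "length \<nu> = d" "part_in d m \<mu>" "part_in d m lam"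
  shows "reversal T = rho (bullet d T)" "reversal T \<in> LR d m \<mu> \<nu> lam" "reversal (reversal T) = T"
proof -
  note B = bullet_oppLR[OF assms(1,2,4)]
  note R = rho_LR[OF B(1) assms(2,4,3)]
  show e: "reversal T = rho (bullet d T)"
    using bullet_LR(3)[OF B(1) assms(2,3)] R(1) B(2) by simp
  show "reversal T \<in> LR d m \<mu> \<nu> lam" using R(2) e by simp
  have "bullet d (reversal (reversal T)) = bullet d T"
    using rho_LR(1,3)[OF B(1) assms(2,4,3)] rho_LR(1)[OF \<open>reversal T \<in> _\<close> assms(2,3,4)] e by simp
  then have "bullet d (bullet d (reversal (reversal T))) = bullet d (bullet d T)" by simp
  then show "reversal (reversal T) = T"
    using bullet_oppLR(2)[OF reversal_LR(1)[OF \<open>reversal T \<in> _\<close> assms(2)] assms(2,4)] B(2) by simp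
qed

section \<open>Row and column readings\<close>

text \<open>Two reading orders that list boxes from south-west to north-east, in the weak sense, have the
  same dual Knuth moves: in a standard filling, boxes whose entries differ by at most 2 are
  comparable in this order.\<close>

definition sw :: "nat \<times> nat \<Rightarrow> nat \<times> nat \<Rightarrow> bool" where
  "sw b a \<longleftrightarrow> fst a \<le> fst b \<and> snd b \<le> snd a"

definition sw_order :: "(nat \<times> nat) list \<Rightarrow> bool" where
  "sw_order bs \<longleftrightarrow> sorted_wrt (\<lambda>a b. \<not> sw b a) bs"

definition std_filling :: "(nat \<times> nat) set \<Rightarrow> (nat \<times> nat \<Rightarrow> nat) \<Rightarrow> bool" where
  "std_filling B g \<longleftrightarrow> inj_on g B \<and>
     (\<forall>a\<in>B. \<forall>b\<in>B. a \<noteq> b \<longrightarrow> fst a \<le> fst b \<longrightarrow> snd a \<le> snd b \<longrightarrow> g a < g b)"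

lemma sw_order_rows: "sw_order (rev (row_boxes T))"
  using sorted_row_boxes[of T] unfolding sw_order_def sorted_wrt_rev
  by (rule sorted_wrt_mono_rel[rotated]) (auto simp: sw_def)

lemma sw_order_cols: "sw_order (rev (col_boxes T))"
  using sorted_col_boxes[of T] unfolding sw_order_def sorted_wrt_rev
  by (rule sorted_wrt_mono_rel[rotated]) (auto simp: sw_def)

lemma sw_order_index:
  assumes "sw_order bs" "p < length bs" "q < length bs" "sw (bs ! p) (bs ! q)" "p \<noteq> q"
  shows "p < q"
proof (rule ccontr)
  assume "\<not> p < q"
  then have "q < p" using assms(5) by simp
  then show False using assms sorted_wrt_nth_less[of _ bs q p] by (auto simp: sw_order_def)
qed

lemma sw_order_distinct: "sw_order bs \<Longrightarrow> distinct bs"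
  unfolding sw_order_def by (rule sorted_wrt_distinct[rotated]) (auto simp: sw_def)

text \<open>If a were strictly north-west of b, the other two corners of their rectangle would hold
  distinct values strictly between, so the values would differ by at least 3.\<close>

lemma std_filling_close:
  assumes sh: "skew_shape T" and g: "std_filling (boxes T) g"
    and ab: "a \<in> boxes T" "b \<in> boxes T" "g a \<le> g b" "g b \<le> g a + 2" "a \<noteq> b"
  shows "sw a b \<or> sw b a"
proof (rule ccontr)
  assume n: "\<not> (sw a b \<or> sw b a)"
  obtain i j i' j' where e: "a = (i, j)" "b = (i', j')" by (cases a; cases b)
  have less: "g c < g d" if "c \<in> boxes T" "d \<in> boxes T" "c \<noteq> d" "fst c \<le> fst d" "snd c \<le> snd d" for c d
    using g that unfolding std_filling_def by blast
  have "\<not> (i' < i \<and> j' < j)" using less[of b a] ab e by auto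
  then have lt: "i < i'" "j < j'" using n by (auto simp: sw_def e)
  have bx: "box T i j" "box T i' j'" using ab e by (auto simp: boxes_def)
  have c: "(i, j') \<in> boxes T" "(i', j) \<in> boxes T"
    using box_convex[OF sh bx, of i j'] box_convex[OF sh bx, of i' j] lt by (auto simp: boxes_def)
  have "g (i, j') \<noteq> g (i', j)"
    using g c lt unfolding std_filling_def inj_on_def by fastforce
  moreover have "g a < g (i, j')" "g a < g (i', j)" "g (i, j') < g b" "g (i', j) < g b"
    using less ab c lt e by auto
  ultimately show False using ab(4) by linarith
qed

lemma std_filling_step:
  assumes sh: "skew_shape T" and g: "std_filling (boxes T) g"
    and bs: "sw_order bs" "set bs = boxes T" and cs: "sw_order cs" "set cs = boxes T"
    and step: "dual_knuth_step (map g bs) \<sigma>"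
  shows "\<exists>g'. std_filling (boxes T) g' \<and> \<sigma> = map g' bs \<and> dual_knuth_step (map g cs) (map g' cs)"
  using step
proof cases
  case (1 p q r a)
  define x y z where "x = bs ! p" and "y = bs ! q" and "z = bs ! r"
  have l: "p < length bs" "q < length bs" "r < length bs" using 1 by auto
  have B: "x \<in> boxes T" "y \<in> boxes T" "z \<in> boxes T"
    using l bs(2) nth_mem unfolding x_def y_def z_def by blast+
  have d: "distinct bs" "distinct cs" using sw_order_distinct bs(1) cs(1) by auto
  have ne: "x \<noteq> y" "y \<noteq> z" "x \<noteq> z"
    using 1 l d(1) by (auto simp: x_def y_def z_def nth_eq_iff_index_eq)
  have gv: "{g x, g z} = {a, Suc a}" "Suc (g y) = a \<or> g y = Suc (Suc a)"
    using 1 l by (auto simp: x_def y_def z_def)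
  have xz: "g x = a \<and> g z = Suc a \<or> g x = Suc a \<and> g z = a" using gv(1) by (auto simp: doubleton_eq_iff)
  have less: "g c < g d" if "c \<in> boxes T" "d \<in> boxes T" "c \<noteq> d" "fst c \<le> fst d" "snd c \<le> snd d" for c d
    using g that unfolding std_filling_def by blast
  have cmp: "sw c d \<or> sw d c" if "c \<in> {x, y, z}" "d \<in> {x, y, z}" "c \<noteq> d" for c d
    using std_filling_close[OF sh g, of c d] std_filling_close[OF sh g, of d c] that B xz gv(2) by force
  have sxy: "sw x y"
    using cmp[of x y] ne sw_order_index[OF bs(1) l(2,1)] 1 by (auto simp: x_def y_def)
  have syz: "sw y z"
    using cmp[of y z] ne sw_order_index[OF bs(1) l(3,2)] 1 by (auto simp: y_def z_def)
  \<comment> \<open>If x and z shared a row or a column, y would lie between them there and its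
    value between theirs, unlike a witness. So z is strictly north-east of x, and exchanging their
    values leaves the filling standard.\<close>
  have strict: "fst z < fst x" "snd x < snd z"
  proof -
    have "\<not> fst x \<le> fst z"
    proof
      assume "fst x \<le> fst z"
      then have "fst x = fst y" "fst y = fst z" "snd x \<le> snd y" "snd y \<le> snd z"
        using sxy syz by (auto simp: sw_def)
      then have "g x < g y" "g y < g z" using less B ne by auto
      then show False using xz gv(2) by auto
    qed
    moreover have "\<not> snd z \<le> snd x"
    proof
      assume "snd z \<le> snd x"
      then have "snd x = snd y" "snd y = snd z" "fst y \<le> fst x" "fst z \<le> fst y"
        using sxy syz by (auto simp: sw_def)
      then have "g y < g x" "g z < g y" using less B ne by auto
      then show False using xz gv(2) by auto
    qed
    ultimately show "fst z < fst x" "snd x < snd z" by auto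
  qed
  define g' where "g' = g(x := g z, z := g x)"
  have inj: "g c \<noteq> g d" if "c \<in> boxes T" "d \<in> boxes T" "c \<noteq> d" for c d
    using g that unfolding std_filling_def inj_on_def by blast
  have "g' c < g' d" if cd: "c \<in> boxes T" "d \<in> boxes T" "c \<noteq> d" "fst c \<le> fst d" "snd c \<le> snd d" for c d
  proof -
    have "\<not> (c = x \<and> d = z)" "\<not> (c = z \<and> d = x)" using cd strict by auto
    then show ?thesis
      using less[OF cd] inj[of c x] inj[of c z] inj[of d x] inj[of d z] cd B xz ne
      by (cases "c = x"; cases "c = z"; cases "d = x"; cases "d = z") (auto simp: g'_def)
  qed
  moreover have "inj_on g' (boxes T)"
    unfolding inj_on_def
  proof (intro ballI impI, rule ccontr)
    fix c d assume "c \<in> boxes T" "d \<in> boxes T" "g' c = g' d" "c \<noteq> d"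
    then show False
      using inj[of c d] inj[of c x] inj[of c z] inj[of d x] inj[of d z] inj[of x z] B ne
      by (cases "c = x"; cases "c = z"; cases "d = x"; cases "d = z") (auto simp: g'_def)
  qed
  ultimately have sf: "std_filling (boxes T) g'" unfolding std_filling_def by blast
  have upd: "map g' ds = (map g ds)[p' := g z, r' := g x]"
    if "distinct ds" "p' < length ds" "r' < length ds" "ds ! p' = x" "ds ! r' = z" for ds p' r'
    using that ne(3) by (intro nth_equalityI) (auto simp: g'_def nth_list_update nth_eq_iff_index_eq)
  have "\<sigma> = map g' bs" using upd[OF d(1) l(1,3)] 1 l by (simp add: x_def z_def)
  moreover obtain p' q' r' where c: "p' < length cs" "q' < length cs" "r' < length cs"
    "cs ! p' = x" "cs ! q' = y" "cs ! r' = z" using B cs(2) by (metis in_set_conv_nth)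
  have "p' < q'" "q' < r'"
    using sw_order_index[OF cs(1), of p' q'] sw_order_index[OF cs(1), of q' r'] c sxy syz ne by auto
  then have "dual_knuth_step (map g cs) ((map g cs)[p' := map g cs ! r', r' := map g cs ! p'])"
    using c gv by (intro dual_knuth_step.intros[of p' q' r' _ a]) auto
  then have "dual_knuth_step (map g cs) (map g' cs)" using upd[OF d(2) c(1,3,4,6)] c by simp
  ultimately show ?thesis using sf by blast
qed

lemma std_filling_chain:
  assumes sh: "skew_shape T" and g: "std_filling (boxes T) g"
    and bs: "sw_order bs" "set bs = boxes T" and cs: "sw_order cs" "set cs = boxes T"
    and d: "dual_knuth (map g bs) (map h bs)"
  shows "dual_knuth (map g cs) (map h cs)"
proof -
  have "\<exists>g'. std_filling (boxes T) g' \<and> \<sigma> = map g' bs \<and> dual_knuth (map g cs) (map g' cs)"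
    if "dual_knuth (map g bs) \<sigma>" for \<sigma>
    using that
  proof (induction rule: equivclp_induct)
    case (step y z)
    then obtain g1 where g1: "std_filling (boxes T) g1" "y = map g1 bs" "dual_knuth (map g cs) (map g1 cs)"
      by blast
    have "dual_knuth_step (map g1 bs) z" using step(2) dual_knuth_step_sym g1(2) by blast
    from std_filling_step[OF sh g1(1) bs cs this] g1(3) show ?case
      by (blast intro: equivclp_into_equivclp)
  qed (use g in auto)
  from this[OF d] obtain g' where g': "map h bs = map g' bs" "dual_knuth (map g cs) (map g' cs)" by blast
  then have "map g' cs = map h cs" using bs(2) cs(2) by auto
  with g'(2) show ?thesis by (simp only:)
qed

text \<open>Standardization without reference to a reading order: equal entries form a horizontal
  strip and are numbered by their columns.\<close>

definition std_of :: "skew_tab \<Rightarrow> nat \<times> nat \<Rightarrow> nat" where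
  "std_of T b = card {a \<in> boxes T. (case a of (i, j) \<Rightarrow> fill T i j) < (case b of (i, j) \<Rightarrow> fill T i j) \<or>
     (case a of (i, j) \<Rightarrow> fill T i j) = (case b of (i, j) \<Rightarrow> fill T i j) \<and> snd a \<le> snd b}"

text \<open>Equal entries of a semistandard tableau are pairwise comparable by \<open>sw\<close>, so
  every such list runs through them from left to right and numbers them alike.\<close>

lemma standardize_reading:
  assumes T: "semistandard T" and bs: "sw_order bs" "set bs = boxes T"
  shows "standardize (map (\<lambda>(i, j). fill T i j) bs) = map (std_of T) bs"
proof (rule nth_equalityI)
  let ?f = "\<lambda>(i, j). fill T i j"
  fix p assume "p < length (standardize (map ?f bs))"
  then have p: "p < length bs" by simp
  have eq: "(snd a \<le> snd b) = sw a b" if "a \<in> boxes T" "b \<in> boxes T" "?f a = ?f b" for a b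
  proof -
    obtain i j i' j' where e: "a = (i, j)" "b = (i', j')" by (cases a; cases b)
    then have "j \<le> j' \<Longrightarrow> i' \<le> i"
      using fill_less[OF T, of i j i' j'] that by (force simp: boxes_def)
    then show ?thesis by (auto simp: sw_def e)
  qed
  have "inj_on ((!) bs) {q. q < length bs}"
    using sw_order_distinct[OF bs(1)] by (auto simp: inj_on_def nth_eq_iff_index_eq)
  moreover have "{a \<in> boxes T. ?f a < ?f (bs ! p) \<or> ?f a = ?f (bs ! p) \<and> snd a \<le> snd (bs ! p)} =
    (!) bs ` {q. q < length bs \<and> (map ?f bs ! q < map ?f bs ! p \<or> map ?f bs ! q = map ?f bs ! p \<and> q \<le> p)}"
    (is "?L = (!) bs ` ?R")
  proof -
    have "bs ! q \<in> ?L \<longleftrightarrow> q \<in> ?R" if q: "q < length bs" for q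
    proof -
      have m: "bs ! q \<in> boxes T" "bs ! p \<in> boxes T" using p q bs(2) nth_mem by blast+
      have "snd (bs ! q) \<le> snd (bs ! p) \<longleftrightarrow> q \<le> p" if f: "?f (bs ! q) = ?f (bs ! p)"
      proof
        assume "snd (bs ! q) \<le> snd (bs ! p)"
        then show "q \<le> p" using eq[OF m f] sw_order_index[OF bs(1) q p] by (cases "q = p") auto
      next
        assume "q \<le> p"
        then show "snd (bs ! q) \<le> snd (bs ! p)"
          using eq[OF m(2,1)] f sw_order_index[OF bs(1) p q] by (cases "q = p") (auto simp: not_le)
      qed
      then show ?thesis using q p m by auto
    qed
    then have iff: "q < length bs \<Longrightarrow> bs ! q \<in> ?L \<longleftrightarrow> q \<in> ?R" for q .
    show ?thesis
    proof (intro set_eqI iffI)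
      fix a assume a: "a \<in> ?L"
      then obtain q where "q < length bs" "a = bs ! q" using bs(2) by (metis (no_types, lifting) CollectD in_set_conv_nth)
      then show "a \<in> (!) bs ` ?R" using iff a by blast
    next
      fix a assume "a \<in> (!) bs ` ?R"
      then obtain q where "q \<in> ?R" "a = bs ! q" by blast
      then show "a \<in> ?L" using iff by blast
    qed
  qed
  ultimately have "std_of T (bs ! p) = card {q. q < length bs \<and> (map ?f bs ! q < map ?f bs ! p \<or> map ?f bs ! q = map ?f bs ! p \<and> q \<le> p)}"
    unfolding std_of_def by (simp add: card_image inj_on_subset[of _ "{q. q < length bs}"] subset_iff)
  then show "standardize (map ?f bs) ! p = map (std_of T) bs ! p" using p by (simp add: standardize_def)
qed simp

lemma std_filling_std_of:
  assumes T: "semistandard T" shows "std_filling (boxes T) (std_of T)"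
proof -
  have sh: "skew_shape T" using T by (simp add: semistandard_iff)
  have s: "sw_order (rev (row_boxes T))" "set (rev (row_boxes T)) = boxes T"
    using sw_order_rows set_row_boxes[OF sh] by auto
  have "distinct (map (std_of T) (rev (row_boxes T)))"
    using is_perm_standardize standardize_reading[OF T s] unfolding is_perm_def by metis
  then have inj: "inj_on (std_of T) (boxes T)" using s(2) by (simp add: distinct_map set_row_boxes[OF sh])
  have "std_of T a < std_of T b" if ab: "a \<in> boxes T" "b \<in> boxes T" "a \<noteq> b" "fst a \<le> fst b" "snd a \<le> snd b" for a b
  proof -
    obtain i j i' j' where e: "a = (i, j)" "b = (i', j')" by (cases a; cases b)
    have m: "fill T i j + (i' - i) \<le> fill T i' j'"
      using fill_mono[OF T, of i j i' j'] ab by (auto simp: e boxes_def)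
    have "std_of T a \<le> std_of T b"
      unfolding std_of_def using m ab finite_boxes[OF sh] by (intro card_mono) (auto simp: e)
    moreover have "std_of T a \<noteq> std_of T b" using inj ab by (auto simp: inj_on_def)
    ultimately show ?thesis by simp
  qed
  then show ?thesis using inj by (simp add: std_filling_def)
qed

text \<open>\<open>ot\<close> prescribes the column word, \<open>dual_knuth_equiv\<close> looks at
  the row word; both are readings of one standard filling.\<close>

lemma dual_knuth_col_row:
  assumes S: "semistandard S" and T: "semistandard T" and ss: "same_shape S T"
    and d: "dual_knuth (standardize (rev (col_word S))) (standardize (rev (col_word T)))"
  shows "dual_knuth_equiv S T"
proof -
  have sh: "skew_shape S" using S by (simp add: semistandard_iff)
  let ?c = "rev (col_boxes S)" and ?r = "rev (row_boxes S)"
  have c: "sw_order ?c" "set ?c = boxes S" and r: "sw_order ?r" "set ?r = boxes S"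
    using sw_order_rows sw_order_cols set_row_boxes[OF sh] set_col_boxes[OF sh] by auto
  note e = same_shape_cong[OF ss]
  have c': "set ?c = boxes T" and r': "set ?r = boxes T" using c r e by auto
  have "dual_knuth (map (std_of S) ?c) (map (std_of T) ?c)"
    using d standardize_reading[OF S c] standardize_reading[OF T c(1) c']
    by (simp add: col_word_def e rev_map)
  then have "dual_knuth (map (std_of S) ?r) (map (std_of T) ?r)"
    by (rule std_filling_chain[OF sh std_filling_std_of[OF S] c r])
  then show ?thesis
    using ss standardize_reading[OF S r] standardize_reading[OF T r(1) r']
    by (simp add: dual_knuth_equiv_def row_word_def e rev_map)
qed

section \<open>Occurrence numbers\<close>

definition occs :: "nat list \<Rightarrow> nat list" where
  "occs w = map (\<lambda>p. count_list (take (Suc p) w) (w ! p)) [0..<length w]"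

lemma ot_word_yamanouchi: "yamanouchi w \<Longrightarrow> ot_word k w = occs w"
  by (simp add: ot_word_def occs_def)

lemma length_occs [simp]: "length (occs w) = length w"
  by (simp add: occs_def)

lemma nth_occs: "p < length w \<Longrightarrow> occs w ! p = count_list (take (Suc p) w) (w ! p)"
  by (simp add: occs_def)

lemma occs_snoc: "occs (w @ [x]) = occs w @ [Suc (count_list w x)]"
  by (auto simp: occs_def nth_append)

lemma occs_Nil [simp]: "occs [] = []"
  by (simp add: occs_def)

lemma take_occs: "take p (occs w) = occs (take p w)"
proof (rule nth_equalityI)
  fix i assume "i < length (take p (occs w))"
  then have "i < p" "i < length w" by auto
  then show "take p (occs w) ! i = occs (take p w) ! i" by (simp add: nth_occs min_absorb1)
qed simp

text \<open>In terms of partitions: the weight of \<open>occs w\<close> is conjugate to the weight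
  of w.\<close>

lemma count_occs: "1 \<le> r \<Longrightarrow> count_list (occs w) r = card {y \<in> set w. r \<le> count_list w y}"
proof (induction w rule: rev_induct)
  case (snoc x w)
  have "{y \<in> set (w @ [x]). r \<le> count_list (w @ [x]) y} =
    {y \<in> set w. r \<le> count_list w y} \<union> (if r = Suc (count_list w x) then {x} else {})"
  proof (intro set_eqI)
    fix y
    have "x \<in> set w" if "1 \<le> count_list w x" using that count_list_0_iff[of w x] by auto
    then show "y \<in> {y \<in> set (w @ [x]). r \<le> count_list (w @ [x]) y} \<longleftrightarrow>
      y \<in> {y \<in> set w. r \<le> count_list w y} \<union> (if r = Suc (count_list w x) then {x} else {})"
      using snoc.prems by (cases "y = x") (auto simp: le_Suc_eq)
  qed
  then show ?case using snoc by (simp add: occs_snoc)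
qed simp

text \<open>A letter about to occur for the (c + 1)-st time, c positive, is among the letters
  counted for c, but not yet among those counted for c + 1.\<close>

lemma yamanouchi_occs: "yamanouchi (occs w)"
proof (induction w rule: rev_induct)
  case Nil
  then show ?case by (simp add: yamanouchi_def)
next
  case (snoc x w)
  have "count_list (occs w) (Suc (count_list w x)) < count_list (occs w) (count_list w x)"
    if "1 \<le> count_list w x"
  proof -
    have "x \<in> set w" using that count_list_0_iff[of w x] by auto
    then have "{y \<in> set w. Suc (count_list w x) \<le> count_list w y} \<subset> {y \<in> set w. count_list w x \<le> count_list w y}"
      by force
    then show ?thesis using that by (simp add: count_occs psubset_card_mono)
  qed
  then show ?case using snoc by (simp add: occs_snoc yamanouchi_snoc)
qed

lemma yamanouchi_take: "yamanouchi w \<Longrightarrow> yamanouchi (take p w)"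
  unfolding yamanouchi_def by (auto simp: take_take min_def)

lemma yamanouchi_count_le:
  assumes "yamanouchi w" "1 \<le> x" "x \<le> y"
  shows "count_list w y \<le> count_list w x"
  using assms(3)
proof (induction y rule: dec_induct)
  case (step y)
  then show ?case using yamanouchi_count[OF assms(1), of y] assms(2) by simp
qed simp

text \<open>Consider a prefix ending with the c-th occurrence of x. The number c occurs in its
  \<open>occs\<close> once for each letter that occurs at least c times. By the Yamanouchi condition
  these are 1, ..., x: a larger letter occurs at most as often as x did before its last
  occurrence.\<close>

lemma occs_occs:
  assumes "yamanouchi w" "0 \<notin> set w"
  shows "occs (occs w) = w"
proof (rule nth_equalityI)
  fix p assume "p < length (occs (occs w))"
  then have p: "p < length w" by simp
  let ?v = "take (Suc p) w" and ?x = "w ! p"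
  have y: "yamanouchi ?v" by (rule yamanouchi_take[OF assms(1)])
  have x: "1 \<le> ?x" using assms(2) nth_mem[OF p] by (metis One_nat_def Suc_leI gr0I)
  have c: "1 \<le> count_list ?v ?x" using p by (simp add: take_Suc_conv_app_nth)
  have "occs (occs w) ! p = count_list (occs ?v) (count_list ?v ?x)"
    using p by (simp add: nth_occs take_occs)
  also have "\<dots> = card {y \<in> set ?v. count_list ?v ?x \<le> count_list ?v y}" by (rule count_occs[OF c])
  also have "{y \<in> set ?v. count_list ?v ?x \<le> count_list ?v y} = {1..?x}"
  proof (intro equalityI subsetI)
    fix y assume a: "y \<in> {y \<in> set ?v. count_list ?v ?x \<le> count_list ?v y}"
    have "1 \<le> y" using a assms(2) set_take_subset[of "Suc p" w] by (metis (mono_tags) One_nat_def Suc_leI gr0I mem_Collect_eq subsetD)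
    moreover have "y \<le> ?x"
    proof (rule ccontr)
      assume "\<not> y \<le> ?x"
      then have "count_list ?v y = count_list (take p w) y" using p by (simp add: take_Suc_conv_app_nth)
      also have "\<dots> \<le> count_list (take p w) ?x"
        using \<open>\<not> y \<le> ?x\<close> x by (intro yamanouchi_count_le yamanouchi_take assms(1)) auto
      also have "\<dots> < count_list ?v ?x" using p by (simp add: take_Suc_conv_app_nth)
      finally show False using a by simp
    qed
    ultimately show "y \<in> {1..?x}" by simp
  next
    fix y assume a: "y \<in> {1..?x}"
    then have "count_list ?v ?x \<le> count_list ?v y" by (intro yamanouchi_count_le[OF y]) auto
    moreover from this have "y \<in> set ?v" using c count_list_0_iff[of ?v y] by auto
    ultimately show "y \<in> {y \<in> set ?v. count_list ?v ?x \<le> count_list ?v y}" by simp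
  qed
  finally show "occs (occs w) ! p = w ! p" by simp
qed simp

lemma occs_le: "x \<in> set (occs w) \<Longrightarrow> \<exists>y\<in>set w. 1 \<le> x \<and> x \<le> count_list w y"
proof -
  assume "x \<in> set (occs w)"
  then obtain p where p: "p < length w" "x = count_list (take (Suc p) w) (w ! p)"
    by (auto simp: occs_def)
  have "count_list w (w ! p) = x + count_list (drop (Suc p) w) (w ! p)"
    unfolding p(2) by (metis append_take_drop_id count_list_append)
  then show ?thesis using p by (intro bexI[of _ "w ! p"]) (auto simp: take_Suc_conv_app_nth)
qed

text \<open>The rule for opposite Yamanouchi words is the conjugate by \<open>\<bullet>\<close> of the rule for Yamanouchi words.\<close>

lemma ot_word_opposite:
  assumes w: "set w \<subseteq> {1..k}" "opp_yamanouchi k w"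
  shows "ot_word k w = bullet_word (count_list w k) (occs (bullet_word k w))"
proof (rule nth_equalityI)
  fix p assume "p < length (ot_word k w)"
  then have p: "p < length w" by (simp add: ot_word_def)
  let ?x = "w ! p" and ?n = "length w" and ?v = "bullet_word k w"
  have x: "1 \<le> ?x" "?x \<le> k" using letter_bounds[OF w(1) p] by auto
  have le: "count_list w ?x \<le> count_list w k"
  proof -
    have "yamanouchi ?v" using w(2) by (simp add: opp_yamanouchi_def)
    then have "count_list ?v (Suc k - ?x) \<le> count_list ?v 1" using x by (intro yamanouchi_count_le) auto
    then show ?thesis using count_bullet_word[OF w(1), of "Suc k - ?x"] count_bullet_word[OF w(1), of 1] x by simp
  qed
  \<comment> \<open>If w is Yamanouchi as well, \<open>ot_word\<close> uses the offset 0; the two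
    rules agree because this multiplicity then equals that of k.\<close>
  have eq: "yamanouchi w \<Longrightarrow> count_list w ?x = count_list w k"
    using le yamanouchi_count_le[of w ?x k] x by simp
  have sp: "count_list w ?x = count_list (take (Suc p) w) ?x + count_list (drop (Suc p) w) ?x"
    by (metis append_take_drop_id count_list_append)
  have "bullet_word (count_list w k) (occs ?v) ! p = Suc (count_list w k) - occs ?v ! (?n - Suc p)"
    using p by (simp add: bullet_word_def rev_nth)
  also have "occs ?v ! (?n - Suc p) = count_list (take (?n - p) ?v) (?v ! (?n - Suc p))"
    using p by (simp add: nth_occs Suc_diff_Suc)
  also have "take (?n - p) ?v = bullet_word k (drop p w)"
    using p by (simp add: bullet_word_def take_rev drop_map)
  also have "?v ! (?n - Suc p) = Suc k - ?x" using p by (simp add: bullet_word_def rev_nth)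
  also have "count_list (bullet_word k (drop p w)) (Suc k - ?x) = count_list (drop p w) ?x"
  proof -
    have "set (drop p w) \<subseteq> {1..k}" using set_drop_subset w(1) by (rule order_trans)
    from count_bullet_word[OF this, of "Suc k - ?x"] show ?thesis using x by simp
  qed
  also have "count_list (drop p w) ?x = Suc (count_list (drop (Suc p) w) ?x)"
    using p by (simp flip: Cons_nth_drop_Suc)
  finally show "ot_word k w ! p = bullet_word (count_list w k) (occs ?v) ! p"
    using p sp le eq by (cases "yamanouchi w") (simp_all add: ot_word_def del: upt_Suc)
qed (simp add: ot_word_def)

text \<open>The positions of the letters of a Yamanouchi word, arranged in rows by letters and in columns
  by occurrence numbers, form a standard array. Its row word is Knuth equivalent to its column word.\<close>

lemma knuth_pass:
  "sorted_wrt (<) (a # Z) \<Longrightarrow> sorted_wrt (>) (a # C) \<Longrightarrow> knuth (a # Z @ C) (a # C @ Z)"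
proof (induction C arbitrary: a)
  case (Cons c C)
  have "knuth ((a # Z @ [c]) @ C) ((a # c # Z) @ C)"
    using Cons.prems by (intro knuth_append_right knuth_move) auto
  also have "(a # c # Z) @ C = [a] @ c # Z @ C" by simp
  also have "knuth \<dots> ([a] @ c # C @ Z)"
    using Cons.prems by (intro knuth_append_left Cons.IH) (auto intro: less_trans)
  finally show ?case by simp
qed simp

text \<open>S is the bottom row of an array whose other rows are already read by columns. Each
  column moves to the entry it stands on.\<close>

lemma knuth_row_columns:
  assumes "sorted_wrt (<) S" "\<forall>s\<in>set S. sorted_wrt (>) (s # C s)"
  shows "knuth (S @ concat (map C S)) (concat (map (\<lambda>s. s # C s) S))"
  using assms
proof (induction S)
  case (Cons s S)
  have "knuth ((s # S @ C s) @ concat (map C S)) ((s # C s @ S) @ concat (map C S))"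
    using Cons.prems by (intro knuth_append_right knuth_pass) auto
  also have "(s # C s @ S) @ concat (map C S) = (s # C s) @ S @ concat (map C S)" by simp
  also have "knuth \<dots> ((s # C s) @ concat (map (\<lambda>s. s # C s) S))"
    using Cons by (intro knuth_append_left) auto
  finally show ?case by simp
qed simp

lemma map_count_occ:
  "map (\<lambda>p. count_list (drop (p - n) v) x) (occ x n v) = rev [1..<Suc (count_list v x)]"
proof (induction v arbitrary: n)
  case (Cons y v)
  have "map (\<lambda>p. count_list (drop (p - n) (y # v)) x) (occ x (Suc n) v) =
    map (\<lambda>p. count_list (drop (p - Suc n) v) x) (occ x (Suc n) v)"
    by (intro map_cong refl) (auto simp: set_occ Suc_diff_Suc drop_Cons' simp flip: diff_Suc_eq_diff_pred)
  then show ?case using Cons[of "Suc n"] by auto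
qed simp

lemma filter_split_dec:
  "sorted_wrt (\<lambda>p q. f q < (f p :: nat)) L \<Longrightarrow>
    filter (\<lambda>p. a \<le> f p) L = filter (\<lambda>p. Suc a \<le> f p) L @ filter (\<lambda>p. f p = a) L"
proof (induction L)
  case (Cons p L)
  show ?case
  proof (cases "Suc a \<le> f p")
    case False
    then have "filter (\<lambda>p. Suc a \<le> f p) L = []" using Cons.prems by (auto simp: filter_empty_conv)
    then show ?thesis using Cons False by auto
  qed (use Cons in auto)
qed simp

text \<open>Induction over the letters from k downwards: the part of the array with letters at least
  x has equivalent row and column readings. The positions of x carry the occurrence numbers in
  decreasing order, which is the order in which the columns are read, so a new row meets its columns
  in the right order.\<close>

lemma knuth_array:
  assumes u: "slat u" "set u \<subseteq> {1..k}" and y: "y = rev (occs (rev u))"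
    and N: "\<And>x. x \<in> set u \<Longrightarrow> count_list u x \<le> N"
  shows "knuth (listing k u) (rev (listing N y))"
proof -
  let ?n = "length u"
  define g where "g p = count_list (drop p u) (u ! p)" for p
  have ly: "length y = ?n" by (simp add: y)
  have yg: "y ! p = g p" if "p < ?n" for p
  proof -
    have "y ! p = occs (rev u) ! (?n - Suc p)" using that by (simp add: y rev_nth)
    also have "\<dots> = count_list (take (?n - p) (rev u)) (rev u ! (?n - Suc p))"
      using that by (simp add: nth_occs Suc_diff_Suc)
    also have "\<dots> = g p" using that by (simp add: g_def take_rev rev_nth)
    finally show ?thesis .
  qed
  have yam: "yamanouchi (rev (drop p u))" for p
    using u(1) yamanouchi_take[of "rev u" "?n - p"]
    by (cases "p \<le> ?n") (simp_all add: yamanouchi_rev take_rev yamanouchi_slat)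
  have lat: "count_list (drop p u) y \<le> count_list (drop p u) x" if "1 \<le> x" "x \<le> y" for p x y
    using yamanouchi_count_le[OF yam that, of p] by simp
  have drop_less: "count_list (drop q u) x + (if u ! p = x then 1 else 0) \<le> count_list (drop p u) x"
    if "p < q" "q \<le> ?n" for p q x
  proof -
    have "drop (Suc p) u = take (q - Suc p) (drop (Suc p) u) @ drop q u"
      using that append_take_drop_id[of "q - Suc p" "drop (Suc p) u"] by simp
    then have "count_list (drop q u) x \<le> count_list (drop (Suc p) u) x"
      by (metis count_list_append le_add2)
    moreover have "drop p u = u ! p # drop (Suc p) u" using that by (simp add: Cons_nth_drop_Suc)
    ultimately show ?thesis by simp
  qed
  have dec: "u ! q < u ! p" if "p < q" "q < ?n" "g p = g q" for p q
  proof (rule ccontr)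
    assume "\<not> u ! q < u ! p"
    then have "g q \<le> count_list (drop q u) (u ! p)"
      unfolding g_def using letter_bounds[OF u(2), of p] that by (intro lat) auto
    also have "\<dots> < g p" using drop_less[of p q "u ! p"] that by (simp add: g_def)
    finally show False using that by simp
  qed
  define L where "L r = occ r 0 y" for r
  have setL: "set (L r) = {p. p < ?n \<and> g p = r}" for r using yg by (auto simp: L_def set_occ ly)
  have sL: "sorted_wrt (<) (L r)" for r unfolding L_def by (rule sorted_occ)
  have sLd: "sorted_wrt (\<lambda>p q. u ! q < u ! p) (L r)" for r
    using sL[of r] by (rule sorted_wrt_mono_rel[rotated]) (auto simp: setL intro: dec)
  \<comment> \<open>Column r cut off below the letter x and read by decreasing positions, that is,
    by increasing letters.\<close>
  define D where "D x r = rev (filter (\<lambda>p. x \<le> u ! p) (L r))" for x r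
  have main: "knuth (concat (map (\<lambda>x. occ x 0 u) [x..<Suc k])) (concat (map (D x) (rev [1..<Suc N])))"
    if "x \<le> Suc k" "1 \<le> x" for x
    using that
  proof (induction x rule: inc_induct)
    case base
    have "D (Suc k) r = []" for r
    proof -
      have "\<forall>p\<in>set (L r). \<not> Suc k \<le> u ! p" using letter_bounds[OF u(2)] by (fastforce simp: setL)
      then show ?thesis by (simp add: D_def filter_empty_conv)
    qed
    then have "concat (map (D (Suc k)) xs) = []" for xs by (induction xs) auto
    then show ?case by (simp del: upt_Suc concat_eq_Nil_conv)
  next
    case (step x)
    let ?A = "occ x 0 u" and ?c = "count_list u x"
    have setA: "set ?A = {p. p < ?n \<and> u ! p = x}" by (auto simp: set_occ)
    have gA: "map g ?A = rev [1..<Suc ?c]"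
    proof -
      have "map g ?A = map (\<lambda>p. count_list (drop (p - 0) u) x) ?A" by (auto simp: setA g_def)
      then show ?thesis by (simp only: map_count_occ)
    qed
    have cN: "?c \<le> N" using N[of x] count_list_0_iff[of u x] by (cases "x \<in> set u") auto
    have rs: "rev [1..<Suc N] = rev [Suc ?c..<Suc N] @ map g ?A"
      using upt_add_eq_append[of 1 "Suc ?c" "N - ?c"] cN by (simp add: gA flip: rev_append del: upt_Suc)
    \<comment> \<open>Multiplicities decrease, so a column numbered beyond the multiplicity of x has
      no letter from x on.\<close>
    have empty: "D z r = []" if "?c < r" "x \<le> z" for z r
    proof -
      have "\<not> z \<le> u ! q" if "q \<in> set (L r)" for q
      proof
        assume "z \<le> u ! q"
        then have "g q \<le> count_list (drop q u) x"
          unfolding g_def using \<open>x \<le> z\<close> step.prems by (intro lat) auto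
        also have "\<dots> \<le> ?c" using count_list_append[of "take q u" "drop q u" x] by simp
        finally show False using \<open>?c < r\<close> that by (auto simp: setL)
      qed
      then show ?thesis by (simp add: D_def filter_empty_conv)
    qed
    have e1: "concat (map (D z) (rev [1..<Suc N])) = concat (map (\<lambda>p. D z (g p)) ?A)" if "x \<le> z" for z
    proof -
      have "concat (map (D z) (rev [Suc ?c..<Suc N])) = []" using empty[OF _ that] by (auto simp del: upt_Suc)
      then show ?thesis unfolding rs by (simp add: o_def del: upt_Suc)
    qed
    have D: "D x (g p) = p # D (Suc x) (g p)" if "p \<in> set ?A" for p
    proof -
      have "filter (\<lambda>q. u ! q = x) (L (g p)) = [p]"
      proof -
        let ?F = "filter (\<lambda>q. u ! q = x) (L (g p))"
        have "set ?F = {p}"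
        proof -
          have p: "p < ?n" "u ! p = x" using that by (auto simp: setA)
          have "q = p" if q: "q < ?n" "g q = g p" "u ! q = x" for q
          proof (rule ccontr)
            assume "q \<noteq> p"
            then consider "p < q" | "q < p" by linarith
            then show False
            proof cases
              case 1
              from dec[OF this q(1) q(2)[symmetric]] show False using q(3) p(2) by simp
            next
              case 2
              from dec[OF this p(1) q(2)] show False using q(3) p(2) by simp
            qed
          qed
          moreover have "set ?F = {q. q < ?n \<and> g q = g p \<and> u ! q = x}" by (simp add: setL conj_assoc)
          ultimately show ?thesis using p by (intro equalityI subsetI) simp_all
        qed
        moreover have "distinct ?F" using sorted_wrt_distinct[OF _ sL[of "g p"]] by simp
        moreover have "xs = [p]" if "set xs = {p}" "distinct xs" for xs :: "nat list"
        proof -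
          have "length xs = 1" using distinct_card[OF that(2)] that(1) by simp
          then show ?thesis using that(1) by (cases xs) auto
        qed
        ultimately show ?thesis by blast
      qed
      then show ?thesis using filter_split_dec[OF sLd, of x] by (simp add: D_def)
    qed
    have "concat (map (\<lambda>x. occ x 0 u) [x..<Suc k]) = ?A @ concat (map (\<lambda>x. occ x 0 u) [Suc x..<Suc k])"
      using step.hyps by (simp add: upt_conv_Cons del: upt_Suc)
    also have "knuth \<dots> (?A @ concat (map (\<lambda>p. D (Suc x) (g p)) ?A))"
      using step.IH e1[of "Suc x"] by (intro knuth_append_left) simp
    also have "knuth \<dots> (concat (map (\<lambda>p. p # D (Suc x) (g p)) ?A))"
    proof (rule knuth_row_columns)
      show "\<forall>p\<in>set ?A. sorted_wrt (>) (p # D (Suc x) (g p))"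
      proof
        fix p assume "p \<in> set ?A"
        then have "p # D (Suc x) (g p) = D x (g p)" using D by simp
        moreover have "sorted_wrt (>) (D x (g p))"
          unfolding D_def sorted_wrt_rev using sL by (intro sorted_wrt_filter) auto
        ultimately show "sorted_wrt (>) (p # D (Suc x) (g p))" by simp
      qed
    qed (rule sorted_occ)
    also have "concat (map (\<lambda>p. p # D (Suc x) (g p)) ?A) = concat (map (\<lambda>p. D x (g p)) ?A)"
      using D by (intro arg_cong[where f = concat] map_cong) auto
    also have "\<dots> = concat (map (D x) (rev [1..<Suc N]))" using e1[of x] by simp
    finally show ?case .
  qed
  have "0 \<notin> set u" using u(2) by auto
  then have "length (occ 0 0 u) = 0" by (simp add: count_list_0_iff)
  then have "occ 0 0 u = []" by (simp only: length_0_conv)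
  then have 1: "listing k u = concat (map (\<lambda>x. occ x 0 u) [1..<Suc k])"
    by (simp add: listing_def upt_conv_Cons del: upt_Suc)
  have "L 0 = []"
  proof -
    have "g p \<noteq> 0" if "p < ?n" for p using drop_less[of p "?n" "u ! p"] that by (simp add: g_def)
    then have "set (L 0) = {}" by (simp add: setL)
    then show ?thesis by simp
  qed
  moreover have Lf: "L = (\<lambda>r. occ r 0 y)" by (auto simp: L_def)
  ultimately have "listing N y = concat (map L [1..<Suc N])"
    by (simp add: listing_def upt_conv_Cons del: upt_Suc)
  then have "rev (listing N y) = concat (map (\<lambda>r. rev (L r)) (rev [1..<Suc N]))"
    by (simp add: rev_concat rev_map o_def del: upt_Suc)
  moreover have "D 1 r = rev (L r)" for r
  proof -
    have "\<forall>p\<in>set (L r). 1 \<le> u ! p" using letter_bounds[OF u(2)] by (auto simp only: setL mem_Collect_eq)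
    then show ?thesis by (simp add: D_def)
  qed
  ultimately have 2: "rev (listing N y) = concat (map (D 1) (rev [1..<Suc N]))" by presburger
  show ?thesis unfolding 1 2 by (rule main) auto
qed

text \<open>The array is listed by rows for w and, backwards, by columns for \<open>occs w\<close>.
  The complement arises because listing positions backwards complements the inverse
  permutation.\<close>

lemma dual_knuth_occs:
  assumes w: "yamanouchi w" "set w \<subseteq> {1..k}" and n: "n = length w"
  shows "dual_knuth (standardize (rev w)) (map (\<lambda>x. Suc n - x) (standardize (rev (occs w))))"
proof -
  let ?N = "length w"
  have c: "count_list w x \<le> ?N" for x by (rule count_le_length)
  have "knuth (listing k (rev w)) (rev (listing ?N (rev (occs w))))"
    using w c by (intro knuth_array) (auto simp: yamanouchi_slat)
  moreover have "is_inv (listing k (rev w)) (standardize (rev w))"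
    using w(2) by (intro is_inv_listing) auto
  moreover have "is_inv (rev (listing ?N (rev (occs w)))) (map (\<lambda>x. Suc n - x) (standardize (rev (occs w))))"
  proof (rule is_inv_rev[OF is_inv_listing])
    show "set (rev (occs w)) \<subseteq> {..?N}"
    proof
      fix x assume "x \<in> set (rev (occs w))"
      then obtain y where "x \<le> count_list w y" using occs_le[of x w] by auto
      then show "x \<in> {..?N}" using c[of y] by simp
    qed
  qed (simp add: n)
  ultimately show ?thesis by (rule knuth_dual_knuth)
qed

section \<open>Row and column Yamanouchi conditions\<close>

definition entry :: "skew_tab \<Rightarrow> nat \<times> nat \<Rightarrow> nat" where
  "entry T = (\<lambda>(i, j). fill T i j)"

definition upto_box :: "(nat \<times> nat \<Rightarrow> nat \<times> nat \<Rightarrow> bool) \<Rightarrow> skew_tab \<Rightarrow> nat \<Rightarrow> nat \<times> nat \<Rightarrow> (nat \<times> nat) set" where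
  "upto_box R T x b = {a \<in> boxes T. entry T a = x \<and> (a = b \<or> R a b)}"

text \<open>Boxes weakly north-east of b are read no later than b in both readings, so this set is
  common to the two prefixes ending at b.\<close>

definition ne_of :: "skew_tab \<Rightarrow> nat \<Rightarrow> nat \<times> nat \<Rightarrow> (nat \<times> nat) set" where
  "ne_of T x b = {a \<in> boxes T. entry T a = x \<and> sw b a}"

lemma row_word_entry: "row_word T = map (entry T) (row_boxes T)"
  by (simp add: row_word_def entry_def)

lemma col_word_entry: "col_word T = map (entry T) (col_boxes T)"
  by (simp add: col_word_def entry_def)

lemma count_upto_box:
  assumes asym: "\<And>x y. R x y \<Longrightarrow> \<not> R y x" and s: "sorted_wrt R bs" and bs: "set bs = boxes T"
    and p: "p < length bs"
  shows "count_list (take (Suc p) (map (entry T) bs)) x = card (upto_box R T x (bs ! p))"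
proof -
  have d: "distinct bs" using sorted_wrt_distinct[OF _ s] asym by blast
  let ?l = "take (Suc p) bs"
  have "count_list (map (entry T) l) x = length (filter (\<lambda>q. entry T q = x) l)" for l
    by (induction l) auto
  then have "count_list (take (Suc p) (map (entry T) bs)) x = length (filter (\<lambda>q. entry T q = x) ?l)"
    by (simp add: take_map)
  also have "\<dots> = card (set (filter (\<lambda>q. entry T q = x) ?l))"
    using d by (metis distinct_card distinct_filter distinct_take)
  also have "set (filter (\<lambda>q. entry T q = x) ?l) = upto_box R T x (bs ! p)"
  proof -
    have "a \<in> set ?l \<longleftrightarrow> a \<in> boxes T \<and> (a = bs ! p \<or> R a (bs ! p))" for a
    proof
      assume "a \<in> set ?l"
      then obtain q where q: "q < Suc p" "q < length bs" "a = bs ! q" by (auto simp: in_set_conv_nth)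
      then have "q = p \<or> R (bs ! q) (bs ! p)" 
        using sorted_wrt_nth_less[OF s, of q p] p by (cases "q = p") auto
      then show "a \<in> boxes T \<and> (a = bs ! p \<or> R a (bs ! p))" using q bs nth_mem by blast
    next
      assume a: "a \<in> boxes T \<and> (a = bs ! p \<or> R a (bs ! p))"
      then obtain q where q: "q < length bs" "a = bs ! q" using bs by (metis in_set_conv_nth)
      have "\<not> p < q"
      proof
        assume "p < q"
        then have "R (bs ! p) a" using sorted_wrt_nth_less[OF s] q by simp
        moreover from this have "a \<noteq> bs ! p" using asym by blast
        ultimately show False using a asym by blast
      qed
      then show "a \<in> set ?l" using q by (auto simp: in_set_conv_nth intro!: exI[of _ q])
    qed
    then show ?thesis by (auto simp: upto_box_def)
  qed
  finally show ?thesis .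
qed

text \<open>The condition for a letter can only become violated at the moment when this letter is
  read.\<close>

lemma yamanouchi_iff:
  "yamanouchi w \<longleftrightarrow> (\<forall>p<length w. 2 \<le> w ! p \<longrightarrow>
    count_list (take (Suc p) w) (w ! p) \<le> count_list (take (Suc p) w) (w ! p - 1))"
proof (induction w rule: rev_induct)
  case Nil
  then show ?case by (simp add: yamanouchi_def)
next
  case (snoc x w)
  have "(\<forall>p<length (w @ [x]). P p) \<longleftrightarrow> (\<forall>p<length w. P p) \<and> P (length w)" for P
    by (auto simp: less_Suc_eq)
  moreover have "2 \<le> x \<Longrightarrow> x - 1 \<noteq> x" by simp
  ultimately show ?case using snoc by (auto simp: yamanouchi_snoc nth_append Suc_le_eq)
qed

lemma yamanouchi_reading:
  assumes "\<And>x y. R x y \<Longrightarrow> \<not> R y x" "sorted_wrt R bs" "set bs = boxes T"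
  shows "yamanouchi (map (entry T) bs) \<longleftrightarrow> (\<forall>b\<in>boxes T. 2 \<le> entry T b \<longrightarrow>
    card (upto_box R T (entry T b) b) \<le> card (upto_box R T (entry T b - 1) b))"
  unfolding yamanouchi_iff assms(3)[symmetric] all_set_conv_all_nth
  using count_upto_box[OF assms] by (simp del: take_Suc)

lemma entry_mono:
  assumes "semistandard T" "a \<in> boxes T" "b \<in> boxes T" "fst a \<le> fst b" "snd a \<le> snd b"
  shows "entry T a + (fst b - fst a) \<le> entry T b"
  using fill_mono[OF assms(1), of "fst a" "snd a" "fst b" "snd b"] assms
  by (auto simp: boxes_def entry_def split: prod.splits)

lemma boxes_convex:
  assumes "skew_shape T" "a \<in> boxes T" "b \<in> boxes T" "fst a \<le> x" "x \<le> fst b" "snd a \<le> y" "y \<le> snd b"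
  shows "(x, y) \<in> boxes T"
  using box_convex[OF assms(1), of "fst a" "snd a" "fst b" "snd b" x y] assms by (auto simp: boxes_def)

text \<open>A box read before b by columns without being north-east of b lies further south and to
  the right, where entries exceed that of b.\<close>

lemma upto_col_ne:
  assumes T: "semistandard T" and b: "b \<in> boxes T" and x: "x \<le> entry T b"
  shows "upto_box col_less T x b = ne_of T x b"
proof -
  have "a = b \<or> col_less a b \<longleftrightarrow> sw b a" if a: "a \<in> boxes T" "entry T a = x" for a
  proof -
    obtain i j i' j' where e: "a = (i, j)" "b = (i', j')" by (cases a; cases b)
    have "\<not> (i' < i \<and> j' \<le> j)" using entry_mono[OF T b a(1)] a(2) x by (auto simp: e)
    then show ?thesis by (auto simp: e sw_def)
  qed
  then show ?thesis by (auto simp: upto_box_def ne_of_def)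
qed

lemma upto_row_ne:
  assumes T: "semistandard T" and b: "b \<in> boxes T"
  shows "upto_box row_less T (entry T b) b = ne_of T (entry T b) b"
proof -
  have "a = b \<or> row_less a b \<longleftrightarrow> sw b a" if a: "a \<in> boxes T" "entry T a = entry T b" for a
  proof -
    obtain i j i' j' where e: "a = (i, j)" "b = (i', j')" by (cases a; cases b)
    have "\<not> (i < i' \<and> j \<le> j')" using entry_mono[OF T a(1) b] a(2) by (auto simp: e)
    then show ?thesis by (auto simp: e sw_def)
  qed
  then show ?thesis by (auto simp: upto_box_def ne_of_def)
qed

lemma ne_subset_upto_row: "ne_of T x b \<subseteq> upto_box row_less T x b"
  by (cases b) (auto simp: ne_of_def upto_box_def sw_def)

text \<open>The row prefix ending at b may contain letters x to the left of b. The comparison is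
  therefore made at c, the leftmost box of the row of b with entry x + 1. Passing from b to c gains
  j - j0 letters x + 1, and the letters x gained must sit just above these boxes, so there are at
  most as many of them.\<close>

lemma ne_row_bound:
  assumes T: "semistandard T" and b: "b \<in> boxes T" and x: "entry T b = Suc x"
    and row: "\<And>c. c \<in> boxes T \<Longrightarrow> entry T c = Suc x \<Longrightarrow>
      card (upto_box row_less T (Suc x) c) \<le> card (upto_box row_less T x c)"
  shows "card (ne_of T (Suc x) b) \<le> card (ne_of T x b)"
proof -
  have sh: "skew_shape T" using T by (simp add: semistandard_iff)
  obtain i j where e: "b = (i, j)" by (cases b)
  define j0 where "j0 = (LEAST y. (i, y) \<in> boxes T \<and> entry T (i, y) = Suc x)"
  have j0: "(i, j0) \<in> boxes T" "entry T (i, j0) = Suc x" "j0 \<le> j"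
    using LeastI[of "\<lambda>y. (i, y) \<in> boxes T \<and> entry T (i, y) = Suc x" j]
      Least_le[of "\<lambda>y. (i, y) \<in> boxes T \<and> entry T (i, y) = Suc x" j] b x by (auto simp: e j0_def)
  have j0_le: "j0 \<le> y" if "(i, y) \<in> boxes T" "entry T (i, y) = Suc x" for y
    unfolding j0_def using that by (intro Least_le) simp
  let ?c = "(i, j0)"
  have mid: "(i, y) \<in> boxes T \<and> entry T (i, y) = Suc x" if "j0 \<le> y" "y \<le> j" for y
  proof -
    have "(i, y) \<in> boxes T" using boxes_convex[OF sh j0(1) b, of i y] that by (simp add: e)
    then show ?thesis
      using entry_mono[OF T j0(1), of "(i, y)"] entry_mono[OF T _ b, of "(i, y)"] that j0(2) x
      by (simp add: e)
  qed
  have fin: "finite (ne_of T z c)" "finite (upto_box R T z c)" for z c R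
    using finite_boxes[OF sh] by (auto simp: ne_of_def upto_box_def)
  have "card (ne_of T (Suc x) b) + (j - j0) = card (ne_of T (Suc x) b \<union> Pair i ` {j0..<j})"
    using fin by (subst card_Un_disjoint) (auto simp: ne_of_def sw_def e card_image inj_on_def)
  also have "\<dots> \<le> card (ne_of T (Suc x) ?c)"
    using mid j0(3) by (intro card_mono fin) (auto simp: ne_of_def sw_def e)
  also have "\<dots> = card (upto_box row_less T (Suc x) ?c)"
    using upto_row_ne[OF T j0(1)] j0(2) by simp
  also have "\<dots> \<le> card (upto_box row_less T x ?c)" by (rule row[OF j0(1,2)])
  also have "\<dots> \<le> card (ne_of T x b \<union> Pair (i - 1) ` {j0..<j})"
  proof (intro card_mono subsetI)
    fix a assume "a \<in> upto_box row_less T x ?c"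
    then obtain r y where a: "a = (r, y)" "(r, y) \<in> boxes T" "entry T (r, y) = x"
      "(r, y) = ?c \<or> row_less (r, y) ?c" by (cases a) (auto simp: upto_box_def)
    have r: "r < i"
    proof (rule ccontr)
      assume "\<not> r < i"
      then have "r = i" "j0 \<le> y" using a(4) by auto
      then show False using entry_mono[OF T j0(1) a(2)] a(3) j0(2) by simp
    qed
    show "a \<in> ne_of T x b \<union> Pair (i - 1) ` {j0..<j}"
    proof (cases "j \<le> y")
      case True
      then show ?thesis using a r by (auto simp: ne_of_def sw_def e)
    next
      case False
      have q: "(i, y) \<in> boxes T" using boxes_convex[OF sh a(2) b, of i y] r False by (simp add: e)
      have "entry T (r, y) + (i - r) \<le> entry T (i, y)" "entry T (i, y) \<le> Suc x"
        using entry_mono[OF T a(2) q] entry_mono[OF T q b] r False x by (auto simp: e)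
      then have "r = i - 1" "entry T (i, y) = Suc x" using a(3) r by auto
      then show ?thesis using j0_le[OF q] False a(1) by auto
    qed
  qed (use fin in auto)
  also have "\<dots> \<le> card (ne_of T x b) + (j - j0)"
    by (rule order_trans[OF card_Un_le]) (simp add: card_image inj_on_def)
  finally show ?thesis by simp
qed

text \<open>From columns to rows the prefix can only gain letters one below the entry just read, by
  \<open>ne_subset_upto_row\<close>. The other direction is the content of
  \<open>ne_row_bound\<close>.\<close>

theorem yamanouchi_row_col:
  assumes T: "semistandard T"
  shows "yamanouchi (row_word T) \<longleftrightarrow> yamanouchi (col_word T)"
proof -
  have sh: "skew_shape T" using T by (simp add: semistandard_iff)
  have fin: "finite (upto_box R T z c)" for z c R
    using finite_boxes[OF sh] by (auto simp: upto_box_def)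
  have r: "yamanouchi (row_word T) \<longleftrightarrow> (\<forall>b\<in>boxes T. 2 \<le> entry T b \<longrightarrow>
    card (upto_box row_less T (entry T b) b) \<le> card (upto_box row_less T (entry T b - 1) b))"
    unfolding row_word_entry
    by (rule yamanouchi_reading[OF row_less_asym sorted_row_boxes set_row_boxes[OF sh]])
  have c: "yamanouchi (col_word T) \<longleftrightarrow> (\<forall>b\<in>boxes T. 2 \<le> entry T b \<longrightarrow>
    card (upto_box col_less T (entry T b) b) \<le> card (upto_box col_less T (entry T b - 1) b))"
    unfolding col_word_entry
    by (rule yamanouchi_reading[OF col_less_asym sorted_col_boxes set_col_boxes[OF sh]])
  show ?thesis
  proof
    assume y: "yamanouchi (row_word T)"
    show "yamanouchi (col_word T)"
      unfolding c
    proof (intro ballI impI)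
      fix b assume b: "b \<in> boxes T" "2 \<le> entry T b"
      then have x: "entry T b = Suc (entry T b - 1)" by simp
      have "card (ne_of T (Suc (entry T b - 1)) b) \<le> card (ne_of T (entry T b - 1) b)"
      proof (rule ne_row_bound[OF T b(1) x])
        fix q assume "q \<in> boxes T" "entry T q = Suc (entry T b - 1)"
        then show "card (upto_box row_less T (Suc (entry T b - 1)) q) \<le> card (upto_box row_less T (entry T b - 1) q)"
          using y b(2) unfolding r by force
      qed
      then show "card (upto_box col_less T (entry T b) b) \<le> card (upto_box col_less T (entry T b - 1) b)"
        using b(2) by (simp add: upto_col_ne[OF T b(1)])
    qed
  next
    assume y: "yamanouchi (col_word T)"
    show "yamanouchi (row_word T)"
      unfolding r
    proof (intro ballI impI)
      fix b assume b: "b \<in> boxes T" "2 \<le> entry T b"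
      have "card (upto_box row_less T (entry T b) b) = card (upto_box col_less T (entry T b) b)"
        by (simp add: upto_row_ne[OF T b(1)] upto_col_ne[OF T b(1)])
      also have "\<dots> \<le> card (upto_box col_less T (entry T b - 1) b)" using y b unfolding c by blast
      also have "\<dots> \<le> card (upto_box row_less T (entry T b - 1) b)"
        using ne_subset_upto_row by (intro card_mono fin) (auto simp: upto_col_ne[OF T b(1)])
      finally show "card (upto_box row_less T (entry T b) b) \<le> card (upto_box row_less T (entry T b - 1) b)" .
    qed
  qed
qed

section \<open>Transposition of partitions\<close>

lemma nat_eq_by_less:
  fixes a b d :: nat
  assumes "a \<le> d" "b \<le> d" "\<And>r. r < d \<Longrightarrow> r < a \<longleftrightarrow> r < b"
  shows "a = b"
  using assms by (metis linorder_neq_iff order_less_le_trans less_irrefl)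

lemma length_transpose_part [simp]: "length (transpose_part m p) = m"
  by (simp add: transpose_part_def)

lemma nth_transpose_part: "j < m \<Longrightarrow> transpose_part m p ! j = length (filter (\<lambda>x. j < x) p)"
  by (simp add: transpose_part_def)

lemma filter_less_iff:
  "sorted_wrt (\<ge>) p \<Longrightarrow> r < length p \<Longrightarrow> r < length (filter (\<lambda>x. (j::nat) < x) p) \<longleftrightarrow> j < p ! r"
proof (induction p arbitrary: r)
  case (Cons a p)
  show ?case
  proof (cases "j < a")
    case True
    then show ?thesis using Cons by (cases r) auto
  next
    case False
    then have "\<forall>x\<in>set (a # p). \<not> j < x" using Cons.prems by auto
    moreover have "(a # p) ! r \<in> set (a # p)" using Cons.prems(2) by (rule nth_mem)
    ultimately have "filter (\<lambda>x. j < x) (a # p) = []" "\<not> j < (a # p) ! r"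
      by (auto simp: filter_empty_conv)
    then show ?thesis by simp
  qed
qed simp

text \<open>Membership of boxes is what transposition reflects;
  \<open>transpose_part_transpose_part\<close> and \<open>transpose_dual_part\<close> are proved by
  comparing boxes.\<close>

lemma transpose_part_less:
  "part_in d m p \<Longrightarrow> j < m \<Longrightarrow> r < d \<Longrightarrow> r < transpose_part m p ! j \<longleftrightarrow> j < p ! r"
  by (auto simp: part_in_def nth_transpose_part filter_less_iff)

lemma transpose_part_le: "part_in d m p \<Longrightarrow> j < m \<Longrightarrow> transpose_part m p ! j \<le> d"
  by (auto simp: part_in_def nth_transpose_part)

lemma part_in_transpose:
  assumes p: "part_in d m p" shows "part_in m d (transpose_part m p)"
proof -
  have "sorted_wrt (\<ge>) (transpose_part m p)"
    unfolding sorted_wrt_iff_nth_less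
  proof (intro allI impI)
    fix i j assume ij: "i < j" "j < length (transpose_part m p)"
    have "length (filter (\<lambda>x. j < x) p) \<le> length (filter (\<lambda>x. i < x) p)"
      using ij(1) by (induction p) auto
    then show "transpose_part m p ! j \<le> transpose_part m p ! i" using ij by (simp add: nth_transpose_part)
  qed
  then show ?thesis using p by (auto simp: part_in_def transpose_part_def)
qed

lemma transpose_part_transpose_part:
  assumes p: "part_in d m p" shows "transpose_part d (transpose_part m p) = p"
proof (rule nth_equalityI)
  show l: "length (transpose_part d (transpose_part m p)) = length p" using p by (simp add: part_in_def)
  fix r assume "r < length (transpose_part d (transpose_part m p))"
  then have r: "r < d" by simp
  show "transpose_part d (transpose_part m p) ! r = p ! r"
  proof (rule nat_eq_by_less[of _ m])
    show "transpose_part d (transpose_part m p) ! r \<le> m"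
      using transpose_part_le[OF part_in_transpose[OF p] r] .
    show "p ! r \<le> m" by (rule part_in_le(2)[OF p r])
    fix j assume "j < m"
    then show "j < transpose_part d (transpose_part m p) ! r \<longleftrightarrow> j < p ! r"
      using transpose_part_less[OF part_in_transpose[OF p] r] transpose_part_less[OF p _ r] by simp
  qed
qed

lemma transpose_dual_part:
  assumes p: "part_in d m p"
  shows "transpose_part m (dual_part m p) = dual_part d (transpose_part m p)"
proof (rule nth_equalityI)
  fix j assume "j < length (transpose_part m (dual_part m p))"
  then have j: "j < m" by simp
  have lp: "length p = d" using p by (simp add: part_in_def)
  show "transpose_part m (dual_part m p) ! j = dual_part d (transpose_part m p) ! j"
  proof (rule nat_eq_by_less[of _ d])
    show "transpose_part m (dual_part m p) ! j \<le> d" by (rule transpose_part_le[OF part_in_dual[OF p] j])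
    show "dual_part d (transpose_part m p) ! j \<le> d" using j by (simp add: nth_dual_part)
    fix r assume r: "r < d"
    have "r < transpose_part m (dual_part m p) ! j \<longleftrightarrow> j < m - p ! (d - Suc r)"
      using transpose_part_less[OF part_in_dual[OF p] j r] r by (simp add: nth_dual_part lp)
    also have "\<dots> \<longleftrightarrow> \<not> m - Suc j < p ! (d - Suc r)" using j by auto
    also have "\<dots> \<longleftrightarrow> \<not> d - Suc r < transpose_part m p ! (m - Suc j)"
      using transpose_part_less[OF p, of "m - Suc j" "d - Suc r"] j r by simp
    also have "\<dots> \<longleftrightarrow> r < dual_part d (transpose_part m p) ! j"
      using r j by (auto simp: nth_dual_part)
    finally show "r < transpose_part m (dual_part m p) ! j \<longleftrightarrow> r < dual_part d (transpose_part m p) ! j" .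
  qed
qed simp

section \<open>The orthogonal transpose\<close>

definition ot_shape :: "skew_tab \<Rightarrow> skew_tab" where
  "ot_shape T = \<lparr>nrows = ncols T, ncols = nrows T,
      inner = dual_part (nrows T) (transpose_part (ncols T) (outer T)),
      outer = dual_part (nrows T) (transpose_part (ncols T) (inner T)),
      fill = (\<lambda>_ _. 0)\<rparr>"

lemma ot_def': "ot k T = fill_columns (ot_shape T) (ot_word k (row_word T))"
  by (simp add: ot_def ot_shape_def)

lemma ot_shape_sel [simp]:
  "nrows (ot_shape T) = ncols T" "ncols (ot_shape T) = nrows T"
  "inner (ot_shape T) = dual_part (nrows T) (transpose_part (ncols T) (outer T))"
  "outer (ot_shape T) = dual_part (nrows T) (transpose_part (ncols T) (inner T))"
  by (simp_all add: ot_shape_def)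

lemma skew_shape_ot:
  assumes "skew_shape T" shows "skew_shape (ot_shape T)"
proof -
  have p: "part_in (nrows T) (ncols T) (inner T)" "part_in (nrows T) (ncols T) (outer T)"
    "list_all2 (\<le>) (inner T) (outer T)" using assms by (auto simp: skew_shape_def)
  have le: "transpose_part (ncols T) (inner T) ! j \<le> transpose_part (ncols T) (outer T) ! j"
    if "j < ncols T" for j
  proof -
    have "length (filter (\<lambda>x. j < x) q) \<le> length (filter (\<lambda>x. j < x) q')" if "list_all2 (\<le>) q q'" for q q'
      using that by (induction rule: list_all2_induct) auto
    then show ?thesis using p(3) that by (simp add: nth_transpose_part)
  qed
  have "list_all2 (\<le>) (inner (ot_shape T)) (outer (ot_shape T))"
    unfolding list_all2_conv_all_nth using le by (auto simp: nth_dual_part intro!: diff_le_mono2)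
  then show ?thesis using p by (simp add: skew_shape_def part_in_dual part_in_transpose)
qed

lemma box_ot_shape:
  assumes "skew_shape T"
  shows "box (ot_shape T) i j \<longleftrightarrow> box T (Suc (nrows T) - j) (Suc (ncols T) - i)"
proof (cases "1 \<le> i \<and> i \<le> ncols T \<and> 1 \<le> j \<and> j \<le> nrows T")
  case True
  let ?d = "nrows T" and ?m = "ncols T"
  have p: "part_in ?d ?m (inner T)" "part_in ?d ?m (outer T)" using assms by (auto simp: skew_shape_def)
  have e: "?m - Suc (i - Suc 0) = ?m - i" "i - Suc 0 < ?m" using True by auto
  have b: "?m - i < ?m" "?d - j < ?d" using True by auto
  have "?d - transpose_part ?m (outer T) ! (?m - i) < j \<longleftrightarrow> ?d - j < transpose_part ?m (outer T) ! (?m - i)"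
    using True transpose_part_le[OF p(2) b(1)] by auto
  also have "\<dots> \<longleftrightarrow> ?m - i < outer T ! (?d - j)" by (rule transpose_part_less[OF p(2) b])
  finally have 1: "inner (ot_shape T) ! (i - 1) < j \<longleftrightarrow> ?m - i < outer T ! (?d - j)"
    using True by (simp add: nth_dual_part e)
  have "j \<le> ?d - transpose_part ?m (inner T) ! (?m - i) \<longleftrightarrow> \<not> ?d - j < transpose_part ?m (inner T) ! (?m - i)"
    using True transpose_part_le[OF p(1) b(1)] by auto
  also have "\<dots> \<longleftrightarrow> \<not> ?m - i < inner T ! (?d - j)" using transpose_part_less[OF p(1) b] by simp
  finally have 2: "j \<le> outer (ot_shape T) ! (i - 1) \<longleftrightarrow> \<not> ?m - i < inner T ! (?d - j)"
    using True by (simp add: nth_dual_part e)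
  have "Suc ?d - j - 1 = ?d - j" "Suc ?m - i = Suc (?m - i)" using True by auto
  then show ?thesis unfolding box_def 1 2 using True by auto
next
  case False
  have "\<not> box (ot_shape T) i j" using box_bounds[OF skew_shape_ot[OF assms], of i j] False by auto
  moreover have "\<not> box T (Suc (nrows T) - j) (Suc (ncols T) - i)"
    using box_bounds[OF assms, of "Suc (nrows T) - j" "Suc (ncols T) - i"] False by auto
  ultimately show ?thesis by simp
qed

text \<open>Reflection in the antidiagonal, the composite of transposition and rotation. It carries
  the row reading of T to the column reading of the image, and the column reading to the row
  reading.\<close>

definition tr :: "skew_tab \<Rightarrow> nat \<times> nat \<Rightarrow> nat \<times> nat" where
  "tr T = (\<lambda>(i, j). (Suc (ncols T) - j, Suc (nrows T) - i))"

lemma tr_image_boxes: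
  assumes "skew_shape T" shows "tr T ` boxes T = boxes (ot_shape T)"
proof (intro equalityI subsetI)
  fix b assume "b \<in> tr T ` boxes T"
  then obtain i j where b: "box T i j" "b = (Suc (ncols T) - j, Suc (nrows T) - i)"
    by (auto simp: boxes_def tr_def)
  then show "b \<in> boxes (ot_shape T)"
    using box_bounds[OF assms b(1)] by (simp add: boxes_def box_ot_shape[OF assms])
next
  fix b assume "b \<in> boxes (ot_shape T)"
  then obtain i j where b: "box (ot_shape T) i j" "b = (i, j)" by (auto simp: boxes_def)
  have "(Suc (nrows T) - j, Suc (ncols T) - i) \<in> boxes T"
    using b by (simp add: boxes_def box_ot_shape[OF assms])
  moreover have "b = tr T (Suc (nrows T) - j, Suc (ncols T) - i)"
    using box_bounds[OF skew_shape_ot[OF assms] b(1)] b(2) by (simp add: tr_def)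
  ultimately show "b \<in> tr T ` boxes T" by blast
qed

lemma col_boxes_ot:
  assumes sh: "skew_shape T" shows "col_boxes (ot_shape T) = map (tr T) (row_boxes T)"
proof (rule col_boxes_eqI)
  have "col_less (tr T x) (tr T y)"
    if "x \<in> set (row_boxes T)" "y \<in> set (row_boxes T)" "row_less x y" for x y
  proof -
    obtain a b c d where "x = (a, b)" "y = (c, d)" by (cases x; cases y)
    then show ?thesis
      using that boxes_bounds[OF sh, of x] boxes_bounds[OF sh, of y]
      by (auto simp: set_row_boxes[OF sh] tr_def)
  qed
  with sorted_row_boxes[of T] show "sorted_wrt col_less (map (tr T) (row_boxes T))"
    by (auto simp: sorted_wrt_map intro: sorted_wrt_mono_rel[rotated])
qed (use sh in \<open>simp_all add: skew_shape_ot tr_image_boxes set_row_boxes\<close>)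

lemma row_boxes_ot:
  assumes sh: "skew_shape T" shows "row_boxes (ot_shape T) = map (tr T) (col_boxes T)"
proof (rule row_boxes_eqI)
  have "row_less (tr T x) (tr T y)"
    if "x \<in> set (col_boxes T)" "y \<in> set (col_boxes T)" "col_less x y" for x y
  proof -
    obtain a b c d where "x = (a, b)" "y = (c, d)" by (cases x; cases y)
    then show ?thesis
      using that boxes_bounds[OF sh, of x] boxes_bounds[OF sh, of y]
      by (auto simp: set_col_boxes[OF sh] tr_def)
  qed
  with sorted_col_boxes[of T] show "sorted_wrt row_less (map (tr T) (col_boxes T))"
    by (auto simp: sorted_wrt_map intro: sorted_wrt_mono_rel[rotated])
qed (use sh in \<open>simp_all add: skew_shape_ot tr_image_boxes set_col_boxes\<close>)

lemma fill_columns: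
  assumes "skew_shape S" "length w = length (col_boxes S)"
  shows "same_shape (fill_columns S w) S" "col_word (fill_columns S w) = w"
    "\<not> box S i j \<Longrightarrow> fill (fill_columns S w) i j = 0"
proof -
  show ss: "same_shape (fill_columns S w) S" by (simp add: same_shape_def fill_columns_def)
  have "fill (fill_columns S w) (fst (col_boxes S ! p)) (snd (col_boxes S ! p)) = w ! p"
    if "p < length w" for p
    using map_of_zip_nth[OF assms(2)[symmetric] distinct_col_boxes that] assms(2) that
    by (simp add: fill_columns_def)
  then show "col_word (fill_columns S w) = w"
    using same_shape_cong(2)[OF ss] assms(2)
    by (intro nth_equalityI) (auto simp: col_word_def case_prod_unfold)
  assume "\<not> box S i j"
  then have "map_of (zip (col_boxes S) w) (i, j) = None"
    using set_col_boxes[OF assms(1)] assms(2) by (simp add: map_of_zip_is_None boxes_def)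
  then show "fill (fill_columns S w) i j = 0" by (simp add: fill_columns_def)
qed

lemma ot_basics:
  assumes sh: "skew_shape T"
  shows "same_shape (ot k T) (ot_shape T)" "col_word (ot k T) = ot_word k (row_word T)"
    "\<not> box (ot_shape T) i j \<Longrightarrow> fill (ot k T) i j = 0"
proof -
  have "length (ot_word k (row_word T)) = length (col_boxes (ot_shape T))"
    by (simp add: col_boxes_ot[OF sh] ot_word_def row_word_def)
  note F = fill_columns[OF skew_shape_ot[OF sh] this]
  show "same_shape (ot k T) (ot_shape T)" "col_word (ot k T) = ot_word k (row_word T)"
    "\<not> box (ot_shape T) i j \<Longrightarrow> fill (ot k T) i j = 0"
    using F by (simp_all add: ot_def')
qed

text \<open>The occurrence number of a box among the boxes with its letter. It is the same for both
  readings, as these meet equal entries in the same order.\<close>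

definition occ_no :: "skew_tab \<Rightarrow> nat \<times> nat \<Rightarrow> nat" where
  "occ_no T b = card (ne_of T (entry T b) b)"

lemma occs_row_word:
  assumes T: "semistandard T" shows "occs (row_word T) = map (occ_no T) (row_boxes T)"
proof (rule nth_equalityI)
  have sh: "skew_shape T" using T by (simp add: semistandard_iff)
  fix p assume "p < length (occs (row_word T))"
  then have p: "p < length (row_boxes T)" by (simp add: row_word_entry)
  then have "row_boxes T ! p \<in> boxes T" using set_row_boxes[OF sh] nth_mem by blast
  then show "occs (row_word T) ! p = map (occ_no T) (row_boxes T) ! p"
    using p count_upto_box[OF row_less_asym sorted_row_boxes set_row_boxes[OF sh] p]
    by (simp add: nth_occs row_word_entry occ_no_def upto_row_ne[OF T] del: take_Suc)
qed (simp add: row_word_entry)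

lemma occs_col_word:
  assumes T: "semistandard T" shows "occs (col_word T) = map (occ_no T) (col_boxes T)"
proof (rule nth_equalityI)
  have sh: "skew_shape T" using T by (simp add: semistandard_iff)
  fix p assume "p < length (occs (col_word T))"
  then have p: "p < length (col_boxes T)" by (simp add: col_word_entry)
  then have "col_boxes T ! p \<in> boxes T" using set_col_boxes[OF sh] nth_mem by blast
  then show "occs (col_word T) ! p = map (occ_no T) (col_boxes T) ! p"
    using p count_upto_box[OF col_less_asym sorted_col_boxes set_col_boxes[OF sh] p]
    by (simp add: nth_occs col_word_entry occ_no_def upto_col_ne[OF T] del: take_Suc)
qed (simp add: col_word_entry)

lemma entry_ot:
  assumes T: "semistandard T" "yamanouchi (row_word T)" and b: "b \<in> boxes T"
  shows "entry (ot k T) (tr T b) = occ_no T b"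
proof -
  have sh: "skew_shape T" using T by (simp add: semistandard_iff)
  have "map (entry (ot k T)) (map (tr T) (row_boxes T)) = map (occ_no T) (row_boxes T)"
    using ot_basics(2)[OF sh, of k] same_shape_cong(2)[OF ot_basics(1)[OF sh, of k]]
    by (simp only: col_word_entry col_boxes_ot[OF sh] ot_word_yamanouchi[OF T(2)] occs_row_word[OF T(1)])
  then show ?thesis using b by (simp add: set_row_boxes[OF sh])
qed

text \<open>Occurrence numbers do not depend on the reading and the reflection exchanges the
  readings, so the rule that defines \<open>ot\<close> also leads from column words to row
  words.\<close>

lemma row_word_ot:
  assumes T: "semistandard T" "yamanouchi (row_word T)"
  shows "row_word (ot k T) = occs (col_word T)"
proof -
  have sh: "skew_shape T" using T by (simp add: semistandard_iff)
  show ?thesis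
    using entry_ot[OF T, of _ k] same_shape_cong(1)[OF ot_basics(1)[OF sh, of k]]
    by (simp add: row_word_entry row_boxes_ot[OF sh] occs_col_word[OF T(1)] set_col_boxes[OF sh])
qed

text \<open>In the prefix ending at the right-hand box, the letter of the left-hand box occurs at
  least as often as the letter just read. The left-hand box itself comes later and adds one
  more.\<close>

lemma occ_no_rows:
  assumes T: "semistandard T" "yamanouchi (row_word T)" and b: "(i, j) \<in> boxes T" "(i, j') \<in> boxes T"
    and j: "j' < j"
  shows "occ_no T (i, j) < occ_no T (i, j')"
proof -
  have sh: "skew_shape T" using T by (simp add: semistandard_iff)
  have fin: "finite (upto_box R T z c)" for z c R
    using finite_boxes[OF sh] by (auto simp: upto_box_def)
  have le: "entry T (i, j') \<le> entry T (i, j)" using entry_mono[OF T(1) b(2,1)] j by simp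
  have pos: "1 \<le> entry T (i, j')" using fill_pos[OF T(1)] b(2) by (simp add: boxes_def entry_def)
  obtain p where p: "p < length (row_boxes T)" "row_boxes T ! p = (i, j)"
    using b(1) set_row_boxes[OF sh] by (metis in_set_conv_nth)
  have "occ_no T (i, j) = card (upto_box row_less T (entry T (i, j)) (i, j))"
    by (simp add: occ_no_def upto_row_ne[OF T(1) b(1)])
  also have "\<dots> \<le> card (upto_box row_less T (entry T (i, j')) (i, j))"
    using yamanouchi_count_le[OF yamanouchi_take[OF T(2), of "Suc p"] pos le]
      count_upto_box[OF row_less_asym sorted_row_boxes set_row_boxes[OF sh] p(1)]
    by (simp add: row_word_entry p(2) del: take_Suc)
  also have "\<dots> < card (upto_box row_less T (entry T (i, j')) (i, j'))"
    using b j by (intro psubset_card_mono fin) (auto simp: upto_box_def)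
  also have "\<dots> = occ_no T (i, j')" by (simp add: occ_no_def upto_row_ne[OF T(1) b(2)])
  finally show ?thesis .
qed

text \<open>The comparison takes place in the column reading, whose prefix may already contain the
  upper box, so the inequality is weak. Equal entries north-east of the lower box cannot lie below
  the upper one, hence are north-east of that one too.\<close>

lemma occ_no_cols:
  assumes T: "semistandard T" "yamanouchi (row_word T)" and b: "(i, j) \<in> boxes T" "(i', j) \<in> boxes T"
    and i: "i' < i"
  shows "occ_no T (i, j) \<le> occ_no T (i', j)"
proof -
  have sh: "skew_shape T" using T by (simp add: semistandard_iff)
  have y: "yamanouchi (col_word T)" using yamanouchi_row_col[OF T(1)] T(2) by simp
  have fin: "finite (ne_of T z c)" for z c using finite_boxes[OF sh] by (auto simp: ne_of_def)
  have le: "entry T (i', j) \<le> entry T (i, j)" using entry_mono[OF T(1) b(2,1)] i by simp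
  have pos: "1 \<le> entry T (i', j)" using fill_pos[OF T(1)] b(2) by (simp add: boxes_def entry_def)
  obtain p where p: "p < length (col_boxes T)" "col_boxes T ! p = (i, j)"
    using b(1) set_col_boxes[OF sh] by (metis in_set_conv_nth)
  have "card (ne_of T (entry T (i, j)) (i, j)) \<le> card (ne_of T (entry T (i', j)) (i, j))"
    using yamanouchi_count_le[OF yamanouchi_take[OF y, of "Suc p"] pos le]
      count_upto_box[OF col_less_asym sorted_col_boxes set_col_boxes[OF sh] p(1)]
    by (simp add: col_word_entry p(2) upto_col_ne[OF T(1) b(1)] le del: take_Suc)
  also have "\<dots> \<le> card (ne_of T (entry T (i', j)) (i', j))"
  proof (intro card_mono fin subsetI)
    fix a assume a: "a \<in> ne_of T (entry T (i', j)) (i, j)"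
    then have "\<not> i' < fst a"
      using entry_mono[OF T(1) b(2), of a] by (auto simp: ne_of_def sw_def)
    then show "a \<in> ne_of T (entry T (i', j)) (i', j)" using a by (auto simp: ne_of_def sw_def)
  qed
  finally show ?thesis by (simp add: occ_no_def)
qed

lemma semistandard_ot:
  assumes T: "semistandard T" "yamanouchi (row_word T)" shows "semistandard (ot k T)"
proof -
  have sh: "skew_shape T" using T by (simp add: semistandard_iff)
  note O = ot_basics[OF sh, where k = k]
  have bx: "box (ot k T) = box (ot_shape T)" by (rule box_cong[OF O(1)])
  let ?b = "\<lambda>i j. (Suc (nrows T) - j, Suc (ncols T) - i)"
  have f: "fill (ot k T) i j = occ_no T (?b i j)" "?b i j \<in> boxes T" if "box (ot_shape T) i j" for i j
  proof -
    show m: "?b i j \<in> boxes T" using that by (simp add: boxes_def box_ot_shape[OF sh])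
    have "tr T (?b i j) = (i, j)"
      using box_bounds[OF skew_shape_ot[OF sh] that] by (simp add: tr_def)
    then show "fill (ot k T) i j = occ_no T (?b i j)"
      using entry_ot[OF T m, of k] by (simp add: entry_def)
  qed
  have pos: "occ_no T b \<noteq> 0" if "b \<in> boxes T" for b
  proof -
    have "b \<in> ne_of T (entry T b) b" using that by (simp add: ne_of_def sw_def)
    moreover have "finite (ne_of T (entry T b) b)" using finite_boxes[OF sh] by (simp add: ne_of_def)
    ultimately show ?thesis unfolding occ_no_def by (metis card_0_eq empty_iff)
  qed
  show ?thesis
    unfolding semistandard_iff bx
  proof (intro conjI allI impI)
    show "skew_shape (ot k T)" using same_shape_cong(3)[OF O(1)] skew_shape_ot[OF sh] by simp
    show "box (ot_shape T) i j \<longleftrightarrow> fill (ot k T) i j \<noteq> 0" for i j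
      using f[of i j] pos O(3)[of i j] by (cases "box (ot_shape T) i j") auto
  next
    fix i j j' assume a: "box (ot_shape T) i j \<and> box (ot_shape T) i j' \<and> j < j'"
    then have "Suc (nrows T) - j' < Suc (nrows T) - j"
      using box_bounds(4)[OF skew_shape_ot[OF sh], of i j'] by (auto intro!: diff_less_mono2)
    then show "fill (ot k T) i j \<le> fill (ot k T) i j'"
      using a f occ_no_cols[OF T] by simp
  next
    fix i i' j assume a: "box (ot_shape T) i j \<and> box (ot_shape T) i' j \<and> i < i'"
    then have "Suc (ncols T) - i' < Suc (ncols T) - i"
      using box_bounds(2)[OF skew_shape_ot[OF sh], of i' j] by (auto intro!: diff_less_mono2)
    then show "fill (ot k T) i j < fill (ot k T) i' j"
      using a f occ_no_rows[OF T] by simp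
  qed
qed

section \<open>The orthogonal transpose on LR and opposite LR tableaux\<close>

lemma first_part_nth: "part_in d m \<nu> \<Longrightarrow> 0 < d \<Longrightarrow> first_part \<nu> = \<nu> ! 0"
  by (cases \<nu>) (auto simp: first_part_def part_in_def)

lemma first_part_ge: "part_in d m \<nu> \<Longrightarrow> i < d \<Longrightarrow> \<nu> ! i \<le> first_part \<nu>"
  using part_in_le(1)[of d m \<nu> 0 i] first_part_nth[of d m \<nu>] by simp

lemma first_part_le: "part_in d m \<nu> \<Longrightarrow> first_part \<nu> \<le> m"
  by (cases \<nu>) (auto simp: first_part_def part_in_def)

lemma tab_over_mono: "tab_over k T \<Longrightarrow> k \<le> l \<Longrightarrow> tab_over l T"
  unfolding tab_over_def by (meson atLeastatMost_subset_iff order_refl order_trans)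

lemma LR_D:
  assumes "T \<in> LR d m \<mu> \<nu> lam" "part_in d m \<nu>"
  shows "tab_over d T" "semistandard T" "skew_shape T" "yamanouchi (row_word T)" "nrows T = d" "ncols T = m"
    "inner T = \<mu>" "outer T = dual_part m lam" "i < d \<Longrightarrow> count_list (row_word T) (Suc i) = \<nu> ! i"
  using assms skew_tabsD[of T d m \<mu> \<nu> lam] tab_overD[of d T] by (auto simp: LR_def part_in_def)

lemma set_occs_LR:
  assumes T: "T \<in> LR d m \<mu> \<nu> lam" and \<nu>: "part_in d m \<nu>"
  shows "set (occs (row_word T)) \<subseteq> {1..first_part \<nu>}"
proof
  note D = LR_D[OF T \<nu>]
  fix x assume "x \<in> set (occs (row_word T))"
  then obtain y where y: "y \<in> set (row_word T)" "1 \<le> x" "x \<le> count_list (row_word T) y"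
    using occs_le by blast
  obtain i where i: "y = Suc i" "i < d"
    using subsetD[OF tab_overD(3)[OF D(1)] y(1)] by (cases y) auto
  then show "x \<in> {1..first_part \<nu>}" using y D(9)[OF i(2)] first_part_ge[OF \<nu> i(2)] by simp
qed

lemma count_occs_LR:
  assumes T: "T \<in> LR d m \<mu> \<nu> lam" and \<nu>: "part_in d m \<nu>" and j: "j < m"
  shows "count_list (occs (row_word T)) (Suc j) = transpose_part m \<nu> ! j"
proof -
  note D = LR_D[OF T \<nu>]
  let ?w = "row_word T"
  have "{y \<in> set ?w. Suc j \<le> count_list ?w y} = Suc ` {i. i < length \<nu> \<and> j < \<nu> ! i}"
  proof (intro equalityI subsetI)
    fix y assume y: "y \<in> {y \<in> set ?w. Suc j \<le> count_list ?w y}"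
    then have "y \<in> {1..d}" using tab_overD(3)[OF D(1)] by blast
    then obtain i where i: "y = Suc i" "i < d" by (cases y) auto
    then show "y \<in> Suc ` {i. i < length \<nu> \<and> j < \<nu> ! i}"
      using y D(9)[OF i(2)] \<nu> by (auto simp: part_in_def)
  next
    fix y assume "y \<in> Suc ` {i. i < length \<nu> \<and> j < \<nu> ! i}"
    then obtain i where i: "y = Suc i" "i < d" "j < \<nu> ! i" using \<nu> by (auto simp: part_in_def)
    then show "y \<in> {y \<in> set ?w. Suc j \<le> count_list ?w y}"
      using D(9)[OF i(2)] count_list_0_iff[of ?w y] by auto
  qed
  then show ?thesis
    using j by (simp add: count_occs nth_transpose_part length_filter_conv_card card_image)
qed

text \<open>The reflection interchanges the two boundaries, so \<mu> and \<open>lam\<close> change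
  places besides being transposed.\<close>

lemma ot_LR:
  assumes T: "T \<in> LR d m \<mu> \<nu> lam" and p: "part_in d m \<mu>" "part_in d m \<nu>" "part_in d m lam"
  shows "ot k T \<in> LR m d (transpose_part m lam) (transpose_part m \<nu>) (transpose_part m \<mu>)"
    "tab_over (first_part \<nu>) (ot k T)" "col_word (ot k T) = occs (row_word T)"
proof -
  note D = LR_D[OF T p(2)]
  note O = ot_basics[OF D(3), where k = k]
  show c: "col_word (ot k T) = occs (row_word T)" using O(2) by (simp add: ot_word_yamanouchi D(4))
  have ss: "semistandard (ot k T)" by (rule semistandard_ot[OF D(2,4)])
  then have sh: "skew_shape (ot k T)" by (simp add: semistandard_iff)
  have st: "set (row_word (ot k T)) = set (occs (row_word T))"
    using set_row_word[OF sh] set_col_word[OF sh] c by simp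
  show t: "tab_over (first_part \<nu>) (ot k T)"
    using ss set_occs_LR[OF T p(2)] by (simp add: tab_over_def st)
  have "tab_over m (ot k T)"
    using t first_part_le[OF p(2)] by (rule tab_over_mono)
  moreover have "yamanouchi (row_word (ot k T))"
    using yamanouchi_row_col[OF ss] c yamanouchi_occs by simp
  moreover have "inner (ot k T) = transpose_part m lam" "outer (ot k T) = dual_part d (transpose_part m \<mu>)"
    "nrows (ot k T) = m" "ncols (ot k T) = d"
    using O(1) D transpose_dual_part[OF p(3)] dual_part_dual_part[OF part_in_transpose[OF p(3)]]
    by (simp_all add: same_shape_def)
  moreover have "count_list (row_word (ot k T)) (Suc j) = transpose_part m \<nu> ! j" if "j < m" for j
    using count_occs_LR[OF T p(2) that] count_col_word[OF sh] c by simp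
  ultimately show "ot k T \<in> LR m d (transpose_part m lam) (transpose_part m \<nu>) (transpose_part m \<mu>)"
    unfolding LR_def by (simp add: skew_tabsI)
qed

text \<open>The row word of the result is \<open>occs\<close> of the column word of
  \<open>ot k T\<close>, which is \<open>occs\<close> of the row word of T; \<open>occs\<close> is
  an involution on Yamanouchi words.\<close>

lemma ot_ot:
  assumes T: "T \<in> LR d m \<mu> \<nu> lam" and p: "part_in d m \<mu>" "part_in d m \<nu>" "part_in d m lam"
  shows "ot l (ot k T) = T"
proof (rule semistandard_eqI)
  note D = LR_D[OF T p(2)]
  note O = ot_LR[OF T p]
  note p' = part_in_transpose[OF p(1)] part_in_transpose[OF p(2)] part_in_transpose[OF p(3)]
  note O2 = ot_LR[OF O(1) p'(3,2,1), of l]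
  note D1 = LR_D[OF O(1) p'(2)]
  note D2 = LR_D[OF O2(1)]
  have D2: "semistandard (ot l (ot k T))" "nrows (ot l (ot k T)) = d" "ncols (ot l (ot k T)) = m"
    "inner (ot l (ot k T)) = \<mu>" "outer (ot l (ot k T)) = dual_part m lam"
    using LR_D[OF O2(1)] p by (simp_all add: transpose_part_transpose_part)
  show "semistandard (ot l (ot k T))" "semistandard T" by (fact D2(1), fact D(2))
  show "same_shape (ot l (ot k T)) T" using D D2 by (simp add: same_shape_def)
  have "0 \<notin> set (row_word T)" using tab_overD(3)[OF D(1)] by auto
  then have "row_word (ot l (ot k T)) = row_word T"
    by (simp add: row_word_ot[OF D1(2,4)] O(3) occs_occs D(4))
  then show "row_word (ot l (ot k T)) = row_word T \<or> col_word (ot l (ot k T)) = col_word T" ..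
qed

lemma tab_eqI:
  assumes "skew_shape T" "same_shape S T" "col_word S = col_word T"
    and "\<And>i j. \<not> box T i j \<Longrightarrow> fill S i j = 0" "\<And>i j. \<not> box T i j \<Longrightarrow> fill T i j = 0"
  shows "S = T"
proof -
  have "fill S i j = fill T i j" for i j
  proof (cases "box T i j")
    case True
    then have "(i, j) \<in> set (col_boxes T)" using assms(1) by (simp add: set_col_boxes boxes_def)
    then show ?thesis
      using assms(3) same_shape_cong(2)[OF assms(2)] by (auto simp: col_word_def)
  qed (use assms(4,5) in simp)
  then have "fill S = fill T" by blast
  then show ?thesis using assms(2) by (auto simp: same_shape_def)
qed

text \<open>The rule for opposite words is the conjugate of the rule for Yamanouchi words, but
  between different alphabets: d letters before and \<nu>1 letters after.\<close>

lemma ot_bullet: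
  assumes T: "T \<in> oppLR d m \<mu> (rev \<nu>) lam" and p: "part_in d m \<mu>" "part_in d m \<nu>" "part_in d m lam"
  shows "ot d T = bullet (first_part \<nu>) (ot d (bullet d T))"
proof (rule tab_eqI)
  have l: "length \<nu> = d" using p by (simp add: part_in_def)
  note B = bullet_oppLR[OF T l p(3)]
  note DB = LR_D[OF B(1) p(2)]
  note O = ot_LR[OF B(1) p(3,2,1), of d]
  have T': "T \<in> skew_tabs d m \<mu> (rev \<nu>) lam" "opp_yamanouchi d (row_word T)"
    using T by (auto simp: oppLR_def)
  have D: "tab_over d T" "nrows T = d" "ncols T = m" "i < d \<Longrightarrow> count_list (row_word T) (Suc i) = rev \<nu> ! i" for i
    using skew_tabsD[OF T'(1)] l by auto
  note sh = tab_overD(2)[OF D(1)]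
  have po: "part_in d m (inner T)" "part_in d m (outer T)" using sh D by (auto simp: skew_shape_def)
  let ?B = "bullet (first_part \<nu>) (ot d (bullet d T))"
  have sho: "skew_shape (ot d (bullet d T))" using tab_overD(2)[OF O(2)] .
  show shB: "skew_shape ?B" by (rule skew_shape_bullet[OF sho])
  note Ob = ot_basics[OF sh, where k = d]
  note Obb = ot_basics(1)[OF DB(3), where k = d]
  have "same_shape (ot_shape T) ?B"
    using Obb D(2,3) transpose_dual_part[OF po(1)] transpose_dual_part[OF po(2)]
      dual_part_dual_part[OF part_in_transpose[OF po(1)]] dual_part_dual_part[OF part_in_transpose[OF po(2)]]
    by (simp add: same_shape_def)
  then show ss: "same_shape (ot d T) ?B" using Ob(1) same_shape_trans by blast
  \<comment> \<open>This multiplicity is the offset in \<open>ot_word\<close> for opposite words and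
    thereby the size of the new alphabet.\<close>
  have "count_list (row_word T) d = first_part \<nu>"
  proof (cases d)
    case 0
    then have "row_word T = []" "\<nu> = []" using tab_overD(3)[OF D(1)] l by auto
    then show ?thesis by (simp add: first_part_def)
  next
    case (Suc e)
    then show ?thesis using D(4)[of e] l first_part_nth[OF p(2)] by (simp add: rev_nth)
  qed
  then show "col_word (ot d T) = col_word ?B"
    using ot_word_opposite[OF tab_overD(3)[OF D(1)] T'(2)]
    by (simp add: Ob(2) col_word_bullet[OF sho] O(3) row_word_bullet[OF sh])
  fix i j assume "\<not> box ?B i j"
  then show "fill (ot d T) i j = 0" "fill ?B i j = 0"
    using Ob(3) box_cong[OF ss] box_cong[OF Ob(1)] by (auto simp: fill_bullet[OF sho])
qed

lemma yamanouchi_unique: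
  assumes "tab_over k S" "tab_over k T" "yamanouchi (row_word S)" "yamanouchi (row_word T)"
    and "dual_knuth_equiv S T"
  shows "S = T"
proof -
  have "bullet k S = bullet k T"
    by (rule opp_yamanouchi_unique[OF tab_over_bullet(1)[OF assms(1)] tab_over_bullet(1)[OF assms(2)]
      yamanouchi_bullet[OF assms(1,3)] yamanouchi_bullet[OF assms(2,4)]
      dual_knuth_equiv_bullet[OF assms(5,1,2)]])
  then show ?thesis by (metis tab_over_bullet(2) assms(1,2))
qed

text \<open>The alphabet does not matter for \<open>\<bullet> e\<close>.\<close>

lemma bullet_reversal_over:
  assumes S: "tab_over k S" "tab_over l S" "yamanouchi (row_word S)"
  shows "bullet k (reversal_over k S) = bullet l (reversal_over l S)"
proof (rule yamanouchi_unique[of "max k l"])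
  have *: "yamanouchi (row_word (bullet k (reversal_over k S)))" "tab_over k (bullet k (reversal_over k S))"
    "dual_knuth_equiv (bullet k S) (bullet k (reversal_over k S))" if "tab_over k S" for k
    using reversal_over_yamanouchi[OF that S(3)] opp_yamanouchi_bullet[of k] tab_over_bullet(1)[of k]
      dual_knuth_equiv_bullet[of S _ k] that by (auto simp: is_reversal_def)
  show "yamanouchi (row_word (bullet k (reversal_over k S)))" "yamanouchi (row_word (bullet l (reversal_over l S)))"
    using * S by auto
  show "tab_over (max k l) (bullet k (reversal_over k S))" "tab_over (max k l) (bullet l (reversal_over l S))"
    using *(2)[OF S(1)] *(2)[OF S(2)] by (auto intro: tab_over_mono)
  have "set (rev (row_word S)) \<subseteq> {..Suc k}" "set (rev (row_word S)) \<subseteq> {..Suc l}"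
    using tab_overD(3)[OF S(1)] tab_overD(3)[OF S(2)] by auto
  \<comment> \<open>Changing the alphabet shifts all letters of the rotated word by the same amount
    and leaves the standardization alone.\<close>
  then have "dual_knuth_equiv (bullet k S) (bullet l S)"
    unfolding dual_knuth_equiv_def
    by (simp add: same_shape_def rev_row_word_bullet tab_overD(2)[OF S(1)] standardize_bullet)
  then show "dual_knuth_equiv (bullet k (reversal_over k S)) (bullet l (reversal_over l S))"
    using *(3)[OF S(1)] *(3)[OF S(2)] dual_knuth_equiv_sym dual_knuth_equiv_trans by blast
qed

lemma comp_comp:
  assumes "is_perm \<sigma>" "n = length \<sigma>"
  shows "map (\<lambda>x. Suc n - x) (map (\<lambda>x. Suc n - x) \<sigma>) = \<sigma>"
  using assms by (auto simp: is_perm_def intro!: map_idI)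

text \<open>By \<open>dual_knuth_occs\<close> the column word of \<open>ot d T\<close> is, up to
  dual Knuth equivalence, the complement of the standardized row word of T. Rotating the same
  statement for \<rho> T gives it for the opposite tableau e T. As T and e T are dual Knuth
  equivalent, so are the complements.\<close>

lemma dual_knuth_equiv_ot:
  assumes T: "T \<in> LR d m \<mu> \<nu> lam" and p: "part_in d m \<mu>" "part_in d m \<nu>" "part_in d m lam"
  shows "dual_knuth_equiv (ot d T) (ot d (reversal T))"
proof -
  have l: "length \<nu> = d" using p by (simp add: part_in_def)
  note D = LR_D[OF T p(2)]
  note R = reversal_LR[OF T l]
  note H = rho_LR[OF T l p(1,3)]
  define T' where "T' = reversal T"
  define V where "V = rho T"
  have T': "tab_over d T'" "same_shape T' T" "dual_knuth_equiv T T'"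
    using reversal_over_yamanouchi(1,5,6)[OF D(1,4)]
    by (auto simp: T'_def reversal_def D(5) is_reversal_def)
  have V: "V \<in> LR d m lam \<nu> \<mu>" "V = bullet d T'" using H by (auto simp: V_def T'_def)
  note DV = LR_D[OF V(1) p(2)]
  note OV = ot_LR[OF V(1) p(3,2,1), of d]
  note OT = ot_LR[OF T p, of d]
  have oT': "ot d T' = bullet (first_part \<nu>) (ot d V)" using ot_bullet[OF R(1) p] by (simp add: V(2) T'_def)
  let ?w = "row_word T" and ?w' = "row_word T'" and ?v = "row_word V"
  let ?n = "length ?w"
  let ?c = "map (\<lambda>x. Suc ?n - x)"
  have d0: "dual_knuth (standardize (rev ?w)) (standardize (rev ?w'))"
    using T'(3) by (simp add: dual_knuth_equiv_def)
  have ln: "length ?w' = ?n" "length ?v = ?n"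
    using dual_knuth_perm(1)[OF d0] by (simp_all add: V(2) row_word_bullet tab_overD(2)[OF T'(1)])
  have bw: "bullet_word ?n s = rev (?c s)" for s by (simp add: bullet_word_def)
  have "set (rev ?w') \<subseteq> {..Suc d}" using tab_overD(3)[OF T'(1)] by auto
  then have sv: "standardize (rev ?v) = rev (?c (standardize (rev ?w')))"
    using standardize_bullet[of "rev ?w'" d] ln
    by (simp add: V(2) rev_row_word_bullet tab_overD(2)[OF T'(1)] bw)
  have "set (rev (occs ?v)) \<subseteq> {..Suc (first_part \<nu>)}" using set_occs_LR[OF V(1) p(2)] by auto
  then have sc: "standardize (rev (col_word (ot d T'))) = rev (?c (standardize (rev (occs ?v))))"
    using standardize_bullet[of "rev (occs ?v)" "first_part \<nu>"] ln
    by (simp add: oT' col_word_bullet tab_overD(2)[OF OV(2)] OV(3) rev_bullet_word bw)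
  have A: "dual_knuth (standardize (rev ?w)) (?c (standardize (rev (occs ?w))))"
    by (rule dual_knuth_occs[OF D(4) tab_overD(3)[OF D(1)] refl])
  have B: "dual_knuth (standardize (rev ?v)) (?c (standardize (rev (occs ?v))))"
    by (rule dual_knuth_occs[OF DV(4) tab_overD(3)[OF DV(1)]]) (simp add: ln)
  have "dual_knuth (?c (standardize (rev ?w))) (?c (?c (standardize (rev (occs ?w)))))"
    by (rule dual_knuth_comp[OF A is_perm_standardize]) simp
  moreover have "?c (?c (standardize (rev (occs ?w)))) = standardize (rev (occs ?w))"
    by (rule comp_comp[OF is_perm_standardize]) simp
  ultimately have 1: "dual_knuth (?c (standardize (rev ?w))) (standardize (rev (col_word (ot d T))))"
    by (simp only: OT(3))
  have 2: "dual_knuth (?c (standardize (rev ?w))) (?c (standardize (rev ?w')))"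
    by (rule dual_knuth_comp[OF d0 is_perm_standardize]) simp
  \<comment> \<open>Both sides of B are rotations: reversed, the left side is the complement for
    \<open>T'\<close>, and the right side is the standardized column word of
    \<open>ot d T'\<close>.\<close>
  have 3: "dual_knuth (?c (standardize (rev ?w'))) (standardize (rev (col_word (ot d T'))))"
    using dual_knuth_rev[OF B] by (simp only: sv sc rev_rev_ident)
  have "dual_knuth (standardize (rev (col_word (ot d T)))) (standardize (rev (col_word (ot d T'))))"
    using 1 2 3 by (meson equivclp_sym equivclp_trans)
  then show ?thesis
    unfolding T'_def[symmetric]
  proof (intro dual_knuth_col_row)
    show "semistandard (ot d T)" by (rule tab_overD(1)[OF OT(2)])
    show "semistandard (ot d T')" unfolding oT' by (rule tab_overD(1)[OF tab_over_bullet(1)[OF OV(2)]])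
    have "same_shape (ot_shape T) (ot_shape T')" using T'(2) by (simp add: same_shape_def)
    then show "same_shape (ot d T) (ot d T')"
      using ot_basics(1)[OF D(3), of d] ot_basics(1)[OF tab_overD(2)[OF T'(1)], of d]
        same_shape_trans same_shape_sym by blast
  qed
qed

lemma knuth_equiv_LR:
  assumes S: "S \<in> LR d m \<mu> \<nu> lam" and T: "T \<in> LR d m \<mu>' \<nu> lam'" and \<nu>: "part_in d m \<nu>"
  shows "knuth_equiv S T"
  unfolding knuth_equiv_def
proof (rule knuth_slat_unique)
  note DS = LR_D[OF S \<nu>] and DT = LR_D[OF T \<nu>]
  note s = tab_overD(3)[OF DS(1)] and t = tab_overD(3)[OF DT(1)]
  show "slat (rev (row_word S))" "slat (rev (row_word T))"
    using DS(4) DT(4) by (simp_all add: yamanouchi_slat)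
  show "0 \<notin> set (rev (row_word S))" "0 \<notin> set (rev (row_word T))" using s t by auto
  fix i :: nat assume i: "1 \<le> i"
  show "count_list (rev (row_word S)) i = count_list (rev (row_word T)) i"
  proof (cases "i \<le> d")
    case True
    then show ?thesis using DS(9)[of "i - 1"] DT(9)[of "i - 1"] i by simp
  next
    case False
    then have "i \<notin> set (row_word S)" "i \<notin> set (row_word T)" using s t by auto
    then show ?thesis by (simp add: count_list_0_iff)
  qed
qed

text \<open>\<open>ot d (reversal T)\<close> meets the definition of the reversal of
  \<open>ot d T\<close> over \<nu>1 letters: the dual Knuth half is
  \<open>dual_knuth_equiv_ot\<close>, and after rotation both tableaux are LR with the same content.
  Hence \<open>ot\<close> commutes with e, and \<rho> applied to \<varrho> T gives back
  \<open>ot d T\<close>.\<close>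

theorem varrho_LR:
  assumes T: "T \<in> LR d m \<mu> \<nu> lam" and p: "part_in d m \<mu>" "part_in d m \<nu>" "part_in d m lam"
  defines "\<nu>1 \<equiv> first_part \<nu>"
  shows "varrho T = ot d (rho T)" "varrho T = bullet \<nu>1 (ot d (reversal T))"
    "varrho T = bullet \<nu>1 (reversal_over \<nu>1 (ot d T))" "varrho T = rho (ot d T)"
    "varrho T \<in> LR m d (transpose_part m \<mu>) (transpose_part m \<nu>) (transpose_part m lam)"
    "col_word (varrho T) = bullet_word \<nu>1 (ot_word d (sigma0 d (row_word T)))"
    "varrho (varrho T) = T"
proof -
  have l: "length \<nu> = d" using p by (simp add: part_in_def)
  note D = LR_D[OF T p(2)]
  note R = reversal_LR[OF T l]
  note H = rho_LR[OF T l p(1,3)]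
  note p' = part_in_transpose[OF p(1)] part_in_transpose[OF p(2)] part_in_transpose[OF p(3)]
  note OT = ot_LR[OF T p, of d]
  note OV = ot_LR[OF H(2) p(3,2,1), of d]
  note DO = LR_D[OF OT(1) p'(2)]
  show 1: "varrho T = ot d (rho T)" by (simp add: varrho_def D(5))
  have oR: "ot d (reversal T) = bullet \<nu>1 (ot d (rho T))"
    using ot_bullet[OF R(1) p] by (simp add: \<nu>1_def H(1))
  have V: "tab_over \<nu>1 (ot d (rho T))" "tab_over \<nu>1 (ot d T)" using OV(2) OT(2) by (simp_all add: \<nu>1_def)
  show 2: "varrho T = bullet \<nu>1 (ot d (reversal T))" using tab_over_bullet(2)[OF V(1)] oR 1 by simp
  have "is_reversal \<nu>1 (ot d T) (ot d (reversal T))"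
  proof -
    have "knuth_equiv (ot d (rho T)) (ot d T)" by (rule knuth_equiv_LR[OF OV(1) OT(1) p'(2)])
    then have "knuth_equiv (ot d (reversal T)) (bullet \<nu>1 (ot d T))"
      unfolding oR by (rule knuth_equiv_bullet[OF _ V])
    then show ?thesis
      using dual_knuth_equiv_ot[OF T p] tab_over_bullet(1)[OF V(1)]
      by (simp add: is_reversal_def tab_over_def flip: oR)
  qed
  then have "reversal_over \<nu>1 (ot d T) = ot d (reversal T)"
    by (rule reversal_over_eqI[OF V(2) disjI1[OF DO(4)]])
  then show 3: "varrho T = bullet \<nu>1 (reversal_over \<nu>1 (ot d T))" using 2 by simp
  \<comment> \<open>Here the alphabet has m letters, the number of rows of \<open>ot d T\<close>,
    instead of \<nu>1.\<close>
  have "rho (ot d T) = bullet m (reversal_over m (ot d T))" by (simp add: rho_def reversal_def DO(5))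
  then show 4: "varrho T = rho (ot d T)"
    using bullet_reversal_over[OF V(2) DO(1,4)] 3 by simp
  have l': "length (transpose_part m \<nu>) = m" by simp
  note HO = rho_LR[OF OT(1) l' p'(3,1)]
  show L: "varrho T \<in> LR m d (transpose_part m \<mu>) (transpose_part m \<nu>) (transpose_part m lam)"
    using HO(2) 4 by simp
  have "skew_shape (ot d (reversal T))"
    unfolding oR by (rule skew_shape_bullet[OF tab_overD(2)[OF V(1)]])
  moreover have "skew_shape (reversal T)"
    using R(1) by (auto simp: oppLR_def skew_tabs_def semistandard_iff)
  ultimately show "col_word (varrho T) = bullet_word \<nu>1 (ot_word d (sigma0 d (row_word T)))"
    by (simp add: 2 col_word_bullet ot_basics(2) R(2))
  have "nrows (varrho T) = m" using LR_D(5)[OF L p'(2)] .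
  then have "varrho (varrho T) = ot m (rho (varrho T))" by (simp add: varrho_def[of "varrho T"])
  also have "rho (varrho T) = ot d T" using HO(3) 4 by simp
  finally show "varrho (varrho T) = T" using ot_ot[OF T p] by simp
qed

lemma bij_betw_involution:
  assumes "\<And>x. x \<in> A \<Longrightarrow> f x \<in> B" "\<And>x. x \<in> B \<Longrightarrow> f x \<in> A"
    "\<And>x. x \<in> A \<Longrightarrow> f (f x) = x" "\<And>x. x \<in> B \<Longrightarrow> f (f x) = x"
  shows "bij_betw f A B"
  by (rule bij_betwI[where g = f]) (use assms in auto)

theorem LR_symmetries:
  fixes d m :: nat and \<mu> \<nu> lam :: "nat list"
  assumes p: "part_in d m \<mu>" "part_in d m \<nu>" "part_in d m lam"
  defines "\<nu>1 \<equiv> first_part \<nu>" and "A \<equiv> LR d m \<mu> \<nu> lam"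
    and "A' \<equiv> oppLR d m \<mu> (rev \<nu>) lam" and "B \<equiv> LR d m lam \<nu> \<mu>"
    and "C \<equiv> LR m d (transpose_part m \<mu>) (transpose_part m \<nu>) (transpose_part m lam)"
  shows "(bij_betw reversal A A' \<and> bij_betw reversal A' A \<and>
         (\<forall>T \<in> A \<union> A'. reversal (reversal T) = T) \<and>
         (\<forall>T \<in> A. row_word (reversal T) = sigma0 d (row_word T)) \<and>
         cLR d m \<mu> \<nu> lam = coppLR d m \<mu> (rev \<nu>) lam) \<and>
        (bij_betw rho A B \<and>
         (\<forall>T \<in> A. rho (rho T) = T) \<and>
         (\<forall>T \<in> A. rho T = bullet d (reversal T) \<and>
           row_word (rho T) = bullet_word d (sigma0 d (row_word T))) \<and>
         cLR d m \<mu> \<nu> lam = cLR d m lam \<nu> \<mu>) \<and>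
        (bij_betw varrho A C \<and>
         (\<forall>T \<in> A. varrho (varrho T) = T) \<and>
         (\<forall>T \<in> A. varrho T = ot d (rho T) \<and>
           varrho T = ot d (bullet d (reversal T)) \<and>
           varrho T = bullet \<nu>1 (ot d (reversal T)) \<and>
           varrho T = bullet \<nu>1 (reversal_over \<nu>1 (ot d T)) \<and>
           varrho T = rho (ot d T) \<and>
           col_word (varrho T) = bullet_word \<nu>1 (ot_word d (sigma0 d (row_word T)))) \<and>
         cLR d m \<mu> \<nu> lam =
           cLR m d (transpose_part m \<mu>) (transpose_part m \<nu>) (transpose_part m lam))"
proof -
  have l: "length \<nu> = d" using p by (simp add: part_in_def)
  note p' = part_in_transpose[OF p(1)] part_in_transpose[OF p(2)] part_in_transpose[OF p(3)]
  have e: "bij_betw reversal A A'" "bij_betw reversal A' A"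
    unfolding A_def A'_def
    by (rule bij_betw_involution;
      rule reversal_LR(1,3)[OF _ l] reversal_oppLR(2,3)[OF _ l p(1,3)]; assumption)+
  have r: "bij_betw rho A B"
    unfolding A_def B_def
    by (rule bij_betw_involution;
      rule rho_LR(2,3)[OF _ l p(1,3)] rho_LR(2,3)[OF _ l p(3,1)]; assumption)
  have v: "bij_betw varrho A C"
    unfolding A_def C_def
  proof (rule bij_betw_involution)
    fix T assume "T \<in> LR m d (transpose_part m \<mu>) (transpose_part m \<nu>) (transpose_part m lam)"
    from varrho_LR(5,7)[OF this p']
    show "varrho T \<in> LR d m \<mu> \<nu> lam" "varrho (varrho T) = T"
      using p by (simp_all add: transpose_part_transpose_part)
  qed (use varrho_LR[OF _ p] in auto)
  have c: "cLR d m \<mu> \<nu> lam = coppLR d m \<mu> (rev \<nu>) lam" "cLR d m \<mu> \<nu> lam = cLR d m lam \<nu> \<mu>"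
    "cLR d m \<mu> \<nu> lam = cLR m d (transpose_part m \<mu>) (transpose_part m \<nu>) (transpose_part m lam)"
    using bij_betw_same_card[OF e(1)] bij_betw_same_card[OF r] bij_betw_same_card[OF v]
    by (simp_all add: cLR_def coppLR_def A_def A'_def B_def C_def)
  have 1: "reversal (reversal T) = T" if "T \<in> A \<union> A'" for T
    using that reversal_LR(3)[OF _ l, of T m \<mu> lam] reversal_oppLR(3)[OF _ l p(1,3), of T]
    unfolding A_def A'_def by blast
  have 2: "row_word (reversal T) = sigma0 d (row_word T)" if "T \<in> A" for T
    using reversal_LR(2)[OF that[unfolded A_def] l] .
  have 3: "rho (rho T) = T" "rho T = bullet d (reversal T)"
    "row_word (rho T) = bullet_word d (sigma0 d (row_word T))" if "T \<in> A" for T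
    using rho_LR(1,3,4)[OF that[unfolded A_def] l p(1,3)] by auto
  have 4: "varrho (varrho T) = T" "varrho T = ot d (rho T)" "varrho T = ot d (bullet d (reversal T))"
    "varrho T = bullet \<nu>1 (ot d (reversal T))" "varrho T = bullet \<nu>1 (reversal_over \<nu>1 (ot d T))"
    "varrho T = rho (ot d T)" "col_word (varrho T) = bullet_word \<nu>1 (ot_word d (sigma0 d (row_word T)))"
    if "T \<in> A" for T
    using varrho_LR[OF that[unfolded A_def] p] 3(2)[OF that] unfolding \<nu>1_def by metis+
  show ?thesis
    by (intro conjI ballI) (fact e r v c 1 2 3 4 | erule 1 2 3 4)+
qed

section \<open>Programs of linear cost\<close>

text \<open>\<open>V\<close> bounds all numbers that occur, \<open>\<beta>\<close> their lengths; \<open>run c s n Q\<close> bounds the cost of \<open>c\<close> by \<open>n\<close> units of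
  size \<open>\<beta>\<close>.\<close>

locale ram_bound =
  fixes V \<beta> :: nat
  assumes bits_le: "x \<le> V \<Longrightarrow> bits x \<le> \<beta>"
begin

lemma \<beta>_pos: "1 \<le> \<beta>"
  using bits_le[of 0] by (simp add: bits_def)

definition run :: "ram \<Rightarrow> ram_state \<Rightarrow> nat \<Rightarrow> (ram_state \<Rightarrow> bool) \<Rightarrow> bool" where
  "run c s n Q \<longleftrightarrow> (\<exists>t s'. exec c s t s' \<and> t \<le> n * \<beta> \<and> Q s')"

lemma run_mono: "run c s n Q \<Longrightarrow> n \<le> n' \<Longrightarrow> run c s n' Q"
  unfolding run_def by (meson mult_le_mono1 order_trans)

lemma run_Skip: "Q s \<Longrightarrow> run Skip s 1 Q"
  using \<beta>_pos exec.intros(1) unfolding run_def by (metis mult_1)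

lemma run_Const: "n \<le> V \<Longrightarrow> Q (r(a := n), M) \<Longrightarrow> run (Const a n) (r, M) 1 Q"
  unfolding run_def using exec.intros(2) bits_le by (metis mult_1)

lemma two_bits: "x \<le> V \<Longrightarrow> y \<le> V \<Longrightarrow> bits x + bits y \<le> 2 * \<beta>"
  using bits_le[of x] bits_le[of y] by simp

lemma run_Add: "r b \<le> V \<Longrightarrow> r c \<le> V \<Longrightarrow> Q (r(a := r b + r c), M) \<Longrightarrow> run (Add a b c) (r, M) 2 Q"
  unfolding run_def using exec.intros(3) two_bits by blast

lemma run_Sub: "r b \<le> V \<Longrightarrow> r c \<le> V \<Longrightarrow> Q (r(a := r b - r c), M) \<Longrightarrow> run (Sub a b c) (r, M) 2 Q"
  unfolding run_def using exec.intros(4) two_bits by blast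

lemma run_Load: "r b \<le> V \<Longrightarrow> M (r b) \<le> V \<Longrightarrow> Q (r(a := M (r b)), M) \<Longrightarrow> run (Load a b) (r, M) 2 Q"
  unfolding run_def using exec.intros(5) two_bits by blast

lemma run_Store: "r a \<le> V \<Longrightarrow> r b \<le> V \<Longrightarrow> Q (r, M(r a := r b)) \<Longrightarrow> run (Store a b) (r, M) 2 Q"
  unfolding run_def using exec.intros(6) two_bits by blast

lemma run_Seq: "run c s n (\<lambda>s'. run c' s' n' Q) \<Longrightarrow> run (Seq c c') s (n + n') Q"
  unfolding run_def by (metis (no_types, opaque_lifting) add_mono add_mult_distrib exec.intros(7))

lemma run_IfPos:
  assumes "r a \<le> V" "0 < r a \<Longrightarrow> run c (r, M) n Q" "r a = 0 \<Longrightarrow> run c' (r, M) n' Q"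
  shows "run (IfPos a c c') (r, M) (1 + (n + n')) Q"
proof (cases "0 < r a")
  case True
  then obtain t s' where "exec c (r, M) t s'" "t \<le> n * \<beta>" "Q s'" using assms unfolding run_def by blast
  moreover from this have "bits (r a) + t \<le> (1 + (n + n')) * \<beta>"
    using bits_le[OF assms(1)] by (simp add: algebra_simps)
  ultimately show ?thesis unfolding run_def using exec.intros(8)[of r a, OF True] by blast
next
  case False
  then obtain t s' where "exec c' (r, M) t s'" "t \<le> n' * \<beta>" "Q s'" using assms unfolding run_def by blast
  moreover from this have "bits (r a) + t \<le> (1 + (n + n')) * \<beta>"
    using bits_le[OF assms(1)] by (simp add: algebra_simps)
  ultimately show ?thesis unfolding run_def using exec.intros(9)[of r a] False by blast
qed

text \<open>The index of I is the number of rounds still to come, so one induction gives both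
  termination and cost; each test of the register costs one unit.\<close>

lemma run_While:
  assumes I0: "\<And>r M. I 0 (r, M) \<Longrightarrow> r a = 0 \<and> Q (r, M)"
    and I1: "\<And>k r M. I (Suc k) (r, M) \<Longrightarrow> 0 < r a \<and> r a \<le> V \<and> run c (r, M) n (I k)"
  shows "I k s \<Longrightarrow> run (WhilePos a c) s (k * (n + 1) + 1) Q"
proof (induction k arbitrary: s)
  case 0
  obtain r M where s: "s = (r, M)" by (cases s)
  then have "exec (WhilePos a c) s (bits (r a)) s" "Q s"
    using I0[of r M] 0 exec.intros(10)[of r a c M] by auto
  moreover have "bits (r a) \<le> \<beta>" using I0[of r M] 0 s bits_le by simp
  ultimately show ?case unfolding run_def by (metis add_0 mult_0 mult_1)
next
  case (Suc k)
  obtain r M where s: "s = (r, M)" by (cases s)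
  have r: "0 < r a" "r a \<le> V" using I1 Suc.prems s by auto
  obtain t s' where t: "exec c (r, M) t s'" "t \<le> n * \<beta>" "I k s'"
    using I1[of k r M] Suc.prems s unfolding run_def by blast
  obtain t' s'' where t': "exec (WhilePos a c) s' t' s''" "t' \<le> (k * (n + 1) + 1) * \<beta>" "Q s''"
    using Suc.IH[OF t(3)] unfolding run_def by blast
  have "exec (WhilePos a c) s (bits (r a) + t + t') s''"
    unfolding s by (rule exec.intros(11)[OF r(1) t(1) t'(1)])
  moreover have "bits (r a) + t + t' \<le> (Suc k * (n + 1) + 1) * \<beta>"
    using bits_le[OF r(2)] t(2) t'(2) by (simp add: algebra_simps)
  ultimately show ?case unfolding run_def using t'(3) by blast
qed

lemmas run_simple = run_Skip run_Const run_Add run_Sub run_Load run_Store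

end

text \<open>Complements and exchanges two cells, addressed from the left by register 1 and from the
  right by register 2. Register 3 holds d + 1, register 4 the constant 1, and register 0 vanishes
  once the pointers have crossed. A middle cell is complemented only once, as both values are loaded
  before anything is stored.\<close>

definition bullet_body :: ram where
  "bullet_body = Seq (Load 5 1) (Seq (Load 6 2) (Seq (Sub 5 3 5) (Seq (Sub 6 3 6)
     (Seq (Store 1 6) (Seq (Store 2 5) (Seq (Add 1 1 4) (Seq (Sub 2 2 4)
     (Seq (Add 0 2 4) (Sub 0 0 1)))))))))"

definition bullet_prog :: ram where
  "bullet_prog = Seq (Const 4 1) (Seq (Const 5 2) (Seq (Load 3 5) (Seq (Add 3 3 4)
     (Seq (Const 1 4) (Seq (Load 2 4) (Seq (Add 2 2 4) (Seq (Add 0 2 4) (Seq (Sub 0 0 1)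
     (WhilePos 0 bullet_body)))))))))"

text \<open>The complement interchanges the markers 0 and d + 1 of the cells off the shape, so that
  no cell needs separate treatment.\<close>

definition bullet_arr :: "nat list list \<Rightarrow> nat list list" where
  "bullet_arr x = (case hd x of d # m # cs \<Rightarrow> [d # m # rev (map (\<lambda>c. Suc d - c) cs)])"

context ram_bound begin

text \<open>t pairs are done and k remain; rounding up lets the middle cell of an odd number count
  as a pair.\<close>

definition bullet_inv :: "nat \<Rightarrow> nat \<Rightarrow> (nat \<Rightarrow> nat) \<Rightarrow> nat \<Rightarrow> ram_state \<Rightarrow> bool" where
  "bullet_inv N S M0 k s \<longleftrightarrow> (case s of (r, M) \<Rightarrow> \<exists>t. t + k = (N + 1) div 2 \<and>
     r 1 = 4 + t \<and> r 2 = 3 + N - t \<and> r 3 = S \<and> r 4 = 1 \<and> r 0 = N - 2 * t \<and>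
     (\<forall>p<4. M p = M0 p) \<and> (\<forall>p<N. M (4 + p) = (if p < t \<or> N \<le> p + t then S - M0 (3 + N - p) else M0 (4 + p))))"

lemma bullet_body_run:
  assumes N: "10 + N \<le> V" and S: "S + 2 \<le> V" and M0: "\<And>p. M0 p \<le> V"
    and I: "bullet_inv N S M0 (Suc k) (r, M)"
  shows "0 < r 0 \<and> r 0 \<le> V \<and> run bullet_body (r, M) 20 (bullet_inv N S M0 k)"
proof -
  obtain t where t: "t + Suc k = (N + 1) div 2" and r: "r 1 = 4 + t" "r 2 = 3 + N - t" "r 3 = S" "r 4 = 1"
    "r 0 = N - 2 * t" and M: "\<And>p. p < 4 \<Longrightarrow> M p = M0 p"
    "\<And>p. p < N \<Longrightarrow> M (4 + p) = (if p < t \<or> N \<le> p + t then S - M0 (3 + N - p) else M0 (4 + p))"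
    using I unfolding bullet_inv_def by auto
  have tN: "2 * t < N" using t by linarith
  have lo: "M (4 + t) = M0 (4 + t)" using M(2)[of t] tN by simp
  have hi: "M (3 + N - t) = M0 (3 + N - t)"
  proof -
    have "3 + N - t = 4 + (N - 1 - t)" using tN by simp
    moreover have "\<not> (N - 1 - t < t \<or> N \<le> N - 1 - t + t)" "N - 1 - t < N" using tN by auto
    ultimately show ?thesis using M(2)[of "N - 1 - t"] by (simp only: if_False)
  qed
  have fin: "bullet_inv N S M0 k (r', M(4 + t := S - M (3 + N - t), 3 + N - t := S - M (4 + t)))"
    if "r' 1 = Suc (4 + t)" "r' 2 = 3 + N - t - 1" "r' 3 = S" "r' 4 = 1"
      "r' 0 = 3 + N - t - 1 + 1 - Suc (4 + t)" for r'
  proof -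
    let ?M = "M(4 + t := S - M (3 + N - t), 3 + N - t := S - M (4 + t))"
    have "?M p = M0 p" if "p < 4" for p using that M(1)[OF that] tN by auto
    moreover have "?M (4 + p) = (if p < Suc t \<or> N \<le> p + Suc t then S - M0 (3 + N - p) else M0 (4 + p))"
      if p: "p < N" for p
    proof -
      consider "3 + N - t = 4 + p" | "p = t" "3 + N - t \<noteq> 4 + p" | "p \<noteq> t" "3 + N - t \<noteq> 4 + p" by blast
      then show ?thesis
      proof cases
        case 1
        then have "N \<le> p + Suc t" "3 + N - p = 4 + t" using tN p by auto
        then show ?thesis using 1 lo by simp
      next
        case 2
        then show ?thesis using hi by simp
      next
        case 3
        then have "(p < Suc t \<or> N \<le> p + Suc t) \<longleftrightarrow> (p < t \<or> N \<le> p + t)" using p tN by auto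
        then show ?thesis using 3 M(2)[OF p] by simp
      qed
    qed
    ultimately show ?thesis
      unfolding bullet_inv_def using that t tN by (auto intro!: exI[of _ "Suc t"])
  qed
  have V: "4 + t \<le> V" "Suc (4 + t) \<le> V" "3 + N - t \<le> V" "3 + N - t - 1 \<le> V" "3 + N - t - 1 + 1 \<le> V" "S \<le> V" "1 \<le> V"
    "M (4 + t) \<le> V" "M (3 + N - t) \<le> V" "S - M (4 + t) \<le> V" "S - M (3 + N - t) \<le> V"
    using N S tN M0 lo hi by auto
  have "run bullet_body (r, M) (2 + (2 + (2 + (2 + (2 + (2 + (2 + (2 + (2 + 2))))))))) (bullet_inv N S M0 k)"
    unfolding bullet_body_def
    by (intro run_Seq run_simple) (simp_all only: fun_upd_apply r, (simp add: V[simplified] V)+, rule fin, simp_all add: r)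
  then show ?thesis using r N tN by simp
qed

lemma bullet_prog_run:
  assumes V: "10 + N + d \<le> V" and M0: "M0 0 = 1" "M0 1 = N + 2" "M0 2 = d" "\<And>p. M0 p \<le> V"
  shows "run bullet_prog (\<lambda>_. 0, M0) (40 + 21 * N) (\<lambda>(r, M). (\<forall>p<4. M p = M0 p) \<and>
    (\<forall>p<N. M (4 + p) = Suc d - M0 (3 + N - p)))"
proof -
  let ?Q = "\<lambda>(r, M). (\<forall>p<4. M p = M0 p) \<and> (\<forall>p<N. M (4 + p) = Suc d - M0 (3 + N - p))"
  let ?K = "(N + 1) div 2"
  have loop: "run (WhilePos 0 bullet_body) s (?K * (20 + 1) + 1) ?Q" if "bullet_inv N (Suc d) M0 ?K s" for s
  proof (rule run_While[where I = "bullet_inv N (Suc d) M0", OF _ _ that])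
    fix r M assume "bullet_inv N (Suc d) M0 0 (r, M)"
    then have "r 0 = N - 2 * ?K" "\<forall>p<4. M p = M0 p"
      "\<forall>p<N. M (4 + p) = (if p < ?K \<or> N \<le> p + ?K then Suc d - M0 (3 + N - p) else M0 (4 + p))"
      unfolding bullet_inv_def by auto
    moreover have "p < ?K \<or> N \<le> p + ?K" for p by linarith
    ultimately show "r 0 = 0 \<and> ?Q (r, M)" by auto
  next
    fix k r M assume "bullet_inv N (Suc d) M0 (Suc k) (r, M)"
    from bullet_body_run[OF _ _ M0(4) this] V
    show "0 < r 0 \<and> r 0 \<le> V \<and> run bullet_body (r, M) 20 (bullet_inv N (Suc d) M0 k)" by simp
  qed
  have init: "bullet_inv N (Suc d) M0 ?K (r', M0)"
    if "r' 1 = 4" "r' 2 = N + 2 + 1" "r' 3 = d + 1" "r' 4 = 1" "r' 0 = N + 2 + 1 + 1 - 4" for r'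
    unfolding bullet_inv_def using that by auto
  have b: "4 \<le> V" "1 \<le> V" "2 \<le> V" "d \<le> V" "d + 1 \<le> V" "N + 2 \<le> V" "N + 2 + 1 \<le> V" "N + 2 + 1 + 1 \<le> V"
    using V by auto
  have "run bullet_prog (\<lambda>_. 0, M0)
     (1 + (1 + (2 + (2 + (1 + (2 + (2 + (2 + (2 + (?K * (20 + 1) + 1)))))))))) ?Q"
    unfolding bullet_prog_def
    by (intro run_Seq run_simple loop init) (simp_all only: fun_upd_apply, (simp add: M0(1-3) M0(2)[simplified] b[simplified] b)+)
  moreover have "?K \<le> N" by linarith
  ultimately show ?thesis by (elim run_mono) simp
qed

end

text \<open>Copies the cells in the order of \<open>ot_cells\<close> behind the input, without
  division: register 1 is the source, register 12 the target. Going up in a column subtracts m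
  (register 8); from the top row the source jumps to the bottom of the next column to the left by
  adding N - m (register 11) and subtracting 1, where N is the number of cells.\<close>

definition ot_move :: ram where
  "ot_move = Seq (Load 5 1) (Seq (Store 12 5) (Seq (Add 12 12 4) (Seq (Sub 6 1 10)
     (Seq (IfPos 6 (Sub 1 1 8) (Seq (Add 1 1 11) (Sub 1 1 4))) (Sub 0 0 4)))))"

text \<open>Reads a copied cell through register 12 and writes the result through register 1. The
  marker 0 becomes m + 1 (register 3) and d + 1 becomes 0. For a letter x the counter at register 14
  plus x, behind the copy where memory is still 0, is increased and its new value written.\<close>

definition ot_count :: ram where
  "ot_count = Seq (Load 5 12) (Seq
     (IfPos 5
       (Seq (Sub 6 15 5) (IfPos 6 (Seq (Add 2 14 5) (Seq (Load 6 2) (Seq (Add 6 6 4) (Store 2 6)))) Skip))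
       (Add 6 3 13))
     (Seq (Store 1 6) (Seq (Add 1 1 4) (Seq (Add 12 12 4) (Sub 0 0 4)))))"

definition ot_init :: ram where
  "ot_init = Seq (Const 4 1) (Seq (Const 5 2) (Seq (Load 7 5) (Seq (Const 6 3) (Seq (Load 8 6)
     (Seq (Load 9 4) (Seq (Sub 9 9 5) (Seq (Add 10 6 8) (Seq (Sub 11 9 8) (Seq (Add 1 6 9)
     (Seq (Add 12 1 4) (Add 0 9 13)))))))))))"

definition ot_mid :: ram where
  "ot_mid = Seq (Const 1 4) (Seq (Add 12 1 9) (Seq (Add 14 12 9) (Seq (Add 15 7 4)
     (Seq (Add 3 8 4) (Add 0 9 13)))))"

definition ot_fin :: ram where
  "ot_fin = Seq (Const 1 2) (Seq (Store 1 8) (Seq (Const 1 3) (Store 1 7)))"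

definition ot_prog :: ram where
  "ot_prog = Seq ot_init (Seq (WhilePos 0 ot_move) (Seq ot_mid (Seq (WhilePos 0 ot_count) ot_fin)))"

text \<open>The columns from right to left, each from bottom to top. This is the row by row order of
  the reflected rectangle.\<close>

definition ot_cells :: "nat \<Rightarrow> nat \<Rightarrow> nat list \<Rightarrow> nat list" where
  "ot_cells d m cs = map (\<lambda>q. cs ! (length cs - 1 - (q mod d * m + q div d))) [0..<length cs]"

text \<open>The reflection interchanges inner and outer cells; the marker for the new outer cells is
  m + 1, as the new rectangle has m rows.\<close>

definition ot_entry :: "nat \<Rightarrow> nat \<Rightarrow> nat list \<Rightarrow> nat \<Rightarrow> nat" where
  "ot_entry d m ts q = (if ts ! q = 0 then Suc m else if ts ! q = Suc d then 0
     else count_list (take (Suc q) ts) (ts ! q))"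

definition ot_arr :: "nat list list \<Rightarrow> nat list list" where
  "ot_arr x = (case hd x of d # m # cs \<Rightarrow>
     [m # d # map (ot_entry d m (ot_cells d m cs)) [0..<length cs]])"

context ram_bound begin

definition move_inv :: "nat \<Rightarrow> nat \<Rightarrow> nat list \<Rightarrow> nat \<Rightarrow> ram_state \<Rightarrow> bool" where
  "move_inv d m cs k s \<longleftrightarrow> (case s of (r, M) \<Rightarrow> \<exists>q. q + k = length cs \<and>
     r 0 = k \<and> (0 < k \<longrightarrow> r 1 = 3 + length cs - (q mod d * m + q div d)) \<and> r 1 \<le> 3 + 2 * length cs \<and>
     r 4 = 1 \<and> r 7 = d \<and> r 8 = m \<and> r 9 = length cs \<and> r 10 = 3 + m \<and> r 11 = length cs - m \<and>
     r 12 = 4 + length cs + q \<and> r 13 = 0 \<and> M 0 = 1 \<and> M 1 = length cs + 2 \<and>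
     (\<forall>p<length cs. M (4 + p) = cs ! p) \<and>
     (\<forall>j<q. M (4 + length cs + j) = ot_cells d m cs ! j) \<and> (\<forall>j\<ge>q. M (4 + length cs + j) = 0))"

lemma ot_move_run:
  assumes V: "20 + 3 * length cs + d + m \<le> V" and cs: "length cs = d * m" "\<forall>c\<in>set cs. c \<le> Suc d"
    and I: "move_inv d m cs (Suc k) (r, M)"
  shows "0 < r 0 \<and> r 0 \<le> V \<and> run ot_move (r, M) 20 (move_inv d m cs k)"
proof -
  let ?N = "length cs"
  obtain q where q: "q + Suc k = ?N" and r: "r 0 = Suc k" "r 1 = 3 + ?N - (q mod d * m + q div d)"
    "r 4 = 1" "r 7 = d" "r 8 = m" "r 9 = ?N" "r 10 = 3 + m" "r 11 = ?N - m" "r 12 = 4 + ?N + q" "r 13 = 0"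
    and M: "M 0 = 1" "M 1 = ?N + 2" "\<And>p. p < ?N \<Longrightarrow> M (4 + p) = cs ! p"
    "\<And>j. j < q \<Longrightarrow> M (4 + ?N + j) = ot_cells d m cs ! j" "\<And>j. j \<ge> q \<Longrightarrow> M (4 + ?N + j) = 0"
    using I unfolding move_inv_def by auto
  have dm: "0 < d" "0 < m" "q < d * m" using q cs by (cases "d = 0"; cases "m = 0"; simp)+
  \<comment> \<open>The cell to be moved lies i rows above the last row and j columns to the left of
    the last column.\<close>
  define i where "i = q mod d" define j where "j = q div d"
  have ij: "i < d" "j < m" using dm by (simp_all add: i_def j_def less_mult_imp_div_less mult.commute)
  have "i * m + j < Suc i * m" using ij by simp
  also have "\<dots> \<le> d * m" using ij by (intro mult_le_mono1) simp
  finally have a: "i * m + j < ?N" using cs by simp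
  have p: "r 1 = 4 + (?N - 1 - (i * m + j))" using r(2) a by (simp add: i_def j_def)
  have val: "M (4 + (?N - 1 - (i * m + j))) = ot_cells d m cs ! q"
    using M(3)[of "?N - 1 - (i * m + j)"] a q by (simp add: ot_cells_def i_def j_def)
  have vle: "ot_cells d m cs ! q \<le> Suc d"
  proof -
    have "ot_cells d m cs ! q = cs ! (?N - 1 - (i * m + j))" using q by (simp add: ot_cells_def i_def j_def)
    moreover have "cs ! (?N - 1 - (i * m + j)) \<in> set cs" using a by (intro nth_mem) simp
    ultimately show ?thesis using cs(2) by simp
  qed
  let ?P = "4 + (?N - 1 - (i * m + j))" let ?M = "M(4 + ?N + q := ot_cells d m cs ! q)"
  have next_ij: "Suc i < d \<Longrightarrow> Suc q mod d = Suc i \<and> Suc q div d = j"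
    "\<not> Suc i < d \<Longrightarrow> Suc q mod d = 0 \<and> Suc q div d = Suc j"
    using ij by (auto simp: i_def j_def mod_Suc div_Suc)
  have mle: "m \<le> ?N" using cs dm by simp
  \<comment> \<open>Addresses up to 3 + m belong to the top row or the header, so the test tells
    whether the column goes on above.\<close>
  have cond: "0 < ?P - (3 + m) \<longleftrightarrow> Suc i < d"
  proof -
    have "0 < ?P - (3 + m) \<longleftrightarrow> Suc i * m + j < ?N" using a by auto
    also have "\<dots> \<longleftrightarrow> Suc i < d"
    proof
      assume "Suc i < d"
      have "Suc i * m + j < Suc (Suc i) * m" using ij by simp
      also have "\<dots> \<le> d * m" using \<open>Suc i < d\<close> by (intro mult_le_mono1) simp
      finally show "Suc i * m + j < ?N" using cs by simp
    next
      assume l: "Suc i * m + j < ?N"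
      show "Suc i < d"
      proof (rule ccontr)
        assume "\<not> Suc i < d"
        then have "d * m \<le> Suc i * m" by (intro mult_le_mono1) simp
        then show False using l cs by simp
      qed
    qed
    finally show ?thesis .
  qed
  have mem: "?M 0 = 1" "?M 1 = ?N + 2" "\<forall>p<?N. ?M (4 + p) = cs ! p"
    "\<forall>j<Suc q. ?M (4 + ?N + j) = ot_cells d m cs ! j" "\<forall>j\<ge>Suc q. ?M (4 + ?N + j) = 0"
    using M by (auto simp: less_Suc_eq)
  have fin: "move_inv d m cs k (r', ?M)"
    if "r' 0 = k" "Suc i < d \<Longrightarrow> r' 1 = ?P - m" "\<not> Suc i < d \<Longrightarrow> r' 1 = ?P + (?N - m) - 1"
      "r' 4 = 1" "r' 7 = d" "r' 8 = m" "r' 9 = ?N" "r' 10 = 3 + m" "r' 11 = ?N - m" "r' 12 = Suc (4 + ?N + q)" "r' 13 = 0"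
    for r'
    unfolding move_inv_def prod.case
  proof (intro exI[of _ "Suc q"] conjI impI)
    assume k: "0 < k"
    show "r' 1 = 3 + ?N - (Suc q mod d * m + Suc q div d)"
    proof (cases "Suc i < d")
      case True
      then show ?thesis using that(2) next_ij(1) a by simp
    next
      case False
      then have "d = Suc i" using ij by simp
      then have "?N = i * m + m" using cs by simp
      then show ?thesis using that(3) next_ij(2) False a by simp
    qed
  next
    show "r' 1 \<le> 3 + 2 * ?N" using that(2,3) a by (cases "Suc i < d") auto
  qed (use that mem q in auto)
  have b: "?P \<le> V" "?P - m \<le> V" "?P - (3 + m) \<le> V" "?P + (?N - m) \<le> V" "m \<le> V" "3 + m \<le> V" "?N - m \<le> V" "1 \<le> V" "Suc k \<le> V"
    "4 + ?N + q \<le> V" "ot_cells d m cs ! q \<le> V" using V vle q by auto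
  have mid: "run (Seq (IfPos 6 (Sub 1 1 8) (Seq (Add 1 1 11) (Sub 1 1 4))) (Sub 0 0 4)) (r', ?M)
      ((1 + (2 + (2 + 2))) + 2) (move_inv d m cs k)"
    if r': "r' 0 = Suc k" "r' 1 = ?P" "r' 6 = z" "r' 4 = 1" "r' 7 = d" "r' 8 = m" "r' 9 = ?N" "r' 10 = 3 + m"
      "r' 11 = ?N - m" "r' 12 = Suc (4 + ?N + q)" "r' 13 = 0" and z: "0 < z \<longleftrightarrow> Suc i < d" "z \<le> V" for r' z
    by (intro run_Seq run_IfPos run_simple)
       (simp_all only: fun_upd_apply r', ((simp add: b[simplified] b z; fail) | rule fin
         | (simp add: r' r'[simplified]; fail) | (use z in \<open>simp add: r' r'[simplified]\<close>; fail))+)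
  let ?R = "Seq (IfPos 6 (Sub 1 1 8) (Seq (Add 1 1 11) (Sub 1 1 4))) (Sub 0 0 4)"
  let ?v = "ot_cells d m cs ! q"
  have s4: "run (Seq (Sub 6 1 10) ?R) (r(5 := ?v, 12 := Suc (4 + ?N + q)), ?M) (2 + ((1 + (2 + (2 + 2))) + 2)) (move_inv d m cs k)"
  proof (rule run_Seq, rule run_Sub)
    show "run ?R ((r(5 := ?v, 12 := Suc (4 + ?N + q)))(6 := (r(5 := ?v, 12 := Suc (4 + ?N + q))) 1 -
        (r(5 := ?v, 12 := Suc (4 + ?N + q))) 10), ?M) ((1 + (2 + (2 + 2))) + 2) (move_inv d m cs k)"
      by (rule mid[of _ "?P - (3 + m)"]) (use b cond in \<open>simp_all add: r p p[simplified]\<close>)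
  qed (use b in \<open>simp_all add: r p p[simplified]\<close>)
  have s3: "run (Seq (Add 12 12 4) (Seq (Sub 6 1 10) ?R)) (r(5 := ?v), ?M) (2 + (2 + ((1 + (2 + (2 + 2))) + 2))) (move_inv d m cs k)"
    by (rule run_Seq, rule run_Add) (use b s4 in \<open>simp_all add: r\<close>)
  have s2: "run (Seq (Store 12 5) (Seq (Add 12 12 4) (Seq (Sub 6 1 10) ?R))) (r(5 := ?v), M)
      (2 + (2 + (2 + ((1 + (2 + (2 + 2))) + 2)))) (move_inv d m cs k)"
  proof (rule run_Seq, rule run_Store)
    have "(r(5 := ?v)) 12 = 4 + ?N + q" "(r(5 := ?v)) 5 = ?v" by (simp_all add: r)
    with s3 show "run (Seq (Add 12 12 4) (Seq (Sub 6 1 10) ?R)) (r(5 := ?v), M((r(5 := ?v)) 12 := (r(5 := ?v)) 5))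
      (2 + (2 + ((1 + (2 + (2 + 2))) + 2))) (move_inv d m cs k)" by (simp only:)
  qed (use b in \<open>simp_all add: r\<close>)
  have "run ot_move (r, M) (2 + (2 + (2 + (2 + ((1 + (2 + (2 + 2))) + 2))))) (move_inv d m cs k)"
    unfolding ot_move_def
  proof (rule run_Seq, rule run_Load)
    show "r 1 \<le> V" using p b by simp
    have "M (r 1) = ?v" using p val by (simp only:)
    with s2 b show "M (r 1) \<le> V" "run (Seq (Store 12 5) (Seq (Add 12 12 4) (Seq (Sub 6 1 10) ?R))) (r(5 := M (r 1)), M)
      (2 + (2 + (2 + ((1 + (2 + (2 + 2))) + 2)))) (move_inv d m cs k)" by (simp_all only:)
  qed
  then show ?thesis using r V q by (auto elim!: run_mono)
qed

definition count_inv :: "nat \<Rightarrow> nat \<Rightarrow> nat list \<Rightarrow> nat \<Rightarrow> ram_state \<Rightarrow> bool" where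
  "count_inv d m ts k s \<longleftrightarrow> (case s of (r, M) \<Rightarrow> \<exists>q. q + k = length ts \<and>
     r 0 = k \<and> r 1 = 4 + q \<and> r 3 = m + 1 \<and> r 4 = 1 \<and> r 7 = d \<and> r 8 = m \<and>
     r 12 = 4 + length ts + q \<and> r 13 = 0 \<and> r 14 = 4 + length ts + length ts \<and> r 15 = d + 1 \<and>
     M 0 = 1 \<and> M 1 = length ts + 2 \<and>
     (\<forall>j<length ts. M (4 + length ts + j) = ts ! j) \<and> (\<forall>j<q. M (4 + j) = ot_entry d m ts j) \<and>
     (\<forall>x. 1 \<le> x \<and> x \<le> d \<longrightarrow> M (4 + length ts + length ts + x) = count_list (take q ts) x))"

lemma ot_count_run:
  assumes V: "20 + 3 * length ts + d + m \<le> V" and ts: "\<forall>c\<in>set ts. c \<le> Suc d"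
    and I: "count_inv d m ts (Suc k) (r, M)"
  shows "0 < r 0 \<and> r 0 \<le> V \<and> run ot_count (r, M) 30 (count_inv d m ts k)"
proof -
  let ?N = "length ts"
  obtain q where q: "q + Suc k = ?N" and r: "r 0 = Suc k" "r 1 = 4 + q" "r 3 = m + 1" "r 4 = 1"
    "r 7 = d" "r 8 = m" "r 12 = 4 + ?N + q" "r 13 = 0" "r 14 = 4 + ?N + ?N" "r 15 = d + 1"
    and M: "M 0 = 1" "M 1 = ?N + 2" "\<And>j. j < ?N \<Longrightarrow> M (4 + ?N + j) = ts ! j"
    "\<And>j. j < q \<Longrightarrow> M (4 + j) = ot_entry d m ts j"
    "\<And>x. 1 \<le> x \<and> x \<le> d \<Longrightarrow> M (4 + ?N + ?N + x) = count_list (take q ts) x"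
    using I unfolding count_inv_def by auto
  define x where "x = ts ! q"
  have qN: "q < ?N" using q by simp
  have xd: "x \<le> Suc d" using ts qN nth_mem unfolding x_def by blast
  have val: "M (4 + ?N + q) = x" using M(3)[OF qN] by (simp add: x_def)
  have tk: "count_list (take (Suc q) ts) y = count_list (take q ts) y + (if y = x then 1 else 0)" for y
    using qN by (simp add: take_Suc_conv_app_nth x_def)
  define C where "C = M (4 + ?N + ?N + x)"
  have regs: "count_inv d m ts k (r', M')"
    if "r' 0 = k" "r' 1 = Suc (4 + q)" "r' 3 = m + 1" "r' 4 = 1" "r' 7 = d" "r' 8 = m" "r' 12 = Suc (4 + ?N + q)"
      "r' 13 = 0" "r' 14 = 4 + ?N + ?N" "r' 15 = d + 1" "M' 0 = 1" "M' 1 = ?N + 2"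
      "\<And>j. j < ?N \<Longrightarrow> M' (4 + ?N + j) = ts ! j" "\<And>j. j < Suc q \<Longrightarrow> M' (4 + j) = ot_entry d m ts j"
      "\<And>y. 1 \<le> y \<and> y \<le> d \<Longrightarrow> M' (4 + ?N + ?N + y) = count_list (take (Suc q) ts) y" for r' M'
    unfolding count_inv_def prod.case using that q by (intro exI[of _ "Suc q"]) auto
  have fin1: "count_inv d m ts k (r', M(4 + q := e))"
    if "x = 0 \<or> x = Suc d" "e = (if x = 0 then Suc m else 0)"
      "r' 0 = k" "r' 1 = Suc (4 + q)" "r' 3 = m + 1" "r' 4 = 1" "r' 7 = d" "r' 8 = m" "r' 12 = Suc (4 + ?N + q)"
      "r' 13 = 0" "r' 14 = 4 + ?N + ?N" "r' 15 = d + 1" for r' e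
  proof (rule regs)
    show "(M(4 + q := e)) (4 + j) = ot_entry d m ts j" if "j < Suc q" for j
      using that M(4)[of j] \<open>x = 0 \<or> x = Suc d\<close> \<open>e = _\<close> by (auto simp: ot_entry_def x_def less_Suc_eq)
    show "(M(4 + q := e)) (4 + ?N + ?N + y) = count_list (take (Suc q) ts) y" if "1 \<le> y \<and> y \<le> d" for y
      using M(5)[OF that] that \<open>x = 0 \<or> x = Suc d\<close> qN by (auto simp: tk)
  qed (use that M qN in auto)
  have fin2: "count_inv d m ts k (r', M(4 + ?N + ?N + x := C + 1, 4 + q := C + 1))"
    if "1 \<le> x" "x \<le> d"
      "r' 0 = k" "r' 1 = Suc (4 + q)" "r' 3 = m + 1" "r' 4 = 1" "r' 7 = d" "r' 8 = m" "r' 12 = Suc (4 + ?N + q)"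
      "r' 13 = 0" "r' 14 = 4 + ?N + ?N" "r' 15 = d + 1" for r'
  proof (rule regs)
    let ?M = "M(4 + ?N + ?N + x := C + 1, 4 + q := C + 1)"
    have C: "C = count_list (take q ts) x" using M(5)[of x] that by (simp add: C_def)
    have "ot_entry d m ts q = count_list (take (Suc q) ts) x"
      using \<open>1 \<le> x\<close> \<open>x \<le> d\<close> by (simp add: ot_entry_def del: take_Suc flip: x_def)
    then have e: "ot_entry d m ts q = C + 1" by (simp add: tk C)
    show "?M (4 + j) = ot_entry d m ts j" if "j < Suc q" for j
      using that M(4)[of j] e qN by (auto simp: less_Suc_eq)
    show "?M (4 + ?N + ?N + y) = count_list (take (Suc q) ts) y" if "1 \<le> y \<and> y \<le> d" for y
      using M(5)[OF that] qN by (auto simp: tk C)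
    show "?M (4 + ?N + j) = ts ! j" if "j < ?N" for j
      using that M(3)[OF that] qN \<open>1 \<le> x\<close> by auto
  qed (use that M qN in auto)
  \<comment> \<open>A counter never exceeds the number of cells and therefore stays within
    V.\<close>
  have CV: "0 < x \<Longrightarrow> 0 < d + 1 - x \<Longrightarrow> C \<le> V \<and> C + 1 \<le> V"
  proof -
    assume "0 < x" "0 < d + 1 - x"
    then have "C = count_list (take q ts) x" using M(5)[of x] by (simp add: C_def)
    also have "\<dots> \<le> ?N" using count_le_length[of "take q ts" x] qN by simp
    finally show ?thesis using V by simp
  qed
  have b: "4 + ?N + q \<le> V" "Suc (4 + ?N + q) \<le> V" "4 + q \<le> V" "Suc (4 + q) \<le> V" "d + 1 \<le> V" "m + 1 \<le> V"
    "4 + ?N + ?N \<le> V" "4 + ?N + ?N + x \<le> V" "x \<le> V" "d + 1 - x \<le> V" "1 \<le> V" "Suc k \<le> V" "0 \<le> V"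
    using V xd q by auto
  have "run ot_count (r, M) (2 + ((1 + ((2 + (1 + ((2 + (2 + (2 + 2))) + 1))) + 2)) + (2 + (2 + (2 + 2)))))
    (count_inv d m ts k)"
  proof -
    have tail: "run (Seq (Store 1 6) (Seq (Add 1 1 4) (Seq (Add 12 12 4) (Sub 0 0 4)))) (r', M') (2 + (2 + (2 + 2)))
        (count_inv d m ts k)"
      if "x = 0 \<and> r' 6 = m + 1 \<and> M' = M \<or> x = d + 1 \<and> r' 6 = 0 \<and> M' = M \<or>
          0 < x \<and> x < d + 1 \<and> r' 6 = C + 1 \<and> M' = M(4 + ?N + ?N + x := C + 1)"
        and r': "r' 0 = Suc k" "r' 1 = 4 + q" "r' 3 = m + 1" "r' 4 = 1" "r' 7 = d" "r' 8 = m" "r' 12 = 4 + ?N + q"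
          "r' 13 = 0" "r' 14 = 4 + ?N + ?N" "r' 15 = d + 1" for r' M'
      using that(1)
    proof (elim disjE conjE)
      assume a: "x = 0" "r' 6 = m + 1" "M' = M"
      show ?thesis unfolding a(3)
        by (intro run_Seq run_simple) (simp_all only: fun_upd_apply r' a(2), (simp add: b[simplified] b)+, rule fin1, simp_all add: r' a)
    next
      assume a: "x = d + 1" "r' 6 = 0" "M' = M"
      show ?thesis unfolding a(3)
        by (intro run_Seq run_simple) (simp_all only: fun_upd_apply r' a(2), (simp add: b[simplified] b)+, rule fin1, simp_all add: r' a)
    next
      assume a: "0 < x" "x < d + 1" "r' 6 = C + 1" "M' = M(4 + ?N + ?N + x := C + 1)"
      have "C + 1 \<le> V" using CV a by simp
      then show ?thesis unfolding a(4)
        by (intro run_Seq run_simple) (simp_all only: fun_upd_apply r' a(3), (simp add: b[simplified] b)+, rule fin2[simplified], use a in \<open>simp_all add: r' a Suc_le_eq\<close>)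
    qed
    have inc: "run (Seq (Add 2 14 5) (Seq (Load 6 2) (Seq (Add 6 6 4) (Store 2 6)))) (r', M) (2 + (2 + (2 + 2))) Q"
      if r': "r' 14 = 4 + ?N + ?N" "r' 5 = x" "r' 4 = 1" "0 < x" "x < d + 1"
        and Q: "\<And>r''. \<forall>a. a \<noteq> 2 \<longrightarrow> a \<noteq> 6 \<longrightarrow> r'' a = r' a \<Longrightarrow> r'' 6 = C + 1 \<Longrightarrow> Q (r'', M(4 + ?N + ?N + x := C + 1))"
      for r' Q
    proof -
      have cv: "C \<le> V" "C + 1 \<le> V" using CV r' by auto
      let ?A = "4 + ?N + ?N + x"
      have st: "run (Store 2 6) (r'(2 := ?A, 6 := C, 6 := C + 1), M) 2 Q"
        by (rule run_Store) (use cv b Q in auto)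
      have ad: "run (Seq (Add 6 6 4) (Store 2 6)) (r'(2 := ?A, 6 := C), M) (2 + 2) Q"
        by (rule run_Seq, rule run_Add) (use cv b r' st in auto)
      have ld: "run (Seq (Load 6 2) (Seq (Add 6 6 4) (Store 2 6))) (r'(2 := ?A), M) (2 + (2 + 2)) Q"
        by (rule run_Seq, rule run_Load) (use cv b r' ad in \<open>auto simp: C_def\<close>)
      show ?thesis
        by (rule run_Seq, rule run_Add) (use b r' ld in auto)
    qed
    let ?T = "Seq (Store 1 6) (Seq (Add 1 1 4) (Seq (Add 12 12 4) (Sub 0 0 4)))"
    let ?Q = "\<lambda>s. run ?T s (2 + (2 + (2 + 2))) (count_inv d m ts k)"
    have br: "run (IfPos 5 (Seq (Sub 6 15 5) (IfPos 6 (Seq (Add 2 14 5) (Seq (Load 6 2) (Seq (Add 6 6 4) (Store 2 6)))) Skip))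
        (Add 6 3 13)) (r(5 := x), M) (1 + ((2 + (1 + ((2 + (2 + (2 + 2))) + 1))) + 2)) ?Q"
    proof (rule run_IfPos)
      show "(r(5 := x)) 5 \<le> V" using b by simp
      assume x0: "0 < (r(5 := x)) 5"
      have "run (IfPos 6 (Seq (Add 2 14 5) (Seq (Load 6 2) (Seq (Add 6 6 4) (Store 2 6)))) Skip)
        (r(5 := x, 6 := d + 1 - x), M) (1 + ((2 + (2 + (2 + 2))) + 1)) ?Q"
      proof (rule run_IfPos)
        show "(r(5 := x, 6 := d + 1 - x)) 6 \<le> V" using b by simp
        assume "0 < (r(5 := x, 6 := d + 1 - x)) 6"
        then have xl: "x < d + 1" by simp
        show "run (Seq (Add 2 14 5) (Seq (Load 6 2) (Seq (Add 6 6 4) (Store 2 6)))) (r(5 := x, 6 := d + 1 - x), M)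
          (2 + (2 + (2 + 2))) ?Q"
        proof (rule inc)
          fix r'' assume h: "\<forall>a. a \<noteq> 2 \<longrightarrow> a \<noteq> 6 \<longrightarrow> r'' a = (r(5 := x, 6 := d + 1 - x)) a" "r'' 6 = C + 1"
          show "?Q (r'', M(4 + ?N + ?N + x := C + 1))"
            by (rule tail) (use h x0 xl in \<open>simp_all add: r r(2)[simplified]\<close>)
        qed (use r x0 xl in simp_all)
      next
        assume "(r(5 := x, 6 := d + 1 - x)) 6 = 0"
        then have "x = d + 1" using xd by simp
        then show "run Skip (r(5 := x, 6 := d + 1 - x), M) 1 ?Q"
          by (intro run_Skip tail) (simp_all add: r r(2)[simplified])
      qed
      then show "run (Seq (Sub 6 15 5) (IfPos 6 (Seq (Add 2 14 5) (Seq (Load 6 2) (Seq (Add 6 6 4) (Store 2 6)))) Skip))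
        (r(5 := x), M) (2 + (1 + ((2 + (2 + (2 + 2))) + 1))) ?Q"
        by (intro run_Seq run_Sub) (use b r in simp_all)
    next
      assume "(r(5 := x)) 5 = 0"
      then have "x = 0" by simp
      then show "run (Add 6 3 13) (r(5 := x), M) 2 ?Q"
        by (intro run_Add tail) (use b r r(2)[simplified] in simp_all)
    qed
    show ?thesis
      unfolding ot_count_def
    proof (rule run_Seq, rule run_Load)
      show "r 12 \<le> V" "M (r 12) \<le> V" using r val b by auto
      have "run (Seq (IfPos 5 (Seq (Sub 6 15 5) (IfPos 6 (Seq (Add 2 14 5) (Seq (Load 6 2) (Seq (Add 6 6 4) (Store 2 6)))) Skip))
        (Add 6 3 13)) ?T) (r(5 := x), M) ((1 + ((2 + (1 + ((2 + (2 + (2 + 2))) + 1))) + 2)) + (2 + (2 + (2 + 2)))) (count_inv d m ts k)"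
        by (rule run_Seq[OF br])
      then show "run (Seq (IfPos 5 (Seq (Sub 6 15 5) (IfPos 6 (Seq (Add 2 14 5) (Seq (Load 6 2) (Seq (Add 6 6 4) (Store 2 6)))) Skip))
        (Add 6 3 13)) ?T) (r(5 := M (r 12)), M) ((1 + ((2 + (1 + ((2 + (2 + (2 + 2))) + 1))) + 2)) + (2 + (2 + (2 + 2)))) (count_inv d m ts k)"
        by (simp only: r(7) val)
    qed
  qed
  then show ?thesis using r V q by (auto elim!: run_mono)
qed

end

lemma length_ot_cells [simp]: "length (ot_cells d m cs) = length cs"
  by (simp add: ot_cells_def)

lemma ot_cells_le:
  assumes "length cs = d * m" "\<forall>c\<in>set cs. c \<le> Suc d"
  shows "\<forall>c\<in>set (ot_cells d m cs). c \<le> Suc d"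
proof
  fix c assume "c \<in> set (ot_cells d m cs)"
  then obtain q where "q < length cs" "c = cs ! (length cs - 1 - (q mod d * m + q div d))"
    by (auto simp: ot_cells_def)
  moreover from this have "c \<in> set cs" by (auto intro!: nth_mem)
  ultimately show "c \<le> Suc d" using assms(2) by blast
qed

context ram_bound begin

lemma run_weaken: "run c s n P \<Longrightarrow> (\<And>s. P s \<Longrightarrow> Q s) \<Longrightarrow> run c s n Q"
  unfolding run_def by blast

lemma run_eq:
  "n \<le> V \<Longrightarrow> Q (r(a := n), M) \<Longrightarrow> run (Const a n) (r, M) 1 Q"
  "r b = x \<Longrightarrow> r c = y \<Longrightarrow> x \<le> V \<Longrightarrow> y \<le> V \<Longrightarrow> Q (r(a := x + y), M) \<Longrightarrow> run (Add a b c) (r, M) 2 Q"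
  "r b = x \<Longrightarrow> r c = y \<Longrightarrow> x \<le> V \<Longrightarrow> y \<le> V \<Longrightarrow> Q (r(a := x - y), M) \<Longrightarrow> run (Sub a b c) (r, M) 2 Q"
  "r b = x \<Longrightarrow> M x = y \<Longrightarrow> x \<le> V \<Longrightarrow> y \<le> V \<Longrightarrow> Q (r(a := y), M) \<Longrightarrow> run (Load a b) (r, M) 2 Q"
  by (blast intro: run_simple)+

text \<open>The phases are chained through their postconditions: each loop ends in a state from
  which the remaining program runs.\<close>

lemma ot_prog_run:
  assumes V: "40 + 3 * length cs + d + m \<le> V" and cs: "length cs = d * m" "\<forall>c\<in>set cs. c \<le> Suc d"
    and M0: "M0 0 = 1" "M0 1 = length cs + 2" "M0 2 = d" "M0 3 = m" "\<And>p. p < length cs \<Longrightarrow> M0 (4 + p) = cs ! p"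
      "\<And>p. 4 + length cs \<le> p \<Longrightarrow> M0 p = 0"
  shows "run ot_prog (\<lambda>_. 0, M0) (60 + 52 * length cs) (\<lambda>(r, M). M 0 = 1 \<and> M 1 = length cs + 2 \<and>
    M 2 = m \<and> M 3 = d \<and> (\<forall>p<length cs. M (4 + p) = ot_entry d m (ot_cells d m cs) p))"
proof -
  let ?N = "length cs" let ?ts = "ot_cells d m cs"
  define Q where "Q = (\<lambda>(r :: nat \<Rightarrow> nat, M). M 0 = 1 \<and> M 1 = ?N + 2 \<and>
    M 2 = m \<and> M 3 = d \<and> (\<forall>p<?N. M (4 + p) = ot_entry d m ?ts p))"
  have b: "1 \<le> V" "2 \<le> V" "3 \<le> V" "4 \<le> V" "d \<le> V" "m \<le> V" "?N \<le> V" "?N + 2 \<le> V" "3 + m \<le> V" "3 + ?N \<le> V"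
    "4 + ?N \<le> V" "4 + ?N + ?N \<le> V" "d + 1 \<le> V" "m + 1 \<le> V" "0 \<le> V" using V by auto
  have fin: "run ot_fin (r, M) (1 + (2 + (1 + 2))) Q" if I: "count_inv d m ?ts 0 (r, M)" for r M
  proof -
    have r: "r 7 = d" "r 8 = m" and M: "M 0 = 1" "M 1 = ?N + 2" "\<forall>j<?N. M (4 + j) = ot_entry d m ?ts j"
      using I unfolding count_inv_def by auto
    have "Q (r', M(2 := m, 3 := d))" for r' using M by (auto simp: Q_def)
    then show ?thesis
      unfolding ot_fin_def by (intro run_Seq run_simple) (use b in \<open>simp_all add: r\<close>)
  qed
  have loop2: "run (WhilePos 0 ot_count) s (?N * (30 + 1) + 1) (\<lambda>s. run ot_fin s (1 + (2 + (1 + 2))) Q)"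
    if "count_inv d m ?ts ?N s" for s
  proof (rule run_While[where I = "count_inv d m ?ts", OF _ _ that])
    fix r M assume i: "count_inv d m ?ts 0 (r, M)"
    then have "r 0 = 0" unfolding count_inv_def by auto
    then show "r 0 = 0 \<and> run ot_fin (r, M) (1 + (2 + (1 + 2))) Q" using fin[OF i] by simp
  next
    fix k r M assume "count_inv d m ?ts (Suc k) (r, M)"
    from ot_count_run[OF _ ot_cells_le[OF cs] this] V
    show "0 < r 0 \<and> r 0 \<le> V \<and> run ot_count (r, M) 30 (count_inv d m ?ts k)" by simp
  qed
  let ?C = "Seq (WhilePos 0 ot_count) ot_fin" and ?nC = "(?N * (30 + 1) + 1) + (1 + (2 + (1 + 2)))"
  have rest2: "run ?C s ?nC Q" if "count_inv d m ?ts ?N s" for s by (rule run_Seq[OF loop2[OF that]])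
  let ?nM = "1 + (2 + (2 + (2 + (2 + 2))))"
  have mid: "run (Seq ot_mid ?C) (r, M) (?nM + ?nC) Q" if I: "move_inv d m cs 0 (r, M)" for r M
  proof -
    have r: "r 4 = 1" "r 7 = d" "r 8 = m" "r 9 = ?N" "r 13 = 0"
      and M: "M 0 = 1" "M 1 = ?N + 2" "\<And>j. j < ?N \<Longrightarrow> M (4 + ?N + j) = ?ts ! j" "\<And>j. j \<ge> ?N \<Longrightarrow> M (4 + ?N + j) = 0"
      using I unfolding move_inv_def by auto
    have inv: "count_inv d m ?ts ?N (r', M)"
      if "r' 0 = ?N" "r' 1 = 4" "r' 3 = m + 1" "r' 4 = 1" "r' 7 = d" "r' 8 = m" "r' 12 = 4 + ?N" "r' 13 = 0"
        "r' 14 = 4 + ?N + ?N" "r' 15 = d + 1" for r'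
      unfolding count_inv_def prod.case
    proof (intro exI[of _ 0] conjI)
      show "\<forall>x. 1 \<le> x \<and> x \<le> d \<longrightarrow> M (4 + length ?ts + length ?ts + x) = count_list (take 0 ?ts) x"
        using M(4)[of "?N + x" for x] by (simp add: add.assoc)
    qed (use that M in auto)
    have "run ot_mid (r, M) ?nM (count_inv d m ?ts ?N)"
      unfolding ot_mid_def by (intro run_Seq run_simple; (rule inv)?; simp add: r b b(1)[simplified])
    then have "run ot_mid (r, M) ?nM (\<lambda>s. run ?C s ?nC Q)" by (rule run_weaken) (rule rest2)
    then show ?thesis by (rule run_Seq)
  qed
  have loop1: "run (WhilePos 0 ot_move) s (?N * (20 + 1) + 1) (\<lambda>s. run (Seq ot_mid ?C) s (?nM + ?nC) Q)"
    if "move_inv d m cs ?N s" for s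
  proof (rule run_While[where I = "move_inv d m cs", OF _ _ that])
    fix r M assume i: "move_inv d m cs 0 (r, M)"
    then have "r 0 = 0" unfolding move_inv_def by auto
    then show "r 0 = 0 \<and> run (Seq ot_mid ?C) (r, M) (?nM + ?nC) Q" using mid[OF i] by simp
  next
    fix k r M assume "move_inv d m cs (Suc k) (r, M)"
    from ot_move_run[OF _ cs this] V
    show "0 < r 0 \<and> r 0 \<le> V \<and> run ot_move (r, M) 20 (move_inv d m cs k)" by simp
  qed
  let ?D = "Seq (WhilePos 0 ot_move) (Seq ot_mid ?C)" and ?nD = "(?N * (20 + 1) + 1) + (?nM + ?nC)"
  have rest1: "run ?D s ?nD Q" if "move_inv d m cs ?N s" for s by (rule run_Seq[OF loop1[OF that]])
  have inv: "move_inv d m cs ?N (r', M0)"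
    if "r' 0 = ?N" "r' 1 = 3 + ?N" "r' 4 = 1" "r' 7 = d" "r' 8 = m" "r' 9 = ?N" "r' 10 = 3 + m" "r' 11 = ?N - m"
      "r' 12 = 4 + ?N" "r' 13 = 0" for r'
    unfolding move_inv_def prod.case using that M0 by (intro exI[of _ 0] conjI) auto
  let ?nI = "1 + (1 + (2 + (1 + (2 + (2 + (2 + (2 + (2 + (2 + (2 + 2))))))))))"
  have "run ot_init (\<lambda>_. 0, M0) ?nI (move_inv d m cs ?N)"
    unfolding ot_init_def by (intro run_Seq run_eq; (rule inv)?)
      ((simp add: b[simplified] b M0(1,3,4) M0(2)[simplified]; fail)+)
  then have "run ot_init (\<lambda>_. 0, M0) ?nI (\<lambda>s. run ?D s ?nD Q)" by (rule run_weaken) (rule rest1)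
  then have "run ot_prog (\<lambda>_. 0, M0) (?nI + ?nD) Q" unfolding ot_prog_def by (rule run_Seq)
  then show ?thesis unfolding Q_def by (rule run_mono) simp
qed

end

section \<open>Costs in terms of the bit size\<close>

definition well_sized :: "nat list list \<Rightarrow> bool" where
  "well_sized x \<longleftrightarrow> (\<exists>d m cs. x = [d # m # cs] \<and> length cs = d * m \<and> (\<forall>c\<in>set cs. c \<le> Suc d))"

lemma le_power_log:
  fixes \<mu> b :: nat
  assumes "1 \<le> \<mu>" "b = nat \<lceil>log 2 (real \<mu>) + 1\<rceil>"
  shows "1 \<le> b" "2 * \<mu> \<le> 2 ^ b"
proof -
  have "0 \<le> log 2 (real \<mu>)" using assms(1) by simp
  then have lb: "log 2 (real \<mu>) + 1 \<le> real b" "1 \<le> b" using assms(2) by linarith+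
  show "1 \<le> b" by fact
  have "real \<mu> \<le> 2 powr (real b - 1)"
    using lb(1) assms(1) by (subst log_le_iff[symmetric]) auto
  also have "2 powr (real b - 1) = 2 ^ b / 2" by (simp add: powr_diff powr_realpow)
  finally have "real (2 * \<mu>) \<le> real (2 ^ b)" by simp
  then show "2 * \<mu> \<le> 2 ^ b" by (simp only: of_nat_le_iff)
qed

text \<open>All numbers are at most 45 \<mu>\<mu> < 16 (2 \<mu>)(2 \<mu>), where 2 \<mu> is at most
  the b-th power of 2. So they have at most 4 + 2 b bits, which is at most 6 b because b is
  positive.\<close>

lemma ram_bound_bits:
  assumes \<mu>: "1 \<le> \<mu>" "d \<le> \<mu>" "m \<le> \<mu>" and b: "b = nat \<lceil>log 2 (real \<mu>) + 1\<rceil>"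
  shows "ram_bound (40 + 3 * (d * m) + d + m) (6 * b)"
proof
  fix x assume x: "x \<le> 40 + 3 * (d * m) + d + m"
  note B = le_power_log[OF \<mu>(1) b]
  have sq: "d * m \<le> \<mu> * \<mu>" "\<mu> \<le> \<mu> * \<mu>" "1 \<le> \<mu> * \<mu>" using \<mu> by (auto intro: mult_le_mono)
  have "x \<le> 45 * (\<mu> * \<mu>)" using x sq \<mu> by linarith
  also have "\<dots> < 16 * ((2 * \<mu>) * (2 * \<mu>))" using \<mu>(1) by simp
  also have "\<dots> \<le> 16 * (2 ^ b * 2 ^ b)" using B(2) by (intro mult_le_mono) auto
  also have "\<dots> = 2 ^ (4 + (b + b))" by (simp only: power_add) simp
  also have "\<dots> \<le> 2 ^ (6 * b)" using B(1) by (intro power_increasing) linarith+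
  finally have "floorlog 2 x \<le> 6 * b" by (intro floorlog_leI) auto
  then show "bits x \<le> 6 * b" using B(1) by (simp add: bits_def)
qed

lemma layout_single: "layout [D] = 1 # length D # D"
  by (simp add: layout_def)

lemma input_state_single:
  "input_state [d # m # cs] = (\<lambda>_. 0, snd (input_state [d # m # cs]))"
  "snd (input_state [d # m # cs]) 0 = 1" "snd (input_state [d # m # cs]) 1 = length cs + 2"
  "snd (input_state [d # m # cs]) 2 = d" "snd (input_state [d # m # cs]) 3 = m"
  "p < length cs \<Longrightarrow> snd (input_state [d # m # cs]) (4 + p) = cs ! p"
  "4 + length cs \<le> q \<Longrightarrow> snd (input_state [d # m # cs]) q = 0"
  by (auto simp: input_state_def layout_single nth_Cons' numeral_eq_Suc)

lemma output_in_single: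
  assumes "M 0 = 1" "M 1 = length cs + 2" "M 2 = d" "M 3 = m" "\<And>p. p < length cs \<Longrightarrow> M (4 + p) = cs ! p"
  shows "output_in [d # m # cs] (r, M)"
  unfolding output_in_def
proof (intro allI impI)
  fix p assume p: "p < length (layout [d # m # cs])"
  consider "p = 0" | "p = 1" | "p = 2" | "p = 3" | q where "p = 4 + q" "q < length cs"
  proof -
    have "p < 4 \<or> (\<exists>q. p = 4 + q \<and> q < length cs)"
      using p by (cases "p < 4") (auto simp: layout_single intro!: exI[of _ "p - 4"])
    then show thesis using that by (auto simp: less_Suc_eq numeral_eq_Suc)
  qed
  then show "snd (r, M) p = layout [d # m # cs] ! p"
    using assms by cases (auto simp: layout_single numeral_eq_Suc)
qed

text \<open>The bit size is the number of cells plus 2, times b. A number of units linear in the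
  number of cells, each of size 6 b, is therefore linear in the bit size.\<close>

lemma linear_costI:
  assumes A: "\<And>x. x \<in> A \<Longrightarrow> well_sized x"
    and run: "\<And>V \<beta> d m cs. ram_bound V \<beta> \<Longrightarrow> 40 + 3 * length cs + d + m \<le> V \<Longrightarrow> length cs = d * m \<Longrightarrow>
      (\<forall>c\<in>set cs. c \<le> Suc d) \<Longrightarrow>
      ram_bound.run \<beta> c (input_state [d # m # cs]) (n * (length cs + 2)) (output_in (f [d # m # cs]))"
  shows "linear_cost A f"
  unfolding linear_cost_def
proof (rule exI[of _ c], rule exI[of _ "6 * n"], rule ballI)
  fix x assume "x \<in> A"
  then obtain d m cs where x: "x = [d # m # cs]" "length cs = d * m" "\<forall>c\<in>set cs. c \<le> Suc d"
    using A unfolding well_sized_def by blast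
  define \<mu> where "\<mu> = Max (insert 1 (set (d # m # cs)))"
  define b where "b = nat \<lceil>log 2 (real \<mu>) + 1\<rceil>"
  have "1 \<le> \<mu>" "d \<le> \<mu>" "m \<le> \<mu>" unfolding \<mu>_def by (rule Max_ge; simp)+
  from ram_bound_bits[OF this b_def] have rb: "ram_bound (40 + 3 * (d * m) + d + m) (6 * b)" .
  from run[OF rb _ x(2,3)] x(2) have
    "ram_bound.run (6 * b) c (input_state x) (n * (length cs + 2)) (output_in (f x))" by (simp add: x(1))
  then obtain t s where ts: "exec c (input_state x) t s" "t \<le> n * (length cs + 2) * (6 * b)" "output_in (f x) s"
    unfolding ram_bound.run_def[OF rb] by blast
  have "bit_size x = (length cs + 2) * b"
    by (simp add: x(1) bit_size_def array_size_def b_def \<mu>_def)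
  then have "n * (length cs + 2) * (6 * b) = 6 * n * bit_size x" by (simp only: ac_simps)
  then show "\<exists>t s. exec c (input_state x) t s \<and> output_in (f x) s \<and> t \<le> 6 * n * Suc (bit_size x)"
    using ts by (intro exI[of _ t] exI[of _ s]) simp
qed

lemma linear_cost_bullet:
  assumes "\<And>x. x \<in> A \<Longrightarrow> well_sized x" shows "linear_cost A bullet_arr"
proof (rule linear_costI[OF assms, where c = bullet_prog and n = 40])
  fix V \<beta> d m :: nat and cs :: "nat list"
  assume rb: "ram_bound V \<beta>" and V: "40 + 3 * length cs + d + m \<le> V" and l: "length cs = d * m"
    and c: "\<forall>c\<in>set cs. c \<le> Suc d"
  interpret ram_bound V \<beta> by fact
  let ?M0 = "snd (input_state [d # m # cs])"
  note S = input_state_single[where d = d and m = m and cs = cs]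
  have M0: "?M0 p \<le> V" for p
  proof -
    consider "p = 0" | "p = 1" | "p = 2" | "p = 3" | q where "p = 4 + q" "q < length cs" | "4 + length cs \<le> p"
    proof -
      have "p < 4 \<or> (\<exists>q. p = 4 + q \<and> q < length cs) \<or> 4 + length cs \<le> p"
        by (cases "p < 4") (auto intro!: exI[of _ "p - 4"])
      then show thesis using that by (auto simp: less_Suc_eq numeral_eq_Suc)
    qed
    then show ?thesis
    proof cases
      case (5 q)
      then have "cs ! q \<le> Suc d" using c nth_mem by blast
      then show ?thesis using 5 S(6)[of q] V by simp
    qed (use S V in auto)
  qed
  have "run bullet_prog (\<lambda>_. 0, ?M0) (40 + 21 * length cs) (\<lambda>(r, M). (\<forall>p<4. M p = ?M0 p) \<and>
    (\<forall>p<length cs. M (4 + p) = Suc d - ?M0 (3 + length cs - p)))"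
    by (rule bullet_prog_run) (use V S(2-4) M0 in auto)
  then obtain t r M where t: "exec bullet_prog (\<lambda>_. 0, ?M0) t (r, M)" "t \<le> (40 + 21 * length cs) * \<beta>"
    and M: "\<And>p. p < 4 \<Longrightarrow> M p = ?M0 p" "\<And>p. p < length cs \<Longrightarrow> M (4 + p) = Suc d - ?M0 (3 + length cs - p)"
    unfolding run_def by auto
  have "output_in (bullet_arr [d # m # cs]) (r, M)"
    unfolding bullet_arr_def list.sel list.case
  proof (rule output_in_single)
    fix p assume "p < length (rev (map (\<lambda>c. Suc d - c) cs))"
    then have p: "p < length cs" by simp
    then have "3 + length cs - p = 4 + (length cs - Suc p)" by simp
    then show "M (4 + p) = rev (map (\<lambda>c. Suc d - c) cs) ! p"
      using M(2)[OF p] S(6)[of "length cs - Suc p"] p by (simp add: rev_nth)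
  qed (use M(1)[of 0] M(1)[of 1] M(1)[of 2] M(1)[of 3] S(2-5) in simp_all)
  moreover have "(40 + 21 * length cs) * \<beta> \<le> 40 * (length cs + 2) * \<beta>" by (intro mult_le_mono1) simp
  ultimately show "run bullet_prog (input_state [d # m # cs]) (40 * (length cs + 2)) (output_in (bullet_arr [d # m # cs]))"
    unfolding run_def by (subst S(1)) (use t order_trans in blast)
qed

lemma linear_cost_ot:
  assumes "\<And>x. x \<in> A \<Longrightarrow> well_sized x" shows "linear_cost A ot_arr"
proof (rule linear_costI[OF assms, where c = ot_prog and n = 60])
  fix V \<beta> d m :: nat and cs :: "nat list"
  assume rb: "ram_bound V \<beta>" and V: "40 + 3 * length cs + d + m \<le> V" and l: "length cs = d * m"
    and c: "\<forall>c\<in>set cs. c \<le> Suc d"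
  interpret ram_bound V \<beta> by fact
  let ?M0 = "snd (input_state [d # m # cs])"
  note S = input_state_single[where d = d and m = m and cs = cs]
  from ot_prog_run[OF V l c S(2-7)] obtain t r M where
    t: "exec ot_prog (\<lambda>_. 0, ?M0) t (r, M)" "t \<le> (60 + 52 * length cs) * \<beta>"
    and M: "M 0 = 1" "M 1 = length cs + 2" "M 2 = m" "M 3 = d"
      "\<And>p. p < length cs \<Longrightarrow> M (4 + p) = ot_entry d m (ot_cells d m cs) p"
    unfolding run_def by auto
  have "output_in (ot_arr [d # m # cs]) (r, M)"
    unfolding ot_arr_def list.sel list.case by (rule output_in_single) (use M in auto)
  moreover have "(60 + 52 * length cs) * \<beta> \<le> 60 * (length cs + 2) * \<beta>" by (intro mult_le_mono1) simp
  ultimately show "run ot_prog (input_state [d # m # cs]) (60 * (length cs + 2)) (output_in (ot_arr [d # m # cs]))"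
    unfolding run_def by (subst S(1)) (use t order_trans in blast)
qed

section \<open>Encoded tableaux\<close>

definition cells :: "skew_tab \<Rightarrow> nat list" where
  "cells T = map (\<lambda>q. cell T (Suc (q div ncols T)) (Suc (q mod ncols T))) [0..<nrows T * ncols T]"

lemma length_cells [simp]: "length (cells T) = nrows T * ncols T"
  by (simp add: cells_def)

lemma concat_grid:
  "concat (map (\<lambda>i. map (f i) [1..<Suc m]) [1..<Suc d]) =
    map (\<lambda>q. f (Suc (q div m)) (Suc (q mod m))) [0..<d * m]"
proof (induction d)
  case (Suc d)
  have "map (f (Suc d)) [1..<Suc m] = map (\<lambda>q. f (Suc (q div m)) (Suc (q mod m))) [d * m..<d * m + m]"
    by (rule nth_equalityI) (auto simp del: upt_Suc)
  moreover have "[1..<Suc (Suc d)] = [1..<Suc d] @ [Suc d]" by simp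
  moreover have "[0..<Suc d * m] = [0..<d * m] @ [d * m..<d * m + m]"
    using upt_add_eq_append[of 0 "d * m" m] by (simp add: add.commute)
  ultimately show ?case using Suc by (simp only: map_append concat_append) simp
qed simp

lemma encode_cells: "encode T = [nrows T # ncols T # cells T]"
  unfolding encode_def cells_def using concat_grid[of "cell T" "ncols T" "nrows T"] by simp

lemma grid_index:
  fixes i j d m :: nat
  assumes "i < d" "j < m"
  shows "i * m + j < d * m" "(i * m + j) div m = i" "(i * m + j) mod m = j"
proof -
  have "i * m + j < Suc i * m" using assms by simp
  also have "\<dots> \<le> d * m" using assms by (intro mult_le_mono1) simp
  finally show "i * m + j < d * m" .
qed (use assms in auto)

lemma grid_reflect:
  fixes i j d m :: nat
  assumes "i < d" "j < m" shows "d * m - Suc (i * m + j) = (d - Suc i) * m + (m - Suc j)"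
proof -
  obtain k where "d = Suc i + k" using assms(1) less_iff_Suc_add by auto
  then show ?thesis using assms(2) by (simp add: algebra_simps)
qed

lemma grid_cases:
  fixes d m q :: nat
  assumes "q < d * m"
  obtains i j where "q = i * m + j" "i < d" "j < m"
proof -
  have m: "0 < m" using assms by (cases m) auto
  show thesis
  proof (rule that)
    show "q = q div m * m + q mod m" by simp
    show "q div m < d" using assms by (simp add: less_mult_imp_div_less)
    show "q mod m < m" using m by simp
  qed
qed

lemma nth_cells:
  assumes "i < nrows T" "j < ncols T" shows "cells T ! (i * ncols T + j) = cell T (Suc i) (Suc j)"
  using grid_index[OF assms] by (simp add: cells_def)

lemma fill_range:
  assumes "tab_over k T" "box T i j" shows "1 \<le> fill T i j" "fill T i j \<le> k"
proof -
  have "fill T i j \<in> set (row_word T)"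
    using assms tab_overD(2)[OF assms(1)] by (force simp: set_row_word boxes_def)
  then show "1 \<le> fill T i j" "fill T i j \<le> k" using tab_overD(3)[OF assms(1)] by auto
qed

lemma shape_bounds:
  assumes "skew_shape T" "i < nrows T"
  shows "inner T ! i \<le> outer T ! i" "inner T ! i \<le> ncols T" "outer T ! i \<le> ncols T"
  using assms part_in_le(2) by (auto simp: skew_shape_def list_all2_conv_all_nth part_in_def)

text \<open>Entries lie between 1 and the number of rows, so neither marker can be mistaken for an
  entry.\<close>

lemma cell_cases:
  assumes T: "tab_over (nrows T) T" and i: "i < nrows T"
  shows "cell T (Suc i) j = 0 \<longleftrightarrow> j \<le> inner T ! i" "cell T (Suc i) j = Suc (nrows T) \<longleftrightarrow> outer T ! i < j"
    "box T (Suc i) j \<Longrightarrow> cell T (Suc i) j = fill T (Suc i) j" "cell T (Suc i) j \<le> Suc (nrows T)"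
    "box T (Suc i) j \<longleftrightarrow> inner T ! i < j \<and> j \<le> outer T ! i"
proof -
  note le = shape_bounds(1)[OF tab_overD(2)[OF T] i]
  show b: "box T (Suc i) j \<longleftrightarrow> inner T ! i < j \<and> j \<le> outer T ! i" using i by (auto simp: box_def)
  note f = fill_range[OF T, of "Suc i" j, unfolded b]
  show "cell T (Suc i) j = 0 \<longleftrightarrow> j \<le> inner T ! i" "cell T (Suc i) j = Suc (nrows T) \<longleftrightarrow> outer T ! i < j"
    "cell T (Suc i) j \<le> Suc (nrows T)" "box T (Suc i) j \<Longrightarrow> cell T (Suc i) j = fill T (Suc i) j"
    using f le unfolding b by (auto simp: cell_def)
qed

lemma well_sized_encode:
  assumes "tab_over (nrows T) T" shows "well_sized (encode T)"
  unfolding well_sized_def encode_cells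
proof (intro exI conjI ballI)
  fix c assume "c \<in> set (cells T)"
  then obtain q where q: "q < nrows T * ncols T" "c = cells T ! q" by (auto simp: in_set_conv_nth)
  from q(1) obtain i j where "q = i * ncols T + j" "i < nrows T" "j < ncols T" by (rule grid_cases)
  then show "c \<le> Suc (nrows T)" using q(2) cell_cases(4)[OF assms] by (simp add: nth_cells)
qed (rule refl, simp)

text \<open>The markers reveal both boundary partitions and the remaining cells the row word; a
  semistandard tableau is determined by these.\<close>

lemma encode_inject:
  assumes S: "tab_over (nrows S) S" and T: "tab_over (nrows T) T" and e: "encode S = encode T"
  shows "S = T"
proof -
  have d: "nrows S = nrows T" "ncols S = ncols T" "cells S = cells T" using e by (auto simp: encode_cells)
  have c: "cell S (Suc i) (Suc j) = cell T (Suc i) (Suc j)" if "i < nrows T" "j < ncols T" for i j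
    using nth_cells[of i S j] nth_cells[of i T j] that d by simp
  note cS = cell_cases[OF S] and cT = cell_cases[OF T]
  note sh = tab_overD(2)[OF S] tab_overD(2)[OF T]
  have io: "inner S ! i = inner T ! i" "outer S ! i = outer T ! i" if i: "i < nrows T" for i
  proof -
    note bd = shape_bounds(2,3)[OF sh(1)] shape_bounds(2,3)[OF sh(2) i]
    have "Suc j \<le> inner S ! i \<longleftrightarrow> Suc j \<le> inner T ! i" "outer S ! i < Suc j \<longleftrightarrow> outer T ! i < Suc j" if "j < ncols T" for j
      using c[OF i that] cS(1,2)[of i "Suc j"] cT(1,2)[of i "Suc j"] i d(1) by simp_all
    then show "inner S ! i = inner T ! i" "outer S ! i = outer T ! i"
      using bd i d by (auto intro!: nat_eq_by_less[where d = "ncols T"] simp: Suc_le_eq less_Suc_eq_le not_le[symmetric])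
  qed
  have "inner S = inner T" "outer S = outer T"
    using sh io d by (auto simp: skew_shape_def part_in_def intro!: nth_equalityI)
  then have ss: "same_shape S T" using d by (simp add: same_shape_def)
  have "row_word S = row_word T"
    unfolding row_word_def same_shape_cong(1)[OF ss]
  proof (rule map_cong[OF refl], clarify)
    fix i j assume "(i, j) \<in> set (row_boxes T)"
    then have b: "box T i j" using sh(2) by (simp add: set_row_boxes boxes_def)
    note bd = box_bounds[OF sh(2) b]
    have bS: "box S i j" using b ss by (simp add: box_def same_shape_def)
    obtain i' j' where ij: "i = Suc i'" "j = Suc j'" using bd by (cases i; cases j) auto
    show "fill S i j = fill T i j"
      using c[of i' j'] cS(3)[of i' j] cT(3)[of i' j] b bS bd d by (simp add: ij)
  qed
  then show ?thesis using semistandard_eqI[OF tab_overD(1)[OF S] tab_overD(1)[OF T] ss] by simp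
qed

lemma cell_bullet:
  assumes T: "tab_over (nrows T) T" and ij: "i < nrows T" "j < ncols T"
  shows "cell (bullet (nrows T) T) (Suc i) (Suc j) = Suc (nrows T) - cell T (nrows T - i) (ncols T - j)"
proof -
  let ?d = "nrows T" and ?m = "ncols T" and ?S = "bullet (nrows T) T"
  note sh = tab_overD(2)[OF T]
  have l: "length (inner T) = ?d" "length (outer T) = ?d" using sh by (auto simp: skew_shape_def part_in_def)
  have n: "nrows ?S = ?d" by (simp add: bullet_def)
  define i' where "i' = ?d - Suc i"
  have i': "i' < ?d" "?d - i = Suc i'" using ij by (auto simp: i'_def)
  have io: "inner ?S ! i = ?m - outer T ! i'" "outer ?S ! i = ?m - inner T ! i'"
    using ij by (simp_all add: bullet_def nth_dual_part l i'_def)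
  note c = cell_cases[OF T i'(1), of "?m - j"]
  have eq: "Suc j \<le> inner ?S ! i \<longleftrightarrow> outer T ! i' < ?m - j" "Suc j \<le> outer ?S ! i \<longleftrightarrow> inner T ! i' < ?m - j"
    using io shape_bounds(2,3)[OF sh i'(1)] ij by auto
  consider "outer T ! i' < ?m - j" | "?m - j \<le> inner T ! i'" | "box T (Suc i') (?m - j)"
    using c(5) by linarith
  then show ?thesis
  proof cases
    case 1
    then show ?thesis using c(2) eq unfolding i'(2) by (simp add: cell_def[of ?S])
  next
    case 2
    then have "\<not> outer T ! i' < ?m - j" using shape_bounds(1)[OF sh i'(1)] by simp
    then show ?thesis using 2 c(1) eq unfolding i'(2) by (simp add: cell_def[of ?S] n)
  next
    case 3
    then have b: "box ?S (Suc i) (Suc j)" using i' by (simp add: box_bullet[OF sh])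
    then have "cell ?S (Suc i) (Suc j) = fill ?S (Suc i) (Suc j)" using 3 c(5) eq by (simp add: cell_def)
    then show ?thesis using b 3 c(3) by (simp add: fill_bullet[OF sh] i')
  qed
qed

lemma encode_bullet:
  assumes T: "tab_over (nrows T) T"
  shows "encode (bullet (nrows T) T) = bullet_arr (encode T)"
proof -
  let ?d = "nrows T" and ?m = "ncols T" and ?S = "bullet (nrows T) T"
  have nm: "nrows ?S = ?d" "ncols ?S = ?m" by (simp_all add: bullet_def)
  have "cells ?S = rev (map (\<lambda>c. Suc ?d - c) (cells T))"
  proof (rule nth_equalityI)
    fix q assume "q < length (cells ?S)"
    then have q: "q < ?d * ?m" by (simp add: nm)
    then obtain i j where ij: "q = i * ?m + j" "i < ?d" "j < ?m" by (rule grid_cases)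
    have "cells ?S ! q = cell ?S (Suc i) (Suc j)" using nth_cells[of i ?S j] ij by (simp add: nm)
    moreover have "cells T ! (?d * ?m - Suc q) = cell T (?d - i) (?m - j)"
      unfolding ij(1) grid_reflect[OF ij(2,3)] using nth_cells[of "?d - Suc i" T "?m - Suc j"] ij by (simp add: Suc_diff_Suc)
    ultimately show "cells ?S ! q = rev (map (\<lambda>c. Suc ?d - c) (cells T)) ! q"
      using q ij cell_bullet[OF T ij(2,3)] by (simp add: rev_nth)
  qed (simp add: nm)
  then show ?thesis by (simp add: encode_cells bullet_arr_def nm)
qed

lemma cell_ot:
  assumes T: "tab_over (nrows T) T" "yamanouchi (row_word T)" and ij: "i < nrows T" "j < ncols T"
  shows "cell (ot k T) (ncols T - j) (nrows T - i) =
    (if cell T (Suc i) (Suc j) = 0 then Suc (ncols T)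
     else if cell T (Suc i) (Suc j) = Suc (nrows T) then 0 else occ_no T (Suc i, Suc j))"
proof -
  let ?d = "nrows T" and ?m = "ncols T" and ?S = "ot k T"
  note sh = tab_overD(2)[OF T(1)]
  have p: "part_in ?d ?m (inner T)" "part_in ?d ?m (outer T)" using sh by (auto simp: skew_shape_def)
  have ss: "nrows ?S = ?m" "inner ?S = dual_part ?d (transpose_part ?m (outer T))"
    "outer ?S = dual_part ?d (transpose_part ?m (inner T))"
    using ot_basics(1)[OF sh, of k] by (simp_all add: same_shape_def)
  have n: "?m - j - 1 = ?m - Suc j" by simp
  have "inner ?S ! (?m - j - 1) = ?d - transpose_part ?m (outer T) ! j"
    "outer ?S ! (?m - j - 1) = ?d - transpose_part ?m (inner T) ! j"
    using ij by (simp_all add: ss nth_dual_part n)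
  then have eq: "?d - i \<le> inner ?S ! (?m - j - 1) \<longleftrightarrow> \<not> j < outer T ! i"
    "?d - i \<le> outer ?S ! (?m - j - 1) \<longleftrightarrow> \<not> j < inner T ! i"
    using transpose_part_less[OF p(2) ij(2,1)] transpose_part_less[OF p(1) ij(2,1)]
      transpose_part_le[OF p(2) ij(2)] transpose_part_le[OF p(1) ij(2)] ij by auto
  note c = cell_cases[OF T(1) ij(1), of "Suc j"]
  consider "j < inner T ! i" | "\<not> j < outer T ! i" | "box T (Suc i) (Suc j)" using c(5) by linarith
  then show ?thesis
  proof cases
    case 1
    then show ?thesis using c(1) shape_bounds(1)[OF sh ij(1)] eq by (simp add: cell_def[of ?S] ss(1))
  next
    case 2
    then show ?thesis using c(1,2) shape_bounds(1)[OF sh ij(1)] eq by (simp add: cell_def[of ?S])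
  next
    case 3
    then have "(Suc i, Suc j) \<in> boxes T" by (simp add: boxes_def)
    from entry_ot[OF tab_overD(1)[OF T(1)] T(2) this, of k]
    have "fill ?S (?m - j) (?d - i) = occ_no T (Suc i, Suc j)" by (simp add: entry_def tr_def)
    moreover have "cell ?S (?m - j) (?d - i) = fill ?S (?m - j) (?d - i)"
      using 3 c(5) eq by (simp add: cell_def[of ?S])
    moreover have "cell T (Suc i) (Suc j) \<noteq> 0" "cell T (Suc i) (Suc j) \<noteq> Suc ?d" using 3 c(1,2,5) by auto
    ultimately show ?thesis by simp
  qed
qed

lemma nth_ot_cells:
  assumes "i < ncols T" "j < nrows T"
  shows "ot_cells (nrows T) (ncols T) (cells T) ! (i * nrows T + j) = cell T (nrows T - j) (ncols T - i)"
proof -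
  let ?d = "nrows T" and ?m = "ncols T"
  have q: "i * ?d + j < ?d * ?m" using grid_index(1)[OF assms] by (simp add: mult.commute)
  then have "ot_cells ?d ?m (cells T) ! (i * ?d + j) = cells T ! (?d * ?m - Suc (j * ?m + i))"
    using assms by (simp add: ot_cells_def)
  also have "\<dots> = cell T (?d - j) (?m - i)"
    unfolding grid_reflect[OF assms(2,1)]
    using nth_cells[of "?d - Suc j" T "?m - Suc i"] assms by (simp add: Suc_diff_Suc)
  finally show ?thesis .
qed

text \<open>The scan runs through the columns from right to left as the column word does, but upwards in
  each column. Since a column contains a letter at most once, this does not affect the count.\<close>

lemma count_ot_cells:
  assumes T: "tab_over (nrows T) T" and b: "box T (nrows T - j) (ncols T - i)" and ij: "i < ncols T" "j < nrows T"
  defines "d \<equiv> nrows T" and "m \<equiv> ncols T"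
  shows "count_list (take (Suc (i * d + j)) (ot_cells d m (cells T))) (fill T (d - j) (m - i)) = occ_no T (d - j, m - i)"
proof -
  let ?ts = "ot_cells d m (cells T)" and ?x = "fill T (d - j) (m - i)" and ?q = "i * d + j" and ?b = "(d - j, m - i)"
  let ?f = "\<lambda>p. (d - p mod d, m - p div d)"
  note ij' = ij[folded d_def m_def] and b' = b[folded d_def m_def]
  note ss = tab_overD(1)[OF T] and sh = tab_overD(2)[OF T]
  have q: "?q < m * d" by (rule grid_index(1)[OF ij'])
  have bb: "?b \<in> boxes T" using b' by (simp add: boxes_def)
  have x: "1 \<le> ?x" "?x \<le> d" using fill_range[OF T b'] by (simp_all add: d_def)
  have nth: "?ts ! (i' * d + j') = ?x \<longleftrightarrow> (d - j', m - i') \<in> boxes T \<and> entry T (d - j', m - i') = ?x"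
    if "i' < m" "j' < d" for i' j'
  proof -
    have e: "?ts ! (i' * d + j') = cell T (d - j') (m - i')"
      using nth_ot_cells[of i' T j'] that by (simp add: d_def m_def)
    have s: "d - j' = Suc (d - Suc j')" using that by simp
    have l: "d - Suc j' < nrows T" using that by (simp add: d_def)
    note c = cell_cases[OF T l, of "m - i'"]
    have "box T (d - j') (m - i')" if "cell T (d - j') (m - i') = ?x"
      using that c(1,2,5) x unfolding s d_def[symmetric] by auto
    then show ?thesis using c(3) unfolding e s by (auto simp: boxes_def entry_def)
  qed
  have "bij_betw ?f {p. p < Suc ?q \<and> ?ts ! p = ?x} (upto_box col_less T ?x ?b)"
  proof (rule bij_betw_byWitness[where f' = "\<lambda>(r, c). (m - c) * d + (d - r)"])
    have "?f p \<in> upto_box col_less T ?x ?b \<and> (case ?f p of (r, c) \<Rightarrow> (m - c) * d + (d - r)) = p"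
      if p: "p < Suc ?q" "?ts ! p = ?x" for p
    proof -
      have "p < m * d" using p(1) q by simp
      then obtain i' j' where p': "p = i' * d + j'" "i' < m" "j' < d" by (rule grid_cases)
      note dm = grid_index(2,3)[OF p'(2,3), folded p'(1)]
      have f: "?f p = (d - j', m - i')" by (simp add: dm)
      have a: "(d - j', m - i') \<in> boxes T" "entry T (d - j', m - i') = ?x" using nth[OF p'(2,3)] p(2) p'(1) by auto
      have le: "i' \<le> i"
      proof (rule ccontr)
        assume "\<not> i' \<le> i"
        then have "Suc i * d \<le> i' * d" by (intro mult_le_mono1) simp
        then show False using p(1) p'(1) ij'(2) by simp
      qed
      have "d - j' = d - j" if "i' = i"
      proof (rule ccontr)
        assume "d - j' \<noteq> d - j"
        then have "fill T (d - j') (m - i) \<noteq> ?x"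
          using ss a(1) b' unfolding semistandard_iff that boxes_def
          by (metis (no_types, lifting) case_prodD linorder_neqE_nat mem_Collect_eq nat_neq_iff)
        then show False using a(2) that by (simp add: entry_def)
      qed
      then have "?f p \<in> upto_box col_less T ?x ?b"
        using a le p' ij' unfolding f upto_box_def by (cases "i' = i") auto
      moreover have "(m - (m - i')) * d + (d - (d - j')) = p" using p' by simp
      ultimately show ?thesis unfolding f by simp
    qed
    then show "?f ` {p. p < Suc ?q \<and> ?ts ! p = ?x} \<subseteq> upto_box col_less T ?x ?b"
      "\<forall>p\<in>{p. p < Suc ?q \<and> ?ts ! p = ?x}. (case ?f p of (r, c) \<Rightarrow> (m - c) * d + (d - r)) = p" by blast+
    have "(m - c) * d + (d - r) < Suc ?q \<and> ?ts ! ((m - c) * d + (d - r)) = ?x \<and> ?f ((m - c) * d + (d - r)) = (r, c)"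
      if "(r, c) \<in> upto_box col_less T ?x ?b" for r c
    proof -
      have a: "(r, c) \<in> boxes T" "entry T (r, c) = ?x" "(r, c) = ?b \<or> col_less (r, c) ?b"
        using that by (auto simp: upto_box_def)
      have "box T r c" using a(1) by (simp add: boxes_def)
      note bd = box_bounds[OF sh this, folded d_def m_def]
      have lt: "m - c < m" "d - r < d" using bd by auto
      note dm = grid_index(2,3)[OF lt]
      have rc: "d - (d - r) = r" "m - (m - c) = c" using bd by auto
      have "(m - c) * d + (d - r) < Suc ?q"
      proof (cases "c = m - i")
        case True
        then have "r = d - j"
        proof -
          have False if "r < d - j"
          proof -
            have "fill T r (m - i) < ?x" using ss b' \<open>box T r c\<close> True that unfolding semistandard_iff by blast
            then show False using a(2) True by (simp add: entry_def)
          qed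
          then show ?thesis using a(3) True by auto
        qed
        then show ?thesis using True ij' by simp
      next
        case False
        then have "Suc (m - c) \<le> i" using a(3) bd by auto
        then have "Suc (m - c) * d \<le> i * d" by (rule mult_le_mono1)
        then show ?thesis using lt(2) by simp
      qed
      then show ?thesis using nth[OF lt] a rc dm by simp
    qed
    then show "(\<lambda>(r, c). (m - c) * d + (d - r)) ` upto_box col_less T ?x ?b \<subseteq> {p. p < Suc ?q \<and> ?ts ! p = ?x}"
      "\<forall>a\<in>upto_box col_less T ?x ?b. ?f (case a of (r, c) \<Rightarrow> (m - c) * d + (d - r)) = a" by auto
  qed
  from bij_betw_same_card[OF this] show ?thesis
    using upto_col_ne[OF ss bb] q count_take_card[of "Suc ?q" ?ts ?x]
    by (simp add: occ_no_def entry_def d_def m_def mult.commute)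
qed

lemma encode_ot:
  assumes T: "tab_over (nrows T) T" "yamanouchi (row_word T)"
  shows "encode (ot k T) = ot_arr (encode T)"
proof -
  let ?d = "nrows T" and ?m = "ncols T" and ?S = "ot k T"
  let ?ts = "ot_cells ?d ?m (cells T)"
  have nm: "nrows ?S = ?m" "ncols ?S = ?d" by (simp_all add: ot_def fill_columns_def)
  have "cells ?S = map (ot_entry ?d ?m ?ts) [0..<?d * ?m]"
  proof (rule nth_equalityI)
    fix q assume "q < length (cells ?S)"
    then have q: "q < ?m * ?d" by (simp add: nm)
    then obtain i j where ij: "q = i * ?d + j" "i < ?m" "j < ?d" by (rule grid_cases)
    define i' where "i' = ?d - Suc j"
    define j' where "j' = ?m - Suc i"
    have ij': "i' < ?d" "j' < ?m" "?m - j' = Suc i" "?d - i' = Suc j" "Suc i' = ?d - j" "Suc j' = ?m - i"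
      using ij by (auto simp: i'_def j'_def)
    have t: "?ts ! q = cell T (Suc i') (Suc j')" using nth_ot_cells[OF ij(2,3)] by (simp add: ij' ij(1))
    note c = cell_cases[OF T(1) ij'(1), of "Suc j'"]
    have "occ_no T (Suc i', Suc j') = count_list (take (Suc q) ?ts) (cell T (Suc i') (Suc j'))"
      if "cell T (Suc i') (Suc j') \<noteq> 0" "cell T (Suc i') (Suc j') \<noteq> Suc ?d"
    proof -
      have "box T (Suc i') (Suc j')" using that c(1,2,5) by auto
      then show ?thesis using count_ot_cells[OF T(1) _ ij(2,3)] c(3) unfolding ij(1) ij'(5,6) by simp
    qed
    moreover have "cells ?S ! q = cell ?S (Suc i) (Suc j)" using nth_cells[of i ?S j] ij by (simp add: nm)
    ultimately show "cells ?S ! q = map (ot_entry ?d ?m ?ts) [0..<?d * ?m] ! q"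
      using cell_ot[OF T ij'(1,2), of k] q t by (simp add: ij'(3,4) ot_entry_def mult.commute)
  qed (simp add: nm)
  then show ?thesis by (simp add: encode_cells ot_arr_def nm)
qed

text \<open>The number of cells is the same, and no entry exceeds one plus the number of rows, hence
  twice the maximum for T. That costs one more bit per entry, and the length per entry at most
  doubles.\<close>

lemma bit_size_encode:
  assumes S: "tab_over (nrows S) S"
    and nm: "nrows S = nrows T \<and> ncols S = ncols T \<or> nrows S = ncols T \<and> ncols S = nrows T"
  shows "bit_size (encode S) \<le> 2 * bit_size (encode T)"
proof -
  define D where "D = nrows T # ncols T # cells T"
  define D' where "D' = nrows S # ncols S # cells S"
  define \<mu> where "\<mu> = Max (insert 1 (set D))"
  define \<mu>' where "\<mu>' = Max (insert 1 (set D'))"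
  have \<mu>: "1 \<le> \<mu>" "nrows T \<le> \<mu>" "ncols T \<le> \<mu>" unfolding \<mu>_def D_def by (rule Max_ge; simp)+
  have "c \<le> 2 * \<mu>" if "c \<in> insert 1 (set D')" for c
  proof -
    obtain d m cs where w: "encode S = [d # m # cs]" "\<forall>c\<in>set cs. c \<le> Suc d"
      using well_sized_encode[OF S] unfolding well_sized_def by blast
    then have "\<forall>c\<in>set (cells S). c \<le> Suc (nrows S)" by (simp add: encode_cells)
    then show ?thesis using that nm \<mu> unfolding D'_def by (auto dest!: bspec)
  qed
  then have le: "\<mu>' \<le> 2 * \<mu>" unfolding \<mu>'_def by (intro Max.boundedI) auto
  have "1 \<le> \<mu>'" unfolding \<mu>'_def by (rule Max_ge; simp)
  then have "log 2 (real \<mu>') \<le> log 2 (2 * real \<mu>)" using le by (subst log_le_cancel_iff) auto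
  also have "\<dots> = 1 + log 2 (real \<mu>)" using \<mu>(1) by (simp add: log_mult)
  finally have "log 2 (real \<mu>') \<le> 1 + log 2 (real \<mu>)" .
  moreover have "0 \<le> log 2 (real \<mu>)" using \<mu>(1) by simp
  ultimately have b: "nat \<lceil>log 2 (real \<mu>') + 1\<rceil> \<le> 2 * nat \<lceil>log 2 (real \<mu>) + 1\<rceil>" by linarith
  have len: "length D' = length D" using nm by (auto simp: D_def D'_def mult.commute)
  have "bit_size (encode S) = length D' * nat \<lceil>log 2 (real \<mu>') + 1\<rceil>"
    "bit_size (encode T) = length D * nat \<lceil>log 2 (real \<mu>) + 1\<rceil>"
    by (simp_all add: encode_cells bit_size_def array_size_def D_def D'_def \<mu>_def \<mu>'_def)
  then show ?thesis using mult_le_mono2[OF b, of "length D"] len by (simp only: ac_simps)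
qed

section \<open>Reductions\<close>

text \<open>A circuit is compared with a map on tableaux, so that compositions are checked on
  tableaux and for any oracle \<alpha>.\<close>

definition computes :: "array_map \<Rightarrow> skew_tab set \<Rightarrow> (skew_tab \<Rightarrow> skew_tab) \<Rightarrow> skew_tab set \<Rightarrow> bool" where
  "computes \<alpha> S P S' \<longleftrightarrow> (\<forall>T\<in>S. P T \<in> S') \<and>
    (\<exists>g s. ps_circuit \<alpha> (encode ` S) g (encode ` S') s \<and> (\<forall>T\<in>S. g (encode T) = encode (P T)))"

lemma computes_linear:
  assumes S: "\<And>T. T \<in> S \<Longrightarrow> P T \<in> S'" and f: "\<And>T. T \<in> S \<Longrightarrow> f (encode T) = encode (P T)"
    and "linear_cost (encode ` S) f" "size_neutral (encode ` S) f"
  shows "computes \<alpha> S P S'"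
proof -
  have "f ` encode ` S \<subseteq> encode ` S'" using S f by auto
  from ps_circuit.linear[OF this assms(3,4)] show ?thesis
    unfolding computes_def using S f by blast
qed

lemma computes_comp:
  assumes P: "computes \<alpha> S P S'" and Q: "computes \<alpha> S' Q S''" and R: "\<And>T. T \<in> S \<Longrightarrow> R T = Q (P T)"
  shows "computes \<alpha> S R S''"
proof -
  obtain f s where f: "ps_circuit \<alpha> (encode ` S) f (encode ` S') s" "\<And>T. T \<in> S \<Longrightarrow> f (encode T) = encode (P T)"
    using P unfolding computes_def by blast
  obtain g t where g: "ps_circuit \<alpha> (encode ` S') g (encode ` S'') t" "\<And>T. T \<in> S' \<Longrightarrow> g (encode T) = encode (Q T)"
    using Q unfolding computes_def by blast
  have m: "P T \<in> S'" if "T \<in> S" for T using P that by (simp add: computes_def)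
  have "\<forall>T\<in>S. R T \<in> S''" "\<forall>T\<in>S. (g \<circ> f) (encode T) = encode (R T)"
    using m Q f(2) g(2) R by (simp_all add: computes_def)
  with ps_circuit.sequential[OF f(1) g(1)] show ?thesis unfolding computes_def by blast
qed

lemma tableau_map_value:
  assumes "inj_on encode S" "T \<in> S" shows "encode (F (the_inv_into S encode (encode T))) = encode (F T)"
  using assms by (simp add: the_inv_into_f_f)

lemma computes_call:
  assumes "inj_on encode S" "\<And>T. T \<in> S \<Longrightarrow> F T \<in> S'"
  shows "computes (tableau_map S F S') S F S'"
  using ps_circuit.call[of "tableau_map S F S'", OF tableau_map_def] assms tableau_map_value[OF assms(1)]
  unfolding computes_def by blast

text \<open>What lets a map on tableaux act on codes: the alphabet fits the markers, so codes are
  injective, and the rectangle is kept or transposed, so sizes stay comparable.\<close>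

definition tame :: "skew_tab set \<Rightarrow> (skew_tab \<Rightarrow> skew_tab) \<Rightarrow> skew_tab set \<Rightarrow> bool" where
  "tame S F S' \<longleftrightarrow> (\<forall>T\<in>S. tab_over (nrows T) T) \<and> (\<forall>T\<in>S'. tab_over (nrows T) T) \<and>
    (\<forall>T\<in>S. F T \<in> S' \<and> (nrows (F T) = nrows T \<and> ncols (F T) = ncols T \<or>
      nrows (F T) = ncols T \<and> ncols (F T) = nrows T))"

lemma tame_inj:
  assumes "tame S F S'" shows "inj_on encode S"
proof (rule inj_onI)
  fix T U assume "T \<in> S" "U \<in> S" "encode T = encode U"
  then show "T = U" using assms encode_inject unfolding tame_def by blast
qed

lemma tame_size_neutral:
  assumes t: "tame S F S'" and f: "\<And>T. T \<in> S \<Longrightarrow> f (encode T) = encode (F T)"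
  shows "size_neutral (encode ` S) f"
  unfolding size_neutral_def
proof (intro exI[of _ 2] ballI)
  fix x assume "x \<in> encode ` S"
  then obtain T where T: "T \<in> S" "x = encode T" by blast
  then show "bit_size (f x) \<le> 2 * bit_size x" using t f bit_size_encode[of "F T" T] by (simp add: tame_def)
qed

lemma tame_call:
  assumes "tame S F S'" shows "computes (tableau_map S F S') S F S'"
  by (rule computes_call[OF tame_inj[OF assms]]) (use assms in \<open>simp add: tame_def\<close>)

lemma linearly_reducibleI:
  assumes P: "tame S P S'" and Q: "tame R Q R'" and c: "computes (tableau_map R Q R') S P S'"
  shows "linearly_reducible (tableau_map S P S') (tableau_map R Q R')"
proof -
  have "size_neutral (encode ` S) (\<lambda>x. encode (P (the_inv_into S encode x)))"
    "size_neutral (encode ` R) (\<lambda>x. encode (Q (the_inv_into R encode x)))"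
    using tame_size_neutral[OF P tableau_map_value[OF tame_inj[OF P]]]
      tame_size_neutral[OF Q tableau_map_value[OF tame_inj[OF Q]]] by blast+
  then show ?thesis
    using c tableau_map_value[OF tame_inj[OF P], of _ P]
    unfolding linearly_reducible_def computes_def by (auto simp: tableau_map_def)
qed

lemma tame_bullet_computes:
  assumes "tame S (\<lambda>T. bullet (nrows T) T) S'" shows "computes \<alpha> S (\<lambda>T. bullet (nrows T) T) S'"
proof (rule computes_linear)
  have T: "tab_over (nrows T) T" if "T \<in> S" for T using assms that by (simp add: tame_def)
  then show f: "bullet_arr (encode T) = encode (bullet (nrows T) T)" if "T \<in> S" for T
    using encode_bullet that by metis
  show "linear_cost (encode ` S) bullet_arr" by (rule linear_cost_bullet) (use T well_sized_encode in blast)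
  show "size_neutral (encode ` S) bullet_arr" by (rule tame_size_neutral[OF assms f])
qed (use assms in \<open>simp add: tame_def\<close>)

lemma tame_ot_computes:
  assumes "tame S (\<lambda>T. ot (nrows T) T) S'" and y: "\<And>T. T \<in> S \<Longrightarrow> yamanouchi (row_word T)"
  shows "computes \<alpha> S (\<lambda>T. ot (nrows T) T) S'"
proof (rule computes_linear)
  have T: "tab_over (nrows T) T" if "T \<in> S" for T using assms(1) that by (simp add: tame_def)
  then show f: "ot_arr (encode T) = encode (ot (nrows T) T)" if "T \<in> S" for T
    using encode_ot[of T "nrows T"] y that by metis
  show "linear_cost (encode ` S) ot_arr" by (rule linear_cost_ot) (use T well_sized_encode in blast)
  show "size_neutral (encode ` S) ot_arr" by (rule tame_size_neutral[OF assms(1) f])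
qed (use assms in \<open>simp add: tame_def\<close>)

lemma all_LR_iff:
  "T \<in> all_LR \<longleftrightarrow> (\<exists>d m \<mu> \<nu> lam. part_in d m \<mu> \<and> part_in d m \<nu> \<and> part_in d m lam \<and> T \<in> LR d m \<mu> \<nu> lam)"
proof
  assume "\<exists>d m \<mu> \<nu> lam. part_in d m \<mu> \<and> part_in d m \<nu> \<and> part_in d m lam \<and> T \<in> LR d m \<mu> \<nu> lam"
  then obtain d m \<mu> \<nu> lam where "part_in d m \<mu>" "part_in d m \<nu>" "part_in d m lam" "T \<in> LR d m \<mu> \<nu> lam" by blast
  then show "T \<in> all_LR" unfolding all_LR_def
    by (intro CollectI exI[of _ "d + m"] exI[of _ d] exI[of _ \<mu>] exI[of _ \<nu>] exI[of _ lam]) simp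
qed (unfold all_LR_def, blast)

lemma all_oppLR_iff:
  "T \<in> all_oppLR \<longleftrightarrow>
    (\<exists>d m \<mu> \<nu> lam. part_in d m \<mu> \<and> part_in d m \<nu> \<and> part_in d m lam \<and> T \<in> oppLR d m \<mu> (rev \<nu>) lam)"
proof
  assume "\<exists>d m \<mu> \<nu> lam. part_in d m \<mu> \<and> part_in d m \<nu> \<and> part_in d m lam \<and> T \<in> oppLR d m \<mu> (rev \<nu>) lam"
  then obtain d m \<mu> \<nu> lam where "part_in d m \<mu>" "part_in d m \<nu>" "part_in d m lam" "T \<in> oppLR d m \<mu> (rev \<nu>) lam" by blast
  then show "T \<in> all_oppLR" unfolding all_oppLR_def
    by (intro CollectI exI[of _ "d + m"] exI[of _ d] exI[of _ \<mu>] exI[of _ \<nu>] exI[of _ lam]) simp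
qed (unfold all_oppLR_def, blast)

lemma LR_dims: "T \<in> LR d m \<mu> \<nu> lam \<Longrightarrow> nrows T = d \<and> ncols T = m"
  "T \<in> oppLR d m \<mu> \<kappa> lam \<Longrightarrow> nrows T = d \<and> ncols T = m"
  by (auto simp: LR_def oppLR_def skew_tabs_def)

text \<open>The identities at the end are the compositions on which the reductions rest.\<close>

lemma all_LR_maps:
  assumes "T \<in> all_LR"
  shows "tab_over (nrows T) T" "yamanouchi (row_word T)"
    "reversal T \<in> all_oppLR" "nrows (reversal T) = nrows T" "ncols (reversal T) = ncols T"
    "rho T \<in> all_LR" "nrows (rho T) = nrows T" "ncols (rho T) = ncols T"
    "varrho T \<in> all_LR" "nrows (varrho T) = ncols T" "ncols (varrho T) = nrows T"
    "bullet (nrows T) T \<in> all_oppLR" "ot (nrows T) T \<in> all_LR"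
    "reversal T = bullet (nrows (rho T)) (rho T)" "varrho T = ot (nrows (rho T)) (rho T)"
    "rho T = ot (nrows (varrho T)) (varrho T)" "rho T = bullet (nrows (reversal T)) (reversal T)"
    "rho T = reversal (bullet (nrows T) T)"
proof -
  obtain d m \<mu> \<nu> lam where p: "part_in d m \<mu>" "part_in d m \<nu>" "part_in d m lam" and T: "T \<in> LR d m \<mu> \<nu> lam"
    using assms by (auto simp: all_LR_iff)
  have l: "length \<nu> = d" using p by (simp add: part_in_def)
  note p' = part_in_transpose[OF p(1)] part_in_transpose[OF p(2)] part_in_transpose[OF p(3)]
  note D = LR_D[OF T p(2)] and e = reversal_LR[OF T l] and r = rho_LR[OF T l p(1,3)] and v = varrho_LR[OF T p]
    and b = bullet_LR[OF T l p(3)] and o = ot_LR[OF T p, of d]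
  show "tab_over (nrows T) T" "yamanouchi (row_word T)" using D by auto
  show n: "nrows (reversal T) = nrows T" "ncols (reversal T) = ncols T" "nrows (rho T) = nrows T" "ncols (rho T) = ncols T"
    "nrows (varrho T) = ncols T" "ncols (varrho T) = nrows T"
    using LR_dims(1)[OF T] LR_dims(1)[OF r(2)] LR_dims(1)[OF v(5)] LR_dims(2)[OF e(1)] by auto
  show "reversal T \<in> all_oppLR" "rho T \<in> all_LR" "varrho T \<in> all_LR" "bullet (nrows T) T \<in> all_oppLR" "ot (nrows T) T \<in> all_LR"
    unfolding all_LR_iff all_oppLR_iff D(5) using p p' e(1) r(2) v(5) b(1) o(1) by blast+
  show "reversal T = bullet (nrows (rho T)) (rho T)" using bullet_oppLR(2)[OF e(1) l p(3)] r(1) n D by simp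
  show "varrho T = ot (nrows (rho T)) (rho T)" using v(1) n D by simp
  show "rho T = ot (nrows (varrho T)) (varrho T)" using ot_ot[OF r(2) p(3,2,1), of "ncols T" d] v(1) n by simp
  show "rho T = bullet (nrows (reversal T)) (reversal T)" using r(1) n D by simp
  show "rho T = reversal (bullet (nrows T) T)" using r(1) b(3) D by simp
qed

lemma all_oppLR_maps:
  assumes "T \<in> all_oppLR"
  shows "tab_over (nrows T) T" "reversal T \<in> all_LR" "nrows (reversal T) = nrows T" "ncols (reversal T) = ncols T"
    "bullet (nrows T) T \<in> all_LR" "reversal T = rho (bullet (nrows T) T)"
proof -
  obtain d m \<mu> \<nu> lam where p: "part_in d m \<mu>" "part_in d m \<nu>" "part_in d m lam" and T: "T \<in> oppLR d m \<mu> (rev \<nu>) lam"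
    using assms by (auto simp: all_oppLR_iff)
  have l: "length \<nu> = d" using p by (simp add: part_in_def)
  note e = reversal_oppLR[OF T l p(1,3)] and b = bullet_oppLR[OF T l p(3)]
  have d: "nrows T = d" "ncols T = m" using LR_dims(2)[OF T] by auto
  show "tab_over (nrows T) T" using T l by (auto simp: oppLR_def tab_over_def skew_tabs_def has_content_def)
  show "nrows (reversal T) = nrows T" "ncols (reversal T) = ncols T" using LR_dims(1)[OF e(2)] d by auto
  show "reversal T \<in> all_LR" "bullet (nrows T) T \<in> all_LR" unfolding all_LR_iff d using p e(2) b(1) by blast+
  show "reversal T = rho (bullet (nrows T) T)" using e(1) d by simp
qed

lemma ot_dims [simp]: "nrows (ot k T) = ncols T" "ncols (ot k T) = nrows T"
  by (simp_all add: ot_def fill_columns_def)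

lemma bullet_dims [simp]: "nrows (bullet k T) = nrows T" "ncols (bullet k T) = ncols T"
  by (simp_all add: bullet_def)

lemma tame_maps:
  "tame all_LR reversal all_oppLR" "tame all_oppLR reversal all_LR" "tame all_LR rho all_LR" "tame all_LR varrho all_LR"
  "tame all_LR (\<lambda>T. bullet (nrows T) T) all_oppLR" "tame all_oppLR (\<lambda>T. bullet (nrows T) T) all_LR"
  "tame all_LR (\<lambda>T. ot (nrows T) T) all_LR"
  unfolding tame_def by (simp_all add: all_LR_maps(1,3-13) all_oppLR_maps(1-5))

theorem linear_equivalences:
  "linearly_equivalent e_map rho_map" "linearly_equivalent e_map varrho_map" "linearly_equivalent rho_map varrho_map"
  "linearly_equivalent e_opp_map rho_map" "linearly_equivalent e_opp_map varrho_map" "linearly_equivalent e_map e_opp_map"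
proof -
  note E = tame_call[OF tame_maps(1), folded e_map_def] and E' = tame_call[OF tame_maps(2), folded e_opp_map_def]
    and R = tame_call[OF tame_maps(3), folded rho_map_def] and V = tame_call[OF tame_maps(4), folded varrho_map_def]
  note b = tame_bullet_computes[OF tame_maps(5)] and b' = tame_bullet_computes[OF tame_maps(6)]
    and o = tame_ot_computes[OF tame_maps(7) all_LR_maps(2)]
  note L = all_LR_maps and O = all_oppLR_maps
  \<comment> \<open>All reductions pass through \<rho>: a circuit for it is obtained from each of
    the maps, and each of them is obtained from it.\<close>
  have eR: "computes \<alpha> all_LR reversal all_oppLR" if "computes \<alpha> all_LR rho all_LR" for \<alpha>
    by (rule computes_comp[OF that b L(14)])
  have Re: "computes \<alpha> all_LR rho all_LR" if "computes \<alpha> all_LR reversal all_oppLR" for \<alpha>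
    by (rule computes_comp[OF that b' L(17)])
  have RV: "computes \<alpha> all_LR rho all_LR" if "computes \<alpha> all_LR varrho all_LR" for \<alpha>
    by (rule computes_comp[OF that o L(16)])
  have VR: "computes \<alpha> all_LR varrho all_LR" if "computes \<alpha> all_LR rho all_LR" for \<alpha>
    by (rule computes_comp[OF that o L(15)])
  have e'R: "computes \<alpha> all_oppLR reversal all_LR" if "computes \<alpha> all_LR rho all_LR" for \<alpha>
    by (rule computes_comp[OF b' that O(6)])
  have Re': "computes \<alpha> all_LR rho all_LR" if "computes \<alpha> all_oppLR reversal all_LR" for \<alpha>
    by (rule computes_comp[OF b that L(18)])
  note red = linearly_reducibleI[OF tame_maps(1), folded e_map_def]
    linearly_reducibleI[OF tame_maps(2), folded e_opp_map_def]
    linearly_reducibleI[OF tame_maps(3), folded rho_map_def]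
    linearly_reducibleI[OF tame_maps(4), folded varrho_map_def]
  have all: "linearly_reducible \<beta> \<alpha>" if "\<beta> \<in> {e_map, e_opp_map, rho_map, varrho_map}" "computes \<alpha> all_LR rho all_LR"
      and "\<alpha> \<in> {e_map, e_opp_map, rho_map, varrho_map}" for \<alpha> \<beta>
    using that(1,3) red(1)[OF _ eR] red(2)[OF _ e'R] red(3) red(4)[OF _ VR] that(2) tame_maps(1-4)
    unfolding e_map_def e_opp_map_def rho_map_def varrho_map_def by blast
  have "computes \<alpha> all_LR rho all_LR" if "\<alpha> \<in> {e_map, e_opp_map, rho_map, varrho_map}" for \<alpha>
    using that Re[OF E] Re'[OF E'] R RV[OF V] by blast
  then show "linearly_equivalent e_map rho_map" "linearly_equivalent e_map varrho_map"
    "linearly_equivalent rho_map varrho_map" "linearly_equivalent e_opp_map rho_map"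
    "linearly_equivalent e_opp_map varrho_map" "linearly_equivalent e_map e_opp_map"
    unfolding linearly_equivalent_def using all by (meson insertI1 insertI2)+
qed

theorem theorem5p5:
  shows
  "(\<forall>n d \<mu> \<nu> lam.
      d \<le> n \<and> part_in d (n - d) \<mu> \<and> part_in d (n - d) \<nu> \<and> part_in d (n - d) lam \<longrightarrow>
      (let m = n - d; \<nu>1 = first_part \<nu>; A = LR d m \<mu> \<nu> lam;
           A' = oppLR d m \<mu> (rev \<nu>) lam; B = LR d m lam \<nu> \<mu>;
           C = LR m d (transpose_part m \<mu>) (transpose_part m \<nu>) (transpose_part m lam) in
        (bij_betw reversal A A' \<and> bij_betw reversal A' A \<and>
         (\<forall>T \<in> A \<union> A'. reversal (reversal T) = T) \<and>
         (\<forall>T \<in> A. row_word (reversal T) = sigma0 d (row_word T)) \<and>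
         cLR d m \<mu> \<nu> lam = coppLR d m \<mu> (rev \<nu>) lam) \<and>
        (bij_betw rho A B \<and>
         (\<forall>T \<in> A. rho (rho T) = T) \<and>
         (\<forall>T \<in> A. rho T = bullet d (reversal T) \<and>
           row_word (rho T) = bullet_word d (sigma0 d (row_word T))) \<and>
         cLR d m \<mu> \<nu> lam = cLR d m lam \<nu> \<mu>) \<and>
        (bij_betw varrho A C \<and>
         (\<forall>T \<in> A. varrho (varrho T) = T) \<and>
         (\<forall>T \<in> A. varrho T = ot d (rho T) \<and>
           varrho T = ot d (bullet d (reversal T)) \<and>
           varrho T = bullet \<nu>1 (ot d (reversal T)) \<and>
           varrho T = bullet \<nu>1 (reversal_over \<nu>1 (ot d T)) \<and>
           varrho T = rho (ot d T) \<and>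
           col_word (varrho T) = bullet_word \<nu>1 (ot_word d (sigma0 d (row_word T)))) \<and>
         cLR d m \<mu> \<nu> lam =
           cLR m d (transpose_part m \<mu>) (transpose_part m \<nu>) (transpose_part m lam))))
   \<and> linearly_equivalent e_map rho_map
   \<and> linearly_equivalent e_map varrho_map
   \<and> linearly_equivalent rho_map varrho_map
   \<and> linearly_equivalent e_opp_map rho_map
   \<and> linearly_equivalent e_opp_map varrho_map
   \<and> linearly_equivalent e_map e_opp_map"
  by (intro conjI linear_equivalences)
    (unfold Let_def, intro allI impI, elim conjE, rule LR_symmetries; assumption)

end
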